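(* Let $N$ be a non-negative integer and let $\kappa$ be a complex number with $|\Re(\kappa)|<\frac{N+1}{3}$; let $\nu$ and $z$ be related by $\nu+\kappa=z$. Then $$H_\nu^{(1)}(z)=-\frac{2}{3\pi}\sum_{n=0}^{N-1}6^{\frac{n+1}{3}}B_n(\kappa)e^{\frac{2(n+1)\pi i}{3}}\sin\left(\frac{(n+1)\pi}{3}\right)\frac{\Gamma\left(\frac{n+1}{3}\right)}{z^{\frac{n+1}{3}}}+R_N^{(H)}(z,\kappa)$$ for $-\frac{\pi}{2}<\arg z<\frac{3\pi}{2}$; $$H_\nu^{(2)}(z)=-\frac{2}{3\pi}\sum_{n=0}^{N-1}6^{\frac{n+1}{3}}B_n(\kappa)e^{-\frac{2(n+1)\pi i}{3}}\sin\left(\frac{(n+1)\pi}{3}\right)\frac{\Gamma\left(\frac{n+1}{3}\right)}{z^{\frac{n+1}{3}}}-R_N^{(H)}(ze^{\pi i},-\kappa)$$ for $-\frac{3\pi}{2}<\arg z<\frac{\pi}{2}$; $$J_\nu(z)=\frac{1}{3\pi}\sum_{n=0}^{N-1}6^{\frac{n+1}{3}}B_n(\kappa)\sin\left(\frac{(n+1)\pi}{3}\right)\frac{\Gamma\left(\frac{n+1}{3}\right)}{z^{\frac{n+1}{3}}}+R_N^{(J)}(z,\kappa),$$ $$Y_\nu(z)=-\frac{2}{3\pi}\sum_{n=0}^{N-1}(-1)^n6^{\frac{n+1}{3}}B_n(\kappa)\sin^2\left(\frac{(n+1)\pi}{3}\right)\frac{\Gamma\left(\frac{n+1}{3}\right)}{z^{\frac{n+1}{3}}}+R_N^{(Y)}(z,\kappa)$$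 for $|\arg z|<\frac{\pi}{2}$. The coefficients $B_n(\kappa)$ are given by $$B_n(\kappa)=\frac{1}{n!}\left[\frac{d^n}{dt^n}\left(e^{\kappa t}\left(\frac16\frac{t^3}{\sinh t-t}\right)^{\frac{n+1}{3}}\right)\right]_{t=0}$$ $$=\frac{6^{-\frac{n+1}{3}}}{2\Gamma\left(\frac{n+1}{3}\right)}\int_0^{+\infty}t^{\frac{n-2}{3}}e^{-2\pi t}\,i\left(e^{(2\pi\kappa-\frac{\pi}{2}n)i}H_{it+\kappa}^{(1)}(it)+e^{-(2\pi\kappa-\frac{\pi}{2}n)i}H_{it-\kappa}^{(1)}(it)\right)dt,$$ the second representation being true if $|\Re(\kappa)|<\frac{n+1}{3}$. The remainder terms can be expressed as $$R_N^{(H)}(z,\kappa)=\frac{e^{(2\pi\kappa-\frac{\pi}{2}N)i}}{6\pi z^{\frac{N+1}{3}}}\int_0^{+\infty}t^{\frac{N-2}{3}}e^{-2\pi t}\left(\frac{e^{\frac{(N+1)\pi i}{3}}}{1+i(t/z)^{\frac13}e^{\frac{\pi}{3}i}}-\frac{e^{(N+1)\pi i}}{1-i(t/z)^{\frac13}}\right)H_{it+\kappa}^{(1)}(it)\,dt$$ $$+\frac{e^{-(2\pi\kappa-\frac{\pi}{2}N)i}}{6\pi z^{\frac{N+1}{3}}}\int_0^{+\infty}t^{\frac{N-2}{3}}e^{-2\pi t}\left(\frac{e^{\frac{(N+1)\pi i}{3}}}{1-i(t/z)^{\frac13}e^{\frac{\pi}{3}i}}-\frac{e^{(N+1)\pi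 i}}{1+i(t/z)^{\frac13}}\right)H_{it-\kappa}^{(1)}(it)\,dt,$$ $$R_N^{(J)}(z,\kappa)=\frac{e^{(2\pi\kappa-\frac{\pi}{2}N)i}}{12\pi z^{\frac{N+1}{3}}}\int_0^{+\infty}t^{\frac{N-2}{3}}e^{-2\pi t}\left(\frac{e^{\frac{(N+1)\pi i}{3}}}{1+i(t/z)^{\frac13}e^{\frac{\pi}{3}i}}-\frac{e^{-\frac{(N+1)\pi i}{3}}}{1+i(t/z)^{\frac13}e^{-\frac{\pi}{3}i}}\right)H_{it+\kappa}^{(1)}(it)\,dt$$ $$+\frac{e^{-(2\pi\kappa-\frac{\pi}{2}N)i}}{12\pi z^{\frac{N+1}{3}}}\int_0^{+\infty}t^{\frac{N-2}{3}}e^{-2\pi t}\left(\frac{e^{\frac{(N+1)\pi i}{3}}}{1-i(t/z)^{\frac13}e^{\frac{\pi}{3}i}}-\frac{e^{-\frac{(N+1)\pi i}{3}}}{1-i(t/z)^{\frac13}e^{-\frac{\pi}{3}i}}\right)H_{it-\kappa}^{(1)}(it)\,dt$$ and $$R_N^{(Y)}(z,\kappa)=\frac{e^{(2\pi\kappa-\frac{\pi}{2}N)i}}{12\pi i z^{\frac{N+1}{3}}}\int_0^{+\infty}t^{\frac{N-2}{3}}e^{-2\pi t}\left(\frac{e^{\frac{(N+1)\pi i}{3}}}{1+i(t/z)^{\frac13}e^{\frac{\pi}{3}i}}+\frac{e^{-\frac{(N+1)\pi i}{3}}}{1+i(t/z)^{\frac13}e^{-\frac{\pi}{3}i}}-\frac{2e^{(N+1)\pi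 i}}{1-i(t/z)^{\frac13}}\right)H_{it+\kappa}^{(1)}(it)\,dt$$ $$+\frac{e^{-(2\pi\kappa-\frac{\pi}{2}N)i}}{12\pi i z^{\frac{N+1}{3}}}\int_0^{+\infty}t^{\frac{N-2}{3}}e^{-2\pi t}\left(\frac{e^{\frac{(N+1)\pi i}{3}}}{1-i(t/z)^{\frac13}e^{\frac{\pi}{3}i}}+\frac{e^{-\frac{(N+1)\pi i}{3}}}{1-i(t/z)^{\frac13}e^{-\frac{\pi}{3}i}}-\frac{2e^{(N+1)\pi i}}{1+i(t/z)^{\frac13}}\right)H_{it-\kappa}^{(1)}(it)\,dt.$$
   Context: $H_\nu^{(1)},H_\nu^{(2)}$ are the Hankel functions and $J_\nu,Y_\nu$ the Bessel functions of the first and second kind, of complex order $\nu$. They are multivalued in $z$: $z$ is regarded as a point of the Riemann surface of the logarithm (so $\arg z$ may be any real number), with the functions being the analytic continuations in $z$ of their principal branches; $ze^{\pi i}$ is the point with argument $\arg z+\pi$. $H^{(1)}_{it\pm\kappa}(it)$, $t>0$, is taken with $\arg(it)=\frac{\pi}{2}$. Cube roots (and powers $z^{k/3}$) are positive on the positive real line and defined by analytic continuation elsewhere, i.e. $z^{1/3}=|z|^{1/3}e^{i(\arg z)/3}$ and $(t/z)^{1/3}=t^{1/3}/z^{1/3}$. In the derivative formula, the power of $\frac16\frac{t^3}{\sinh t-t}$ is the branch equal to $1$ at $t=0$. Empty sums are zero. *)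

theory Defs
  imports "HOL-Analysis.Analysis"
begin

text \<open>
  Points of the Riemann surface of the logarithm are represented by their logarithm: a complex
  number \<open>\<zeta>\<close> stands for the point lying over \<open>z = exp \<zeta>\<close>, with \<open>\<bar>z\<bar> = exp (Re \<zeta>)\<close> and
  \<open>arg z = Im \<zeta>\<close>. Principal values correspond to \<open>- pi < Im \<zeta> \<le> pi\<close>, multiplication by
  \<open>exp (pi * \<i>)\<close> on the surface is addition of \<open>pi * \<i>\<close> to \<open>\<zeta>\<close>, and analytic continuation in \<open>z\<close>
  is continuation in \<open>\<zeta>\<close>. All functions of \<open>z\<close> below take \<open>\<zeta>\<close> as argument.
\<close>

definition zpow :: "complex \<Rightarrow> real \<Rightarrow> complex" where
  "zpow \<zeta> a = exp (of_real a * \<zeta>)"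

text \<open>
  The factor \<open>(z/2)\<^sup>\<nu>\<close> of the usual power series is \<open>exp (\<nu> * (\<zeta> - ln 2))\<close>. Since \<open>rGamma\<close> is the
  entire function \<open>1/\<Gamma>\<close>, the series makes sense for every complex order.
\<close>

definition bessel_J :: "complex \<Rightarrow> complex \<Rightarrow> complex" where
  "bessel_J \<nu> \<zeta> = exp (\<nu> * (\<zeta> - of_real (ln 2))) *
     (\<Sum>k. (-1) ^ k * rGamma (\<nu> + of_nat k + 1) / fact k * (exp \<zeta> / 2) ^ (2 * k))"

text \<open>For integer order, the quotient is replaced by its limit in the order.\<close>

definition bessel_Y_quot :: "complex \<Rightarrow> complex \<Rightarrow> complex" where
  "bessel_Y_quot \<nu> \<zeta> =
     (bessel_J \<nu> \<zeta> * cos (of_real pi * \<nu>) - bessel_J (- \<nu>) \<zeta>) / sin (of_real pi * \<nu>)"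

definition bessel_Y :: "complex \<Rightarrow> complex \<Rightarrow> complex" where
  "bessel_Y \<nu> \<zeta> =
     (if \<nu> \<in> \<int> then Lim (at \<nu>) (\<lambda>\<mu>. bessel_Y_quot \<mu> \<zeta>) else bessel_Y_quot \<nu> \<zeta>)"

definition hankel_1 :: "complex \<Rightarrow> complex \<Rightarrow> complex" where
  "hankel_1 \<nu> \<zeta> = bessel_J \<nu> \<zeta> + \<i> * bessel_Y \<nu> \<zeta>"

definition hankel_2 :: "complex \<Rightarrow> complex \<Rightarrow> complex" where
  "hankel_2 \<nu> \<zeta> = bessel_J \<nu> \<zeta> - \<i> * bessel_Y \<nu> \<zeta>"

text \<open>\<open>hankel_it t \<kappa>\<close> is the value at \<open>it\<close>, with \<open>arg (it) = pi / 2\<close>, of the first Hankel function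
  of order \<open>it + \<kappa>\<close> (for \<open>t > 0\<close>).\<close>

definition hankel_it :: "real \<Rightarrow> complex \<Rightarrow> complex" where
  "hankel_it t \<kappa> = hankel_1 (\<i> * of_real t + \<kappa>) (of_real (ln t) + \<i> * of_real (pi / 2))"

text \<open>The function \<open>t\<^sup>3 / (6 (sinh t - t))\<close> with its removable singularity at 0 filled in.\<close>

definition B_base :: "complex \<Rightarrow> complex" where
  "B_base t = (if t = 0 then 1 else 1 / 6 * (t ^ 3 / (sinh t - t)))"

text \<open>As \<open>B_base\<close> is close to 1 near 0, the principal power is there the branch equal to 1 at 0.\<close>

definition B_coeff :: "nat \<Rightarrow> complex \<Rightarrow> complex" where
  "B_coeff n \<kappa> = 1 / fact n *
     (deriv ^^ n) (\<lambda>t. exp (\<kappa> * t) * B_base t powr (of_nat (n + 1) / 3)) 0"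

definition B_integrand :: "nat \<Rightarrow> complex \<Rightarrow> real \<Rightarrow> complex" where
  "B_integrand n \<kappa> t =
     of_real (t powr ((real n - 2) / 3) * exp (- 2 * pi * t)) * \<i> *
     (exp ((2 * of_real pi * \<kappa> - of_real (pi / 2 * real n)) * \<i>) * hankel_it t \<kappa> +
      exp (- (2 * of_real pi * \<kappa> - of_real (pi / 2 * real n)) * \<i>) * hankel_it t (- \<kappa>))"

text \<open>\<open>(t/z)\<^bsup>1/3\<^esup> = t\<^bsup>1/3\<^esup> / z\<^bsup>1/3\<^esup>\<close>, positive for \<open>z\<close> on the positive real axis of the principal sheet.\<close>

definition cbrt_quot :: "real \<Rightarrow> complex \<Rightarrow> complex" where
  "cbrt_quot t \<zeta> = of_real (t powr (1 / 3)) / zpow \<zeta> (1 / 3)"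

text \<open>
  Each remainder is a sum of two terms that differ only by the sign of \<open>\<kappa>\<close>, of the exponent of the
  prefactor, and of every \<open>\<i> (t/z)\<^bsup>1/3\<^esup>\<close> in the kernel. The parameter \<open>s\<close> is that sign:
  \<open>s = 1\<close> for the first term, \<open>s = -1\<close> for the second.
\<close>

definition kernel_H :: "nat \<Rightarrow> complex \<Rightarrow> complex \<Rightarrow> real \<Rightarrow> complex" where
  "kernel_H N s \<zeta> t =
     cis (real (N + 1) * pi / 3) / (1 + s * \<i> * cbrt_quot t \<zeta> * cis (pi / 3))
     - cis (real (N + 1) * pi) / (1 - s * \<i> * cbrt_quot t \<zeta>)"

definition kernel_J :: "nat \<Rightarrow> complex \<Rightarrow> complex \<Rightarrow> real \<Rightarrow> complex" where
  "kernel_J N s \<zeta> t =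
     cis (real (N + 1) * pi / 3) / (1 + s * \<i> * cbrt_quot t \<zeta> * cis (pi / 3))
     - cis (- (real (N + 1) * pi / 3)) / (1 + s * \<i> * cbrt_quot t \<zeta> * cis (- (pi / 3)))"

definition kernel_Y :: "nat \<Rightarrow> complex \<Rightarrow> complex \<Rightarrow> real \<Rightarrow> complex" where
  "kernel_Y N s \<zeta> t =
     cis (real (N + 1) * pi / 3) / (1 + s * \<i> * cbrt_quot t \<zeta> * cis (pi / 3))
     + cis (- (real (N + 1) * pi / 3)) / (1 + s * \<i> * cbrt_quot t \<zeta> * cis (- (pi / 3)))
     - 2 * cis (real (N + 1) * pi) / (1 - s * \<i> * cbrt_quot t \<zeta>)"

definition rem_integrand ::
  "(nat \<Rightarrow> complex \<Rightarrow> complex \<Rightarrow> real \<Rightarrow> complex) \<Rightarrow> nat \<Rightarrow> complex \<Rightarrow> complex \<Rightarrow> complex \<Rightarrow> real \<Rightarrow> complex"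
where
  "rem_integrand K N s \<zeta> \<kappa> t =
     of_real (t powr ((real N - 2) / 3) * exp (- 2 * pi * t)) * K N s \<zeta> t * hankel_it t (s * \<kappa>)"

definition rem_converges ::
  "(nat \<Rightarrow> complex \<Rightarrow> complex \<Rightarrow> real \<Rightarrow> complex) \<Rightarrow> nat \<Rightarrow> complex \<Rightarrow> complex \<Rightarrow> bool"
where
  "rem_converges K N \<zeta> \<kappa> \<longleftrightarrow>
     set_integrable lborel {0<..} (rem_integrand K N 1 \<zeta> \<kappa>) \<and>
     set_integrable lborel {0<..} (rem_integrand K N (-1) \<zeta> \<kappa>)"

text \<open>\<open>c\<close> is the constant in the denominator of the prefactor.\<close>

definition remainder ::
  "(nat \<Rightarrow> complex \<Rightarrow> complex \<Rightarrow> real \<Rightarrow> complex) \<Rightarrow> complex \<Rightarrow> nat \<Rightarrow> complex \<Rightarrow> complex \<Rightarrow> complex"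
where
  "remainder K c N \<zeta> \<kappa> =
     exp ((2 * of_real pi * \<kappa> - of_real (pi / 2 * real N)) * \<i>) / (c * zpow \<zeta> (real (N + 1) / 3)) *
       (LBINT t:{0<..}. rem_integrand K N 1 \<zeta> \<kappa> t)
     + exp (- (2 * of_real pi * \<kappa> - of_real (pi / 2 * real N)) * \<i>) / (c * zpow \<zeta> (real (N + 1) / 3)) *
       (LBINT t:{0<..}. rem_integrand K N (-1) \<zeta> \<kappa> t)"

definition rem_H :: "nat \<Rightarrow> complex \<Rightarrow> complex \<Rightarrow> complex" where
  "rem_H = remainder kernel_H (6 * of_real pi)"

definition rem_J :: "nat \<Rightarrow> complex \<Rightarrow> complex \<Rightarrow> complex" where
  "rem_J = remainder kernel_J (12 * of_real pi)"

definition rem_Y :: "nat \<Rightarrow> complex \<Rightarrow> complex \<Rightarrow> complex" where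
  "rem_Y = remainder kernel_Y (12 * of_real pi * \<i>)"

end

theory Submission
  imports Defs "HOL-Complex_Analysis.Complex_Analysis" "HOL-Real_Asymp.Real_Asymp"
begin

text \<open>Let \<open>A\<^sub>\<kappa>(z)\<close> be the integral of \<open>exp (- z (sinh t - t) - \<kappa> t)\<close> over \<open>t > 0\<close>, continued to the
  surface of the logarithm. For \<open>\<nu> + \<kappa> = z\<close> the Bessel and Hankel functions are combinations of
  \<open>A\<^sub>\<kappa>(z)\<close> and \<open>A\<^bsub>-\<kappa>\<^esub>(z exp (\<plusminus>\<pi>\<i>))\<close>, by comparison with Hankel's loop integral for \<open>1/\<Gamma>\<close>. As
  \<open>sinh t - t\<close> has a triple zero at 0, Lagrange inversion gives an expansion of \<open>A\<^sub>\<kappa>\<close> in powers of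
  \<open>z\<^bsup>-1/3\<^esup>\<close>, uniformly for \<open>\<bar>arg z\<bar> \<le> 3\<pi>/2\<close>, with coefficients \<open>B\<^sub>n(-\<kappa>)\<close>. On the edges \<open>arg z = \<plusminus>3\<pi>/2\<close>
  the sum \<open>A\<^sub>\<kappa> + A\<^bsub>-\<kappa>\<^esub>\<close> of the boundary values is a multiple of \<open>exp (- 2\<pi>t) H\<^bsub>it+\<kappa>\<^esub>(it)\<close>.

  In the variable \<open>l = (log z) / 3\<close> the sector is the strip \<open>\<bar>Im l\<bar> \<le> \<pi>/2\<close>. Cauchy's formula there, with
  kernel \<open>1 / (exp l - w)\<close> for \<open>A\<^sub>\<kappa>\<close> minus its truncated expansion and with the kernel \<open>1 / (exp l + w)\<close>,
  which has no pole in the strip, for \<open>A\<^bsub>-\<kappa>\<^esub>\<close>, lets the boundary values enter only through these sums; the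
  result is the exact remainder. Letting \<open>z \<rightarrow> \<infinity>\<close> in it yields the integral for \<open>B\<^sub>n\<close>.\<close>

section \<open>Integrals along horizontal rays\<close>

text \<open>The continuation costs nothing if the path runs from 0 to - log z and then horizontally
  to infinity: on that ray z exp t is positive, so a single absolutely convergent formula is entire
  in log z and valid on every sheet. The obstacle is that on an edge of the sector no single
  boundary value of \<open>near_A\<close> is a Bessel function; only the values for \<kappa> and
  -\<kappa> on opposite edges combine to one. This forces the second Cauchy integral, and the
  truncated expansions disappear from the combined boundary values because B_n(-\<kappa>) = (-1)^n
  B_n(\<kappa>). The bound on Re \<kappa> is a growth condition at z = 0: there A is at most of
  order |z|^(-\<sigma>) for each \<sigma> > |Re \<kappa>|, which the factor z^((N+1)/3) must
  outweigh. For the expansion, with \<alpha> = arg z, a path should leave 0 in a direction near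
  -\<alpha>/3, since sinh t - t starts with t^3/6, and end at a height near -\<alpha>, where z exp t
  grows in the right half-plane. Three two-piece paths and their conjugates achieve this for all
  |\<alpha>| up to 3 pi/2.\<close>

lemma set_integrable_lebesgue_imp_lborel:
  fixes f :: "real \<Rightarrow> 'a :: euclidean_space"
  assumes "f absolutely_integrable_on S" "S \<in> sets borel" "set_borel_measurable borel S f"
  shows "set_integrable lborel S f"
  using assms by (simp add: set_integrable_def set_borel_measurable_def integrable_completion)

lemma set_integrable_exp_neg_rate:
  assumes "a > 0"
  shows "set_integrable lborel {0<..} (\<lambda>s::real. C * exp (- (a * s)))"
proof -
  have "(\<lambda>s::real. exp (- a * s)) absolutely_integrable_on {0..}"
    using assms by (intro nonnegative_absolutely_integrable_1 integrable_on_exp_minus_to_infinity) auto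
  then have "set_integrable lborel {0..} (\<lambda>s::real. exp (- a * s))"
    by (intro set_integrable_lebesgue_imp_lborel)
       (auto simp: set_borel_measurable_def intro!: borel_measurable_indicator)
  then have "set_integrable lborel {0<..} (\<lambda>s::real. exp (- a * s))"
    by (rule set_integrable_subset) auto
  then show ?thesis by simp
qed

lemma set_integrable_exp_neg: "set_integrable lborel {0<..} (\<lambda>s::real. C * exp (- s))"
  using set_integrable_exp_neg_rate[of 1 C] by simp

lemma set_integrable_continuous_bound:
  fixes f :: "real \<Rightarrow> 'a :: euclidean_space"
  assumes "continuous_on A f" "A \<in> sets borel" "set_integrable lborel A g"
    and "\<And>x. x \<in> A \<Longrightarrow> norm (f x) \<le> g x"
  shows "set_integrable lborel A f"
proof (rule set_integrable_bound[OF assms(3)])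
  show "set_borel_measurable lborel A f"
    using set_measurable_continuous_on[of A f] assms(1,2) by (simp add: set_borel_measurable_def borel_measurable_continuous_on_indicator)
  show "AE x in lborel. x \<in> A \<longrightarrow> norm (f x) \<le> norm (g x)"
    using assms(4) by (intro AE_I2) (metis abs_of_nonneg norm_ge_zero order_trans real_norm_def)
qed

lemma entire_primitive:
  fixes g :: "complex \<Rightarrow> complex"
  assumes "g holomorphic_on UNIV"
  obtains G where "\<And>x. (G has_field_derivative g x) (at x)"
  using holomorphic_convex_primitive'[OF _ _ assms] by auto

lemma contour_integral_linepath_primitive:
  assumes "\<And>x. (G has_field_derivative g x) (at x)"
  shows "contour_integral (linepath a b) g = G b - G a"
  using contour_integral_primitive[of UNIV G g "linepath a b"] assms
  by (intro contour_integral_unique) (auto intro: DERIV_subset)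

text \<open>Unbounded paths end in horizontal rays because \<open>exp\<close> keeps its argument
  along them, so z exp t keeps the sign of its real part.\<close>

definition ray_int :: "(complex \<Rightarrow> complex) \<Rightarrow> complex \<Rightarrow> complex" where
  "ray_int g a = (LBINT s:{0<..}. g (a + of_real s))"

lemma ray_integrable:
  fixes g :: "complex \<Rightarrow> complex"
  assumes "continuous_on UNIV g" "\<And>s. s \<ge> 0 \<Longrightarrow> norm (g (a + of_real s)) \<le> C * exp (- s)"
  shows "set_integrable lborel {0<..} (\<lambda>s. g (a + of_real s))"
  using assms by (intro set_integrable_continuous_bound[OF _ _ set_integrable_exp_neg[of C]])
     (auto intro!: continuous_intros continuous_on_compose2[OF assms(1)])

lemma norm_ray_int_le:
  assumes "\<And>s. s \<ge> 0 \<Longrightarrow> norm (g (a + of_real s)) \<le> C * exp (- s)"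
  shows "norm (ray_int g a) \<le> C"
proof -
  have eqC: "(LBINT s:{0<..}. C * exp (- s :: real)) = C"
  proof -
    have "((\<lambda>s::real. exp (- 1 * s)) has_integral exp (- 1 * 0) / 1) {0..}"
      by (rule has_integral_exp_minus_to_infinity) auto
    then have "((\<lambda>s::real. exp (- s)) has_integral 1) {0<..}"
    proof -
      have "{x::real. 0 \<le> x \<and> \<not> 0 < x} = {0}" "negligible {x::real. 0 < x \<and> \<not> 0 \<le> x}"
        by (auto simp: not_less intro: negligible_subset[of "{}"])
      then show ?thesis if "((\<lambda>s::real. exp (- 1 * s)) has_integral exp (- 1 * 0) / 1) {0..}"
        using has_integral_spike_set_eq[of "{0..}" "{0<..}" "\<lambda>s::real. exp (- s)" 1] that by simp
    qed
    moreover have "set_integrable lborel {0<..} (\<lambda>s::real. 1 * exp (- s))"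
      by (rule set_integrable_exp_neg)
    ultimately show ?thesis
      by (simp add: set_borel_integral_eq_integral(2) integral_unique)
  qed
  have "norm (ray_int g a) \<le> (LBINT s:{0<..}. C * exp (- s :: real))"
  proof (cases "set_integrable lborel {0<..} (\<lambda>s. g (a + of_real s))")
    case True
    have "norm (ray_int g a) \<le> (LBINT s:{0<..}. norm (g (a + of_real s)))"
      unfolding ray_int_def by (rule set_integral_norm_bound[OF True])
    also have "\<dots> \<le> (LBINT s:{0<..}. C * exp (- s :: real))"
      by (intro set_integral_mono set_integrable_norm True set_integrable_exp_neg assms) auto
    finally show ?thesis .
  next
    \<comment> \<open>A non-integrable function has integral 0 by convention; the hypothesis at s =
      0 makes C nonnegative.\<close>
    case False
    then have "ray_int g a = 0"
      by (simp add: ray_int_def set_lebesgue_integral_def set_integrable_def not_integrable_integral_eq)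
    moreover have "C \<ge> 0" using assms[of 0] norm_ge_zero[of "g a"] by (simp del: norm_ge_zero)
    ultimately show ?thesis unfolding eqC by simp
  qed
  then show ?thesis unfolding eqC .
qed

text \<open>Links the Lebesgue integral along a ray to the increments of a primitive, so that later
  contour arguments only evaluate primitives at corners.\<close>

lemma ray_int_tendsto:
  assumes G: "\<And>x. (G has_field_derivative g x) (at x)"
    and bd: "\<And>s. s \<ge> 0 \<Longrightarrow> norm (g (a + of_real s)) \<le> C * exp (- s)"
  shows "((\<lambda>X. G (a + of_real X) - G a) \<longlongrightarrow> ray_int g a) at_top"
proof -
  have cont: "continuous_on UNIV g"
    using G by (meson DERIV_continuous_on analytic_imp_holomorphic analytic_on_open derivative_is_holomorphic
      holomorphic_on_imp_continuous_on holomorphic_on_open open_UNIV)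
  note int = ray_integrable[OF cont bd]
  have "((\<lambda>X. LBINT s:{0..X}. g (a + of_real s)) \<longlongrightarrow> (LBINT s:{0..}. g (a + of_real s))) at_top"
  proof (rule tendsto_set_lebesgue_integral_at_top)
    show "set_integrable lborel {0..} (\<lambda>s. g (a + of_real s))"
      using int by (subst set_integrable_discrete_difference[of "{0}" _ "{0<..}"]) auto
  qed auto
  moreover have "(LBINT s:{0..}. g (a + of_real s)) = ray_int g a"
    unfolding ray_int_def
    by (rule set_integral_discrete_difference[of "{0}"]) auto
  moreover have "(LBINT s:{0..X}. g (a + of_real s)) = G (a + of_real X) - G a" if "X \<ge> 0" for X
  proof -
    have "((\<lambda>s. g (a + of_real s)) has_integral G (a + of_real X) - G (a + of_real 0)) {0..X}"
    proof (rule fundamental_theorem_of_calculus[OF that])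
      fix x assume "x \<in> {0..X}"
      have "((\<lambda>s. G (a + of_real s)) has_vector_derivative (1 * g (a + of_real x))) (at x)"
        by (rule field_vector_diff_chain_at[unfolded o_def, where f = "\<lambda>s. a + of_real s"])
           (auto intro!: derivative_eq_intros G)
      then show "((\<lambda>s. G (a + of_real s)) has_vector_derivative (g (a + of_real x))) (at x within {0..X})"
        by (simp add: has_vector_derivative_at_within)
    qed
    moreover have "set_integrable lborel {0..X} (\<lambda>s. g (a + of_real s))"
      by (rule borel_integrable_atLeastAtMost')
         (auto intro!: continuous_intros continuous_on_compose2[OF cont])
    ultimately show ?thesis
      by (simp add: set_borel_integral_eq_integral(2) integral_unique)
  qed
  then have "\<forall>\<^sub>F X in at_top. (LBINT s:{0..X}. g (a + of_real s)) = G (a + of_real X) - G a"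
    by (intro eventually_at_top_linorderI[of 0]) auto
  ultimately show ?thesis
    by (simp add: tendsto_cong)
qed

text \<open>Cauchy's theorem in the half-strip between two parallel rays: decay that is uniform over
  the starting segment makes the far side vanish.\<close>

lemma ray_shift:
  assumes hol: "g holomorphic_on UNIV"
    and bd: "\<And>s y. s \<ge> 0 \<Longrightarrow> y \<in> closed_segment a b \<Longrightarrow> norm (g (y + of_real s)) \<le> C * exp (- s)"
  shows "ray_int g a = contour_integral (linepath a b) g + ray_int g b"
proof -
  obtain G where G: "\<And>x. (G has_field_derivative g x) (at x)"
    using entire_primitive[OF hol] by blast
  have 1: "((\<lambda>X. (G (a + of_real X) - G a) - (G (b + of_real X) - G b)) \<longlongrightarrow> ray_int g a - ray_int g b) at_top"
    by (intro tendsto_diff ray_int_tendsto[where C = C] G bd) auto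
  \<comment> \<open>The far side has constant length and an integrand of size
    \<open>C * exp (- X)\<close>.\<close>
  have "((\<lambda>X. G (b + of_real X) - G (a + of_real X)) \<longlongrightarrow> 0) at_top"
  proof (rule Lim_null_comparison)
    have "norm (G (b + of_real X) - G (a + of_real X)) \<le> norm (b - a) * (C * exp (- X))" if "X \<ge> 0" for X
    proof -
      have "norm (contour_integral (linepath (a + of_real X) (b + of_real X)) g)
              \<le> C * exp (- X) * norm ((b + of_real X) - (a + of_real X))"
      proof (rule contour_integral_bound_linepath)
        show "g contour_integrable_on linepath (a + of_real X) (b + of_real X)"
          using contour_integral_primitive[of UNIV G g] G
          by (auto simp: contour_integrable_on_def intro: DERIV_subset)
        show "0 \<le> C * exp (- X)" using bd[OF that, of a] norm_ge_zero order_trans by blast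
        fix x assume "x \<in> closed_segment (a + of_real X) (b + of_real X)"
        then have "x - of_real X \<in> closed_segment a b"
          using closed_segment_translation_eq[of "of_real X" "x - of_real X" a b] by (simp add: add.commute)
        from bd[OF that this] show "norm (g x) \<le> C * exp (- X)" by simp
      qed
      then show ?thesis
        by (simp add: contour_integral_linepath_primitive[OF G] mult.commute)
    qed
    then show "\<forall>\<^sub>F X in at_top. norm (G (b + of_real X) - G (a + of_real X)) \<le> norm (b - a) * (C * exp (- X))"
      by (intro eventually_at_top_linorderI[of 0]) auto
    show "((\<lambda>X. norm (b - a) * (C * exp (- X))) \<longlongrightarrow> 0) at_top"
      by real_asymp
  qed
  with 1 have "((\<lambda>X. ((G (a + of_real X) - G a) - (G (b + of_real X) - G b)) + (G (b + of_real X) - G (a + of_real X)))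
      \<longlongrightarrow> (ray_int g a - ray_int g b) + 0) at_top"
    by (intro tendsto_add)
  then have "((\<lambda>X::real. G b - G a) \<longlongrightarrow> ray_int g a - ray_int g b) at_top" by simp
  then have "ray_int g a - ray_int g b = G b - G a"
    by (metis tendsto_const_iff trivial_limit_at_top_linorder)
  then show ?thesis by (simp add: contour_integral_linepath_primitive[OF G] algebra_simps)
qed

section \<open>Weber's integral\<close>

text \<open>Cauchy's inequality converts a majorant of the integrand on a disc into a majorant of
  its difference quotients on the disc of half the radius; dominated convergence then yields the
  complex derivative.\<close>

lemma holomorphic_on_integral_param:
  fixes f :: "complex \<Rightarrow> 'a \<Rightarrow> complex"
  assumes S: "open S"
    and hol: "\<And>x. x \<in> space M \<Longrightarrow> (\<lambda>z. f z x) holomorphic_on S"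
    and meas: "\<And>z. z \<in> S \<Longrightarrow> f z \<in> borel_measurable M"
    and dom: "\<And>z0. z0 \<in> S \<Longrightarrow> \<exists>r>0. \<exists>h. cball z0 r \<subseteq> S \<and> integrable M h \<and>
                (\<forall>z\<in>cball z0 r. \<forall>x\<in>space M. norm (f z x) \<le> h x)"
  shows "(\<lambda>z. \<integral>x. f z x \<partial>M) holomorphic_on S"
proof -
  have "(\<lambda>z. \<integral>x. f z x \<partial>M) field_differentiable at z0" if z0: "z0 \<in> S" for z0
  proof -
    obtain r h where r: "r > 0" "cball z0 r \<subseteq> S" and h: "integrable M h"
      and le: "\<And>z x. z \<in> cball z0 r \<Longrightarrow> x \<in> space M \<Longrightarrow> norm (f z x) \<le> h x"
      using dom[OF z0] by blast
    have int: "integrable M (f z)" if "z \<in> cball z0 r" for z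
      using that r le[OF that] by (intro Bochner_Integration.integrable_bound[OF h] meas AE_I2) force+
    have quot: "norm (f z x - f z0 x) \<le> h x / (r / 2) * norm (z - z0)"
      if x: "x \<in> space M" and z: "z \<in> cball z0 (r / 2)" for z x
    proof (rule field_differentiable_bound[OF convex_cball, of z0 "r / 2" "\<lambda>z. f z x" "deriv (\<lambda>z. f z x)"])
      have sub: "cball w (r / 2) \<subseteq> cball z0 r" if "w \<in> cball z0 (r / 2)" for w
      proof
        fix y assume "y \<in> cball w (r / 2)"
        then show "y \<in> cball z0 r" using that dist_triangle[of z0 y w] by simp
      qed
      fix w assume w: "w \<in> cball z0 (r / 2)"
      have wS: "w \<in> S" using sub[OF w] r w by auto
      show "((\<lambda>z. f z x) has_field_derivative deriv (\<lambda>z. f z x) w) (at w within cball z0 (r / 2))"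
        by (rule holomorphic_derivI[OF hol[OF x] S wS])
      have "norm ((deriv ^^ 1) (\<lambda>z. f z x) w) \<le> fact 1 * h x / (r / 2) ^ 1"
      proof (rule Cauchy_inequality)
        show "(\<lambda>z. f z x) holomorphic_on ball w (r / 2)"
          by (rule holomorphic_on_subset[OF hol[OF x]]) (use sub[OF w] r ball_subset_cball in blast)
        show "continuous_on (cball w (r / 2)) (\<lambda>z. f z x)"
          by (rule continuous_on_subset[OF holomorphic_on_imp_continuous_on[OF hol[OF x]]])
             (use sub[OF w] r in blast)
        show "norm (f z x) \<le> h x" if "norm (w - z) = r / 2" for z
          by (rule le[OF _ x]) (use that sub[OF w] in \<open>auto simp: dist_norm subset_iff\<close>)
      qed (use r in auto)
      then show "norm (deriv (\<lambda>z. f z x) w) \<le> h x / (r / 2)" by simp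
    qed (use z r in auto)
    have "((\<lambda>z. ((\<integral>x. f z x \<partial>M) - (\<integral>x. f z0 x \<partial>M)) / (z - z0)) \<longlongrightarrow>
            (\<integral>x. deriv (\<lambda>z. f z x) z0 \<partial>M)) (at z0)"
      unfolding tendsto_at_iff_sequentially comp_def
    proof (intro allI impI)
      fix X :: "nat \<Rightarrow> complex" assume X: "\<forall>i. X i \<in> UNIV - {z0}" "X \<longlonglongrightarrow> z0"
      \<comment> \<open>Dominated convergence works along sequences, and the bound on difference
        quotients holds in the half-size disc only; hence the initial terms of X are cut
        off.\<close>
      have "\<forall>\<^sub>F n in sequentially. X n \<in> ball z0 (r / 2)"
        using X(2) r by (intro topological_tendstoD) auto
      then obtain N where N: "\<And>n. X (n + N) \<in> ball z0 (r / 2)"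
        by (auto simp: eventually_sequentially) (metis le_add2)
      have XS: "X (n + N) \<in> cball z0 r" for n using N[of n] r by auto
      have X0: "X (n + N) \<noteq> z0" for n using X(1) by auto
      have lim: "(\<lambda>n. (f (X (n + N)) x - f z0 x) / (X (n + N) - z0)) \<longlonglongrightarrow> deriv (\<lambda>z. f z x) z0"
        if "x \<in> space M" for x
      proof -
        have "((\<lambda>z. f z x) has_field_derivative deriv (\<lambda>z. f z x) z0) (at z0)"
          by (rule holomorphic_derivI[OF hol[OF that] S z0])
        then have "((\<lambda>z. (f z x - f z0 x) / (z - z0)) \<longlongrightarrow> deriv (\<lambda>z. f z x) z0) (at z0)"
          by (simp add: has_field_derivative_iff)
        moreover have "filterlim (\<lambda>n. X (n + N)) (at z0) sequentially"
          using X0 LIMSEQ_ignore_initial_segment[OF X(2), of N] by (auto simp: filterlim_at)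
        ultimately show ?thesis by (rule filterlim_compose)
      qed
      have m: "(\<lambda>x. (f (X (n + N)) x - f z0 x) / (X (n + N) - z0)) \<in> borel_measurable M" for n
        using XS r z0 by (intro borel_measurable_divide borel_measurable_diff borel_measurable_const meas) auto
      have "(\<lambda>n. \<integral>x. (f (X (n + N)) x - f z0 x) / (X (n + N) - z0) \<partial>M) \<longlonglongrightarrow>
              (\<integral>x. deriv (\<lambda>z. f z x) z0 \<partial>M)"
      proof (rule integral_dominated_convergence[where w = "\<lambda>x. h x / (r / 2)"])
        show "(\<lambda>x. deriv (\<lambda>z. f z x) z0) \<in> borel_measurable M"
          by (rule borel_measurable_LIMSEQ_metric[OF m lim])
        show "AE x in M. norm ((f (X (n + N)) x - f z0 x) / (X (n + N) - z0)) \<le> h x / (r / 2)" for n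
          using quot N[of n] X0[of n] by (intro AE_I2) (auto simp: norm_divide divide_le_eq less_imp_le)
      qed (use h lim m in auto)
      also have "(\<lambda>n. \<integral>x. (f (X (n + N)) x - f z0 x) / (X (n + N) - z0) \<partial>M) =
          (\<lambda>n. ((\<integral>x. f (X (n + N)) x \<partial>M) - (\<integral>x. f z0 x \<partial>M)) / (X (n + N) - z0))"
        using int XS r by (auto simp: Bochner_Integration.integral_diff)
      finally show "(\<lambda>n. ((\<integral>x. f (X n) x \<partial>M) - (\<integral>x. f z0 x \<partial>M)) / (X n - z0)) \<longlonglongrightarrow>
              (\<integral>x. deriv (\<lambda>z. f z x) z0 \<partial>M)"
        by (rule LIMSEQ_offset)
    qed
    then show ?thesis by (auto simp: field_differentiable_def has_field_derivative_iff)
  qed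
  then show ?thesis by (simp add: holomorphic_on_def field_differentiable_at_within)
qed

lemma contour_integral_linepath_lborel:
  assumes "continuous_on UNIV g"
  shows "contour_integral (linepath a b) g = (LBINT x:{0..1}. g (linepath a b x) * (b - a))"
    and "set_integrable lborel {0..1} (\<lambda>x. g (linepath a b x) * (b - a))"
proof -
  show 1: "set_integrable lborel {0..1} (\<lambda>x. g (linepath a b x) * (b - a))"
    by (rule borel_integrable_atLeastAtMost')
       (auto intro!: continuous_intros continuous_on_compose2[OF assms])
  show "contour_integral (linepath a b) g = (LBINT x:{0..1}. g (linepath a b x) * (b - a))"
    unfolding set_borel_integral_eq_integral(2)[OF 1] by (simp add: contour_integral_integral)
qed

text \<open>Completing the square in c s^2/2 - (d + 1) s, after exp s \<ge> s^2/2, gives the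
  constant. All doubly exponential decay is weakened in this way to \<open>exp (- s)\<close>, the
  rate used for rays.\<close>

lemma exp_neg_exp_le:
  assumes "c > 0" "s \<ge> 0"
  shows "exp (- (c * exp s) + d * s) \<le> exp ((d + 1)\<^sup>2 / (2 * c)) * exp (- s :: real)"
proof -
  have "s\<^sup>2 / 2 \<le> exp s" using exp_lower_Taylor_quadratic[OF assms(2)] assms by simp
  then have 1: "c * (s\<^sup>2 / 2) \<le> c * exp s" using assms by simp
  have "0 \<le> (c * s - (d + 1))\<^sup>2 / (2 * c)" using assms by simp
  also have "\<dots> = c * (s\<^sup>2 / 2) - (d + 1) * s + (d + 1)\<^sup>2 / (2 * c)"
    using assms by (simp add: power2_eq_square field_simps)
  finally show ?thesis using 1 by (simp add: mult_exp_exp algebra_simps)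
qed

definition weber_kernel :: "complex \<Rightarrow> complex \<Rightarrow> complex \<Rightarrow> complex" where
  "weber_kernel z \<nu> t = exp (- (z * sinh t) - \<nu> * t)"

text \<open>For |arg z| < pi/2 this is pi times the associated Anger-Weber function, the integral of
  the kernel over t > 0. The detour through \<open>- \<zeta>\<close> gives convergence on all
  sheets: on the ray, exp \<zeta> exp t is the positive number exp s.\<close>

definition weber_A :: "complex \<Rightarrow> complex \<Rightarrow> complex" where
  "weber_A \<nu> \<zeta> = contour_integral (linepath 0 (- \<zeta>)) (weber_kernel (exp \<zeta>) \<nu>)
                   + ray_int (weber_kernel (exp \<zeta>) \<nu>) (- \<zeta>)"

section \<open>Holomorphy and growth of the kernel\<close>

lemma holomorphic_weber_kernel [holomorphic_intros]:
  assumes "f holomorphic_on S" "g holomorphic_on S" "h holomorphic_on S"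
  shows "(\<lambda>w. weber_kernel (f w) (g w) (h w)) holomorphic_on S"
  unfolding weber_kernel_def sinh_field_def by (intro holomorphic_intros assms) auto

lemma holomorphic_weber_kernel' [holomorphic_intros]: "weber_kernel z \<nu> holomorphic_on S"
  using holomorphic_weber_kernel[of "\<lambda>_. z" S "\<lambda>_. \<nu>" "\<lambda>t. t"] by (simp add: holomorphic_intros)

lemma continuous_on_weber_kernel' [continuous_intros]:
  assumes "continuous_on S f" "continuous_on S g" "continuous_on S h"
  shows "continuous_on S (\<lambda>w. weber_kernel (f w) (g w) (h w))"
  unfolding weber_kernel_def sinh_field_def by (intro continuous_intros assms) auto

lemma continuous_on_weber_kernel: "continuous_on S (weber_kernel z \<nu>)"
  by (intro holomorphic_on_imp_continuous_on holomorphic_intros)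

lemma Re_exp_mult_sinh:
  "Re (exp \<zeta> * sinh t) = (exp (Re \<zeta> + Re t) * cos (Im \<zeta> + Im t) - exp (Re \<zeta> - Re t) * cos (Im \<zeta> - Im t)) / 2"
proof -
  have "exp \<zeta> * sinh t = (exp (\<zeta> + t) - exp (\<zeta> - t)) / 2"
    by (simp add: sinh_field_def exp_add exp_diff exp_minus field_simps)
  then have "Re (exp \<zeta> * sinh t) = Re ((exp (\<zeta> + t) - exp (\<zeta> - t)) / 2)" by (simp only:)
  then show ?thesis by (simp add: Re_exp del: times_complex.sel)
qed

text \<open>K bounds how far t is from the point s of the positive axis. The growing exponential in
  z sinh t has a cosine of at least cos \<beta> > 0 and gives the decay; the other one and the
  offset in \<nu> t only cost constants.\<close>

lemma norm_weber_kernel_le: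
  assumes "\<bar>Im t + Im \<zeta>\<bar> \<le> \<beta>" "\<beta> < pi / 2" "norm t \<le> K + s" "Re t \<ge> - K + s" "s \<ge> 0" 
  shows "norm (weber_kernel (exp \<zeta>) \<nu> t) \<le>
    exp (exp (Re \<zeta> + K) / 2 + norm \<nu> * K) * exp (- (exp (Re \<zeta> - K) * cos \<beta> / 2 * exp s) + norm \<nu> * s)"
proof -
  have c: "cos (Im \<zeta> + Im t) \<ge> cos \<beta>" 
    using assms(1,2) cos_monotone_0_pi_le[of "\<bar>Im t + Im \<zeta>\<bar>" \<beta>] by (simp add: cos_abs_real add.commute)
  have c0: "cos \<beta> \<ge> 0" using assms(1,2) by (intro cos_ge_zero) auto
  have "exp (Re \<zeta> - K + s) * cos \<beta> \<le> exp (Re \<zeta> + Re t) * cos (Im \<zeta> + Im t)"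
    using assms c c0 by (intro mult_mono) auto
  moreover have "exp (Re \<zeta> - Re t) * cos (Im \<zeta> - Im t) \<le> exp (Re \<zeta> + K)"
  proof -
    have "exp (Re \<zeta> - Re t) * cos (Im \<zeta> - Im t) \<le> exp (Re \<zeta> - Re t) * 1"
      by (intro mult_left_mono) auto
    also have "\<dots> \<le> exp (Re \<zeta> + K)" using assms by simp
    finally show ?thesis .
  qed
  ultimately have 1: "Re (exp \<zeta> * sinh t) \<ge> (exp (Re \<zeta> - K + s) * cos \<beta> - exp (Re \<zeta> + K)) / 2"
    unfolding Re_exp_mult_sinh by (simp add: field_simps)
  have "\<bar>Re (\<nu> * t)\<bar> \<le> norm \<nu> * norm t" using abs_Re_le_cmod[of "\<nu> * t"] by (simp add: norm_mult)
  also have "\<dots> \<le> norm \<nu> * (K + s)" using assms by (intro mult_left_mono) auto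
  finally have 2: "- Re (\<nu> * t) \<le> norm \<nu> * (K + s)" by linarith
  have "norm (weber_kernel (exp \<zeta>) \<nu> t) = exp (- Re (exp \<zeta> * sinh t) - Re (\<nu> * t))"
    by (simp add: weber_kernel_def del: times_complex.sel)
  also have "\<dots> \<le> exp ((exp (Re \<zeta> + K) - exp (Re \<zeta> - K + s) * cos \<beta>) / 2 + norm \<nu> * (K + s))"
    using 1 2 by (simp add: field_simps del: times_complex.sel)
  also have "\<dots> = exp (exp (Re \<zeta> + K) / 2 + norm \<nu> * K) * exp (- (exp (Re \<zeta> - K) * cos \<beta> / 2 * exp s) + norm \<nu> * s)"
    by (simp add: mult_exp_exp algebra_simps diff_divide_distrib)
  finally show ?thesis .
qed

lemma weber_kernel_ray_bound:
  assumes "\<bar>Im a + Im \<zeta>\<bar> < pi / 2" "\<bar>Im b + Im \<zeta>\<bar> < pi / 2"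
  obtains C where "\<And>s y. s \<ge> 0 \<Longrightarrow> y \<in> closed_segment a b \<Longrightarrow>
      norm (weber_kernel (exp \<zeta>) \<nu> (y + of_real s)) \<le> C * exp (- s)"
proof -
  define \<beta> where "\<beta> = max \<bar>Im a + Im \<zeta>\<bar> \<bar>Im b + Im \<zeta>\<bar>"
  have \<beta>: "\<beta> < pi / 2" "\<beta> \<ge> 0" using assms by (auto simp: \<beta>_def)
  define K where "K = max (norm a) (norm b)"
  define c where "c = exp (Re \<zeta> - K) * cos \<beta> / 2"
  have "c > 0" unfolding c_def using \<beta> by (auto intro!: mult_pos_pos cos_gt_zero_pi)
  show ?thesis
  proof
    fix s :: real and y assume s: "s \<ge> 0" and y: "y \<in> closed_segment a b"
    have "closed_segment a b \<subseteq> cball 0 K"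
      by (rule closed_segment_subset) (auto simp: K_def)
    then have yK: "norm y \<le> K" using y by auto
    have "closed_segment a b \<subseteq> {y. Im y \<le> \<beta> - Im \<zeta>} \<inter> {y. Im y \<ge> - \<beta> - Im \<zeta>}"
      by (rule closed_segment_subset)
         (auto simp: \<beta>_def intro!: convex_Int convex_halfspace_Im_le convex_halfspace_Im_ge)
    then have "\<bar>Im y + Im \<zeta>\<bar> \<le> \<beta>" using y by (auto simp: abs_le_iff)
    then have "norm (weber_kernel (exp \<zeta>) \<nu> (y + of_real s)) \<le>
      exp (exp (Re \<zeta> + K) / 2 + norm \<nu> * K) * exp (- (c * exp s) + norm \<nu> * s)"
      unfolding c_def using \<beta> s yK abs_Re_le_cmod[of y]
      by (intro norm_weber_kernel_le) (auto intro: order_trans[OF norm_triangle_ineq])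
    also have "\<dots> \<le> exp (exp (Re \<zeta> + K) / 2 + norm \<nu> * K) * (exp ((norm \<nu> + 1)\<^sup>2 / (2 * c)) * exp (- s))"
      by (intro mult_left_mono exp_neg_exp_le) (use \<open>c > 0\<close> s in auto)
    finally show "norm (weber_kernel (exp \<zeta>) \<nu> (y + of_real s)) \<le>
      (exp (exp (Re \<zeta> + K) / 2 + norm \<nu> * K) * exp ((norm \<nu> + 1)\<^sup>2 / (2 * c))) * exp (- s)"
      by (simp add: mult_ac)
  qed
qed

text \<open>The final ray may lie at any height in the band of width pi where z exp t has positive
  real part. The defining ray from \<open>- \<zeta>\<close> runs along the middle of this band and
  can be slid within it.\<close>

lemma weber_A_base:
  assumes "\<bar>Im a + Im \<zeta>\<bar> < pi / 2"
  shows "weber_A \<nu> \<zeta> = contour_integral (linepath 0 a) (weber_kernel (exp \<zeta>) \<nu>)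
                   + ray_int (weber_kernel (exp \<zeta>) \<nu>) a"
proof -
  let ?g = "weber_kernel (exp \<zeta>) \<nu>"
  have hol: "?g holomorphic_on UNIV" by (intro holomorphic_intros)
  obtain G where G: "\<And>x. (G has_field_derivative ?g x) (at x)"
    using entire_primitive[OF hol] by blast
  obtain C where C: "\<And>s y. s \<ge> 0 \<Longrightarrow> y \<in> closed_segment (- \<zeta>) a \<Longrightarrow> norm (?g (y + of_real s)) \<le> C * exp (- s)"
    using weber_kernel_ray_bound[of "- \<zeta>" \<zeta> a] assms by auto
  show ?thesis
    using ray_shift[OF hol C]
    by (simp add: weber_A_def contour_integral_linepath_primitive[OF G])
qed

text \<open>The order may depend on the point, since the saddle point integral is obtained with the
  order \<open>\<kappa> - exp \<zeta>\<close>. Both pieces of the path are parameter integrals with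
  locally uniform majorants.\<close>

lemma holomorphic_on_weber_A:
  assumes n: "n holomorphic_on UNIV" and h: "h holomorphic_on UNIV"
  shows "(\<lambda>w. weber_A (n w) (h w)) holomorphic_on UNIV"
proof -
  have cn: "continuous_on T n" "continuous_on T h" for T
    using n h by (meson continuous_on_subset holomorphic_on_imp_continuous_on subset_UNIV)+
  have hn: "n holomorphic_on T" "h holomorphic_on T" for T
    using n h holomorphic_on_subset by blast+
  define F1 where "F1 = (\<lambda>w x. weber_kernel (exp (h w)) (n w) (linepath 0 (- h w) x) * (- h w))"
  have 1: "contour_integral (linepath 0 (- h w)) (weber_kernel (exp (h w)) (n w)) = (\<integral>x. indicator {0..1} x *\<^sub>R F1 w x \<partial>lborel)" for w
    by (simp add: contour_integral_linepath_lborel[OF continuous_on_weber_kernel] F1_def set_lebesgue_integral_def)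
  have cF1: "continuous_on T (\<lambda>p. F1 (fst p) (snd p))" for T
    unfolding F1_def linepath_def
    by (intro continuous_intros continuous_on_compose2[OF cn(1)[of UNIV]] continuous_on_compose2[OF cn(2)[of UNIV]]) auto
  have "(\<lambda>w. \<integral>x. indicator {0..1} x *\<^sub>R F1 w x \<partial>lborel) holomorphic_on UNIV"
  proof (rule holomorphic_on_integral_param)
    fix x :: real
    show "(\<lambda>w. indicator {0..1} x *\<^sub>R F1 w x) holomorphic_on UNIV"
      unfolding F1_def linepath_def by (simp add: scaleR_conv_of_real, intro holomorphic_intros hn)
  next
    fix z
    have "continuous_on {0..1} (F1 z)"
      by (rule continuous_on_compose2[OF cF1[of UNIV], of _ "\<lambda>x. (z, x)", simplified]) (intro continuous_intros)
    then show "(\<lambda>x. indicator {0..1} x *\<^sub>R F1 z x) \<in> borel_measurable lborel"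
      by (simp add: borel_measurable_continuous_on_indicator)
  next
    fix z0 :: complex
    have "compact ((\<lambda>p. F1 (fst p) (snd p)) ` (cball z0 1 \<times> {0..1}))"
      by (intro compact_continuous_image cF1 compact_Times) auto
    then obtain B where B: "\<And>z x. z \<in> cball z0 1 \<Longrightarrow> x \<in> {0..1} \<Longrightarrow> norm (F1 z x) \<le> B"
      by (fastforce dest!: compact_imp_bounded simp: bounded_iff)
    show "\<exists>r>0. \<exists>g. cball z0 r \<subseteq> UNIV \<and> integrable lborel g \<and>
        (\<forall>z\<in>cball z0 r. \<forall>x\<in>space lborel. norm (indicator {0..1} x *\<^sub>R F1 z x) \<le> g x)"
    proof (intro exI[of _ 1] exI[of _ "\<lambda>x. indicator {0..1} x *\<^sub>R B"] conjI ballI)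
      show "integrable lborel (\<lambda>x::real. indicator {0..1} x *\<^sub>R B)"
        by (intro integrable_scaleR_left) auto
      show "norm (indicator {0..1} x *\<^sub>R F1 z x) \<le> indicator {0..1} x *\<^sub>R B" if "z \<in> cball z0 1" for z and x :: real
        using B[OF that, of x] by (auto simp: indicator_def)
    qed auto
  qed auto
  moreover
  define F2 where "F2 = (\<lambda>w s. weber_kernel (exp (h w)) (n w) (- h w + of_real s))"
  have 2: "ray_int (weber_kernel (exp (h w)) (n w)) (- h w) = (\<integral>x. indicator {0<..} x *\<^sub>R F2 w x \<partial>lborel)" for w
    by (simp add: ray_int_def F2_def set_lebesgue_integral_def)
  have "(\<lambda>w. \<integral>x. indicator {0<..} x *\<^sub>R F2 w x \<partial>lborel) holomorphic_on UNIV"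
  proof (rule holomorphic_on_integral_param)
    fix x :: real
    show "(\<lambda>w. indicator {0<..} x *\<^sub>R F2 w x) holomorphic_on UNIV"
      unfolding F2_def by (simp add: scaleR_conv_of_real, intro holomorphic_intros hn)
  next
    fix z
    have "continuous_on {0<..} (F2 z)"
      unfolding F2_def by (intro continuous_intros)
    then show "(\<lambda>x. indicator {0<..} x *\<^sub>R F2 z x) \<in> borel_measurable lborel"
      by (simp add: borel_measurable_continuous_on_indicator)
  next
    fix z0 :: complex
    have "compact (n ` cball z0 1)" "compact (h ` cball z0 1)"
      by (intro compact_continuous_image cn compact_cball)+
    then obtain L0 K0 where LK0: "\<And>z. z \<in> cball z0 1 \<Longrightarrow> norm (n z) \<le> L0" "\<And>z. z \<in> cball z0 1 \<Longrightarrow> norm (h z) \<le> K0"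
      by (fastforce dest!: compact_imp_bounded simp: bounded_iff)
    define L K where "L = max L0 0" and "K = max K0 0"
    have LK: "norm (n z) \<le> L" "norm (h z) \<le> K" "L \<ge> 0" "K \<ge> 0" if "z \<in> cball z0 1" for z
      using LK0[OF that] by (auto simp: L_def K_def)
    \<comment> \<open>The angle 0 is admissible in the kernel bound, as Im t + Im \<zeta> = 0 on the
      ray from - \<zeta>.\<close>
    define c where "c = exp (- K - K) * cos 0 / 2"
    have "c > 0" by (simp add: c_def)
    define C where "C = exp (exp (K + K) / 2 + L * K) * exp ((L + 1)\<^sup>2 / (2 * c))"
    have "norm (F2 z s) \<le> C * exp (- s)" if z: "z \<in> cball z0 1" and s: "s \<ge> 0" for z s
    proof -
      note LKz = LK[OF z]
      have Re: "\<bar>Re (h z)\<bar> \<le> K" using LKz(2) abs_Re_le_cmod[of "h z"] by linarith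
      have "norm (F2 z s) \<le> exp (exp (Re (h z) + K) / 2 + norm (n z) * K) * 
         exp (- (exp (Re (h z) - K) * cos 0 / 2 * exp s) + norm (n z) * s)"
        unfolding F2_def
      proof (rule norm_weber_kernel_le)
        show "norm (- h z + of_real s) \<le> K + s" 
          using norm_triangle_ineq[of "- h z" "of_real s"] LKz(2) s by simp
      qed (use Re s in auto)
      also have "\<dots> \<le> exp (exp (K + K) / 2 + L * K) * exp (- (c * exp s) + L * s)"
      proof -
        have "exp (Re (h z) + K) \<le> exp (K + K)" "norm (n z) * K \<le> L * K" "norm (n z) * s \<le> L * s"
          using Re LKz s by (auto intro!: mult_right_mono)
        moreover have "c \<le> exp (Re (h z) - K) * cos 0 / 2"
          using Re by (simp add: c_def)
        then have "c * exp s \<le> exp (Re (h z) - K) * cos 0 / 2 * exp s"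
          by (rule mult_right_mono) simp
        ultimately have "exp (Re (h z) + K) / 2 + norm (n z) * K \<le> exp (K + K) / 2 + L * K"
          "- (exp (Re (h z) - K) * cos 0 / 2 * exp s) + norm (n z) * s \<le> - (c * exp s) + L * s"
          by linarith+
        then show ?thesis by (intro mult_mono) auto
      qed
      also have "\<dots> \<le> exp (exp (K + K) / 2 + L * K) * (exp ((L + 1)\<^sup>2 / (2 * c)) * exp (- s))"
        by (intro mult_left_mono exp_neg_exp_le) (use \<open>c > 0\<close> s in auto)
      finally show ?thesis by (simp add: C_def mult_ac)
    qed
    then show "\<exists>r>0. \<exists>g. cball z0 r \<subseteq> UNIV \<and> integrable lborel g \<and>
        (\<forall>z\<in>cball z0 r. \<forall>x\<in>space lborel. norm (indicator {0<..} x *\<^sub>R F2 z x) \<le> g x)"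
      using set_integrable_exp_neg[of C]
      by (intro exI[of _ 1] exI[of _ "\<lambda>x. indicator {0<..} x *\<^sub>R (C * exp (- x))"])
         (auto simp: set_integrable_def indicator_def)
  qed auto
  ultimately show ?thesis
    unfolding weber_A_def 1 2 by (intro holomorphic_intros)
qed

text \<open>Both sinh under t \<mapsto> t + i pi and z under \<zeta> \<mapsto> \<zeta> - i pi change
  sign, so translation maps one kernel to a multiple of the other. The translated path starts at - i
  pi, whence the extra segment.\<close>

lemma weber_A_shift:
  "weber_A \<nu> (\<zeta> - \<i> * pi) = exp (- (\<i> * pi * \<nu>)) *
     (contour_integral (linepath (- (\<i> * pi)) 0) (weber_kernel (exp \<zeta>) \<nu>) + weber_A \<nu> \<zeta>)"
proof -
  let ?g = "weber_kernel (exp \<zeta>) \<nu>"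
  let ?h = "weber_kernel (exp (\<zeta> - \<i> * pi)) \<nu>"
  have eq: "?h (t + \<i> * pi) = exp (- (\<i> * pi * \<nu>)) * ?g t" for t
  proof -
    have "sinh (t + \<i> * pi) = - sinh t"
      by (simp add: sinh_field_def exp_add exp_diff exp_minus field_simps)
    moreover have "exp (\<zeta> - \<i> * pi) = - exp \<zeta>" by (simp add: exp_diff)
    ultimately show ?thesis
      by (simp add: weber_kernel_def mult_exp_exp algebra_simps)
  qed
  obtain G where G: "\<And>x. (G has_field_derivative ?g x) (at x)"
    using entire_primitive[OF holomorphic_weber_kernel'] by blast
  define H where "H = (\<lambda>t. exp (- (\<i> * pi * \<nu>)) * G (t - \<i> * pi))"
  have H: "(H has_field_derivative ?h x) (at x)" for x
  proof -
    have "(H has_field_derivative exp (- (\<i> * pi * \<nu>)) * (?g (x - \<i> * pi) * 1)) (at x)"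
      unfolding H_def by (intro DERIV_cmult DERIV_chain'[OF _ G]) (auto intro!: derivative_eq_intros)
    then show ?thesis using eq[of "x - \<i> * pi"] by simp
  qed
  have "ray_int ?h (- (\<zeta> - \<i> * pi)) = exp (- (\<i> * pi * \<nu>)) * ray_int ?g (- \<zeta>)"
  proof -
    have "?h (- (\<zeta> - \<i> * pi) + of_real s) = exp (- (\<i> * pi * \<nu>)) * ?g (- \<zeta> + of_real s)" for s
      using eq[of "- \<zeta> + of_real s"] by (simp add: algebra_simps)
    then show ?thesis unfolding ray_int_def by simp
  qed
  then show ?thesis
    unfolding weber_A_def
    by (simp add: contour_integral_linepath_primitive[OF G] contour_integral_linepath_primitive[OF H])
       (simp add: H_def algebra_simps)
qed

text \<open>The reflection t \<mapsto> - i pi - t fixes sinh t and reverses the segment; only \<nu>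
  t changes sign, up to a constant.\<close>

lemma weber_kernel_half_period_reflect:
  "contour_integral (linepath (- (\<i> * pi)) 0) (weber_kernel z \<nu>) =
   exp (\<i> * pi * \<nu>) * contour_integral (linepath (- (\<i> * pi)) 0) (weber_kernel z (- \<nu>))"
proof -
  have eq: "weber_kernel z \<nu> (- (\<i> * pi) - t) = exp (\<i> * pi * \<nu>) * weber_kernel z (- \<nu>) t" for t
  proof -
    have "sinh (- (\<i> * pi) - t) = sinh t"
      by (simp add: sinh_field_def exp_diff exp_minus exp_add field_simps)
    then show ?thesis
      by (simp add: weber_kernel_def mult_exp_exp algebra_simps)
  qed
  obtain G where G: "\<And>x. (G has_field_derivative weber_kernel z \<nu> x) (at x)"
    using entire_primitive[OF holomorphic_weber_kernel'] by blast
  define H where "H = (\<lambda>t. - exp (- (\<i> * pi * \<nu>)) * G (- (\<i> * pi) - t))"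
  have H: "(H has_field_derivative weber_kernel z (- \<nu>) x) (at x)" for x
  proof -
    have "(H has_field_derivative - exp (- (\<i> * pi * \<nu>)) * (weber_kernel z \<nu> (- (\<i> * pi) - x) * (- 1))) (at x)"
      unfolding H_def by (intro DERIV_cmult DERIV_chain'[OF _ G]) (auto intro!: derivative_eq_intros)
    then show ?thesis by (simp add: eq mult_exp_exp flip: mult.assoc)
  qed
  show ?thesis
    by (simp add: contour_integral_linepath_primitive[OF G] contour_integral_linepath_primitive[OF H])
       (simp add: H_def algebra_simps exp_minus)
qed

text \<open>Two values three half-turns apart are reduced to two values one half-turn apart. Each
  half-turn produces a segment integral, and by the reflection these cancel between the orders \<nu>
  and -\<nu>. With arg z = pi/2 this expresses the boundary values at 3 pi/2 and -3 pi/2 by a Hankel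
  function.\<close>

lemma weber_A_connection:
  "weber_A \<nu> (\<zeta> + \<i> * pi) + weber_A (- \<nu>) (\<zeta> - 2 * \<i> * pi) =
   exp (2 * \<i> * pi * \<nu>) * (weber_A \<nu> (\<zeta> - \<i> * pi) + weber_A (- \<nu>) \<zeta>)"
proof -
  define E where "E = exp (\<i> * pi * \<nu>)"
  have E: "exp (- (\<i> * pi * \<nu>)) = 1 / E" "exp (2 * \<i> * pi * \<nu>) = E * E" "E \<noteq> 0"
    by (auto simp: E_def exp_minus field_simps mult_exp_exp)
  define W where "W = (\<lambda>z \<nu>. contour_integral (linepath (- (\<i> * pi)) 0) (weber_kernel z \<nu>))"
  have m: "exp (\<zeta> + \<i> * pi) = - exp \<zeta>" "exp (\<zeta> - \<i> * pi) = - exp \<zeta>" by (simp_all add: exp_add exp_diff)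
  have 1: "weber_A \<nu> \<zeta> = 1 / E * (W (- exp \<zeta>) \<nu> + weber_A \<nu> (\<zeta> + \<i> * pi))"
    using weber_A_shift[of \<nu> "\<zeta> + \<i> * pi"] by (simp add: W_def m E)
  have 2: "weber_A \<nu> (\<zeta> - \<i> * pi) = 1 / E * (W (exp \<zeta>) \<nu> + weber_A \<nu> \<zeta>)"
    using weber_A_shift[of \<nu> "\<zeta>"] by (simp add: W_def m E)
  have 3: "weber_A (- \<nu>) (\<zeta> - 2 * \<i> * pi) = E * (W (- exp \<zeta>) (- \<nu>) + weber_A (- \<nu>) (\<zeta> - \<i> * pi))"
    using weber_A_shift[of "- \<nu>" "\<zeta> - \<i> * pi"] by (simp add: W_def m E_def algebra_simps)
  have 4: "weber_A (- \<nu>) (\<zeta> - \<i> * pi) = E * (W (exp \<zeta>) (- \<nu>) + weber_A (- \<nu>) \<zeta>)"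
    using weber_A_shift[of "- \<nu>" \<zeta>] by (simp add: W_def m E_def)
  have 5: "W z \<nu> = E * W z (- \<nu>)" for z
    unfolding W_def E_def by (rule weber_kernel_half_period_reflect)
  have 6: "weber_A \<nu> (\<zeta> + \<i> * pi) = E * weber_A \<nu> \<zeta> - W (- exp \<zeta>) \<nu>"
    using 1 E(3) by (simp add: field_simps)
  have 7: "weber_A \<nu> \<zeta> = E * weber_A \<nu> (\<zeta> - \<i> * pi) - W (exp \<zeta>) \<nu>"
    using 2 E(3) by (simp add: field_simps)
  show ?thesis unfolding 6 7 3 4 5 E(2) by (simp add: algebra_simps)
qed

section \<open>Hankel's loop integral\<close>

lemma set_integrable_mirror:
  fixes k :: "real \<Rightarrow> complex"
  shows "set_integrable lborel {0<..} (\<lambda>x. k (- x)) \<longleftrightarrow> set_integrable lborel {..<0} k"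
    and "(LBINT x:{0<..}. k (- x)) = (LBINT x:{..<0}. k x)"
proof -
  have eq: "indicator {..<0} (0 + - 1 * x) *\<^sub>R k (0 + - 1 * x) = indicator {0<..} x *\<^sub>R k (- x)" for x :: real
    by (simp add: indicator_def)
  show "set_integrable lborel {0<..} (\<lambda>x. k (- x)) \<longleftrightarrow> set_integrable lborel {..<0} k"
    using lborel_integrable_real_affine_iff[of "- 1" "\<lambda>x. indicator {..<0} x *\<^sub>R k x" 0]
    unfolding eq by (simp add: set_integrable_def)
  show "(LBINT x:{0<..}. k (- x)) = (LBINT x:{..<0}. k x)"
    using lborel_integral_real_affine[of "- 1" "\<lambda>x. indicator {..<0} x *\<^sub>R k x" 0]
    unfolding eq by (simp add: set_lebesgue_integral_def)
qed

lemma integrable_line_split: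
  fixes k :: "real \<Rightarrow> complex"
  assumes 1: "set_integrable lborel {0<..} k" and 2: "set_integrable lborel {0<..} (\<lambda>x. k (- x))"
  shows "integrable lborel k"
    and "(LBINT x. k x) = (LBINT x:{0<..}. k x) + (LBINT x:{0<..}. k (- x))"
proof -
  have 3: "set_integrable lborel {..<0} k" using 2 by (simp add: set_integrable_mirror)
  have 4: "set_integrable lborel ({..<0} \<union> {0<..}) k"
    by (intro set_integrable_Un 1 3) auto
  have "set_integrable lborel UNIV k"
    using 4 by (subst set_integrable_discrete_difference[of "{0}" _ "{..<0} \<union> {0<..}"]) auto
  then show "integrable lborel k" by (simp add: set_integrable_def)
  have "(LBINT x. k x) = (LBINT x:UNIV. k x)" by (simp add: set_lebesgue_integral_def)
  also have "\<dots> = (LBINT x:{..<0} \<union> {0<..}. k x)"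
    by (rule set_integral_discrete_difference[of "{0}"]) auto
  also have "\<dots> = (LBINT x:{..<0}. k x) + (LBINT x:{0<..}. k x)"
    by (intro set_integral_Un 1 3) auto
  finally show "(LBINT x. k x) = (LBINT x:{0<..}. k x) + (LBINT x:{0<..}. k (- x))"
    by (simp add: set_integrable_mirror)
qed

text \<open>Integrability is transferred first, through the nonnegative substitution rule applied to
  norms; this justifies the substitution for the complex integrand. It serves with c = 1, 1/3 and
  3.\<close>

lemma integral_exp_substitution:
  fixes F :: "real \<Rightarrow> complex"
  assumes c: "c > 0" and F: "continuous_on {0<..} F"
    and int: "integrable lborel (\<lambda>x. (c * exp (c * x)) *\<^sub>R F (exp (c * x)))"
  shows "set_integrable lborel {0<..} F"
    and "(LBINT t:{0<..}. F t) = (LBINT x. (c * exp (c * x)) *\<^sub>R F (exp (c * x)))"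
proof -
  have lim: "((ereal \<circ> (\<lambda>x. exp (c * x)) \<circ> real_of_ereal) \<longlongrightarrow> 0) (at_right (- \<infinity>))"
    "((ereal \<circ> (\<lambda>x. exp (c * x)) \<circ> real_of_ereal) \<longlongrightarrow> \<infinity>) (at_left \<infinity>)"
  proof -
    have "((\<lambda>x. exp (c * x)) \<longlongrightarrow> 0) at_bot" "filterlim (\<lambda>x. exp (c * x)) at_top at_top"
      using c by real_asymp+
    then show "((ereal \<circ> (\<lambda>x. exp (c * x)) \<circ> real_of_ereal) \<longlongrightarrow> 0) (at_right (- \<infinity>))"
      "((ereal \<circ> (\<lambda>x. exp (c * x)) \<circ> real_of_ereal) \<longlongrightarrow> \<infinity>) (at_left \<infinity>)"
      unfolding ereal_tendsto_simps by (simp_all add: o_def zero_ereal_def ereal_tendsto_simps)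
  qed
  have contF: "isCont F (exp (c * x))" for x
    using F by (simp add: continuous_on_eq_continuous_at)
  have e0: "einterval 0 \<infinity> = {0<..}"
    by (simp add: zero_ereal_def del: ereal_eq_0)
  have "set_integrable lborel (einterval 0 \<infinity>) (\<lambda>t. norm (F t))"
  proof (rule interval_integral_substitution_nonneg(1)[where g = "\<lambda>x. exp (c * x)" and g' = "\<lambda>x. c * exp (c * x)" and a = "-\<infinity>" and b = "\<infinity>"])
    show "set_integrable lborel (einterval (- \<infinity>) \<infinity>) (\<lambda>x. norm (F (exp (c * x))) * (c * exp (c * x)))"
      using integrable_norm[OF int] c by (simp add: set_integrable_def mult_ac)
    show "((ereal \<circ> (\<lambda>x. exp (c * x)) \<circ> real_of_ereal) \<longlongrightarrow> 0) (at_right (- \<infinity>))" by (rule lim)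
    show "((ereal \<circ> (\<lambda>x. exp (c * x)) \<circ> real_of_ereal) \<longlongrightarrow> \<infinity>) (at_left \<infinity>)" by (rule lim)
  qed (use c in \<open>auto intro!: derivative_eq_intros continuous_intros contF\<close>)
  then have n: "set_integrable lborel {0<..} (\<lambda>t. norm (F t))" by (simp add: e0)
  show i: "set_integrable lborel {0<..} F"
    by (rule set_integrable_continuous_bound[OF F _ n]) auto
  have "(LBINT t=0..\<infinity>. F t) = (LBINT x=- \<infinity>..\<infinity>. (c * exp (c * x)) *\<^sub>R F (exp (c * x)))"
  proof (rule interval_integral_substitution_integrable)
    show "((ereal \<circ> (\<lambda>x. exp (c * x)) \<circ> real_of_ereal) \<longlongrightarrow> 0) (at_right (- \<infinity>))" by (rule lim)
    show "((ereal \<circ> (\<lambda>x. exp (c * x)) \<circ> real_of_ereal) \<longlongrightarrow> \<infinity>) (at_left \<infinity>)" by (rule lim)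
    show "set_integrable lborel (einterval (- \<infinity>) \<infinity>) (\<lambda>x. (c * exp (c * x)) *\<^sub>R F (exp (c * x)))"
      using int by (simp add: set_integrable_def)
    show "set_integrable lborel (einterval 0 \<infinity>) F" using i by (simp add: e0)
  qed (use c in \<open>auto intro!: derivative_eq_intros continuous_intros contF\<close>)
  then show "(LBINT t:{0<..}. F t) = (LBINT x. (c * exp (c * x)) *\<^sub>R F (exp (c * x)))"
    by (simp add: interval_lebesgue_integral_def e0 set_lebesgue_integral_def)
qed

text \<open>Euler's integral after t = exp x. The two half-lines are recorded separately because the
  loop integral meets them as separate rays.\<close>

lemma Gamma_integral_line:
  assumes z: "Re z > 0"
  shows "integrable lborel (\<lambda>x. exp (z * of_real x - of_real (exp x)))"
    and "(LBINT x. exp (z * of_real x - of_real (exp x))) = Gamma z"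
    and "set_integrable lborel {0<..} (\<lambda>x. exp (z * of_real x - of_real (exp x)))"
    and "set_integrable lborel {0<..} (\<lambda>x. exp (z * of_real (- x) - of_real (exp (- x))))"
proof -
  define k where "k = (\<lambda>x::real. exp (z * of_real x - of_real (exp x)))"
  have ck: "continuous_on A k" for A unfolding k_def by (intro continuous_intros)
  have 1: "set_integrable lborel {0<..} k"
  proof (rule set_integrable_continuous_bound[OF ck _ set_integrable_exp_neg])
    fix x :: real assume "x \<in> {0<..}"
    then show "norm (k x) \<le> exp ((Re z + 1)\<^sup>2 / (2 * 1)) * exp (- x)"
      using exp_neg_exp_le[of 1 x "Re z"] by (simp add: k_def)
  qed auto
  have 2: "set_integrable lborel {0<..} (\<lambda>x. k (- x))"
  proof (rule set_integrable_continuous_bound[OF _ _ set_integrable_exp_neg_rate[OF z]])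
    show "continuous_on {0<..} (\<lambda>x. k (- x))" unfolding k_def by (intro continuous_intros)
    fix x :: real assume "x \<in> {0<..}"
    then show "norm (k (- x)) \<le> 1 * exp (- (Re z * x))"
      by (simp add: k_def)
  qed auto
  show "set_integrable lborel {0<..} (\<lambda>x. exp (z * of_real x - of_real (exp x)))"
    "set_integrable lborel {0<..} (\<lambda>x. exp (z * of_real (- x) - of_real (exp (- x))))"
    using 1 2 by (simp_all add: k_def)
  have int: "integrable lborel k" by (rule integrable_line_split(1)[OF 1 2])
  then show "integrable lborel (\<lambda>x. exp (z * of_real x - of_real (exp x)))" by (simp add: k_def)
  define F where "F = (\<lambda>t. of_real t powr (z - 1) / of_real (exp t) :: complex)"
  have eq: "(1 * exp (1 * x)) *\<^sub>R F (exp (1 * x)) = k x" for x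
  proof -
    have "of_real (exp x) powr (z - 1) = exp ((z - 1) * of_real x)"
      by (simp add: powr_def Ln_of_real flip: of_real_exp)
    then have "(1 * exp (1 * x)) *\<^sub>R F (exp (1 * x)) = exp (of_real x) * (exp ((z - 1) * of_real x) * exp (- of_real (exp x)))"
      by (simp add: F_def scaleR_conv_of_real exp_minus field_simps exp_of_real)
    also have "\<dots> = k x" by (simp add: k_def mult_exp_exp algebra_simps)
    finally show ?thesis .
  qed
  have cF: "continuous_on {0<..} F"
    unfolding F_def by (intro continuous_intros) auto
  have i: "set_integrable lborel {0<..} F" "(LBINT t:{0<..}. F t) = (LBINT x. k x)"
    using integral_exp_substitution[of 1 F] cF int by (simp_all only: eq)
  have "(F has_integral Gamma z) {0<..}"
    unfolding F_def using z by (intro Gamma_integral_complex') auto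
  then have "(LBINT t:{0<..}. F t) = Gamma z"
    using set_borel_integral_eq_integral(2)[OF i(1)] by (simp add: integral_unique)
  then show "(LBINT x. exp (z * of_real x - of_real (exp x))) = Gamma z"
    using i(2) by (simp add: k_def)
qed

text \<open>Under u = exp t this is Hankel's contour: in along the lower side of the negative axis,
  once around the unit circle, out along the upper side. In the variable t the branch of a power of
  u is explicit.\<close>

definition hankel_loop :: "(complex \<Rightarrow> complex) \<Rightarrow> complex" where
  "hankel_loop h = contour_integral (linepath (- (\<i> * pi)) (\<i> * pi)) h + ray_int h (\<i> * pi) - ray_int h (- (\<i> * pi))"

lemma exp_plus_i_pi: "exp (t + \<i> * pi) = - exp t" "exp (t - \<i> * pi) = - exp t" "exp (- (\<i> * pi) + t) = - exp t" "exp (\<i> * pi + t) = - exp t"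
  by (simp_all add: exp_add exp_diff exp_minus)

lemma norm_gamma_kernel_ray_le:
  assumes "s \<ge> 0" "a = \<i> * pi \<or> a = - (\<i> * pi)" "norm w \<le> L"
  shows "norm (exp (exp (a + of_real s) - w * (a + of_real s)))
     \<le> exp (L * pi) * exp ((L + 1)\<^sup>2 / (2 * 1)) * exp (- s)"
proof -
  have "norm (a + of_real s) \<le> pi + s"
    using assms by (intro order_trans[OF norm_triangle_ineq]) (auto simp: norm_mult)
  then have "norm (w * (a + of_real s)) \<le> L * (pi + s)"
    unfolding norm_mult using assms by (intro mult_mono) (auto intro: order_trans[OF norm_ge_zero])
  then have "- Re (w * (a + of_real s)) \<le> L * (pi + s)"
    using abs_Re_le_cmod[of "w * (a + of_real s)"] by linarith
  moreover have "exp (a + of_real s) = - of_real (exp s)"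
    using assms(2) by (auto simp: exp_plus_i_pi exp_of_real)
  ultimately have "norm (exp (exp (a + of_real s) - w * (a + of_real s))) \<le> exp (- exp s + L * (pi + s))"
    by (simp del: times_complex.sel)
  also have "\<dots> = exp (L * pi) * exp (- (1 * exp s) + L * s)" by (simp add: mult_exp_exp algebra_simps)
  also have "\<dots> \<le> exp (L * pi) * (exp ((L + 1)\<^sup>2 / (2 * 1)) * exp (- s))"
    using assms by (intro mult_left_mono exp_neg_exp_le) auto
  finally show ?thesis by (simp add: mult_ac)
qed

text \<open>For Re s < 0 the circular part can be shrunk to u = 0, that is, the vertical segment is
  pushed to Re t \<rightarrow> - \<infinity>. What remains are two full lines, each a phase times
  \<Gamma>(1 - s), and the reflection formula turns their difference into 1/\<Gamma>(s).\<close>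

lemma hankel_loop_left:
  assumes s: "Re s < 0"
  shows "hankel_loop (\<lambda>t. exp (exp t - (s - 1) * t)) = 2 * pi * \<i> * rGamma s"
proof -
  define h where "h = (\<lambda>t. exp (exp t - (s - 1) * t))"
  \<comment> \<open>Reversing t makes the leftward shift an instance of the shift of rays to the
    right.\<close>
  define h' where "h' = (\<lambda>t. h (- t))"
  have hol: "h holomorphic_on UNIV" "h' holomorphic_on UNIV"
    unfolding h'_def h_def by (intro holomorphic_intros)+
  obtain H where H: "\<And>x. (H has_field_derivative h x) (at x)"
    using entire_primitive[OF hol(1)] by blast
  define H' where "H' = (\<lambda>t. - H (- t))"
  have H': "(H' has_field_derivative h' x) (at x)" for x
  proof -
    have "(H' has_field_derivative - (h (- x) * (- 1))) (at x)"
      unfolding H'_def by (intro DERIV_minus DERIV_chain'[OF _ H]) (auto intro!: derivative_eq_intros)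
    then show ?thesis by (simp add: h'_def)
  qed
  define C where "C = exp (1 + (norm (s - 1)) * pi)"
  have "ray_int h' (- (\<i> * pi)) = contour_integral (linepath (- (\<i> * pi)) (\<i> * pi)) h' + ray_int h' (\<i> * pi)"
  proof (rule ray_shift[OF hol(2)])
    fix x :: real and y assume x: "x \<ge> 0" and y: "y \<in> closed_segment (- (\<i> * pi)) (\<i> * pi)"
    have "closed_segment (- (\<i> * pi)) (\<i> * pi) \<subseteq> cball 0 pi"
      by (rule closed_segment_subset) (auto simp: norm_mult)
    then have ny: "norm y \<le> pi" using y by auto
    have "closed_segment (- (\<i> * pi)) (\<i> * pi) \<subseteq> {y. Re y \<le> 0} \<inter> {y. Re y \<ge> 0}"
      by (rule closed_segment_subset)
         (auto intro!: convex_Int convex_halfspace_Re_le convex_halfspace_Re_ge)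
    then have "Re y \<le> 0" "Re y \<ge> 0" using y by blast+
    then have Ry: "Re y = 0" by simp
    have "Re ((s - 1) * y) \<le> norm (s - 1) * pi"
      using complex_Re_le_cmod[of "(s - 1) * y"] mult_left_mono[OF ny, of "norm (s - 1)"] by (simp add: norm_mult)
    moreover have "Re (exp (- (y + of_real x))) \<le> 1"
      using complex_Re_le_cmod[of "exp (- (y + of_real x))"] Ry x by (simp del: exp_le_one_iff add: order_trans[OF _ iffD2[OF exp_le_one_iff]])
    \<comment> \<open>Here Re s < 0 supplies the decay rate \<open>exp (- x)\<close> that the shift
      of rays asks for.\<close>
    moreover have "(Re s - 1) * x \<le> - x" using s x mult_nonpos_nonneg[of "Re s" x] by (simp add: algebra_simps)
    moreover have "Re (exp (- (y + of_real x)) - (s - 1) * (- (y + of_real x))) =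
        Re (exp (- (y + of_real x))) + Re ((s - 1) * y) + (Re s - 1) * x"
      by (simp add: algebra_simps)
    ultimately have "Re (exp (- (y + of_real x)) - (s - 1) * (- (y + of_real x))) \<le> 1 + norm (s - 1) * pi - x"
      by linarith
    then have "norm (h' (y + of_real x)) \<le> exp (1 + norm (s - 1) * pi - x)"
      unfolding h'_def h_def norm_exp_eq_Re exp_le_cancel_iff .
    then show "norm (h' (y + of_real x)) \<le> C * exp (- x)"
      by (simp add: C_def mult_exp_exp)
  qed
  then have 1: "contour_integral (linepath (- (\<i> * pi)) (\<i> * pi)) h = ray_int h' (- (\<i> * pi)) - ray_int h' (\<i> * pi)"
    unfolding contour_integral_linepath_primitive[OF H] contour_integral_linepath_primitive[OF H']
    by (simp add: H'_def algebra_simps)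
  define k where "k = (\<lambda>x::real. exp ((1 - s) * of_real x - of_real (exp x)))"
  have h: "h (\<i> * pi + of_real x) = exp (- (\<i> * pi * (s - 1))) * k x"
    "h (- (\<i> * pi) + of_real x) = exp (\<i> * pi * (s - 1)) * k x" for x
    unfolding h_def k_def exp_plus_i_pi mult_exp_exp by (simp_all add: exp_of_real algebra_simps)
  have h': "h' (- (\<i> * pi) + of_real x) = exp (- (\<i> * pi * (s - 1))) * k (- x)"
    "h' (\<i> * pi + of_real x) = exp (\<i> * pi * (s - 1)) * k (- x)" for x
    using h[of "- x"] by (simp_all add: h'_def algebra_simps)
  have k: "set_integrable lborel {0<..} k" "set_integrable lborel {0<..} (\<lambda>x. k (- x))" "(LBINT x. k x) = Gamma (1 - s)"
    using Gamma_integral_line[of "1 - s"] s by (simp_all add: k_def)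
  have "hankel_loop h = (exp (- (\<i> * pi * (s - 1))) - exp (\<i> * pi * (s - 1))) * (LBINT x. k x)"
    unfolding hankel_loop_def 1 ray_int_def h h' integrable_line_split(2)[OF k(1,2)]
    by (simp add: algebra_simps)
  also have "exp (- (\<i> * pi * (s - 1))) - exp (\<i> * pi * (s - 1)) = 2 * \<i> * sin (pi * s)"
  proof -
    have "exp (- (\<i> * pi * (s - 1))) = - exp (- (\<i> * pi * s))" "exp (\<i> * pi * (s - 1)) = - exp (\<i> * pi * s)"
      using exp_plus_i_pi[of "- (\<i> * pi * s)"] exp_plus_i_pi[of "\<i> * pi * s"] by (simp_all add: algebra_simps)
    then show ?thesis by (simp add: sin_exp_eq mult_ac) 
  qed
  also have "sin (pi * s) = pi * (rGamma s * rGamma (1 - s))"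
    by (simp add: rGamma_reflection_complex)
  also have "2 * \<i> * (pi * (rGamma s * rGamma (1 - s))) * (LBINT x. k x) = 2 * pi * \<i> * rGamma s * (rGamma (1 - s) * Gamma (1 - s))"
    by (simp add: k)
  also have "rGamma (1 - s) * Gamma (1 - s) = 1"
  proof -
    have "1 - s \<notin> \<int>\<^sub>\<le>\<^sub>0" using s by (auto elim!: nonpos_Ints_cases simp: complex_eq_iff)
    then show ?thesis by (simp add: Gamma_def rGamma_eq_zero_iff)
  qed
  finally show ?thesis by (simp add: h_def)
qed

lemma holomorphic_hankel_loop:
  "(\<lambda>s. hankel_loop (\<lambda>t. exp (exp t - (s - 1) * t))) holomorphic_on UNIV"
proof -
  define h where "h = (\<lambda>s t. exp (exp t - (s - 1) * t) :: complex)"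
  have hol: "h s holomorphic_on A" "(\<lambda>s. h s t) holomorphic_on A" for s t A
    unfolding h_def by (intro holomorphic_intros)+
  have c: "continuous_on A (h s)" for s A by (intro holomorphic_on_imp_continuous_on hol)
  have "(\<lambda>s. \<integral>x. indicator {0..1} x *\<^sub>R (h s (linepath (- (\<i> * pi)) (\<i> * pi) x) * (\<i> * pi - - (\<i> * pi))) \<partial>lborel) holomorphic_on UNIV"
  proof (rule holomorphic_on_integral_param)
    fix x :: real
    show "(\<lambda>s. indicator {0..1} x *\<^sub>R (h s (linepath (- (\<i> * pi)) (\<i> * pi) x) * (\<i> * pi - - (\<i> * pi)))) holomorphic_on UNIV"
      by (simp add: scaleR_conv_of_real, intro holomorphic_intros hol)
  next
    fix s
    have "continuous_on {0..1} (\<lambda>x. h s (linepath (- (\<i> * pi)) (\<i> * pi) x) * (\<i> * pi - - (\<i> * pi)))"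
      by (intro continuous_intros continuous_on_compose2[OF c[of UNIV]]) auto
    then show "(\<lambda>x. indicator {0..1} x *\<^sub>R (h s (linepath (- (\<i> * pi)) (\<i> * pi) x) * (\<i> * pi - - (\<i> * pi)))) \<in> borel_measurable lborel"
      by (simp add: borel_measurable_continuous_on_indicator)
  next
    fix s0 :: complex
    define L where "L = norm s0 + 2"
    define B where "B = exp (1 + L * pi) * (2 * pi)"
    have B: "norm (h s (linepath (- (\<i> * pi)) (\<i> * pi) x) * (\<i> * pi - - (\<i> * pi))) \<le> B"
      if "s \<in> cball s0 1" "x \<in> {0..1}" for s x
    proof -
      define t where "t = linepath (- (\<i> * pi)) (\<i> * pi) x"
      have eqt: "t = \<i> * of_real (pi * (2 * x - 1))" by (simp add: t_def linepath_def scaleR_conv_of_real algebra_simps)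
      have "norm t = pi * \<bar>2 * x - 1\<bar>" by (simp add: eqt norm_mult abs_mult del: of_real_mult of_real_diff)
      also have "\<dots> \<le> pi * 1" using that by (intro mult_left_mono) auto
      finally have nt: "norm t \<le> pi" by simp
      have "norm (s - 1) \<le> L"
        using that norm_triangle_ineq4[of s 1] norm_triangle_ineq2[of s s0] by (simp add: L_def dist_norm norm_minus_commute)
      then have "norm ((s - 1) * t) \<le> L * pi" unfolding norm_mult using nt by (intro mult_mono) (auto simp: L_def)
      then have "- Re ((s - 1) * t) \<le> L * pi" using abs_Re_le_cmod[of "(s - 1) * t"] by linarith
      moreover have "Re (exp t) \<le> 1" using complex_Re_le_cmod[of "exp t"] by (simp add: eqt)
      ultimately have "norm (h s t) \<le> exp (1 + L * pi)" by (simp add: h_def del: times_complex.sel)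
      then show ?thesis by (simp add: B_def norm_mult t_def)
    qed
    show "\<exists>r>0. \<exists>g. cball s0 r \<subseteq> UNIV \<and> integrable lborel g \<and>
        (\<forall>s\<in>cball s0 r. \<forall>x\<in>space lborel. norm (indicator {0..1} x *\<^sub>R (h s (linepath (- (\<i> * pi)) (\<i> * pi) x) * (\<i> * pi - - (\<i> * pi)))) \<le> g x)"
    proof (intro exI[of _ 1] exI[of _ "\<lambda>x. indicator {0..1} x *\<^sub>R B"] conjI ballI)
      show "integrable lborel (\<lambda>x::real. indicator {0..1} x *\<^sub>R B)"
        by (intro integrable_scaleR_left) auto
      show "norm (indicator {0..1} x *\<^sub>R (h s (linepath (- (\<i> * pi)) (\<i> * pi) x) * (\<i> * pi - - (\<i> * pi)))) \<le> indicator {0..1} x *\<^sub>R B"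
        if "s \<in> cball s0 1" for s and x :: real
        using B[OF that, of x] by (simp add: indicator_def)
    qed auto
  qed auto
  moreover have "(\<lambda>s. ray_int (h s) a) holomorphic_on UNIV" if a: "a = \<i> * pi \<or> a = - (\<i> * pi)" for a
    unfolding ray_int_def set_lebesgue_integral_def
  proof (rule holomorphic_on_integral_param)
    fix x :: real
    show "(\<lambda>s. indicator {0<..} x *\<^sub>R h s (a + of_real x)) holomorphic_on UNIV"
      by (simp add: scaleR_conv_of_real, intro holomorphic_intros hol)
  next
    fix s
    have "continuous_on {0<..} (\<lambda>x. h s (a + of_real x))"
      by (intro continuous_intros continuous_on_compose2[OF c[of UNIV]]) auto
    then show "(\<lambda>x. indicator {0<..} x *\<^sub>R h s (a + of_real x)) \<in> borel_measurable lborel"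
      by (simp add: borel_measurable_continuous_on_indicator)
  next
    fix s0 :: complex
    define L where "L = norm s0 + 2"
    define C where "C = exp (L * pi) * exp ((L + 1)\<^sup>2 / (2 * 1))"
    have "norm (h s (a + of_real x)) \<le> C * exp (- x)" if "s \<in> cball s0 1" "x \<ge> 0" for s x
    proof -
      have "norm (s - 1) \<le> L"
        using that norm_triangle_ineq4[of s 1] norm_triangle_ineq2[of s s0] by (simp add: L_def dist_norm norm_minus_commute)
      then show ?thesis unfolding h_def C_def using a that by (intro norm_gamma_kernel_ray_le)
    qed
    then show "\<exists>r>0. \<exists>g. cball s0 r \<subseteq> UNIV \<and> integrable lborel g \<and>
        (\<forall>s\<in>cball s0 r. \<forall>x\<in>space lborel. norm (indicator {0<..} x *\<^sub>R h s (a + of_real x)) \<le> g x)"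
      using set_integrable_exp_neg[of C]
      by (intro exI[of _ 1] exI[of _ "\<lambda>x. indicator {0<..} x *\<^sub>R (C * exp (- x))"])
         (auto simp: set_integrable_def indicator_def)
  qed auto
  moreover have hs: "(\<lambda>t. exp (exp t - (s - 1) * t)) = h s" for s by (simp add: h_def)
  ultimately show ?thesis
    unfolding hs hankel_loop_def contour_integral_linepath_lborel(1)[OF c] set_lebesgue_integral_def
    by (intro holomorphic_intros) auto
qed

text \<open>Both sides are entire in s and agree on a half-plane, so the identity theorem
  applies.\<close>

lemma hankel_loop_rGamma:
  "hankel_loop (\<lambda>t. exp (exp t - (s - 1) * t)) = 2 * pi * \<i> * rGamma s"
proof -
  define f where "f = (\<lambda>s. hankel_loop (\<lambda>t. exp (exp t - (s - 1) * t)) - 2 * pi * \<i> * rGamma s)"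
  have "f s = 0"
  proof (rule analytic_continuation[where f = f and S = UNIV and U = "{s. Re s < 0}" and \<xi> = "- 1"])
    show "f holomorphic_on UNIV"
      unfolding f_def by (intro holomorphic_intros holomorphic_hankel_loop)
    have "open {s. Re s < 0}" by (rule open_halfspace_Re_lt)
    then show "- 1 islimpt {s. Re s < 0}" by (intro interior_limit_point) (auto simp: interior_open)
  qed (auto simp: hankel_loop_left f_def)
  then show ?thesis by (simp add: f_def)
qed

section \<open>Bessel functions in terms of one integral\<close>

text \<open>Since |q| \<le> 1, the k-th term is at most |c|^k/k! times |E|, and these norms have
  summable integrals; series and integral may be exchanged.\<close>

lemma exp_series_integral:
  fixes E q :: "real \<Rightarrow> complex"
  assumes A: "A \<in> sets borel" and E: "set_integrable lborel A E"
    and q: "continuous_on A q" "\<And>x. x \<in> A \<Longrightarrow> norm (q x) \<le> 1"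
  shows "(\<lambda>k. LBINT x:A. ((c * q x) ^ k / fact k) * E x) sums (LBINT x:A. exp (c * q x) * E x)"
proof -
  have mq: "set_borel_measurable lborel A q"
    using set_measurable_continuous_on[of A q] q(1) A
    by (simp add: set_borel_measurable_def borel_measurable_continuous_on_indicator)
  define f where "f = (\<lambda>k x. indicator A x *\<^sub>R (((c * q x) ^ k / fact k) * E x))"
  have bd: "norm (f k x) \<le> (norm c ^ k / fact k) * norm (indicator A x *\<^sub>R E x)" for k x
  proof (cases "x \<in> A")
    case True
    have "norm (c * q x) ^ k \<le> norm c ^ k"
      using q(2)[OF True] by (intro power_mono) (auto simp: norm_mult mult_left_le)
    then show ?thesis using True
      by (auto simp: f_def norm_mult norm_divide norm_power power_mult_distrib intro!: mult_right_mono divide_right_mono)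
  qed (auto simp: f_def)
  have eqf: "f k x = ((c * (indicator A x *\<^sub>R q x)) ^ k / fact k) * (indicator A x *\<^sub>R E x)" for k x
    by (simp add: f_def indicator_def)
  have mf: "f k \<in> borel_measurable lborel" for k
    using mq E unfolding eqf[abs_def] set_borel_measurable_def set_integrable_def
    by (intro borel_measurable_times borel_measurable_divide borel_measurable_power borel_measurable_const) auto
  have intf: "integrable lborel (f k)" for k
  proof (rule Bochner_Integration.integrable_bound)
    show "integrable lborel (\<lambda>x. (norm c ^ k / fact k) * norm (indicator A x *\<^sub>R E x))"
      using E by (intro integrable_mult_right integrable_norm) (simp add: set_integrable_def)
    show "AE x in lborel. norm (f k x) \<le> norm ((norm c ^ k / fact k) * norm (indicator A x *\<^sub>R E x))"
      by (intro AE_I2 order_trans[OF bd]) simp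
  qed (rule mf)
  have summable_bd: "summable (\<lambda>k. (norm c ^ k / fact k) * B)" for B :: real
    using summable_exp[of "norm c"] by (intro summable_mult2) (simp add: divide_inverse mult.commute)
  have "(\<lambda>k. integral\<^sup>L lborel (f k)) sums (LBINT x. (\<Sum>k. f k x))"
  proof (rule sums_integral)
    show "AE x in lborel. summable (\<lambda>k. norm (f k x))"
    proof (intro AE_I2)
      fix x show "summable (\<lambda>k. norm (f k x))"
        by (rule summable_comparison_test'[OF summable_bd]) (use bd in simp)
    qed
    show "summable (\<lambda>k. LBINT x. norm (f k x))"
    proof (rule summable_comparison_test')
      show "summable (\<lambda>k. (norm c ^ k / fact k) * (LBINT x. norm (indicator A x *\<^sub>R E x)))"
        by (rule summable_bd)
      fix k :: nat
      have "norm (LBINT x. norm (f k x)) = (LBINT x. norm (f k x))" by simp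
      also have "\<dots> \<le> (LBINT x. (norm c ^ k / fact k) * norm (indicator A x *\<^sub>R E x))"
        using E bd intf by (intro integral_mono integrable_norm integrable_mult_right) (auto simp: set_integrable_def)
      finally show "norm (LBINT x. norm (f k x)) \<le> (norm c ^ k / fact k) * (LBINT x. norm (indicator A x *\<^sub>R E x))"
        by simp
    qed
  qed (rule intf)
  also have "(\<lambda>x. \<Sum>k. f k x) = (\<lambda>x. indicator A x *\<^sub>R (exp (c * q x) * E x))"
  proof
    fix x
    have "(\<lambda>k. ((c * q x) ^ k /\<^sub>R fact k) * (indicator A x *\<^sub>R E x)) sums (exp (c * q x) * (indicator A x *\<^sub>R E x))"
      by (intro sums_mult2 exp_converges)
    then have "(\<lambda>k. f k x) sums (indicator A x *\<^sub>R (exp (c * q x) * E x))"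
      by (simp add: f_def scaleR_conv_of_real field_simps)
    then show "(\<Sum>k. f k x) = indicator A x *\<^sub>R (exp (c * q x) * E x)"
      by (simp add: sums_iff)
  qed
  finally show ?thesis unfolding set_lebesgue_integral_def f_def .
qed

text \<open>The factor exp (- w exp (- t)) is expanded under the integral. On the whole loop Re t
  \<ge> 0, so exp (- t) has modulus at most 1, and each term is Hankel's integral with exponent
  raised by k.\<close>

lemma hankel_loop_exp_series:
  "(\<lambda>k. (- w) ^ k / fact k * (2 * pi * \<i> * rGamma (\<nu> + of_nat k + 1))) sums
     hankel_loop (\<lambda>t. exp (exp t - w * exp (- t) - \<nu> * t))"
proof -
  define E where "E = (\<lambda>t. exp (exp t - \<nu> * t))"
  have cE: "continuous_on A E" for A unfolding E_def by (intro continuous_intros)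
  define e where "e = (\<lambda>k t. exp (exp t - (\<nu> + of_nat k + 1 - 1) * t))"
  define W where "W = (\<lambda>t. exp (exp t - w * exp (- t) - \<nu> * t))"
  have ce: "continuous_on A (e k)" for A k unfolding e_def by (intro continuous_intros)
  have cW: "continuous_on A W" for A unfolding W_def by (intro continuous_intros)
  have 1: "((- w) * exp (- t)) ^ k / fact k * E t = (- w) ^ k / fact k * e k t" for k t
  proof -
    have "((- w) * exp (- t)) ^ k = (- w) ^ k * exp (of_nat k * (- t))"
      by (simp only: power_mult_distrib exp_of_nat_mult)
    moreover have "exp (of_nat k * (- t)) * E t = e k t"
      by (simp add: E_def e_def mult_exp_exp algebra_simps)
    ultimately show ?thesis by (metis times_divide_eq_left mult.assoc)
  qed
  have 2: "exp ((- w) * exp (- t)) * E t = W t" for t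
    by (simp add: E_def W_def mult_exp_exp algebra_simps)
  have ray: "(\<lambda>k. (- w) ^ k / fact k * ray_int (e k) a) sums ray_int W a" if a: "a = \<i> * pi \<or> a = - (\<i> * pi)" for a
  proof -
    have "set_integrable lborel {0<..} (\<lambda>x. E (a + of_real x))"
      unfolding E_def by (rule ray_integrable[OF _ norm_gamma_kernel_ray_le[OF _ a order_refl]])
         (auto intro!: continuous_intros)
    then have "(\<lambda>k. LBINT x:{0<..}. (((- w) * exp (- (a + of_real x))) ^ k / fact k) * E (a + of_real x)) sums
        (LBINT x:{0<..}. exp ((- w) * exp (- (a + of_real x))) * E (a + of_real x))"
      by (intro exp_series_integral) (use a in \<open>auto intro!: continuous_intros\<close>)
    then show ?thesis unfolding 1 2 by (simp add: ray_int_def)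
  qed
  define p where "p = linepath (- (\<i> * pi)) (\<i> * pi)"
  have Rep: "Re (p x) = 0" for x by (simp add: p_def linepath_def)
  have seg: "(\<lambda>k. (- w) ^ k / fact k * contour_integral p (e k)) sums contour_integral p W"
  proof -
    have "(\<lambda>k. LBINT x:{0..1}. (((- w) * exp (- p x)) ^ k / fact k) * (E (p x) * (\<i> * pi - - (\<i> * pi)))) sums
        (LBINT x:{0..1}. exp ((- w) * exp (- p x)) * (E (p x) * (\<i> * pi - - (\<i> * pi))))"
    proof (intro exp_series_integral)
      show "set_integrable lborel {0..1} (\<lambda>x. E (p x) * (\<i> * pi - - (\<i> * pi)))"
        unfolding p_def by (rule contour_integral_linepath_lborel(2)[OF cE])
    qed (auto simp: p_def Rep[unfolded p_def] intro!: continuous_intros)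
    then have "(\<lambda>k. (- w) ^ k / fact k * (LBINT x:{0..1}. e k (p x) * (\<i> * pi - - (\<i> * pi)))) sums
        (LBINT x:{0..1}. W (p x) * (\<i> * pi - - (\<i> * pi)))"
      unfolding mult.assoc[symmetric] 1 2 unfolding mult.assoc set_integral_mult_right .
    then show ?thesis
      unfolding p_def contour_integral_linepath_lborel(1)[OF ce] contour_integral_linepath_lborel(1)[OF cW] .
  qed
  have "(\<lambda>k. (- w) ^ k / fact k * hankel_loop (e k)) sums hankel_loop W"
    unfolding hankel_loop_def
    using sums_diff[OF sums_add[OF seg ray[of "\<i> * pi"]] ray[of "- (\<i> * pi)"]]
    by (simp add: p_def algebra_simps)
  moreover have "hankel_loop (e k) = 2 * pi * \<i> * rGamma (\<nu> + of_nat k + 1)" for k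
    unfolding e_def by (rule hankel_loop_rGamma)
  ultimately show ?thesis by (simp add: W_def)
qed

lemma hankel_loop_cmult:
  assumes "continuous_on UNIV h"
  shows "hankel_loop (\<lambda>t. c * h t) = c * hankel_loop h"
proof -
  have "h contour_integrable_on linepath a b" for a b
    by (intro contour_integrable_continuous_linepath continuous_on_subset[OF assms]) auto
  then show ?thesis
    by (simp add: hankel_loop_def ray_int_def contour_integral_lmul algebra_simps)
qed

text \<open>This is Schlaefli's loop integral: the two continuations use the same kernel and end in
  rays 2 pi apart, so their difference is a loop, whose expansion is the power series of J.\<close>

lemma bessel_J_weber_A:
  "bessel_J \<nu> \<zeta> = (weber_A \<nu> (\<zeta> - \<i> * pi) - weber_A \<nu> (\<zeta> + \<i> * pi)) / (2 * pi * \<i>)"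
proof -
  define k where "k = weber_kernel (- exp \<zeta>) \<nu>"
  have ek: "exp (\<zeta> - \<i> * pi) = - exp \<zeta>" "exp (\<zeta> + \<i> * pi) = - exp \<zeta>"
    by (simp_all add: exp_add exp_diff)
  \<comment> \<open>The translation by b is the scaling u \<mapsto> 2u/z, which turns z sinh t into
    exp t - (z/2)^2 exp (- t), the form of the loop integral above.\<close>
  define b where "b = - \<zeta> + of_real (ln 2)"
  obtain G where G: "\<And>x. (G has_field_derivative k x) (at x)"
    unfolding k_def using entire_primitive[OF holomorphic_weber_kernel'] by blast
  define h where "h = (\<lambda>t. k (b + t))"
  have G': "((\<lambda>t. G (b + t)) has_field_derivative h x) (at x)" for x
  proof -
    have "((\<lambda>t. G (b + t)) has_field_derivative k (b + x) * 1) (at x)"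
      by (intro DERIV_chain'[OF _ G]) (auto intro!: derivative_eq_intros)
    then show ?thesis by (simp add: h_def)
  qed
  have 1: "weber_A \<nu> (\<zeta> - \<i> * pi) = contour_integral (linepath 0 (b + \<i> * pi)) k + ray_int k (b + \<i> * pi)"
    unfolding k_def by (subst weber_A_base[of "b + \<i> * pi"]) (auto simp: b_def ek)
  have 2: "weber_A \<nu> (\<zeta> + \<i> * pi) = contour_integral (linepath 0 (b - \<i> * pi)) k + ray_int k (b - \<i> * pi)"
    unfolding k_def by (subst weber_A_base[of "b - \<i> * pi"]) (auto simp: b_def ek)
  have ray: "ray_int k (b + a) = ray_int h a" for a
    by (simp add: ray_int_def h_def add.assoc)
  have "weber_A \<nu> (\<zeta> - \<i> * pi) - weber_A \<nu> (\<zeta> + \<i> * pi) = hankel_loop h"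
    unfolding 1 2 hankel_loop_def contour_integral_linepath_primitive[OF G] contour_integral_linepath_primitive[OF G']
    using ray[of "\<i> * pi"] ray[of "- (\<i> * pi)"] by simp
  also have "h = (\<lambda>t. exp (\<nu> * (\<zeta> - of_real (ln 2))) * exp (exp t - (exp \<zeta> / 2)\<^sup>2 * exp (- t) - \<nu> * t))"
  proof
    fix t
    have "exp (of_real (ln 2)) = (2 :: complex)" by (simp add: exp_of_real)
    then have "exp (b + t) = 2 * exp t / exp \<zeta>" "exp (- (b + t)) = exp \<zeta> * exp (- t) / 2"
      by (simp_all add: b_def exp_add exp_minus exp_diff field_simps)
    then have "exp \<zeta> * sinh (b + t) = exp t - (exp \<zeta> / 2)\<^sup>2 * exp (- t)"
      by (simp add: sinh_field_def field_simps power2_eq_square)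
    then have "h t = exp (exp t - (exp \<zeta> / 2)\<^sup>2 * exp (- t) - \<nu> * (b + t))"
      by (simp add: h_def k_def weber_kernel_def)
    then show "h t = exp (\<nu> * (\<zeta> - of_real (ln 2))) * exp (exp t - (exp \<zeta> / 2)\<^sup>2 * exp (- t) - \<nu> * t)"
      by (simp add: mult_exp_exp b_def algebra_simps)
  qed
  also have "hankel_loop \<dots> = exp (\<nu> * (\<zeta> - of_real (ln 2))) * hankel_loop (\<lambda>t. exp (exp t - (exp \<zeta> / 2)\<^sup>2 * exp (- t) - \<nu> * t))"
    by (intro hankel_loop_cmult continuous_intros)
  finally have A: "weber_A \<nu> (\<zeta> - \<i> * pi) - weber_A \<nu> (\<zeta> + \<i> * pi) = \<dots>" .
  have "(\<lambda>k. (- (exp \<zeta> / 2)\<^sup>2) ^ k / fact k * (2 * pi * \<i> * rGamma (\<nu> + of_nat k + 1)) / (2 * pi * \<i>)) sums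
     (hankel_loop (\<lambda>t. exp (exp t - (exp \<zeta> / 2)\<^sup>2 * exp (- t) - \<nu> * t)) / (2 * pi * \<i>))"
    by (intro sums_divide hankel_loop_exp_series)
  moreover have "(- (exp \<zeta> / 2)\<^sup>2) ^ k / fact k * (2 * pi * \<i> * rGamma (\<nu> + of_nat k + 1)) / (2 * pi * \<i>) =
     (- 1) ^ k * rGamma (\<nu> + of_nat k + 1) / fact k * (exp \<zeta> / 2) ^ (2 * k)" for k
    by (subst power_minus) (simp add: power_mult)
  ultimately have "(\<lambda>k. (- 1) ^ k * rGamma (\<nu> + of_nat k + 1) / fact k * (exp \<zeta> / 2) ^ (2 * k)) sums
     (hankel_loop (\<lambda>t. exp (exp t - (exp \<zeta> / 2)\<^sup>2 * exp (- t) - \<nu> * t)) / (2 * pi * \<i>))"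
    by (simp only:)
  then show ?thesis
    unfolding A bessel_J_def by (simp add: sums_iff)
qed

section \<open>The function of the second kind, integer orders included\<close>

lemma sin_pi_eq_0_iff: "sin (of_real pi * \<nu> :: complex) = 0 \<longleftrightarrow> \<nu> \<in> \<int>"
proof -
  have "sin (of_real pi * \<nu>) = 0 \<longleftrightarrow> (\<exists>n::int. of_real pi * \<nu> = of_real (of_int n * pi))"
    by (simp add: sin_eq_0)
  also have "\<dots> \<longleftrightarrow> (\<exists>n::int. \<nu> = of_int n)"
    by (simp add: mult.commute)
  finally show ?thesis by (auto simp: Ints_def)
qed

text \<open>By half-turn shifts and reflection, all values that occur are linear in the four
  quantities X, Y, p, q with coefficients in E = exp (i pi \<nu>). The claim becomes an identity of
  rational functions in these letters.\<close>

lemma bessel_Y_quot_weber_A: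
  assumes "\<nu> \<notin> \<int>"
  shows "bessel_Y_quot \<nu> \<zeta> = \<i> * bessel_J \<nu> \<zeta> - (weber_A \<nu> (\<zeta> - \<i> * pi) + weber_A (- \<nu>) \<zeta>) / pi"
proof -
  define E where "E = exp (\<i> * pi * \<nu>)"
  have E0: "E \<noteq> 0" by (simp add: E_def)
  have Em: "exp (- (\<i> * pi * \<nu>)) = 1 / E" by (simp add: E_def exp_minus inverse_eq_divide)
  define W where "W = (\<lambda>z \<nu>. contour_integral (linepath (- (\<i> * pi)) 0) (weber_kernel z \<nu>))"
  have m: "exp (\<zeta> + \<i> * pi) = - exp \<zeta>" "exp (\<zeta> - \<i> * pi) = - exp \<zeta>" by (simp_all add: exp_add exp_diff)
  define X Y p q where "X = weber_A \<nu> (\<zeta> - \<i> * pi)" and "Y = weber_A (- \<nu>) \<zeta>"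
    and "p = W (exp \<zeta>) (- \<nu>)" and "q = W (- exp \<zeta>) (- \<nu>)"
  have W: "W z \<nu> = E * W z (- \<nu>)" for z
    unfolding W_def E_def by (rule weber_kernel_half_period_reflect)
  have "X = 1 / E * (E * p + weber_A \<nu> \<zeta>)"
    unfolding X_def p_def W[symmetric] using weber_A_shift[of \<nu> \<zeta>] by (simp add: W_def Em)
  then have 1: "weber_A \<nu> \<zeta> = E * X - E * p" using E0 by (simp add: field_simps)
  have "weber_A \<nu> \<zeta> = 1 / E * (E * q + weber_A \<nu> (\<zeta> + \<i> * pi))"
    unfolding q_def W[symmetric] using weber_A_shift[of \<nu> "\<zeta> + \<i> * pi"] by (simp add: W_def Em m)
  then have 2: "weber_A \<nu> (\<zeta> + \<i> * pi) = E * E * X - E * E * p - E * q" 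
    using E0 1 by (simp add: field_simps)
  have 3: "weber_A (- \<nu>) (\<zeta> - \<i> * pi) = E * (p + Y)"
    using weber_A_shift[of "- \<nu>" \<zeta>] by (simp add: W_def E_def p_def Y_def)
  have "Y = E * (q + weber_A (- \<nu>) (\<zeta> + \<i> * pi))"
    using weber_A_shift[of "- \<nu>" "\<zeta> + \<i> * pi"] by (simp add: W_def E_def m q_def Y_def)
  then have 4: "weber_A (- \<nu>) (\<zeta> + \<i> * pi) = Y / E - q"
    using E0 by (simp add: field_simps)
  have J: "bessel_J \<nu> \<zeta> = (X - (E * E * X - E * E * p - E * q)) / (2 * pi * \<i>)"
    unfolding bessel_J_weber_A 2 X_def ..
  have J': "bessel_J (- \<nu>) \<zeta> = (E * (p + Y) - (Y / E - q)) / (2 * pi * \<i>)"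
    unfolding bessel_J_weber_A 3 4 ..
  have sn: "sin (of_real pi * \<nu>) = (E - 1 / E) / (2 * \<i>)" and cs: "cos (of_real pi * \<nu>) = (E + 1 / E) / 2"
    unfolding sin_exp_eq cos_exp_eq E_def by (simp_all add: mult_ac exp_minus inverse_eq_divide)
  have s0: "sin (of_real pi * \<nu>) \<noteq> 0" using assms by (simp add: sin_pi_eq_0_iff)
  then have D: "E * E \<noteq> 1" using sn E0 by (auto simp: field_simps)
  have "bessel_J \<nu> \<zeta> * cos (of_real pi * \<nu>) - bessel_J (- \<nu>) \<zeta> = (\<i> * bessel_J \<nu> \<zeta> - (X + Y) / pi) * sin (of_real pi * \<nu>)"
    unfolding sn cs J J' using E0 by (simp add: field_simps)
  then show ?thesis
    unfolding bessel_Y_quot_def X_def[symmetric] Y_def[symmetric] using s0 by (simp add: field_simps)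
qed

text \<open>The right-hand side is entire in the order, hence continuous at an integer, where it
  equals the limit that defines Y.\<close>

lemma bessel_Y_weber_A:
  "bessel_Y \<nu> \<zeta> = \<i> * bessel_J \<nu> \<zeta> - (weber_A \<nu> (\<zeta> - \<i> * pi) + weber_A (- \<nu>) \<zeta>) / pi"
proof (cases "\<nu> \<in> \<int>")
  case False
  then show ?thesis by (simp add: bessel_Y_def bessel_Y_quot_weber_A)
next
  case True
  define F where "F = (\<lambda>\<nu>. \<i> * bessel_J \<nu> \<zeta> - (weber_A \<nu> (\<zeta> - \<i> * pi) + weber_A (- \<nu>) \<zeta>) / pi)"
  have "F holomorphic_on UNIV"
    unfolding F_def bessel_J_weber_A
    by (intro holomorphic_intros holomorphic_on_weber_A) auto
  then have "F \<midarrow>\<nu>\<rightarrow> F \<nu>"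
    by (metis UNIV_I continuous_on_def holomorphic_on_imp_continuous_on)
  moreover have "\<forall>\<^sub>F \<mu> in at \<nu>. F \<mu> = bessel_Y_quot \<mu> \<zeta>"
  proof -
    have "\<forall>\<^sub>F \<mu> in at \<nu>. \<mu> \<in> ball \<nu> 1 - {\<nu>}"
      by (rule eventually_at_in_open) auto
    then show ?thesis
    proof eventually_elim
      case (elim \<mu>)
      have "\<mu> \<notin> \<int>"
      proof
        assume "\<mu> \<in> \<int>"
        then obtain m n where mn: "\<mu> = of_int m" "\<nu> = of_int n" using True by (auto elim!: Ints_cases)
        then have "norm (of_int (m - n) :: complex) < 1" using elim by (simp add: dist_norm norm_minus_commute)
        then have "m = n" unfolding norm_of_int by linarith
        then show False using mn elim by simp
      qed
      then show ?case by (simp add: F_def bessel_Y_quot_weber_A)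
    qed
  qed
  ultimately have "((\<lambda>\<mu>. bessel_Y_quot \<mu> \<zeta>) \<longlongrightarrow> F \<nu>) (at \<nu>)"
    by (rule Lim_transform_eventually)
  then have "Lim (at \<nu>) (\<lambda>\<mu>. bessel_Y_quot \<mu> \<zeta>) = F \<nu>"
    by (intro tendsto_Lim) auto
  then show ?thesis using True by (simp add: bessel_Y_def F_def)
qed

text \<open>The function \<open>\<integral>\<^sub>0\<^sup>\<infinity> exp (- z (sinh t - t) - \<kappa> t) dt\<close>, continued analytically to the surface of
  the logarithm.\<close>

definition near_A :: "complex \<Rightarrow> complex \<Rightarrow> complex" where
  "near_A \<kappa> \<zeta> = weber_A (\<kappa> - exp \<zeta>) \<zeta>"

lemma holomorphic_near_A [holomorphic_intros]:
  assumes "h holomorphic_on UNIV"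
  shows "(\<lambda>w. near_A \<kappa> (h w)) holomorphic_on UNIV"
  unfolding near_A_def by (intro holomorphic_on_weber_A holomorphic_intros assms)

text \<open>With \<nu> = z - \<kappa>, both -\<nu> at z and \<nu> at z exp (\<plusminus> pi i) have
  the form (constant minus point) required by \<open>near_A\<close>, the constants being \<kappa>
  and -\<kappa>.\<close>

lemma bessel_near_A:
  assumes "\<nu> + \<kappa> = exp \<zeta>"
  shows bessel_J_near_A: "bessel_J \<nu> \<zeta> = (near_A (- \<kappa>) (\<zeta> - \<i> * pi) - near_A (- \<kappa>) (\<zeta> + \<i> * pi)) / (2 * pi * \<i>)"
    and hankel_1_near_A: "hankel_1 \<nu> \<zeta> = (near_A \<kappa> \<zeta> + near_A (- \<kappa>) (\<zeta> - \<i> * pi)) / (pi * \<i>)"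
    and hankel_2_near_A: "hankel_2 \<nu> \<zeta> = - (near_A \<kappa> \<zeta> + near_A (- \<kappa>) (\<zeta> + \<i> * pi)) / (pi * \<i>)"
    and bessel_Y_near_A: "bessel_Y \<nu> \<zeta> = - (2 * near_A \<kappa> \<zeta> + near_A (- \<kappa>) (\<zeta> - \<i> * pi) + near_A (- \<kappa>) (\<zeta> + \<i> * pi)) / (2 * pi)"
proof -
  have \<nu>: "\<nu> = exp \<zeta> - \<kappa>" using assms by (simp add: eq_diff_eq)
  have "exp (\<zeta> - \<i> * pi) = - exp \<zeta>" "exp (\<zeta> + \<i> * pi) = - exp \<zeta>"
    by (simp_all add: exp_add exp_diff)
  then have n: "near_A \<kappa> \<zeta> = weber_A (- \<nu>) \<zeta>" "near_A (- \<kappa>) (\<zeta> - \<i> * pi) = weber_A \<nu> (\<zeta> - \<i> * pi)"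
    "near_A (- \<kappa>) (\<zeta> + \<i> * pi) = weber_A \<nu> (\<zeta> + \<i> * pi)"
    by (simp_all add: near_A_def \<nu>)
  show "bessel_J \<nu> \<zeta> = (near_A (- \<kappa>) (\<zeta> - \<i> * pi) - near_A (- \<kappa>) (\<zeta> + \<i> * pi)) / (2 * pi * \<i>)"
    by (simp add: n bessel_J_weber_A)
  show "hankel_1 \<nu> \<zeta> = (near_A \<kappa> \<zeta> + near_A (- \<kappa>) (\<zeta> - \<i> * pi)) / (pi * \<i>)"
    "hankel_2 \<nu> \<zeta> = - (near_A \<kappa> \<zeta> + near_A (- \<kappa>) (\<zeta> + \<i> * pi)) / (pi * \<i>)"
    "bessel_Y \<nu> \<zeta> = - (2 * near_A \<kappa> \<zeta> + near_A (- \<kappa>) (\<zeta> - \<i> * pi) + near_A (- \<kappa>) (\<zeta> + \<i> * pi)) / (2 * pi)"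
    unfolding n hankel_1_def hankel_2_def bessel_Y_weber_A bessel_J_weber_A
    by (simp_all add: field_simps)
qed

text \<open>The only place where the Hankel function of the remainder enters. The factor exp (- 2 pi
  t) is the modulus part of exp (2 pi i \<nu>) for the order \<nu> = i t + \<kappa>, produced by the
  connection formula.\<close>

lemma near_A_jump:
  assumes "t > 0"
  shows "near_A \<kappa> (of_real (ln t) + \<i> * (3 * pi / 2)) + near_A (- \<kappa>) (of_real (ln t) - \<i> * (3 * pi / 2)) =
    pi * \<i> * exp (2 * pi * \<i> * \<kappa>) * exp (- 2 * pi * t) * hankel_it t \<kappa>"
proof -
  define \<zeta> where "\<zeta> = of_real (ln t) + \<i> * of_real (pi / 2)"
  define \<nu> where "\<nu> = \<i> * of_real t + \<kappa>"
  have "exp (of_real (ln t)) = (of_real t :: complex)" using assms by (simp add: exp_of_real)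
  then have e: "exp \<zeta> = \<i> * of_real t" 
    using cis_conv_exp[of "pi / 2"] by (simp add: \<zeta>_def exp_add cis_pi_half del: of_real_divide)
  have "hankel_it t \<kappa> = (weber_A \<nu> (\<zeta> - \<i> * pi) + weber_A (- \<nu>) \<zeta>) / (pi * \<i>)"
  proof -
    have "\<nu> + (- \<kappa>) = exp \<zeta>" by (simp add: e \<nu>_def)
    from hankel_1_near_A[OF this]
    have "hankel_1 \<nu> \<zeta> = (near_A (- \<kappa>) \<zeta> + near_A (- (- \<kappa>)) (\<zeta> - \<i> * pi)) / (pi * \<i>)" .
    moreover have "near_A (- \<kappa>) \<zeta> = weber_A (- \<nu>) \<zeta>"
      "near_A (- (- \<kappa>)) (\<zeta> - \<i> * pi) = weber_A \<nu> (\<zeta> - \<i> * pi)"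
      by (simp_all add: near_A_def e \<nu>_def exp_diff add.commute)
    moreover have "hankel_it t \<kappa> = hankel_1 \<nu> \<zeta>"
      by (simp add: hankel_it_def \<zeta>_def \<nu>_def)
    ultimately show ?thesis by (simp add: add.commute)
  qed
  then have "weber_A \<nu> (\<zeta> + \<i> * pi) + weber_A (- \<nu>) (\<zeta> - 2 * \<i> * pi) = exp (2 * \<i> * pi * \<nu>) * (pi * \<i> * hankel_it t \<kappa>)"
    by (simp add: weber_A_connection)
  moreover have "weber_A \<nu> (\<zeta> + \<i> * pi) = near_A \<kappa> (of_real (ln t) + \<i> * (3 * pi / 2))"
  proof -
    have "of_real (ln t) + \<i> * (3 * pi / 2) = \<zeta> + \<i> * pi" by (simp add: \<zeta>_def field_simps)
    then show ?thesis by (simp add: near_A_def exp_add e \<nu>_def add.commute)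
  qed
  moreover have "weber_A (- \<nu>) (\<zeta> - 2 * \<i> * pi) = near_A (- \<kappa>) (of_real (ln t) - \<i> * (3 * pi / 2))"
  proof -
    have "of_real (ln t) - \<i> * (3 * pi / 2) = \<zeta> - 2 * \<i> * pi" by (simp add: \<zeta>_def field_simps)
    moreover have "exp (\<zeta> - 2 * \<i> * pi) = exp \<zeta>" using exp_two_pi_i by (simp add: exp_diff mult_ac)
    moreover have "- \<nu> = - \<kappa> - \<i> * of_real t" by (simp add: \<nu>_def)
    ultimately show ?thesis by (simp add: near_A_def e)
  qed
  moreover have "exp (2 * \<i> * pi * \<nu>) = exp (2 * pi * \<i> * \<kappa>) * exp (- 2 * pi * t)"
    by (simp add: \<nu>_def mult_exp_exp algebra_simps flip: exp_of_real)
  ultimately show ?thesis by (simp add: mult_ac)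
qed

section \<open>Lagrange inversion\<close>

text \<open>With s = X P the coefficient is the residue of s^(n-N-1) ds, an exact differential as n
  < N. In power series terms, I^m with I = 1/P and m = N - n cancels against the derivative of I^m
  at the m-th coefficient.\<close>

lemma fps_lagrange_step_zero:
  fixes P :: "complex fps"
  assumes P: "P $ 0 \<noteq> 0" and n: "n < N"
  shows "((fps_X * P) ^ n * fps_deriv (fps_X * P) * inverse P ^ (N + 1)) $ N = 0"
proof -
  define I where "I = inverse P"
  have PI: "P * I = 1" using P by (simp add: I_def inverse_mult_eq_1')
  define m where "m = N - n"
  have m: "N + 1 = n + (m + 1)" "m \<ge> 1" using n by (auto simp: m_def)
  have pw: "P ^ n * I ^ n = 1" by (simp add: PI flip: power_mult_distrib)
  have "(fps_X * P) ^ n * fps_deriv (fps_X * P) * I ^ (N + 1) =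
     fps_X ^ n * ((P ^ n * I ^ n) * ((P + fps_X * fps_deriv P) * I ^ (m + 1)))"
    unfolding m(1) by (simp add: power_mult_distrib power_add algebra_simps)
  also have "\<dots> = fps_X ^ n * ((P * I) * I ^ m + fps_X * (fps_deriv P * I ^ (m + 1)))"
    unfolding pw by (simp add: algebra_simps)
  also have "\<dots> = fps_X ^ n * (I ^ m + fps_X * (fps_deriv P * I ^ (m + 1)))" by (simp add: PI)
  finally have "((fps_X * P) ^ n * fps_deriv (fps_X * P) * I ^ (N + 1)) $ N =
     (I ^ m + fps_X * (fps_deriv P * I ^ (m + 1))) $ m"
    using n by (simp add: fps_X_power_mult_nth m_def)
  also have "\<dots> = (I ^ m) $ m + (fps_deriv P * I ^ (m + 1)) $ (m - 1)"
    using m(2) by (simp del: power_Suc)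
  also have "(fps_deriv P * I ^ (m + 1)) = fps_const (- 1 / of_nat m) * fps_deriv (I ^ m)"
  proof -
    have "fps_deriv (I ^ m) = fps_const (of_nat m) * (- fps_deriv P * I\<^sup>2) * I ^ (m - 1)"
      unfolding fps_deriv_power I_def fps_inverse_deriv[OF P] ..
    also have "\<dots> = fps_const (of_nat m) * (- fps_deriv P * I ^ (m + 1))"
    proof -
      have "I\<^sup>2 * I ^ (m - 1) = I ^ (m + 1)" using m(2) by (simp flip: power_add)
      then show ?thesis by (metis mult.assoc)
    qed
    finally have "fps_const (- 1 / of_nat m) * fps_deriv (I ^ m) =
       fps_const (- 1 / of_nat m) * fps_const (of_nat m) * (- fps_deriv P * I ^ (m + 1))"
      by (simp add: mult.assoc)
    also have "fps_const (- 1 / of_nat m) * fps_const (of_nat m) = (- 1 :: complex fps)"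
    proof -
      have "- 1 / of_nat m * of_nat m = (- 1 :: complex)" using m(2) by simp
      then show ?thesis by (metis fps_const_1_eq_1 fps_const_mult fps_const_neg)
    qed
    finally show ?thesis by simp
  qed
  also have "(fps_const (- 1 / of_nat m) * fps_deriv (I ^ m)) $ (m - 1) = - (I ^ m) $ m"
    using m(2) by (simp add: of_nat_diff)
  finally show ?thesis by (simp add: I_def)
qed

text \<open>Lagrange inversion without the inverse function: expansion of \<open>E\<close> in the differentials
  \<open>s\<^sup>n ds\<close> of the new variable \<open>s = X P\<close>.\<close>

lemma fps_lagrange_remainder:
  fixes P E :: "complex fps"
  assumes P: "P $ 0 \<noteq> 0"
  shows "\<exists>R. E = (\<Sum>n<N. fps_const ((E * inverse P ^ (n + 1)) $ n) * ((fps_X * P) ^ n * fps_deriv (fps_X * P))) + fps_X ^ N * R"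
proof (induction N)
  case 0
  show ?case by (rule exI[of _ E]) simp
next
  case (Suc N)
  define s where "s = fps_X * P"
  define b where "b = (\<lambda>n. (E * inverse P ^ (n + 1)) $ n)"
  obtain R where R: "E = (\<Sum>n<N. fps_const (b n) * (s ^ n * fps_deriv s)) + fps_X ^ N * R"
    using Suc by (auto simp: b_def s_def)
  have "b N = (\<Sum>n<N. (fps_const (b n) * (s ^ n * fps_deriv s * inverse P ^ (N + 1))) $ N) + (fps_X ^ N * (R * inverse P ^ (N + 1))) $ N"
  proof -
    have "E * inverse P ^ (N + 1) = (\<Sum>n<N. fps_const (b n) * (s ^ n * fps_deriv s * inverse P ^ (N + 1))) + fps_X ^ N * (R * inverse P ^ (N + 1))"
      by (subst R) (simp add: sum_distrib_right distrib_right mult.assoc del: power_Suc)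
    then have "(E * inverse P ^ (N + 1)) $ N = ((\<Sum>n<N. fps_const (b n) * (s ^ n * fps_deriv s * inverse P ^ (N + 1))) + fps_X ^ N * (R * inverse P ^ (N + 1))) $ N"
      by (rule arg_cong)
    then show ?thesis by (simp only: b_def fps_add_nth fps_sum_nth)
  qed
  \<comment> \<open>The terms already split off contribute nothing to the coefficient of index N, so
    it is determined by the current remainder alone.\<close>
  also have "(\<Sum>n<N. (fps_const (b n) * (s ^ n * fps_deriv s * inverse P ^ (N + 1))) $ N) = 0"
  proof (rule sum.neutral, rule ballI)
    fix n assume "n \<in> {..<N}"
    then show "(fps_const (b n) * (s ^ n * fps_deriv s * inverse P ^ (N + 1))) $ N = 0"
      unfolding fps_mult_left_const_nth s_def using fps_lagrange_step_zero[OF P, of n N] by simp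
  qed
  also have "(fps_X ^ N * (R * inverse P ^ (N + 1))) $ N = R $ 0 / (P $ 0) ^ (N + 1)"
  proof -
    have "(fps_X ^ N * (R * inverse P ^ (N + 1))) $ N = (R * inverse P ^ (N + 1)) $ 0"
      unfolding fps_X_power_mult_nth by simp
    then show ?thesis
      by (simp add: fps_mult_nth_0 fps_power_zeroth divide_inverse power_inverse del: power_Suc)
  qed
  finally have bN: "b N * (P $ 0) ^ (N + 1) = R $ 0" using P by simp
  \<comment> \<open>The differential s^N ds starts with X^N P_0^(N+1); subtracting b_N times it
    removes exactly the constant term of R.\<close>
  define R' where "R' = R - fps_const (b N) * (P ^ N * (P + fps_X * fps_deriv P))"
  have "R' $ 0 = 0" using bN by (simp add: R'_def fps_mult_nth_0 fps_power_zeroth mult.commute)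
  then have R': "R' = fps_X * fps_shift 1 R'"
    by (intro fps_ext) (auto simp: fps_X_mult_nth)
  have "fps_X ^ N * R = fps_const (b N) * (s ^ N * fps_deriv s) + fps_X ^ N * R'"
    by (simp add: R'_def s_def power_mult_distrib algebra_simps)
  also have "fps_X ^ N * R' = fps_X ^ Suc N * fps_shift 1 R'"
    by (subst R') (simp add: mult_ac)
  finally show ?case
    by (intro exI[of _ "fps_shift 1 R'"]) (subst R, simp add: b_def s_def del: power_Suc)
qed

text \<open>Division by t^N leaves a function that is analytic at 0, hence bounded near it.\<close>

lemma has_fps_expansion_X_power_bound:
  fixes f :: "complex \<Rightarrow> complex"
  assumes f: "f has_fps_expansion (fps_X ^ N * R)"
  shows "\<exists>C. \<forall>\<^sub>F t in nhds 0. norm (f t) \<le> C * norm t ^ N"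
proof -
  define g where "g = (\<lambda>x. if x = 0 then R $ 0 else f x / x ^ N)"
  have "g has_fps_expansion R"
  proof (cases "R = 0")
    case True
    then have "\<forall>\<^sub>F x in nhds 0. f x = 0" using f by (simp add: has_fps_expansion_0_iff)
    then have "\<forall>\<^sub>F x in nhds 0. g x = 0" by eventually_elim (simp add: g_def True)
    then show ?thesis by (simp add: True has_fps_expansion_0_iff)
  next
    case False
    have "g has_fps_expansion fps_shift N (fps_X ^ N * R)"
      unfolding g_def using False by (intro has_fps_expansion_shift f) (auto simp: fps_X_power_mult_nth)
    also have "fps_shift N (fps_X ^ N * R) = R" by (intro fps_ext) (simp add: fps_X_power_mult_nth)
    finally show ?thesis .
  qed
  then have "isCont g 0" by (rule has_fps_expansion_imp_continuous)
  then have evg: "\<forall>\<^sub>F t in nhds 0. norm (g t) < norm (g 0) + 1"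
    by (intro order_tendstoD[OF tendsto_norm]) (auto simp: isCont_def tendsto_at_iff_tendsto_nhds)
  have "f 0 = (fps_X ^ N * R) $ 0" 
    using fps_nth_fps_expansion[OF f, of 0] by simp
  then have ft: "f t = t ^ N * g t" for t by (auto simp: g_def fps_X_power_mult_nth)
  from evg have "\<forall>\<^sub>F t in nhds 0. norm (f t) \<le> (norm (g 0) + 1) * norm t ^ N"
  proof (rule eventually_mono)
    fix t assume "norm (g t) < norm (g 0) + 1" 
    then show "norm (f t) \<le> (norm (g 0) + 1) * norm t ^ N"
      using mult_left_mono[of "norm (g t)" "norm (g 0) + 1" "norm t ^ N"]
      by (simp add: ft norm_mult norm_power mult.commute)
  qed
  then show ?thesis by blast
qed

text \<open>\<open>sinh_cbrt\<close> is the branch of \<open>(sinh t - t)\<^bsup>1/3\<^esup>\<close> near 0 that is positive for \<open>t > 0\<close>.\<close>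

definition sinh_quot :: "complex \<Rightarrow> complex" where
  "sinh_quot t = (if t = 0 then 1 / 6 else (sinh t - t) / t ^ 3)"

definition sinh_cbrt :: "complex \<Rightarrow> complex" where
  "sinh_cbrt t = t * (of_real (6 powr (- 1 / 3)) * exp (Ln (6 * sinh_quot t) / 3))"

section \<open>The analytic cube root and its expansion\<close>

lemma sinh_minus_eq: "sinh t - t = t ^ 3 * sinh_quot t"
  by (simp add: sinh_quot_def)

lemma sinh_quot_analytic: "sinh_quot analytic_on A"
proof -
  have "sinh_quot analytic_on {z}" for z
  proof (cases "z = 0")
    case True
    define S :: "complex fps" where "S = fps_const (1 / 2) * (fps_exp 1 - fps_exp (- 1)) - fps_X"
    have "(\<lambda>t. 1 / 2 * (exp (1 * t) - exp (- 1 * t)) - t) has_fps_expansion S"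
      unfolding S_def by (intro fps_expansion_intros)
    then have S: "(\<lambda>t. sinh t - t) has_fps_expansion S"
      by (simp add: sinh_field_def diff_divide_distrib)
    have S3: "S $ 3 = 1 / 6" "S $ 0 = 0" "S $ 1 = 0" "S $ 2 = 0"
      by (simp_all add: S_def fact_numeral)
    have "3 \<le> subdegree S"
    proof (rule subdegree_geI)
      show "S \<noteq> 0" using S3(1) by auto
      show "S $ i = 0" if "i < 3" for i
      proof -
        have "i = 0 \<or> i = 1 \<or> i = 2" using that by auto
        then show ?thesis using S3 by auto
      qed
    qed
    then have "sinh_quot has_fps_expansion fps_shift 3 S"
      unfolding sinh_quot_def using S3 by (intro has_fps_expansion_shift S) auto
    then show ?thesis unfolding True by (rule has_fps_expansion_imp_analytic_0)
  next
    case False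
    have "(\<lambda>t. (sinh t - t) / t ^ 3) holomorphic_on - {0}"
      unfolding sinh_field_def by (intro holomorphic_intros) auto
    then have "sinh_quot holomorphic_on - {0}"
      by (rule holomorphic_transform) (auto simp: sinh_quot_def)
    then have "sinh_quot analytic_on - {0}"
      using analytic_on_open[of "- {0}" sinh_quot] by auto
    then show ?thesis by (rule analytic_on_subset) (use False in auto)
  qed
  then show ?thesis by (subst analytic_on_analytic_at) auto
qed

lemma B_base_sinh_quot: "B_base t = 1 / (6 * sinh_quot t)"
  by (simp add: B_base_def sinh_quot_def)

text \<open>In the variable s with s^3 = sinh t - t the kernel becomes exp (- z s^3), so exp (-
  \<kappa> t) dt has to be expanded in s^n ds. The Lagrange coefficients are, up to the powers of 6
  that come from (sinh t - t) ~ t^3/6, the derivatives defining B_n(-\<kappa>).\<close>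

lemma lagrange_expansion:
  fixes \<kappa> :: complex
  defines "b \<equiv> \<lambda>n. of_real (6 powr (real (n + 1) / 3)) * B_coeff n (- \<kappa>)"
  shows "\<exists>C. \<forall>\<^sub>F t in nhds 0. norm (exp (- (\<kappa> * t)) - (\<Sum>n<N. b n * (sinh_cbrt t ^ n * deriv sinh_cbrt t))) \<le> C * norm t ^ N"
    and "\<forall>\<^sub>F t in nhds 0. sinh_cbrt analytic_on {t} \<and> sinh_cbrt t ^ 3 = sinh t - t"
    and "((\<lambda>t. sinh_cbrt t / t) \<longlongrightarrow> of_real (6 powr (- 1 / 3))) (at 0)"
proof -
  define l where "l = (\<lambda>t. Ln (6 * sinh_quot t))"
  have q0: "6 * sinh_quot 0 = 1" by (simp add: sinh_quot_def)
  have cont: "isCont sinh_quot t" for t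
    using sinh_quot_analytic analytic_at_imp_isCont by blast
  have ev: "\<forall>\<^sub>F t in nhds 0. 6 * sinh_quot t \<in> {w. Re w > 0}"
  proof -
    have "((\<lambda>t. 6 * sinh_quot t) \<longlongrightarrow> 6 * sinh_quot 0) (nhds 0)"
      using cont[of 0] by (intro tendsto_intros) (simp add: isCont_def tendsto_at_iff_tendsto_nhds)
    then show ?thesis
      by (rule topological_tendstoD) (auto simp: q0 open_halfspace_Re_gt)
  qed
  have nonpos: "w \<notin> \<real>\<^sub>\<le>\<^sub>0" if "Re w > 0" for w using that by (auto simp: complex_nonpos_Reals_iff)
  have l_an: "l analytic_on {t}" if "Re (6 * sinh_quot t) > 0" for t
    unfolding l_def using nonpos[OF that]
    by (intro analytic_intros sinh_quot_analytic) auto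
  define c6 where "c6 = complex_of_real (6 powr (- 1 / 3))"
  have c6: "c6 \<noteq> 0" by (simp add: c6_def)
  define p where "p = (\<lambda>t. c6 * exp (l t / 3))"
  have p_an: "p analytic_on {t}" if "Re (6 * sinh_quot t) > 0" for t
    unfolding p_def by (intro analytic_intros l_an that) auto
  have l0: "l 0 = 0" by (simp add: l_def q0)
  have p0: "p 0 = c6" by (simp add: p_def l0)
  have scb: "sinh_cbrt = (\<lambda>t. t * p t)" by (simp add: sinh_cbrt_def p_def l_def c6_def fun_eq_iff)
  have c63: "c6 ^ 3 = 1 / 6"
  proof -
    have "(6 powr (- 1 / 3)) ^ 3 = (6 powr (- 1 / 3)) powr real 3"
      by (rule powr_realpow[symmetric]) simp
    also have "\<dots> = (6 :: real) powr (- 1)" unfolding powr_powr by simp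
    also have "\<dots> = 1 / 6" unfolding powr_minus by (simp add: inverse_eq_divide)
    finally have "(6 powr (- 1 / 3)) ^ 3 = (1 / 6 :: real)" .
    then show ?thesis unfolding c6_def by (metis of_real_1 of_real_divide of_real_numeral of_real_power)
  qed
  show "\<forall>\<^sub>F t in nhds 0. sinh_cbrt analytic_on {t} \<and> sinh_cbrt t ^ 3 = sinh t - t"
    using ev
  proof eventually_elim
    case (elim t)
    then have R: "Re (6 * sinh_quot t) > 0" by auto
    then have "6 * sinh_quot t \<noteq> 0" by force
    then have "exp (l t) = 6 * sinh_quot t" unfolding l_def by (rule exp_Ln)
    moreover have "exp (l t / 3) ^ 3 = exp (l t)" by (simp flip: exp_of_nat_mult)
    ultimately have "sinh_cbrt t ^ 3 = t ^ 3 * sinh_quot t"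
      unfolding scb p_def by (simp add: power_mult_distrib c63)
    moreover have "sinh_cbrt analytic_on {t}"
      unfolding scb by (intro analytic_intros p_an R)
    ultimately show ?case by (simp add: sinh_minus_eq)
  qed
  have p_an0: "p analytic_on {0}" by (rule p_an) (simp add: q0)
  have "(p \<longlongrightarrow> c6) (at 0)" 
    using analytic_at_imp_isCont[OF p_an0] p0 by (simp add: isCont_def)
  moreover have "\<forall>\<^sub>F t in at 0. sinh_cbrt t / t = p t"
    by (auto simp: scb eventually_at intro!: exI[of _ 1])
  ultimately show "((\<lambda>t. sinh_cbrt t / t) \<longlongrightarrow> of_real (6 powr (- 1 / 3))) (at 0)"
    by (simp add: tendsto_cong c6_def)
  define P where "P = fps_expansion p 0"
  have P: "p has_fps_expansion P"
    unfolding P_def by (rule analytic_at_imp_has_fps_expansion_0[OF p_an0])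
  have P0: "P $ 0 \<noteq> 0"
    using P p0 c6 by (simp add: fps_nth_fps_expansion)
  define E where "E = fps_exp (- \<kappa>)"
  have E: "(\<lambda>t. exp (- \<kappa> * t)) has_fps_expansion E" unfolding E_def by (intro fps_expansion_intros)
  have s: "sinh_cbrt has_fps_expansion (fps_X * P)" unfolding scb by (intro fps_expansion_intros P)
  \<comment> \<open>With \<open>sinh_cbrt t = t * p t\<close>, the n-th Lagrange coefficient is that
    of exp (- \<kappa> t) / p(t)^(n+1), and p(t)^(-(n+1)) is 6^((n+1)/3) times the principal power
    of \<open>B_base\<close> near 0.\<close>
  have b: "(E * inverse P ^ (n + 1)) $ n = b n" for n
  proof -
    have 1: "(\<lambda>t. exp (- \<kappa> * t) * inverse (p t) ^ (n + 1)) has_fps_expansion (E * inverse P ^ (n + 1))"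
      by (intro fps_expansion_intros E P P0)
    have e: "\<forall>\<^sub>F t in nhds 0. exp (- \<kappa> * t) * inverse (p t) ^ (n + 1) =
       of_real (6 powr (real (n + 1) / 3)) * (exp (- \<kappa> * t) * B_base t powr (of_nat (n + 1) / 3))"
      using ev
    proof eventually_elim
      case (elim t)
      then have R: "Re (6 * sinh_quot t) > 0" by auto
      define w where "w = 6 * sinh_quot t"
      have w: "w \<noteq> 0" "w \<notin> \<real>\<^sub>\<le>\<^sub>0" using R nonpos[OF R] by (auto simp: w_def)
      have "B_base t powr (of_nat (n + 1) / 3) = exp (of_nat (n + 1) / 3 * Ln (inverse w))"
        using w by (simp add: B_base_sinh_quot powr_def w_def inverse_eq_divide)
      also have "Ln (inverse w) = - l t" unfolding l_def w_def[symmetric] by (rule Ln_inverse) (use w in auto)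
      also have "exp (of_nat (n + 1) / 3 * - l t) = inverse (exp (l t / 3) ^ (n + 1))"
      proof -
        have "of_nat (n + 1) / 3 * - l t = - (of_nat (n + 1) * (l t / 3))" by simp
        then show ?thesis by (simp only: exp_of_nat_mult exp_minus)
      qed
      finally have B: "B_base t powr (of_nat (n + 1) / 3) = inverse (exp (l t / 3) ^ (n + 1))" .
      have "inverse (c6 ^ (n + 1)) = of_real (6 powr (real (n + 1) / 3))"
      proof -
        have "(6 powr (- 1 / 3)) ^ (n + 1) = (6::real) powr (- (real (n + 1) / 3))"
        proof -
          have "(6 powr (- 1 / 3)) ^ (n + 1) = (6 powr (- 1 / 3)) powr real (n + 1)"
            by (rule powr_realpow[symmetric]) simp
          then show ?thesis unfolding powr_powr by simp
        qed
        then have "inverse ((6 powr (- 1 / 3)) ^ (n + 1)) = (6::real) powr (real (n + 1) / 3)"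
          by (simp add: powr_minus)
        then show ?thesis unfolding c6_def by (metis of_real_inverse of_real_power)
      qed
      then have "inverse (p t) ^ (n + 1) = of_real (6 powr (real (n + 1) / 3)) * inverse (exp (l t / 3) ^ (n + 1))"
        unfolding p_def power_inverse power_mult_distrib by (simp del: power_Suc)
      then show ?case unfolding B by (simp del: power_Suc)
    qed
    define c c' where "c = complex_of_real (6 powr (real (n + 1) / 3))"
      and "c' = complex_of_real (6 powr (- (real (n + 1) / 3)))"
    define \<phi> where "\<phi> = (\<lambda>t. exp (- \<kappa> * t) * B_base t powr (of_nat (n + 1) / 3))"
    define G where "G = E * inverse P ^ (n + 1)"
    have cc: "c' * c = 1" "c * c' = 1" by (simp_all add: c_def c'_def flip: of_real_mult powr_add)
    have "(\<lambda>t. c * \<phi> t) has_fps_expansion G"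
      using 1 has_fps_expansion_cong[OF e refl] by (simp add: c_def \<phi>_def G_def)
    then have "(\<lambda>t. c' * (c * \<phi> t)) has_fps_expansion fps_const c' * G"
      by (rule has_fps_expansion_cmult_left)
    also have "(\<lambda>t. c' * (c * \<phi> t)) = \<phi>"
      by (simp add: fun_eq_iff cc flip: mult.assoc)
    finally have "(fps_const c' * G) $ n = (deriv ^^ n) \<phi> 0 / fact n"
      by (rule fps_nth_fps_expansion)
    then have "c' * G $ n = B_coeff n (- \<kappa>)"
      unfolding B_coeff_def \<phi>_def by simp
    then have "b n = (c * c') * G $ n" by (simp add: b_def c_def)
    then show ?thesis by (simp add: cc G_def)
  qed
  obtain R where R: "E = (\<Sum>n<N. fps_const (b n) * ((fps_X * P) ^ n * fps_deriv (fps_X * P))) + fps_X ^ N * R"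
    using fps_lagrange_remainder[OF P0, of E N] unfolding b by blast
  have "(\<lambda>t. exp (- \<kappa> * t) - (\<Sum>n<N. b n * (sinh_cbrt t ^ n * deriv sinh_cbrt t))) has_fps_expansion
      (E - (\<Sum>n<N. fps_const (b n) * ((fps_X * P) ^ n * fps_deriv (fps_X * P))))"
    by (intro fps_expansion_intros E s)
  also have "E - (\<Sum>n<N. fps_const (b n) * ((fps_X * P) ^ n * fps_deriv (fps_X * P))) = fps_X ^ N * R"
    by (subst R) simp
  finally show "\<exists>C. \<forall>\<^sub>F t in nhds 0. norm (exp (- (\<kappa> * t)) - (\<Sum>n<N. b n * (sinh_cbrt t ^ n * deriv sinh_cbrt t))) \<le> C * norm t ^ N"
    using has_fps_expansion_X_power_bound by simp
qed

section \<open>The cubic saddle point\<close>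

lemma Re_of_real_mult: "Re (of_real r * z) = r * Re z"
  by simp

text \<open>The summand 1 of the witness serves x \<le> 1. Beyond 1, x^3 dominates x, and the K-th
  term of the series of exp (c x) gives K!/c^K.\<close>

lemma power_exp_neg_cube_bounded:
  fixes c :: real
  assumes "c > 0"
  shows "\<exists>C>0. \<forall>x\<ge>0. x ^ K * exp (- (c * x ^ 3)) \<le> C"
proof (intro exI[of _ "1 + fact K / c ^ K"] conjI allI impI)
  show "1 + fact K / c ^ K > 0" using assms by (simp add: add_pos_nonneg)
  fix x :: real assume x: "x \<ge> 0"
  show "x ^ K * exp (- (c * x ^ 3)) \<le> 1 + fact K / c ^ K"
  proof (cases "x \<le> 1")
    case True
    then have "x ^ K * exp (- (c * x ^ 3)) \<le> 1 * 1"
      using x assms by (intro mult_mono power_le_one) auto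
    then show ?thesis using assms by (simp add: add_increasing2)
  next
    case False
    have "x ^ 1 \<le> x ^ 3" using False by (intro power_increasing) auto
    then have "c * x \<le> c * x ^ 3" using assms by simp
    have "(c * x) ^ K /\<^sub>R fact K \<le> (\<Sum>n. (c * x) ^ n /\<^sub>R fact n)"
      using sum_le_suminf[OF summable_exp_generic[of "c * x"], of "{K}"] x assms by simp
    also have "\<dots> = exp (c * x)" by (simp add: exp_def)
    also have "\<dots> \<le> exp (c * x ^ 3)" using \<open>c * x \<le> c * x ^ 3\<close> by simp
    finally have "(c * x) ^ K / fact K \<le> exp (c * x ^ 3)"
      by (simp add: divide_inverse mult.commute)
    then have "c ^ K * x ^ K \<le> fact K * exp (c * x ^ 3)"
      by (simp add: power_mult_distrib divide_le_eq mult.commute)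
    then have "x ^ K * exp (- (c * x ^ 3)) \<le> fact K / c ^ K"
      using assms by (simp add: exp_minus field_simps)
    then show ?thesis by simp
  qed
qed

section \<open>Incomplete Gamma integrals in the cubic variable\<close>

definition cubic_gauss :: "nat \<Rightarrow> complex \<Rightarrow> complex" where
  "cubic_gauss n y = y ^ n * exp (- (y ^ 3))"

lemma holomorphic_cubic_gauss: "cubic_gauss n holomorphic_on A"
  unfolding cubic_gauss_def by (intro holomorphic_intros)

text \<open>One half of the exponent absorbs the power y^n. The other half is split by (X + s)^3
  \<ge> X^3 + s^3 into smallness in the starting point and decay along the ray.\<close>

lemma cubic_gauss_ray_bound:
  "\<exists>C. \<forall>X\<ge>0. \<forall>s\<ge>0. norm (cubic_gauss n (of_real X + of_real s)) \<le> C * exp (- (X ^ 3 / 2)) * exp (- s)"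
proof -
  obtain C where C: "\<And>x::real. x \<ge> 0 \<Longrightarrow> x ^ n * exp (- (1 / 2 * x ^ 3)) \<le> C" "C > 0"
    using power_exp_neg_cube_bounded[of "1 / 2" n] by auto
  have "norm (cubic_gauss n (of_real X + of_real s)) \<le> (C * exp 1) * exp (- (X ^ 3 / 2)) * exp (- s)"
    if X: "X \<ge> 0" and s: "s \<ge> 0" for X s
  proof -
    define x where "x = X + s"
    have x: "x \<ge> 0" using X s by (simp add: x_def)
    have "X ^ 3 + s ^ 3 \<le> x ^ 3"
      using X s by (simp add: x_def power3_eq_cube algebra_simps)
    moreover have "2 * s - 2 \<le> s ^ 3"
    proof -
      \<comment> \<open>A decomposition into nonnegative summands, which shows s^3 \<ge> 2s - 2;
        halved, this is the rate \<open>exp (- s)\<close>.\<close>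
      have "s ^ 3 - 2 * s + 2 = s * (s - 1)\<^sup>2 + 2 * (s - 3 / 4)\<^sup>2 + 7 / 8"
        by (simp add: power3_eq_cube power2_eq_square field_simps)
      moreover have "0 \<le> s * (s - 1)\<^sup>2" "0 \<le> 2 * (s - 3 / 4)\<^sup>2" using s by auto
      ultimately show ?thesis by linarith
    qed
    ultimately have "- (1 / 2 * x ^ 3) \<le> 1 + (- (X ^ 3 / 2)) + (- s)" by simp
    then have e: "exp (- (1 / 2 * x ^ 3)) \<le> exp 1 * exp (- (X ^ 3 / 2)) * exp (- s)"
      unfolding mult_exp_exp by simp
    have "cubic_gauss n (of_real X + of_real s) = of_real (x ^ n * exp (- (x ^ 3)))"
      by (simp add: cubic_gauss_def x_def exp_of_real[symmetric])
    then have "norm (cubic_gauss n (of_real X + of_real s)) = \<bar>x ^ n * exp (- (x ^ 3))\<bar>"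
      by (simp only: norm_of_real)
    also have "\<dots> = x ^ n * exp (- (x ^ 3))" using x by simp
    finally have "norm (cubic_gauss n (of_real X + of_real s)) = x ^ n * exp (- (x ^ 3))" .
    also have "\<dots> = (x ^ n * exp (- (1 / 2 * x ^ 3))) * exp (- (1 / 2 * x ^ 3))"
      by (simp add: mult_exp_exp mult.assoc)
    also have "\<dots> \<le> C * (exp 1 * exp (- (X ^ 3 / 2)) * exp (- s))"
      using C x e by (intro mult_mono) auto
    finally show ?thesis by (simp add: mult.assoc)
  qed
  then show ?thesis by blast
qed

lemma cubic_gauss_ray_int: "ray_int (cubic_gauss n) 0 = of_real (Gamma (real (n + 1) / 3) / 3)"
proof -
  define z where "z = complex_of_real (real (n + 1) / 3)"
  have z: "Re z > 0" by (simp add: z_def)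
  define F where "F = (\<lambda>s. cubic_gauss n (of_real s))"
  have cF: "continuous_on A F" for A
    unfolding F_def cubic_gauss_def by (intro continuous_intros)
  have eq: "((1 / 3) * exp ((1 / 3) * x)) *\<^sub>R F (exp ((1 / 3) * x)) = (1 / 3) * exp (z * of_real x - of_real (exp x))" for x
  proof -
    define e where "e = complex_of_real (x / 3)"
    have F: "F (exp ((1 / 3) * x)) = exp e ^ n * exp (- (exp e ^ 3))"
      by (simp add: F_def cubic_gauss_def e_def exp_of_real del: of_real_divide)
    have "exp e ^ 3 = exp (of_nat 3 * e)" by (rule exp_of_nat_mult[symmetric])
    then have "exp e ^ 3 = of_real (exp x)" by (simp add: e_def exp_of_real)
    moreover have "exp e * exp e ^ n = exp (z * of_real x)"
    proof -
      have "exp e * exp e ^ n = exp (of_nat (n + 1) * e)" unfolding exp_of_nat_mult by simp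
      also have "of_nat (n + 1) * e = z * of_real x" by (simp add: z_def e_def)
      finally show ?thesis .
    qed
    moreover have "((1 / 3) * exp ((1 / 3) * x)) *\<^sub>R F (exp ((1 / 3) * x)) = (1 / 3) * ((exp e * exp e ^ n) * exp (- (exp e ^ 3)))"
    proof -
      have "of_real (exp ((1 / 3) * x)) = exp e" by (simp add: e_def exp_of_real del: of_real_divide)
      then show ?thesis unfolding F scaleR_conv_of_real of_real_mult by simp
    qed
    ultimately show ?thesis by (simp add: mult_exp_exp)
  qed
  have "(LBINT t:{0<..}. F t) = (LBINT x. ((1 / 3) * exp ((1 / 3) * x)) *\<^sub>R F (exp ((1 / 3) * x)))"
  proof (rule integral_exp_substitution(2))
    show "integrable lborel (\<lambda>x. ((1 / 3) * exp ((1 / 3) * x)) *\<^sub>R F (exp ((1 / 3) * x)))"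
      unfolding eq by (intro integrable_mult_right Gamma_integral_line(1) z)
  qed (simp_all add: cF)
  also have "\<dots> = Gamma z / 3"
    unfolding eq using Gamma_integral_line(2)[OF z] by simp
  also have "Gamma z = of_real (Gamma (real (n + 1) / 3))"
    by (simp only: z_def Gamma_complex_of_real)
  finally show ?thesis
    by (simp add: ray_int_def F_def)
qed

text \<open>An integral that stops at Y differs from the complete one by less than any power of
  1/|Y|. The endpoint Y is joined by a chord to the real point |Y|, where the tail is negligible,
  and on the chord Re (y^3) stays comparable to |Y|^3.\<close>

lemma gamma_sector:
  assumes c: "c > 0"
  shows "\<exists>C. \<forall>Y. Re Y > 0 \<longrightarrow> Re (Y ^ 3) \<ge> c * norm Y ^ 3 \<longrightarrow>
    norm (contour_integral (linepath 0 Y) (cubic_gauss n) - of_real (Gamma (real (n + 1) / 3) / 3)) \<le> C / norm Y ^ K"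
proof -
  obtain G where G: "\<And>x. (G has_field_derivative cubic_gauss n x) (at x)"
    using entire_primitive[OF holomorphic_cubic_gauss] by blast
  obtain C0 where C0: "\<And>X s. X \<ge> 0 \<Longrightarrow> s \<ge> 0 \<Longrightarrow> norm (cubic_gauss n (of_real X + of_real s)) \<le> C0 * exp (- (X ^ 3 / 2)) * exp (- s)"
    using cubic_gauss_ray_bound[of n] by blast
  obtain C1 where C1: "\<And>x::real. x \<ge> 0 \<Longrightarrow> x ^ K * exp (- (1 / 2 * x ^ 3)) \<le> C1" "C1 > 0"
    using power_exp_neg_cube_bounded[of "1 / 2" K] by auto
  \<comment> \<open>The n + 1 additional powers pay for y^n and for the length of the chord.\<close>
  obtain C2 where C2: "\<And>x::real. x \<ge> 0 \<Longrightarrow> x ^ (K + n + 1) * exp (- (c / 4 * x ^ 3)) \<le> C2" "C2 > 0"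
    using power_exp_neg_cube_bounded[of "c / 4" "K + n + 1"] c by auto
  have C00: "C0 \<ge> 0" using C0[of 0 0] norm_ge_zero[of "cubic_gauss n 0"] by (simp del: norm_ge_zero)
  have "norm (contour_integral (linepath 0 Y) (cubic_gauss n) - of_real (Gamma (real (n + 1) / 3) / 3)) \<le> (2 * C2 + C0 * C1) / norm Y ^ K"
    if Y: "Re Y > 0" "Re (Y ^ 3) \<ge> c * norm Y ^ 3" for Y
  proof -
    define X where "X = norm Y"
    have X: "X > 0" using Y(1) by (auto simp: X_def)
    have "ray_int (cubic_gauss n) 0 = contour_integral (linepath 0 (of_real X)) (cubic_gauss n) + ray_int (cubic_gauss n) (of_real X)"
    proof (rule ray_shift[OF holomorphic_cubic_gauss])
      fix s :: real and y assume s: "s \<ge> 0" and "y \<in> closed_segment 0 (complex_of_real X)"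
      then obtain u where u: "y = of_real u" "u \<ge> 0"
        using X by (auto simp: closed_segment_def scaleR_conv_of_real simp flip: of_real_mult)
      have "norm (cubic_gauss n (y + of_real s)) \<le> C0 * exp (- (u ^ 3 / 2)) * exp (- s)"
        unfolding u(1) by (rule C0[OF u(2) s])
      also have "\<dots> \<le> C0 * 1 * exp (- s)" using C00 u(2) by (intro mult_mono) auto
      finally show "norm (cubic_gauss n (y + of_real s)) \<le> C0 * exp (- s)" by simp
    qed
    then have 1: "of_real (Gamma (real (n + 1) / 3) / 3) = G (of_real X) - G 0 + ray_int (cubic_gauss n) (of_real X)"
      by (simp only: cubic_gauss_ray_int contour_integral_linepath_primitive[OF G])
    have "norm (ray_int (cubic_gauss n) (of_real X)) \<le> C0 * exp (- (X ^ 3 / 2))"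
      by (rule norm_ray_int_le) (use C0[of X] X in auto)
    also have "\<dots> = C0 * (X ^ K * exp (- (1 / 2 * X ^ 3))) / X ^ K" using X by simp
    also have "\<dots> \<le> C0 * C1 / X ^ K"
      using X C00 C1(1)[of X] by (intro divide_right_mono mult_left_mono) auto
    finally have 2: "norm (ray_int (cubic_gauss n) (of_real X)) \<le> C0 * C1 / X ^ K" .
    have 3: "norm (contour_integral (linepath (of_real X) Y) (cubic_gauss n)) \<le> (X ^ n * exp (- (c / 4 * X ^ 3))) * norm (Y - of_real X)"
    proof (rule contour_integral_bound_linepath)
      show "cubic_gauss n contour_integrable_on linepath (of_real X) Y"
        by (intro contour_integrable_continuous_linepath holomorphic_on_imp_continuous_on holomorphic_cubic_gauss)
      fix y assume "y \<in> closed_segment (of_real X) Y"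
      then obtain x where x: "0 \<le> x" "x \<le> 1" and y: "y = (1 - x) *\<^sub>R of_real X + x *\<^sub>R Y"
        by (auto simp: closed_segment_def)
      have ny: "norm y \<le> X"
      proof -
        have "norm y \<le> (1 - x) * X + x * X" unfolding y
          using x X by (intro order_trans[OF norm_triangle_ineq]) (auto simp: X_def abs_mult)
        then show ?thesis by (simp add: algebra_simps)
      qed
      define e where "e = Y / of_real X"
      have Ye: "Y = of_real X * e" using X by (simp add: e_def)
      have ne: "norm e = 1" using X by (simp add: e_def norm_divide X_def)
      have Re1: "Re e > 0" using Y(1) X by (simp add: e_def Re_divide_of_real)
      have Re3: "Re (e ^ 3) \<ge> c"
      proof -
        have "Y ^ 3 = of_real (X ^ 3) * e ^ 3" by (simp add: Ye power_mult_distrib)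
        then have "Re (Y ^ 3) = X ^ 3 * Re (e ^ 3)" by (metis Re_complex_of_real Re_of_real_mult)
        then show ?thesis using Y(2) X by (simp add: X_def[symmetric])
      qed
      have sq: "(Re e)\<^sup>2 + (Im e)\<^sup>2 = 1" using ne cmod_power2[of e] by simp
      have "Re (e ^ 3) = Re e * (4 * (Re e)\<^sup>2 - 3)"
      proof -
        have "Re (e ^ 3) = (Re e) ^ 3 - 3 * Re e * (Im e)\<^sup>2"
          by (simp add: power3_eq_cube power2_eq_square algebra_simps)
        also have "(Im e)\<^sup>2 = 1 - (Re e)\<^sup>2" using sq by simp
        finally show ?thesis by (simp add: power3_eq_cube power2_eq_square algebra_simps)
      qed
      \<comment> \<open>Positive real parts of both e and e^3 confine e to |arg e| < pi/6, excluding
        the other two sectors where e^3 has positive real part; therefore Re (e^2) > 0 as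
        well.\<close>
      then have "Re e * (4 * (Re e)\<^sup>2 - 3) > 0" using Re3 c by simp
      then have "4 * (Re e)\<^sup>2 - 3 > 0" using Re1 by (simp add: zero_less_mult_iff)
      moreover have "Re (e\<^sup>2) = 2 * (Re e)\<^sup>2 - 1"
        using sq by (simp add: power2_eq_square)
      ultimately have Re2: "Re (e\<^sup>2) \<ge> 0" by simp
      have c1: "c \<le> 1" using Re3 complex_Re_le_cmod[of "e ^ 3"] ne by (simp add: norm_power)
      define w where "w = of_real (1 - x) + of_real x * e"
      have yw: "y = of_real X * w" by (simp add: y w_def Ye scaleR_conv_of_real algebra_simps)
      \<comment> \<open>In the binomial expansion the mixed terms have nonnegative real part. The
        pure ones give at least c ((1 - x)^3 + x^3), minimal at x = 1/2; this is the origin of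
        c/4.\<close>
      have "w ^ 3 = of_real ((1 - x) ^ 3) + of_real (3 * (1 - x)\<^sup>2 * x) * e + of_real (3 * (1 - x) * x\<^sup>2) * e\<^sup>2 + of_real (x ^ 3) * e ^ 3"
        by (simp add: w_def power3_eq_cube power2_eq_square algebra_simps)
      then have "Re (w ^ 3) = (1 - x) ^ 3 + 3 * (1 - x)\<^sup>2 * x * Re e + 3 * (1 - x) * x\<^sup>2 * Re (e\<^sup>2) + x ^ 3 * Re (e ^ 3)"
        by (simp only: plus_complex.sel Re_complex_of_real Re_of_real_mult)
      moreover have "3 * (1 - x)\<^sup>2 * x * Re e \<ge> 0" "3 * (1 - x) * x\<^sup>2 * Re (e\<^sup>2) \<ge> 0"
        using x Re1 Re2 by (intro mult_nonneg_nonneg; simp)+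
      moreover have "x ^ 3 * Re (e ^ 3) \<ge> x ^ 3 * c" using Re3 x by (intro mult_left_mono) auto
      moreover have "(1 - x) ^ 3 * 1 \<ge> (1 - x) ^ 3 * c" using c1 x by (intro mult_left_mono) auto
      moreover have "c * ((1 - x) ^ 3 + x ^ 3) \<ge> c * (1 / 4)"
      proof (rule mult_left_mono)
        have "(1 - x) ^ 3 + x ^ 3 = 1 / 4 + 3 * (x - 1 / 2)\<^sup>2"
          by (simp add: power3_eq_cube power2_eq_square field_simps)
        then show "1 / 4 \<le> (1 - x) ^ 3 + x ^ 3" by simp
      qed (use c in auto)
      ultimately have "Re (w ^ 3) \<ge> c / 4" by (simp add: algebra_simps)
      moreover have "Re (y ^ 3) = X ^ 3 * Re (w ^ 3)"
      proof -
        have "y ^ 3 = of_real (X ^ 3) * w ^ 3" by (simp add: yw power_mult_distrib)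
        then show ?thesis by (metis Re_of_real_mult)
      qed
      ultimately have "Re (y ^ 3) \<ge> X ^ 3 * (c / 4)" using X by (simp add: mult_left_mono)
      then have "norm (exp (- (y ^ 3))) \<le> exp (- (c / 4 * X ^ 3))" by (simp add: mult.commute)
      then show "norm (cubic_gauss n y) \<le> X ^ n * exp (- (c / 4 * X ^ 3))"
        unfolding cubic_gauss_def norm_mult norm_power using ny X by (intro mult_mono power_mono) auto
    qed (use X in auto)
    have "norm (Y - of_real X) \<le> 2 * X"
      using norm_triangle_ineq4[of Y "of_real X"] X by (simp add: X_def)
    then have "norm (contour_integral (linepath (of_real X) Y) (cubic_gauss n)) \<le> (X ^ n * exp (- (c / 4 * X ^ 3))) * (2 * X)"
      using X by (intro order_trans[OF 3] mult_left_mono) auto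
    also have "\<dots> = 2 * (X ^ (K + n + 1) * exp (- (c / 4 * X ^ 3))) / X ^ K"
      using X by (simp add: power_add)
    also have "\<dots> \<le> 2 * C2 / X ^ K"
      using X C2(1)[of X] by (intro divide_right_mono mult_left_mono) auto
    finally have 4: "norm (G Y - G (of_real X)) \<le> 2 * C2 / X ^ K"
      by (simp only: contour_integral_linepath_primitive[OF G])
    have "contour_integral (linepath 0 Y) (cubic_gauss n) - of_real (Gamma (real (n + 1) / 3) / 3) =
        (G Y - G (of_real X)) - ray_int (cubic_gauss n) (of_real X)"
      unfolding 1 contour_integral_linepath_primitive[OF G] by simp
    then have "norm (contour_integral (linepath 0 Y) (cubic_gauss n) - of_real (Gamma (real (n + 1) / 3) / 3)) \<le>
        2 * C2 / X ^ K + C0 * C1 / X ^ K"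
      using norm_triangle_ineq4[of "G Y - G (of_real X)" "ray_int (cubic_gauss n) (of_real X)"] 2 4 by simp
    then show ?thesis by (simp add: X_def add_divide_distrib)
  qed
  then show ?thesis by blast
qed

definition near_kernel :: "complex \<Rightarrow> complex \<Rightarrow> complex \<Rightarrow> complex" where
  "near_kernel \<kappa> z t = exp (- (z * (sinh t - t)) - \<kappa> * t)"

section \<open>The path split at a point near the saddle\<close>

lemma near_kernel_weber: "near_kernel \<kappa> z = weber_kernel z (\<kappa> - z)"
  by (simp add: fun_eq_iff near_kernel_def weber_kernel_def algebra_simps)

lemma holomorphic_near_kernel: "near_kernel \<kappa> z holomorphic_on A"
  unfolding near_kernel_weber by (rule holomorphic_weber_kernel')

lemma near_A_base:
  assumes "\<bar>Im a + Im \<zeta>\<bar> < pi / 2"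
  shows "near_A \<kappa> \<zeta> = contour_integral (linepath 0 a) (near_kernel \<kappa> (exp \<zeta>)) + ray_int (near_kernel \<kappa> (exp \<zeta>)) a"
  unfolding near_A_def near_kernel_weber by (rule weber_A_base[OF assms])

lemma exp_polar: "exp \<zeta> = of_real (exp (Re \<zeta> / 3) ^ 3) * cis (Im \<zeta>)" "exp (\<zeta> / 3) = of_real (exp (Re \<zeta> / 3)) * cis (Im \<zeta> / 3)"
proof -
  have "exp (Re \<zeta> / 3) ^ 3 = exp (Re \<zeta>)" by (simp flip: exp_of_nat_mult)
  then show "exp \<zeta> = of_real (exp (Re \<zeta> / 3) ^ 3) * cis (Im \<zeta>)" by (simp add: exp_eq_polar)
  show "exp (\<zeta> / 3) = of_real (exp (Re \<zeta> / 3)) * cis (Im \<zeta> / 3)" by (simp add: exp_eq_polar)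
qed

lemma norm_near_kernel_le:
  assumes "Re (cis (Im \<zeta>) * (sinh t - t)) \<ge> m"
  shows "norm (near_kernel \<kappa> (exp \<zeta>) t) \<le> exp (- (exp (Re \<zeta> / 3) ^ 3 * m) + norm \<kappa> * norm t)"
proof -
  have "Re (exp \<zeta> * (sinh t - t)) = exp (Re \<zeta> / 3) ^ 3 * Re (cis (Im \<zeta>) * (sinh t - t))"
    unfolding exp_polar(1) mult.assoc by (rule Re_of_real_mult)
  also have "\<dots> \<ge> exp (Re \<zeta> / 3) ^ 3 * m" using assms by (intro mult_left_mono) auto
  finally have "exp (Re \<zeta> / 3) ^ 3 * m \<le> Re (exp \<zeta> * (sinh t - t))" .
  moreover have "- Re (\<kappa> * t) \<le> norm \<kappa> * norm t"
    using abs_Re_le_cmod[of "\<kappa> * t"] unfolding norm_mult by linarith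
  ultimately show ?thesis
    unfolding near_kernel_def norm_exp_eq_Re exp_le_cancel_iff minus_complex.sel uminus_complex.sel by linarith
qed

text \<open>Away from 0 the exponent is at most - c |z| up to the bounded or linear contribution of
  \<kappa>, so this part is smaller than any power of 1/|z|; the power N + 1 is all that is kept.
  The constant C must not depend on \<zeta>.\<close>

lemma near_tail_bound:
  assumes c: "c > 0"
  shows "\<exists>C. \<forall>\<zeta>. Re \<zeta> \<ge> 0 \<longrightarrow> (\<forall>x\<in>{\<rho>0..1}. Re (cis (Im \<zeta>) * (sinh (of_real x * a) - of_real x * a)) \<ge> c) \<longrightarrow>
      (\<forall>s\<ge>0. Re (cis (Im \<zeta>) * (sinh (a + of_real s) - (a + of_real s))) \<ge> c * exp s) \<longrightarrow> \<rho>0 \<in> {0<..1} \<longrightarrow>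
      norm (contour_integral (linepath (of_real \<rho>0 * a) a) (near_kernel \<kappa> (exp \<zeta>)) + ray_int (near_kernel \<kappa> (exp \<zeta>)) a)
        \<le> C / exp (Re \<zeta> / 3) ^ (N + 1)"
proof -
  obtain C0 where C0: "\<And>x::real. x \<ge> 0 \<Longrightarrow> x ^ (N + 1) * exp (- (c / 2 * x ^ 3)) \<le> C0" "C0 > 0"
    using power_exp_neg_cube_bounded[of "c / 2" "N + 1"] c by auto
  define K where "K = exp (norm \<kappa> * norm a)"
  define L where "L = exp ((norm \<kappa> + 1)\<^sup>2 / (2 * (c / 2)))"
  have "norm (contour_integral (linepath (of_real \<rho>0 * a) a) (near_kernel \<kappa> (exp \<zeta>)) + ray_int (near_kernel \<kappa> (exp \<zeta>)) a)
        \<le> ((K * norm a + K * L) * C0) / exp (Re \<zeta> / 3) ^ (N + 1)"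
    if \<zeta>: "Re \<zeta> \<ge> 0" and 1: "\<forall>x\<in>{\<rho>0..1}. Re (cis (Im \<zeta>) * (sinh (of_real x * a) - of_real x * a)) \<ge> c"
      and 2: "\<forall>s\<ge>0. Re (cis (Im \<zeta>) * (sinh (a + of_real s) - (a + of_real s))) \<ge> c * exp s" and \<rho>0: "\<rho>0 \<in> {0<..1}" for \<zeta>
  proof -
    define R where "R = exp (Re \<zeta> / 3)"
    have R: "R \<ge> 1" using \<zeta> by (simp add: R_def)
    have R3: "R ^ 3 \<ge> 1" using R by simp
    define e where "e = exp (- (c / 2 * R ^ 3))"
    have e: "e \<le> C0 / R ^ (N + 1)"
      using C0(1)[of R] R by (simp add: e_def le_divide_eq mult.commute)
    have "norm (contour_integral (linepath (of_real \<rho>0 * a) a) (near_kernel \<kappa> (exp \<zeta>))) \<le> (K * e) * norm (a - of_real \<rho>0 * a)"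
    proof (rule contour_integral_bound_linepath)
      show "near_kernel \<kappa> (exp \<zeta>) contour_integrable_on linepath (of_real \<rho>0 * a) a"
        by (intro contour_integrable_continuous_linepath holomorphic_on_imp_continuous_on holomorphic_near_kernel)
      fix y assume "y \<in> closed_segment (of_real \<rho>0 * a) a"
      then obtain u where u: "0 \<le> u" "u \<le> 1" "y = (1 - u) *\<^sub>R (of_real \<rho>0 * a) + u *\<^sub>R a"
        by (auto simp: closed_segment_def)
      define x where "x = (1 - u) * \<rho>0 + u"
      have y: "y = of_real x * a" by (simp add: u(3) x_def scaleR_conv_of_real algebra_simps)
      have "(1 - u) * \<rho>0 + u * \<rho>0 \<le> x" "x \<le> (1 - u) * 1 + u"
        unfolding x_def using u \<rho>0 by (intro add_mono mult_left_mono; simp add: mult_left_le)+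
      then have x: "x \<in> {\<rho>0..1}" by (simp add: algebra_simps)
      have ny: "norm y \<le> norm a" using x \<rho>0 by (simp add: y norm_mult mult_left_le_one_le)
      have "norm (near_kernel \<kappa> (exp \<zeta>) y) \<le> exp (- (R ^ 3 * c) + norm \<kappa> * norm y)"
        unfolding R_def by (rule norm_near_kernel_le) (use 1 x in \<open>simp add: y\<close>)
      also have "\<dots> \<le> exp (norm \<kappa> * norm a + - (c / 2 * R ^ 3))"
      proof -
        have "norm \<kappa> * norm y \<le> norm \<kappa> * norm a" using ny by (intro mult_left_mono) auto
        moreover have "0 \<le> c / 2 * R ^ 3" using c R by simp
        ultimately show ?thesis by (simp add: mult.commute)
      qed
      finally show "norm (near_kernel \<kappa> (exp \<zeta>) y) \<le> K * e" by (simp add: K_def e_def mult_exp_exp)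
    qed (auto simp: K_def e_def)
    also have "norm (a - of_real \<rho>0 * a) \<le> norm a"
    proof -
      have "a - of_real \<rho>0 * a = of_real (1 - \<rho>0) * a" by (simp add: algebra_simps)
      then have "norm (a - of_real \<rho>0 * a) = \<bar>1 - \<rho>0\<bar> * norm a" by (simp only: norm_mult norm_of_real)
      also have "\<dots> \<le> 1 * norm a" using \<rho>0 by (intro mult_right_mono) auto
      finally show ?thesis by simp
    qed
    finally have A: "norm (contour_integral (linepath (of_real \<rho>0 * a) a) (near_kernel \<kappa> (exp \<zeta>))) \<le> (K * e) * norm a"
      by (simp add: K_def e_def mult_left_mono)
    have B: "norm (ray_int (near_kernel \<kappa> (exp \<zeta>)) a) \<le> K * e * L"
    proof (rule norm_ray_int_le)
      fix s :: real assume s: "s \<ge> 0"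
      have "norm (near_kernel \<kappa> (exp \<zeta>) (a + of_real s)) \<le> exp (- (R ^ 3 * (c * exp s)) + norm \<kappa> * norm (a + of_real s))"
        unfolding R_def by (rule norm_near_kernel_le) (use 2 s in auto)
      also have "\<dots> \<le> exp (- (c / 2 * R ^ 3) + - (c / 2 * exp s) + norm \<kappa> * (norm a + s))"
      proof -
        \<comment> \<open>From R^3 \<ge> 1 and exp s \<ge> 1 the product R^3 exp s dominates the
          mean of its factors. Thus half of c pays for smallness in R and half for convergence in
          s.\<close>
        have "0 \<le> (R ^ 3 - 1) * (exp s - 1)" using R3 s by simp
        moreover have "R ^ 3 * exp s \<ge> 1 * 1" using R R3 s by (intro mult_mono) auto
        ultimately have "R ^ 3 / 2 + exp s / 2 \<le> R ^ 3 * exp s" by (simp add: algebra_simps)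
        then have "c * (R ^ 3 / 2 + exp s / 2) \<le> c * (R ^ 3 * exp s)" using c by (intro mult_left_mono) auto
        moreover have "norm \<kappa> * norm (a + of_real s) \<le> norm \<kappa> * (norm a + s)"
          using s norm_triangle_ineq[of a "of_real s"] by (intro mult_left_mono) auto
        ultimately show ?thesis by (simp add: algebra_simps)
      qed
      also have "\<dots> = K * e * exp (- (c / 2 * exp s) + norm \<kappa> * s)"
        by (simp add: K_def e_def mult_exp_exp algebra_simps)
      also have "\<dots> \<le> K * e * (L * exp (- s))"
        unfolding L_def by (intro mult_left_mono exp_neg_exp_le) (use c s in \<open>auto simp: K_def e_def\<close>)
      finally show "norm (near_kernel \<kappa> (exp \<zeta>) (a + of_real s)) \<le> K * e * L * exp (- s)" by (simp add: mult_ac)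
    qed
    have "norm (contour_integral (linepath (of_real \<rho>0 * a) a) (near_kernel \<kappa> (exp \<zeta>)) + ray_int (near_kernel \<kappa> (exp \<zeta>)) a)
       \<le> (K * norm a + K * L) * e"
      using norm_triangle_mono[OF A B] by (simp add: algebra_simps)
    also have "\<dots> \<le> (K * norm a + K * L) * (C0 / R ^ (N + 1))"
      using e by (intro mult_left_mono) (auto simp: K_def L_def)
    finally show ?thesis by (simp add: R_def)
  qed
  then show ?thesis by blast
qed

text \<open>Lagrange coefficient times the integral of y^n exp (- y^3) over y > 0. The argument
  -\<kappa> reflects that the kernel contains exp (- \<kappa> t).\<close>

definition near_coeff :: "nat \<Rightarrow> complex \<Rightarrow> complex" where
  "near_coeff n \<kappa> = of_real (6 powr (real (n + 1) / 3)) * B_coeff n (- \<kappa>) * of_real (Gamma (real (n + 1) / 3) / 3)"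

lemma has_integral_inverse_square:
  fixes R :: real
  assumes "R > 0"
  shows "((\<lambda>x. 1 / (1 + R * x)\<^sup>2) has_integral (1 - 1 / (1 + R)) / R) {0..1}"
proof -
  have "((\<lambda>x. 1 / (1 + R * x)\<^sup>2) has_integral (- (1 / R) * inverse (1 + R * 1) - - (1 / R) * inverse (1 + R * 0))) {0..1}"
  proof (rule fundamental_theorem_of_calculus)
    fix x :: real assume x: "x \<in> {0..1}"
    have p: "1 + R * x > 0" using x assms by (simp add: add_pos_nonneg)
    have "((\<lambda>x. - (1 / R) * inverse (1 + R * x)) has_real_derivative
        - (1 / R) * (- (inverse (1 + R * x) * R * inverse (1 + R * x)))) (at x within {0..1})"
      using p by (intro DERIV_cmult DERIV_inverse') (auto intro!: derivative_eq_intros)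
    also have "- (1 / R) * (- (inverse (1 + R * x) * R * inverse (1 + R * x))) = 1 / (1 + R * x)\<^sup>2"
      using assms by (simp add: power2_eq_square divide_inverse)
    finally show "((\<lambda>x. - (1 / R) * inverse (1 + R * x)) has_vector_derivative 1 / (1 + R * x)\<^sup>2) (at x within {0..1})"
      by (simp add: has_real_derivative_iff_has_vector_derivative)
  qed auto
  then show ?thesis using assms by (simp add: divide_inverse algebra_simps)
qed

text \<open>With u = z^(1/3), the substitution y = u \<open>sinh_cbrt t\<close> maps each term of
  the expansion to an incomplete Gamma integral up to u S. The expansion remainder, of size |t|^N,
  is integrated against exp (- c R^3 x^3), and scaling by R = |u| gains the exponent N + 1.\<close>

lemma near_segment_asymptotic:
  fixes e \<kappa> :: complex
  defines "b \<equiv> \<lambda>n. of_real (6 powr (real (n + 1) / 3)) * B_coeff n (- \<kappa>)"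
  assumes c: "c > 0"
    and s: "\<And>t. t \<in> ball 0 \<delta> \<Longrightarrow> sinh_cbrt analytic_on {t} \<and> sinh_cbrt t ^ 3 = sinh t - t"
    and rem: "\<And>t. t \<in> ball 0 \<delta> \<Longrightarrow> norm (exp (- (\<kappa> * t)) - (\<Sum>n<N. b n * (sinh_cbrt t ^ n * deriv sinh_cbrt t))) \<le> Cr * norm t ^ N"
    and e: "e \<in> ball 0 \<delta>"
  shows "\<exists>C. \<forall>\<zeta>. Re \<zeta> \<ge> 0 \<longrightarrow> (\<forall>x\<in>{0..1}. Re (cis (Im \<zeta>) * (sinh (of_real x * e) - of_real x * e)) \<ge> c * x ^ 3) \<longrightarrow>
      Re (cis (Im \<zeta> / 3) * sinh_cbrt e) > 0 \<longrightarrow>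
      norm (contour_integral (linepath 0 e) (near_kernel \<kappa> (exp \<zeta>)) - (\<Sum>n<N. near_coeff n \<kappa> / exp (\<zeta> / 3) ^ (n + 1)))
        \<le> C / exp (Re \<zeta> / 3) ^ (N + 1)"
proof -
  define S where "S = sinh_cbrt e"
  have \<delta>: "\<delta> > 0" using e by (metis ball_eq_empty empty_iff not_le)
  have Cr: "Cr * norm e ^ N \<ge> 0" using rem[OF e] norm_ge_zero order_trans by blast
  have sder: "(sinh_cbrt has_field_derivative deriv sinh_cbrt t) (at t)" if "t \<in> ball 0 \<delta>" for t
    using s[OF that] analytic_on_imp_differentiable_at[of sinh_cbrt "{t}" t] by (auto simp: DERIV_deriv_iff_field_differentiable)
  \<comment> \<open>Compares Re ((u S)^3) \<ge> c R^3 with |u S|^3 = R^3 |S|^3. Adding 1 keeps the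
    denominator positive while S \<noteq> 0 is not yet known.\<close>
  define cY where "cY = c / (norm S + 1) ^ 3"
  have "norm S + 1 > 0" by (simp add: add_nonneg_pos)
  then have cY: "cY > 0" unfolding cY_def using c by (intro divide_pos_pos zero_less_power)
  obtain Cg where Cg: "\<And>n Y. Re Y > 0 \<Longrightarrow> Re (Y ^ 3) \<ge> cY * norm Y ^ 3 \<Longrightarrow>
    norm (contour_integral (linepath 0 Y) (cubic_gauss n) - of_real (Gamma (real (n + 1) / 3) / 3)) \<le> Cg n / norm Y ^ N"
    using gamma_sector[OF cY, of _ N] by metis
  obtain C1 where C1: "\<And>x::real. x \<ge> 0 \<Longrightarrow> x ^ N * exp (- (c * x ^ 3)) \<le> C1" "C1 > 0"
    using power_exp_neg_cube_bounded[OF c, of N] by auto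
  obtain C2 where C2: "\<And>x::real. x \<ge> 0 \<Longrightarrow> x ^ (N + 1) * exp (- (c * x ^ 3)) \<le> C2" "C2 > 0"
    using power_exp_neg_cube_bounded[OF c, of "N + 1"] by auto
  obtain C3 where C3: "\<And>x::real. x \<ge> 0 \<Longrightarrow> x ^ (N + 2) * exp (- (c * x ^ 3)) \<le> C3" "C3 > 0"
    using power_exp_neg_cube_bounded[OF c, of "N + 2"] by auto
  \<comment> \<open>The three bounds match the terms of (1 + y)^2, so that D / (1 + y)^2 is a
    majorant with an elementary integral of order 1/R.\<close>
  define D where "D = C1 + 2 * C2 + C3"
  have D: "y ^ N * exp (- (c * y ^ 3)) \<le> D / (1 + y)\<^sup>2" if "y \<ge> 0" for y :: real
  proof -
    have "y ^ N * exp (- (c * y ^ 3)) * (1 + y)\<^sup>2 = y ^ N * exp (- (c * y ^ 3)) + 2 * (y ^ (N + 1) * exp (- (c * y ^ 3))) + y ^ (N + 2) * exp (- (c * y ^ 3))"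
      by (simp add: power2_eq_square algebra_simps)
    also have "\<dots> \<le> D" unfolding D_def using C1(1)[OF that] C2(1)[OF that] C3(1)[OF that] by linarith
    finally show ?thesis using that by (simp add: le_divide_eq add_pos_nonneg)
  qed
  define CT where "CT = Cr * norm e ^ N * norm e * D + (\<Sum>n<N. norm (b n) * (Cg n / norm S ^ N))"
  have "norm (contour_integral (linepath 0 e) (near_kernel \<kappa> (exp \<zeta>)) - (\<Sum>n<N. near_coeff n \<kappa> / exp (\<zeta> / 3) ^ (n + 1)))
        \<le> CT / exp (Re \<zeta> / 3) ^ (N + 1)"
    if \<zeta>: "Re \<zeta> \<ge> 0" and P: "\<forall>x\<in>{0..1}. Re (cis (Im \<zeta>) * (sinh (of_real x * e) - of_real x * e)) \<ge> c * x ^ 3"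
      and PS: "Re (cis (Im \<zeta> / 3) * sinh_cbrt e) > 0" for \<zeta>
  proof -
    define R where "R = exp (Re \<zeta> / 3)"
    have R: "R \<ge> 1" using \<zeta> by (simp add: R_def)
    define u where "u = exp (\<zeta> / 3)"
    have nu: "norm u = R" by (simp add: u_def R_def)
    have u0: "u \<noteq> 0" by (simp add: u_def)
    have u3: "u ^ 3 = exp \<zeta>" by (simp add: u_def flip: exp_of_nat_mult)
    define K where "K = near_kernel \<kappa> (exp \<zeta>)"
    have sub: "closed_segment 0 e \<subseteq> ball 0 \<delta>"
      using e \<delta> by (intro closed_segment_subset) auto
    have A: "((\<lambda>t. exp (- (exp \<zeta> * (sinh t - t))) * (sinh_cbrt t ^ n * deriv sinh_cbrt t)) has_contour_integral
        contour_integral (linepath 0 (u * S)) (cubic_gauss n) / u ^ (n + 1)) (linepath 0 e)" for n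
    proof -
      obtain G where G: "\<And>x. (G has_field_derivative cubic_gauss n x) (at x)"
        using entire_primitive[OF holomorphic_cubic_gauss] by blast
      \<comment> \<open>The change of variables is carried out through a primitive: G at u s,
        divided by u^(n+1) from u^n and dy = u ds.\<close>
      define H where "H = (\<lambda>t. G (u * sinh_cbrt t) / u ^ (n + 1))"
      have "((\<lambda>t. exp (- (exp \<zeta> * (sinh t - t))) * (sinh_cbrt t ^ n * deriv sinh_cbrt t)) has_contour_integral
         (H (pathfinish (linepath 0 e)) - H (pathstart (linepath 0 e)))) (linepath 0 e)"
      proof (rule contour_integral_primitive)
        show "(H has_field_derivative exp (- (exp \<zeta> * (sinh t - t))) * (sinh_cbrt t ^ n * deriv sinh_cbrt t)) (at t within ball 0 \<delta>)"
          if t: "t \<in> ball 0 \<delta>" for t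
        proof -
          have "(H has_field_derivative cubic_gauss n (u * sinh_cbrt t) * (u * deriv sinh_cbrt t) / u ^ (n + 1)) (at t)"
            unfolding H_def by (intro DERIV_cdivide DERIV_chain'[OF _ G] DERIV_cmult sder t)
          moreover have "cubic_gauss n (u * sinh_cbrt t) * (u * deriv sinh_cbrt t) / u ^ (n + 1) =
              exp (- (exp \<zeta> * (sinh t - t))) * (sinh_cbrt t ^ n * deriv sinh_cbrt t)"
            using s[OF t] u0 by (simp add: cubic_gauss_def power_mult_distrib u3)
          ultimately show ?thesis by (simp add: has_field_derivative_at_within)
        qed
        show "valid_path (linepath 0 e)" by (rule valid_path_linepath)
        show "path_image (linepath 0 e) \<subseteq> ball 0 \<delta>" using sub by (simp only: path_image_linepath)
      qed
      moreover have "sinh_cbrt 0 = 0" by (simp add: sinh_cbrt_def)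
      ultimately show ?thesis
        by (simp add: H_def S_def contour_integral_linepath_primitive[OF G] diff_divide_distrib)
    qed
    define Z where "Z = (\<Sum>n<N. b n * (contour_integral (linepath 0 (u * S)) (cubic_gauss n) / u ^ (n + 1)))"
    have sumA: "((\<lambda>t. \<Sum>n<N. b n * (exp (- (exp \<zeta> * (sinh t - t))) * (sinh_cbrt t ^ n * deriv sinh_cbrt t))) has_contour_integral Z) (linepath 0 e)"
      unfolding Z_def by (intro has_contour_integral_sum has_contour_integral_lmul A) auto
    have "(K has_contour_integral contour_integral (linepath 0 e) K) (linepath 0 e)"
      unfolding K_def by (intro has_contour_integral_integral contour_integrable_continuous_linepath holomorphic_on_imp_continuous_on holomorphic_near_kernel)
    from has_contour_integral_diff[OF this sumA]
    have I: "((\<lambda>x. (K (linepath 0 e x) - (\<Sum>n<N. b n * (exp (- (exp \<zeta> * (sinh (linepath 0 e x) - linepath 0 e x))) * (sinh_cbrt (linepath 0 e x) ^ n * deriv sinh_cbrt (linepath 0 e x))))) * (e - 0)) has_integral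
        (contour_integral (linepath 0 e) K - Z)) {0..1}" (is "(?F has_integral _) _")
      unfolding has_contour_integral_linepath .
    have J: "((\<lambda>x. (Cr * norm e ^ N * norm e * D / R ^ N) * (1 / (1 + R * x)\<^sup>2)) has_integral
        (Cr * norm e ^ N * norm e * D / R ^ N) * ((1 - 1 / (1 + R)) / R)) {0..1}"
      using R by (intro has_integral_mult_right has_integral_inverse_square) auto
    have "norm (contour_integral (linepath 0 e) K - Z) \<le> (Cr * norm e ^ N * norm e * D / R ^ N) * ((1 - 1 / (1 + R)) / R)"
    proof -
      have "norm (integral {0..1} ?F) \<le> integral {0..1} (\<lambda>x. (Cr * norm e ^ N * norm e * D / R ^ N) * (1 / (1 + R * x)\<^sup>2))"
      proof (rule integral_norm_bound_integral)
        show "?F integrable_on {0..1}" using I by (rule has_integral_integrable)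
        show "(\<lambda>x. (Cr * norm e ^ N * norm e * D / R ^ N) * (1 / (1 + R * x)\<^sup>2)) integrable_on {0..1}"
          using J by (rule has_integral_integrable)
        fix x :: real assume x: "x \<in> {0..1}"
        define t where "t = linepath 0 e x"
        have t: "t = of_real x * e" by (simp add: t_def linepath_def scaleR_conv_of_real)
        have tb: "t \<in> ball 0 \<delta>" using sub x linepath_in_path[of x 0 e] by (auto simp: t_def)
        have "?F x = exp (- (exp \<zeta> * (sinh t - t))) * (exp (- (\<kappa> * t)) - (\<Sum>n<N. b n * (sinh_cbrt t ^ n * deriv sinh_cbrt t))) * e"
          unfolding t_def[symmetric] K_def near_kernel_def
          by (simp add: right_diff_distrib sum_distrib_left mult_ac mult_exp_exp)
        then have "norm (?F x) = norm (exp (- (exp \<zeta> * (sinh t - t)))) * norm (exp (- (\<kappa> * t)) - (\<Sum>n<N. b n * (sinh_cbrt t ^ n * deriv sinh_cbrt t))) * norm e"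
          by (simp only: norm_mult)
        also have "\<dots> \<le> exp (- (R ^ 3 * (c * x ^ 3))) * (Cr * norm t ^ N) * norm e"
        proof (intro mult_right_mono mult_mono rem tb)
          have "norm (near_kernel 0 (exp \<zeta>) t) \<le> exp (- (R ^ 3 * (c * x ^ 3)) + norm (0::complex) * norm t)"
            unfolding R_def using P x by (intro norm_near_kernel_le) (auto simp: t)
          then show "norm (exp (- (exp \<zeta> * (sinh t - t)))) \<le> exp (- (R ^ 3 * (c * x ^ 3)))"
            by (simp add: near_kernel_def)
        qed auto
        also have "\<dots> = (Cr * norm e ^ N * norm e / R ^ N) * ((R * x) ^ N * exp (- (c * (R * x) ^ 3)))"
          using x R by (simp add: t norm_mult power_mult_distrib mult_ac)
        also have "\<dots> \<le> (Cr * norm e ^ N * norm e / R ^ N) * (D / (1 + R * x)\<^sup>2)"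
          using x R Cr by (intro mult_left_mono D) auto
        finally show "norm (?F x) \<le> (Cr * norm e ^ N * norm e * D / R ^ N) * (1 / (1 + R * x)\<^sup>2)"
          by (simp add: mult_ac)
      qed
      then show ?thesis unfolding integral_unique[OF I] integral_unique[OF J] .
    qed
    also have "\<dots> \<le> (Cr * norm e ^ N * norm e * D / R ^ N) * (1 / R)"
      using R Cr C1(2) C2(2) C3(2) by (intro mult_left_mono divide_right_mono) (auto simp: D_def)
    finally have 1: "norm (contour_integral (linepath 0 e) K - Z) \<le> Cr * norm e ^ N * norm e * D / R ^ (N + 1)"
      by (simp add: mult_ac)
    have uS: "Re (u * S) > 0"
      using PS R unfolding u_def exp_polar(2) mult.assoc Re_of_real_mult S_def by simp
    then have S0: "S \<noteq> 0" by auto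
    have "(u * S) ^ 3 = exp \<zeta> * (sinh e - e)"
      using s[OF e] by (simp add: power_mult_distrib u3 S_def)
    then have "Re ((u * S) ^ 3) = R ^ 3 * Re (cis (Im \<zeta>) * (sinh e - e))"
      unfolding exp_polar(1) mult.assoc R_def by (simp only: Re_of_real_mult)
    also have "\<dots> \<ge> R ^ 3 * c" using P[rule_format, of 1] R by (intro mult_left_mono) auto
    finally have "R ^ 3 * c \<le> Re ((u * S) ^ 3)" .
    moreover have "cY * norm (u * S) ^ 3 \<le> R ^ 3 * c"
    proof -
      have "norm S ^ 3 \<le> (norm S + 1) ^ 3" by (intro power_mono) auto
      then have "norm S ^ 3 / (norm S + 1) ^ 3 \<le> 1"
        using \<open>norm S + 1 > 0\<close> by (simp add: divide_le_eq_1)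
      then have "(R ^ 3 * c) * (norm S ^ 3 / (norm S + 1) ^ 3) \<le> (R ^ 3 * c) * 1"
        using R c by (intro mult_left_mono) auto
      then show ?thesis by (simp add: cY_def norm_mult nu power_mult_distrib mult_ac)
    qed
    ultimately have uS3: "cY * norm (u * S) ^ 3 \<le> Re ((u * S) ^ 3)" by simp
    have 2: "norm (Z - (\<Sum>n<N. near_coeff n \<kappa> / u ^ (n + 1))) \<le> (\<Sum>n<N. norm (b n) * (Cg n / norm S ^ N)) / R ^ (N + 1)"
    proof -
      have "Z - (\<Sum>n<N. near_coeff n \<kappa> / u ^ (n + 1)) = (\<Sum>n<N. b n * ((contour_integral (linepath 0 (u * S)) (cubic_gauss n) - of_real (Gamma (real (n + 1) / 3) / 3)) / u ^ (n + 1)))"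
        unfolding Z_def near_coeff_def b_def sum_subtractf[symmetric]
        by (intro sum.cong refl) (simp add: diff_divide_distrib algebra_simps)
      also have "norm \<dots> \<le> (\<Sum>n<N. norm (b n) * (Cg n / norm S ^ N) / R ^ (N + 1))"
      proof (rule sum_norm_le)
        fix n assume "n \<in> {..<N}"
        define dd where "dd = norm (contour_integral (linepath 0 (u * S)) (cubic_gauss n) - of_real (Gamma (real (n + 1) / 3) / 3))"
        have dd: "dd \<le> Cg n / norm (u * S) ^ N" unfolding dd_def by (rule Cg[OF uS uS3])
        \<comment> \<open>Of the n + 1 factors R only one is used; the factor |u S|^(-N) supplies
          the other N.\<close>
        have "dd / R ^ (n + 1) \<le> dd / R ^ 1"
          using R by (intro divide_left_mono power_increasing) (auto simp: dd_def)
        also have "\<dots> \<le> Cg n / norm (u * S) ^ N / R ^ 1" using dd R by (intro divide_right_mono) auto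
        finally have "norm (b n) * (dd / R ^ (n + 1)) \<le> norm (b n) * (Cg n / norm (u * S) ^ N / R ^ 1)"
          by (intro mult_left_mono) auto
        then show "norm (b n * ((contour_integral (linepath 0 (u * S)) (cubic_gauss n) - of_real (Gamma (real (n + 1) / 3) / 3)) / u ^ (n + 1)))
           \<le> norm (b n) * (Cg n / norm S ^ N) / R ^ (N + 1)"
          unfolding norm_mult norm_divide norm_power nu dd_def[symmetric]
          by (simp add: power_mult_distrib mult_ac)
      qed
      finally show ?thesis by (simp add: sum_divide_distrib)
    qed
    have "norm (contour_integral (linepath 0 e) K - (\<Sum>n<N. near_coeff n \<kappa> / u ^ (n + 1))) \<le> CT / R ^ (N + 1)"
    proof -
      have "contour_integral (linepath 0 e) K - (\<Sum>n<N. near_coeff n \<kappa> / u ^ (n + 1)) =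
        (contour_integral (linepath 0 e) K - Z) + (Z - (\<Sum>n<N. near_coeff n \<kappa> / u ^ (n + 1)))" by simp
      then show ?thesis
        using norm_triangle_mono[OF 1 2] unfolding CT_def add_divide_distrib by (simp only:)
    qed
    then show ?thesis by (simp add: K_def R_def u_def)
  qed
  then show ?thesis by blast
qed

section \<open>Paths of descent\<close>

lemma strictly_positive_by_deriv:
  fixes f :: "real \<Rightarrow> real"
  assumes "f 0 = 0" "x > 0" "\<And>y. (f has_real_derivative f' y) (at y)" "\<And>y. 0 < y \<Longrightarrow> y < x \<Longrightarrow> f' y > 0"
  shows "f x > 0"
proof -
  have "f 0 < f x"
  proof (rule DERIV_pos_imp_increasing_open[OF assms(2)])
    show "\<exists>y. (f has_real_derivative y) (at z) \<and> y > 0" if "0 < z" "z < x" for z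
      using assms(3,4) that by blast
    show "continuous_on {0..x} f"
      using assms(3) by (intro continuous_at_imp_continuous_on ballI DERIV_isCont) blast
  qed
  then show ?thesis using assms(1) by simp
qed

section \<open>Inequalities along the paths of descent\<close>

lemma sinh_real_gt:
  assumes "x > 0"
  shows "sinh x > (x::real)"
proof -
  have "cosh y - 1 > 0" if "y > 0" for y :: real
    by (rule strictly_positive_by_deriv[where f = "\<lambda>y. cosh y - 1" and f' = sinh])
       (use that in \<open>auto intro!: derivative_eq_intros\<close>)
  then have "sinh x - x > 0"
    by (intro strictly_positive_by_deriv[where f = "\<lambda>x. sinh x - x" and f' = "\<lambda>x. cosh x - 1"])
       (use assms in \<open>auto intro!: derivative_eq_intros\<close>)
  then show ?thesis by simp
qed

lemma cosh_real_gt_quadratic: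
  assumes "x > 0"
  shows "cosh x > 1 + x\<^sup>2 / (2::real)"
proof -
  have "cosh x - 1 - x\<^sup>2 / 2 > 0"
    by (rule strictly_positive_by_deriv[where f = "\<lambda>x. cosh x - 1 - x\<^sup>2 / 2" and f' = "\<lambda>x. sinh x - x"])
       (use assms in \<open>auto intro!: derivative_eq_intros simp: sinh_real_gt\<close>)
  then show ?thesis by simp
qed

text \<open>The quadratic minorant 1 + x^2/2 of cosh is at least sqrt 2 times x. This covers the
  range where sin x \<ge> sqrt 2 / 2 and the ray at height -3 pi/4, where the sine has exactly this
  size.\<close>

lemma cosh_gt_sqrt2: "x > 0 \<Longrightarrow> cosh x * (sqrt 2 / 2) > (x::real)"
proof -
  assume x: "x > 0"
  have "0 \<le> (x - sqrt 2)\<^sup>2" by simp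
  then have "2 * sqrt 2 * x \<le> x\<^sup>2 + 2" by (simp add: power2_diff algebra_simps)
  then have "sqrt 2 * x \<le> 1 + x\<^sup>2 / 2" by simp
  also have "\<dots> < cosh x" by (rule cosh_real_gt_quadratic[OF x])
  finally have "(sqrt 2 * x) * (sqrt 2 / 2) < cosh x * (sqrt 2 / 2)"
    by (rule mult_strict_right_mono) simp
  moreover have "(sqrt 2 * x) * (sqrt 2 / 2) = x" by simp
  ultimately show ?thesis by (simp only:)
qed

text \<open>Up to pi/4 the second derivative 2 sinh x cos x is positive; from pi/4 to 3 pi/4 the
  sine is at least sqrt 2 / 2.\<close>

lemma cosh_sin_gt:
  assumes "0 < x" "x \<le> 3 * pi / 4"
  shows "cosh x * sin x > x"
proof (cases "x \<le> pi / 4")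
  case True
  have "sinh y * sin y + cosh y * cos y - 1 > 0" if "0 < y" "y < x" for y
  proof (rule strictly_positive_by_deriv[where f = "\<lambda>y. sinh y * sin y + cosh y * cos y - 1" and f' = "\<lambda>y. 2 * sinh y * cos y"])
    show "0 < 2 * sinh v * cos v" if v: "0 < v" "v < y" for v
      using v True \<open>y < x\<close> by (intro mult_pos_pos cos_gt_zero) auto
  qed (use that in \<open>auto intro!: derivative_eq_intros\<close>)
  then have "cosh x * sin x - x > 0"
    by (intro strictly_positive_by_deriv[where f = "\<lambda>x. cosh x * sin x - x" and f' = "\<lambda>y. sinh y * sin y + cosh y * cos y - 1"])
       (use assms in \<open>auto intro!: derivative_eq_intros\<close>)
  then show ?thesis by simp
next
  case False
  have "sin x = cos (x - pi / 2)" by (simp add: cos_diff)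
  also have "\<dots> = cos \<bar>x - pi / 2\<bar>" by (simp only: cos_abs_real)
  also have "cos \<bar>x - pi / 2\<bar> \<ge> cos (pi / 4)"
  proof (rule cos_monotone_0_pi_le)
    show "\<bar>x - pi / 2\<bar> \<le> pi / 4" unfolding abs_le_iff using False assms by linarith
  qed auto
  finally have "sin x \<ge> sqrt 2 / 2" by (simp add: cos_45)
  then have "cosh x * (sqrt 2 / 2) \<le> cosh x * sin x" by (intro mult_left_mono) auto
  then show ?thesis using cosh_gt_sqrt2[OF assms(1)] by linarith
qed

lemma sinh_cos_less:
  assumes "0 < x" "x \<le> 3 * pi / 4"
  shows "sinh x * cos x < x"
proof -
  have "1 - cosh y * cos y + sinh y * sin y > 0" if "0 < y" "y < x" for y
  proof (rule strictly_positive_by_deriv[where f = "\<lambda>y. 1 - cosh y * cos y + sinh y * sin y" and f' = "\<lambda>y. 2 * cosh y * sin y"])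
    show "0 < 2 * cosh v * sin v" if v: "0 < v" "v < y" for v
      using v assms \<open>y < x\<close> by (intro mult_pos_pos sin_gt_zero) auto
  qed (use that in \<open>auto intro!: derivative_eq_intros\<close>)
  then have "x - sinh x * cos x > 0"
    by (intro strictly_positive_by_deriv[where f = "\<lambda>x. x - sinh x * cos x" and f' = "\<lambda>y. 1 - cosh y * cos y + sinh y * sin y"])
       (use assms in \<open>auto intro!: derivative_eq_intros\<close>)
  then show ?thesis by simp
qed

lemma sin_less_self:
  assumes "0 < x"
  shows "sin x < (x::real)"
proof (cases "x \<le> pi")
  case True
  have "1 - cos y > 0" if "0 < y" "y < x" for y
    using cos_monotone_0_pi[of 0 y] that True by simp
  then have "x - sin x > 0"
    by (intro strictly_positive_by_deriv[where f = "\<lambda>x. x - sin x" and f' = "\<lambda>x. 1 - cos x"])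
       (use assms in \<open>auto intro!: derivative_eq_intros\<close>)
  then show ?thesis by simp
next
  case False
  then show ?thesis using sin_le_one[of x] pi_gt3 by linarith
qed

lemma sinh_Complex: "sinh (Complex x y) = Complex (sinh x * cos y) (cosh x * sin y)"
  by (simp add: complex_eq_iff sinh_field_def cosh_field_def Re_exp Im_exp field_simps)

text \<open>A path \<open>0 \<rightarrow> a \<rightarrow> a + \<infinity>\<close> is admissible for \<open>arg z = \<alpha>\<close> if \<open>Re (z (sinh t - t))\<close> is
  positive along it, including the limiting directions at both ends.\<close>

definition descent_base :: "real \<Rightarrow> complex \<Rightarrow> bool" where
  "descent_base \<alpha> a \<longleftrightarrow> \<bar>Im a + \<alpha>\<bar> < pi / 2 \<and> Re (cis (\<alpha> / 3) * a) > 0 \<and> Re (cis \<alpha> * a ^ 3) > 0 \<and>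
     (\<forall>\<rho>. 0 < \<rho> \<and> \<rho> \<le> 1 \<longrightarrow> Re (cis \<alpha> * (sinh (of_real \<rho> * a) - of_real \<rho> * a)) > 0) \<and>
     (\<forall>s\<ge>0. Re (cis \<alpha> * (sinh (a + of_real s) - (a + of_real s))) > 0) \<and> Re (cis \<alpha> * exp a) > 0"

lemma descent_base_cnj:
  assumes "descent_base \<alpha> a"
  shows "descent_base (- \<alpha>) (cnj a)"
proof -
  have c: "cis (- x) = cnj (cis x)" for x by (simp add: cis_cnj)
  have s: "sinh (cnj t) = cnj (sinh t)" for t by (simp add: sinh_field_def exp_cnj)
  have e: "cnj a * of_real r = cnj (a * of_real r)" "cnj a + of_real r = cnj (a + of_real r)" "of_real r * cnj a = cnj (of_real r * a)" for r
    by simp_all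
  have R: "Re (cnj x * cnj y) = Re (x * y)" for x y by simp
  have d: "cnj x - cnj y = cnj (x - y)" "cnj x ^ n = cnj (x ^ n)" for x y n by simp_all
  have m: "- \<alpha> / 3 = - (\<alpha> / 3)" by simp
  have i: "\<bar>Im (cnj a) + - \<alpha>\<bar> = \<bar>Im a + \<alpha>\<bar>" by simp
  show ?thesis
    using assms unfolding descent_base_def i m c e s d exp_cnj[symmetric] R .
qed

lemma descent_base_real:
  assumes "0 \<le> \<alpha>" "\<alpha> < pi / 2"
  shows "descent_base \<alpha> 1"
proof -
  have c: "cos \<alpha> > 0" "cos (\<alpha> / 3) > 0" using assms by (auto intro!: cos_gt_zero_pi)
  have R: "Re (cis \<alpha> * of_real r) > 0" if "r > 0" for r using c that by simp
  have s: "sinh (of_real x) - of_real x = complex_of_real (sinh x - x)" for x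
    by (simp add: sinh_field_def exp_of_real flip: of_real_minus)
  have "Re (cis \<alpha> * (sinh (of_real \<rho> * 1) - of_real \<rho> * 1)) > 0" if "\<rho> > 0" for \<rho>
    using R[of "sinh \<rho> - \<rho>"] sinh_real_gt[OF that] by (simp only: s mult_1_right)
  moreover have "Re (cis \<alpha> * (sinh (1 + of_real x) - (1 + of_real x))) > 0" if "x \<ge> 0" for x
  proof -
    have "1 + of_real x = complex_of_real (1 + x)" by simp
    then show ?thesis using R[of "sinh (1 + x) - (1 + x)"] sinh_real_gt[of "1 + x"] that
      by (simp only: s) simp
  qed
  moreover have "Re (cis \<alpha> * exp 1) > 0" using R[of "exp 1"] by (simp add: exp_of_real[of 1, symmetric])
  ultimately show ?thesis using c assms by (auto simp: descent_base_def)
qed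

text \<open>The direction of the base point is -pi/4 and its height -3 pi/4, the values of
  -\<alpha>/3 and -\<alpha> at the midpoint \<alpha> = 3 pi/4 of the range. Along the whole path
  sinh t - t lies in the open third quadrant, which rotation by such an \<alpha> carries into the
  right half-plane.\<close>

lemma descent_base_middle:
  assumes "pi / 2 \<le> \<alpha>" "\<alpha> \<le> pi"
  shows "descent_base \<alpha> (Complex (3 * pi / 4) (- (3 * pi / 4)))"
proof -
  define h where "h = 3 * pi / 4"
  have h: "h > 0" by (simp add: h_def)
  have trig: "sin h = sqrt 2 / 2" "cos h = - (sqrt 2 / 2)"
  proof -
    have "h = pi - pi / 4" by (simp add: h_def)
    then show "sin h = sqrt 2 / 2" "cos h = - (sqrt 2 / 2)"
      by (simp_all only: sin_pi_minus cos_pi_minus sin_45 cos_45)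
  qed
  have ca: "cos \<alpha> \<le> 0" using assms cos_monotone_0_pi_le[of "pi / 2" \<alpha>] by simp
  have sa: "sin \<alpha> \<ge> 0" using assms by (intro sin_ge_zero) auto
  have Q: "Re (cis \<alpha> * w) > 0" if w: "Re w < 0" "Im w < 0" for w
  proof -
    have 1: "cos \<alpha> * Re w \<ge> 0" "sin \<alpha> * Im w \<le> 0"
      using ca sa w by (auto simp: mult_nonpos_nonpos mult_nonneg_nonpos)
    have "cos \<alpha> \<noteq> 0 \<or> sin \<alpha> \<noteq> 0"
      by (metis sin_cos_squared_add power_zero_numeral add_0 zero_neq_one)
    then have "cos \<alpha> * Re w \<noteq> 0 \<or> sin \<alpha> * Im w \<noteq> 0" using w by auto
    then have "cos \<alpha> * Re w - sin \<alpha> * Im w > 0" using 1 by (elim disjE) linarith+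
    then show ?thesis by simp
  qed
  have "Re (cis (\<alpha> / 3) * Complex h (- h)) > 0"
  proof -
    have "cos (\<alpha> / 3) > 0" by (rule cos_gt_zero_pi) (use assms pi_gt_zero in linarith)+
    moreover have "sin (\<alpha> / 3) > 0" by (rule sin_gt_zero) (use assms pi_gt_zero in linarith)+
    ultimately show ?thesis using h by (simp add: add_pos_pos)
  qed
  moreover have "Re (cis \<alpha> * Complex h (- h) ^ 3) > 0"
    by (rule Q) (use h in \<open>simp_all add: power3_eq_cube\<close>)
  moreover have "Re (cis \<alpha> * (sinh (of_real \<rho> * Complex h (- h)) - of_real \<rho> * Complex h (- h))) > 0"
    if "0 < \<rho> \<and> \<rho> \<le> 1" for \<rho>
  proof (rule Q)
    define x where "x = \<rho> * h"
    have x: "0 < x" "x \<le> 3 * pi / 4" using that h mult_right_mono[of \<rho> 1 h] by (auto simp: x_def h_def)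
    have eq: "of_real \<rho> * Complex h (- h) = Complex x (- x)" by (simp add: x_def complex_eq_iff)
    show "Re (sinh (of_real \<rho> * Complex h (- h)) - of_real \<rho> * Complex h (- h)) < 0"
      unfolding eq sinh_Complex using sinh_cos_less[OF x] by simp
    show "Im (sinh (of_real \<rho> * Complex h (- h)) - of_real \<rho> * Complex h (- h)) < 0"
      unfolding eq sinh_Complex using cosh_sin_gt[OF x] by simp
  qed
  moreover have "Re (cis \<alpha> * (sinh (Complex h (- h) + of_real s) - (Complex h (- h) + of_real s))) > 0"
    if "s \<ge> 0" for s
  proof (rule Q)
    define x where "x = h + s"
    have x: "x > 0" "h \<le> x" using that h by (auto simp: x_def)
    have eq: "Complex h (- h) + of_real s = Complex x (- h)" by (simp add: x_def complex_eq_iff)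
    have "sinh x * (sqrt 2 / 2) > 0" using x by simp
    then show "Re (sinh (Complex h (- h) + of_real s) - (Complex h (- h) + of_real s)) < 0"
      unfolding eq sinh_Complex minus_complex.sel complex.sel cos_minus trig mult_minus_right using x by linarith
    show "Im (sinh (Complex h (- h) + of_real s) - (Complex h (- h) + of_real s)) < 0"
      unfolding eq sinh_Complex using cosh_gt_sqrt2[OF x(1)] x by (simp add: trig)
  qed
  moreover have "Re (cis \<alpha> * exp (Complex h (- h))) > 0"
    by (rule Q) (simp_all add: Re_exp Im_exp trig)
  moreover have "\<bar>- h + \<alpha>\<bar> < pi / 2"
    unfolding h_def abs_less_iff using assms pi_gt_zero by linarith
  ultimately show ?thesis by (simp add: descent_base_def h_def[symmetric])
qed

text \<open>The values for the extreme argument \<alpha> = 3 pi/2: start in direction -pi/2, end at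
  height -3 pi/2. On the imaginary piece sinh t - t is i (x - sin x), and on the ray it stays in the
  second quadrant or on the positive imaginary axis, which is what a cosine \<le> 0 and a negative
  sine need.\<close>

lemma descent_base_left:
  assumes "pi < \<alpha>" "\<alpha> \<le> 3 * pi / 2"
  shows "descent_base \<alpha> (Complex 0 (- (3 * pi / 2)))"
proof -
  define h where "h = 3 * pi / 2"
  have h: "h > 0" by (simp add: h_def)
  have trig: "sin h = - 1" "cos h = 0"
  proof -
    have "h = pi + pi / 2" by (simp add: h_def)
    then show "sin h = - 1" "cos h = 0" by (simp_all only: sin_add cos_add) simp_all
  qed
  have "cos (\<alpha> - pi) \<ge> 0" using assms by (intro cos_ge_zero) auto
  then have ca: "cos \<alpha> \<le> 0" by (simp add: cos_diff)
  have "sin (\<alpha> - pi) > 0" using assms by (intro sin_gt_zero) auto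
  then have sa: "sin \<alpha> < 0" by (simp add: sin_diff)
  have Q: "Re (cis \<alpha> * w) > 0" if w: "Re w \<le> 0" "Im w > 0" for w
  proof -
    have "cos \<alpha> * Re w \<ge> 0" "sin \<alpha> * Im w < 0"
      using ca sa w by (auto simp: mult_nonpos_nonpos mult_neg_pos)
    then show ?thesis by simp
  qed
  have "Re (cis (\<alpha> / 3) * Complex 0 (- h)) > 0"
  proof -
    have "sin (\<alpha> / 3) > 0" using assms pi_gt_zero by (intro sin_gt_zero) auto
    then show ?thesis using h by simp
  qed
  moreover have "Re (cis \<alpha> * Complex 0 (- h) ^ 3) > 0"
    by (rule Q) (use h in \<open>simp_all add: power3_eq_cube\<close>)
  moreover have "Re (cis \<alpha> * (sinh (of_real \<rho> * Complex 0 (- h)) - of_real \<rho> * Complex 0 (- h))) > 0"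
    if "0 < \<rho> \<and> \<rho> \<le> 1" for \<rho>
  proof (rule Q)
    define x where "x = \<rho> * h"
    have x: "0 < x" using that h by (auto simp: x_def)
    have eq: "of_real \<rho> * Complex 0 (- h) = Complex 0 (- x)" by (simp add: x_def complex_eq_iff)
    show "Re (sinh (of_real \<rho> * Complex 0 (- h)) - of_real \<rho> * Complex 0 (- h)) \<le> 0"
      unfolding eq sinh_Complex by simp
    show "Im (sinh (of_real \<rho> * Complex 0 (- h)) - of_real \<rho> * Complex 0 (- h)) > 0"
      unfolding eq sinh_Complex using sin_less_self[OF x] by simp
  qed
  moreover have "Re (cis \<alpha> * (sinh (Complex 0 (- h) + of_real s) - (Complex 0 (- h) + of_real s))) > 0"
    if "s \<ge> 0" for s
  proof (rule Q)
    have eq: "Complex 0 (- h) + of_real s = Complex s (- h)" by (simp add: complex_eq_iff)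
    show "Re (sinh (Complex 0 (- h) + of_real s) - (Complex 0 (- h) + of_real s)) \<le> 0"
      unfolding eq sinh_Complex using that by (simp add: trig)
    show "Im (sinh (Complex 0 (- h) + of_real s) - (Complex 0 (- h) + of_real s)) > 0"
      unfolding eq sinh_Complex using h cosh_real_pos[of s] by (simp add: trig add_pos_pos)
  qed
  moreover have "Re (cis \<alpha> * exp (Complex 0 (- h))) > 0"
    by (rule Q) (simp_all add: Re_exp Im_exp trig)
  moreover have "\<bar>- h + \<alpha>\<bar> < pi / 2"
    unfolding h_def abs_less_iff using assms pi_gt_zero by linarith
  ultimately show ?thesis by (simp add: descent_base_def h_def[symmetric])
qed

lemma descent_base_exists:
  assumes "\<bar>\<alpha>\<bar> \<le> 3 * pi / 2"
  shows "\<exists>a. descent_base \<alpha> a"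
proof -
  have *: "\<exists>a. descent_base \<alpha> a" if "0 \<le> \<alpha>" "\<alpha> \<le> 3 * pi / 2" for \<alpha>
    using descent_base_real[of \<alpha>] descent_base_middle[of \<alpha>] descent_base_left[of \<alpha>] that
    by (metis linorder_not_less)
  show ?thesis
  proof (cases "\<alpha> \<ge> 0")
    case True
    then show ?thesis using * assms by simp
  next
    case False
    then obtain a where "descent_base (- \<alpha>) a" using *[of "- \<alpha>"] assms by auto
    from descent_base_cnj[OF this] show ?thesis by auto
  qed
qed

section \<open>Uniformity in the argument of z\<close>

lemma norm_sinh_le: "norm (sinh (w::complex)) \<le> exp (norm w)"
proof -
  have "norm (exp w - exp (- w)) \<le> norm (exp w) + norm (exp (- w))" by (rule norm_triangle_ineq4)
  also have "\<dots> \<le> exp (norm w) + exp (norm w)"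
    using abs_Re_le_cmod[of w] by (intro add_mono) auto
  finally show ?thesis by (simp add: sinh_field_def norm_divide)
qed

text \<open>After division by \<rho>^3 on the segment and by exp s on the ray, the positive
  quantities extend continuously to the two ends, with positive values there by the last conditions
  on the base point. Compactness gives positive minima, which survive a small rotation because the
  quotients are bounded.\<close>

lemma descent_base_uniform:
  assumes "descent_base \<alpha>0 a"
  shows "\<exists>c>0. \<forall>\<^sub>F \<alpha> in nhds \<alpha>0.
     (\<forall>\<rho>\<in>{0..1}. Re (cis \<alpha> * (sinh (of_real \<rho> * a) - of_real \<rho> * a)) \<ge> c * \<rho> ^ 3) \<and>
     (\<forall>s\<ge>0. Re (cis \<alpha> * (sinh (a + of_real s) - (a + of_real s))) \<ge> c * exp s)"
proof -
  note B = assms[unfolded descent_base_def]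
  have cq: "continuous_on A sinh_quot" for A
    by (intro holomorphic_on_imp_continuous_on analytic_imp_holomorphic sinh_quot_analytic)
  \<comment> \<open>The triple zero at 0 is divided out, so that \<rho> = 0 becomes an ordinary
    point of a compact interval.\<close>
  define g where "g = (\<lambda>\<rho>. a ^ 3 * sinh_quot (of_real \<rho> * a))"
  have fg: "sinh (of_real \<rho> * a) - of_real \<rho> * a = of_real (\<rho> ^ 3) * g \<rho>" for \<rho>
    unfolding sinh_minus_eq by (simp add: g_def power_mult_distrib)
  have cg: "continuous_on A g" for A
    unfolding g_def by (intro continuous_intros continuous_on_compose2[OF cq[of UNIV]]) auto
  have gpos: "Re (cis \<alpha>0 * g \<rho>) > 0" if "\<rho> \<in> {0..1}" for \<rho>
  proof (cases "\<rho> = 0")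
    case True
    have "Re (cis \<alpha>0 * g \<rho>) = Re (cis \<alpha>0 * a ^ 3) / 6"
      by (simp add: True g_def sinh_quot_def)
    then show ?thesis using B by simp
  next
    case False
    then have r: "\<rho> > 0" using that by simp
    have "Re (cis \<alpha>0 * (of_real (\<rho> ^ 3) * g \<rho>)) > 0"
      unfolding fg[symmetric] using B r that by auto
    also have "cis \<alpha>0 * (of_real (\<rho> ^ 3) * g \<rho>) = of_real (\<rho> ^ 3) * (cis \<alpha>0 * g \<rho>)" by (simp add: mult_ac)
    finally have "\<rho> ^ 3 * Re (cis \<alpha>0 * g \<rho>) > 0" by (simp only: Re_of_real_mult)
    then show ?thesis using r by (simp add: zero_less_mult_iff)
  qed
  obtain \<rho>1 where \<rho>1: "\<rho>1 \<in> {0..1}" "\<And>\<rho>. \<rho> \<in> {0..1} \<Longrightarrow> Re (cis \<alpha>0 * g \<rho>1) \<le> Re (cis \<alpha>0 * g \<rho>)"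
  proof -
    have "\<exists>x\<in>{0..1::real}. \<forall>y\<in>{0..1}. Re (cis \<alpha>0 * g x) \<le> Re (cis \<alpha>0 * g y)"
      by (rule continuous_attains_inf) (simp, simp, intro continuous_intros cg)
    then show ?thesis using that by blast
  qed
  define c1 where "c1 = Re (cis \<alpha>0 * g \<rho>1)"
  have c1: "c1 > 0" using gpos \<rho>1 by (simp add: c1_def)
  have "compact (g ` {0..1})" by (intro compact_continuous_image cg) auto
  then obtain M1 where M1: "\<And>\<rho>. \<rho> \<in> {0..1} \<Longrightarrow> norm (g \<rho>) \<le> M1"
    by (fastforce dest!: compact_imp_bounded simp: bounded_iff)
  \<comment> \<open>Normalised by exp s, the ray integrand tends to exp a / 2 at infinity.\<close>
  define k where "k = (\<lambda>s::real. (sinh (a + of_real s) - (a + of_real s)) * of_real (exp (- s)))"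
  have fk: "sinh (a + of_real s) - (a + of_real s) = of_real (exp s) * k s" for s
    by (simp add: k_def exp_minus field_simps)
  have ck: "continuous_on A k" for A unfolding k_def sinh_field_def by (intro continuous_intros) auto
  have "k = (\<lambda>s. exp a / 2 - exp (- a) * of_real (exp (- 2 * s)) / 2 - a * of_real (exp (- s)) - of_real (s * exp (- s)))"
  proof
    fix s :: real
    have "exp (a + of_real s) * of_real (exp (- s)) = exp a" "exp (- (a + of_real s)) * of_real (exp (- s)) = exp (- a) * of_real (exp (- 2 * s))"
      unfolding exp_of_real[symmetric] mult_exp_exp by (simp_all add: algebra_simps)
    then show "k s = exp a / 2 - exp (- a) * of_real (exp (- 2 * s)) / 2 - a * of_real (exp (- s)) - of_real (s * exp (- s))"
      unfolding k_def sinh_field_def by (simp only: left_diff_distrib diff_divide_distrib times_divide_eq_left) (simp add: algebra_simps)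
  qed
  moreover have "((\<lambda>s::real. exp a / 2 - exp (- a) * of_real (exp (- 2 * s)) / 2 - a * of_real (exp (- s)) - of_real (s * exp (- s)))
     \<longlongrightarrow> exp a / 2 - exp (- a) * of_real 0 / 2 - a * of_real 0 - of_real 0) at_top"
  proof -
    have "((\<lambda>s::real. exp (- 2 * s)) \<longlongrightarrow> 0) at_top" "((\<lambda>s::real. exp (- s)) \<longlongrightarrow> 0) at_top"
      "((\<lambda>s::real. s * exp (- s)) \<longlongrightarrow> 0) at_top"
      by real_asymp+
    then show ?thesis by (intro tendsto_diff tendsto_mult tendsto_divide tendsto_const tendsto_of_real) auto
  qed
  ultimately have "(k \<longlongrightarrow> exp a / 2) at_top" by simp
  then have klim: "((\<lambda>s. Re (cis \<alpha>0 * k s)) \<longlongrightarrow> Re (cis \<alpha>0 * (exp a / 2))) at_top"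
    by (intro tendsto_intros)
  define l where "l = Re (cis \<alpha>0 * (exp a / 2))"
  have l: "l > 0" using B by (simp add: l_def)
  have "\<forall>\<^sub>F s in at_top. Re (cis \<alpha>0 * k s) > l / 2"
    using klim l by (intro order_tendstoD(1)[OF klim]) (auto simp: l_def)
  then obtain S0 where S0: "\<And>s. s \<ge> S0 \<Longrightarrow> Re (cis \<alpha>0 * k s) > l / 2"
    by (auto simp: eventually_at_top_linorder)
  have kpos: "Re (cis \<alpha>0 * k s) > 0" if "s \<ge> 0" for s
  proof -
    have "Re (cis \<alpha>0 * (of_real (exp s) * k s)) > 0" unfolding fk[symmetric] using B that by auto
    also have "cis \<alpha>0 * (of_real (exp s) * k s) = of_real (exp s) * (cis \<alpha>0 * k s)" by (simp add: mult_ac)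
    finally have "exp s * Re (cis \<alpha>0 * k s) > 0" by (simp only: Re_of_real_mult)
    then show ?thesis by (simp add: zero_less_mult_iff)
  qed
  obtain s1 where s1: "s1 \<in> {0..max 0 S0}" "\<And>s. s \<in> {0..max 0 S0} \<Longrightarrow> Re (cis \<alpha>0 * k s1) \<le> Re (cis \<alpha>0 * k s)"
  proof -
    have "\<exists>x\<in>{0..max 0 S0}. \<forall>y\<in>{0..max 0 S0}. Re (cis \<alpha>0 * k x) \<le> Re (cis \<alpha>0 * k y)"
      by (rule continuous_attains_inf) (simp, simp, intro continuous_intros ck)
    then show ?thesis using that by blast
  qed
  define c2 where "c2 = min (Re (cis \<alpha>0 * k s1)) (l / 2)"
  have c2: "c2 > 0" using kpos s1 l by (simp add: c2_def)
  have kc2: "Re (cis \<alpha>0 * k s) \<ge> c2" if "s \<ge> 0" for s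
    using s1(2)[of s] S0[of s] that by (cases "s \<ge> S0") (auto simp: c2_def min_def)
  define M2 where "M2 = exp (norm a) + norm a + 1"
  have M2: "norm (k s) \<le> M2" if s: "s \<ge> 0" for s
  proof -
    have n: "norm (a + of_real s) \<le> norm a + s" using norm_triangle_ineq[of a "of_real s"] s by simp
    have "norm (sinh (a + of_real s) - (a + of_real s)) \<le> exp (norm (a + of_real s)) + norm (a + of_real s)"
      using norm_sinh_le norm_triangle_ineq4 by (metis add_right_mono order_trans)
    also have "\<dots> \<le> exp (norm a + s) + (norm a + s)" using n by (intro add_mono) auto
    also have "\<dots> \<le> exp (norm a) * exp s + (norm a * exp s + exp s)"
    proof -
      have "norm a * 1 \<le> norm a * exp s" using s by (intro mult_left_mono) auto
      then show ?thesis unfolding exp_add using exp_ge_add_one_self[of s] by linarith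
    qed
    finally have "norm (sinh (a + of_real s) - (a + of_real s)) \<le> M2 * exp s" by (simp add: M2_def algebra_simps)
    moreover have "norm (sinh (a + of_real s) - (a + of_real s)) = exp s * norm (k s)"
      unfolding fk by (simp add: norm_mult)
    ultimately show ?thesis by simp
  qed
  define M where "M = max (max M1 M2) 1"
  have M: "M > 0" by (simp add: M_def)
  \<comment> \<open>Half of the minimum at the central angle; the other half absorbs the change
    caused by replacing the central angle.\<close>
  define c where "c = min c1 c2 / 2"
  have c: "c > 0" using c1 c2 by (simp add: c_def)
  have "((\<lambda>\<alpha>. norm (cis \<alpha> - cis \<alpha>0)) \<longlongrightarrow> norm (cis \<alpha>0 - cis \<alpha>0)) (nhds \<alpha>0)"
    by (intro tendsto_intros filterlim_ident)
  then have "\<forall>\<^sub>F \<alpha> in nhds \<alpha>0. norm (cis \<alpha> - cis \<alpha>0) < c / M"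
    using c by (intro order_tendstoD) (auto simp: M_def)
  then have "\<forall>\<^sub>F \<alpha> in nhds \<alpha>0.
     (\<forall>\<rho>\<in>{0..1}. Re (cis \<alpha> * (sinh (of_real \<rho> * a) - of_real \<rho> * a)) \<ge> c * \<rho> ^ 3) \<and>
     (\<forall>s\<ge>0. Re (cis \<alpha> * (sinh (a + of_real s) - (a + of_real s))) \<ge> c * exp s)"
  proof eventually_elim
    case (elim \<alpha>)
    have key: "Re (cis \<alpha> * (of_real r * w)) \<ge> c * r" if "r \<ge> 0" "norm w \<le> M" "Re (cis \<alpha>0 * w) \<ge> 2 * c" for r w
    proof -
      have "norm ((cis \<alpha> - cis \<alpha>0) * w) \<le> c / M * M"
        unfolding norm_mult using elim that M c by (intro mult_mono) auto
      then have "Re ((cis \<alpha> - cis \<alpha>0) * w) \<ge> - c"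
        using abs_Re_le_cmod[of "(cis \<alpha> - cis \<alpha>0) * w"] M by simp
      moreover have "cis \<alpha> * w = cis \<alpha>0 * w + (cis \<alpha> - cis \<alpha>0) * w" by (simp add: algebra_simps)
      then have "Re (cis \<alpha> * w) = Re (cis \<alpha>0 * w) + Re ((cis \<alpha> - cis \<alpha>0) * w)" by (metis plus_complex.sel(1))
      ultimately have "Re (cis \<alpha> * w) \<ge> c" using that by linarith
      then have "r * Re (cis \<alpha> * w) \<ge> r * c" using that by (intro mult_left_mono)
      moreover have "cis \<alpha> * (of_real r * w) = of_real r * (cis \<alpha> * w)" by (simp add: mult_ac)
      ultimately show ?thesis by (simp only: Re_of_real_mult mult.commute)
    qed
    show ?case
    proof (intro conjI ballI allI impI)
      fix \<rho> :: real assume r: "\<rho> \<in> {0..1}"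
      show "Re (cis \<alpha> * (sinh (of_real \<rho> * a) - of_real \<rho> * a)) \<ge> c * \<rho> ^ 3"
        unfolding fg
      proof (rule key)
        show "norm (g \<rho>) \<le> M" using M1[OF r] by (simp add: M_def)
        show "2 * c \<le> Re (cis \<alpha>0 * g \<rho>)" using \<rho>1(2)[OF r] by (auto simp: c_def c1_def)
      qed (use r in auto)
    next
      fix s :: real assume s: "s \<ge> 0"
      show "Re (cis \<alpha> * (sinh (a + of_real s) - (a + of_real s))) \<ge> c * exp s"
        unfolding fk
      proof (rule key)
        show "norm (k s) \<le> M" using M2[OF s] by (simp add: M_def)
        show "2 * c \<le> Re (cis \<alpha>0 * k s)" using kc2[OF s] by (auto simp: c_def)
      qed auto
    qed
  qed
  then show ?thesis using c by blast
qed

text \<open>The path is cut at a point e = \<rho>0 a inside the disc where the Lagrange expansion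
  holds; the segment before it yields the expansion and the rest is negligible.\<close>

lemma near_A_asymptotic_local:
  assumes "descent_base \<alpha>0 a"
  shows "\<exists>C. \<forall>\<^sub>F \<alpha> in nhds \<alpha>0. \<forall>\<zeta>. Im \<zeta> = \<alpha> \<longrightarrow> Re \<zeta> \<ge> 0 \<longrightarrow>
    norm (near_A \<kappa> \<zeta> - (\<Sum>n<N. near_coeff n \<kappa> / exp (\<zeta> / 3) ^ (n + 1))) \<le> C / exp (Re \<zeta> / 3) ^ (N + 1)"
proof -
  note B = assms[unfolded descent_base_def]
  obtain c where c: "c > 0" and evc: "\<forall>\<^sub>F \<alpha> in nhds \<alpha>0.
     (\<forall>\<rho>\<in>{0..1}. Re (cis \<alpha> * (sinh (of_real \<rho> * a) - of_real \<rho> * a)) \<ge> c * \<rho> ^ 3) \<and>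
     (\<forall>s\<ge>0. Re (cis \<alpha> * (sinh (a + of_real s) - (a + of_real s))) \<ge> c * exp s)"
    using descent_base_uniform[OF assms] by blast
  have a0: "a \<noteq> 0" using B by auto
  obtain Cr where Cr: "\<forall>\<^sub>F t in nhds 0. norm (exp (- (\<kappa> * t)) - (\<Sum>n<N. of_real (6 powr (real (n + 1) / 3)) * B_coeff n (- \<kappa>) * (sinh_cbrt t ^ n * deriv sinh_cbrt t))) \<le> Cr * norm t ^ N"
    using lagrange_expansion(1) by blast
  obtain \<delta> where \<delta>: "\<delta> > 0" and ball: "\<And>t. dist t 0 < \<delta> \<Longrightarrow>
      norm (exp (- (\<kappa> * t)) - (\<Sum>n<N. of_real (6 powr (real (n + 1) / 3)) * B_coeff n (- \<kappa>) * (sinh_cbrt t ^ n * deriv sinh_cbrt t))) \<le> Cr * norm t ^ N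
      \<and> sinh_cbrt analytic_on {t} \<and> sinh_cbrt t ^ 3 = sinh t - t"
    using eventually_conj[OF Cr lagrange_expansion(2)] unfolding eventually_nhds_metric by blast
  have rem: "norm (exp (- (\<kappa> * t)) - (\<Sum>n<N. of_real (6 powr (real (n + 1) / 3)) * B_coeff n (- \<kappa>) * (sinh_cbrt t ^ n * deriv sinh_cbrt t))) \<le> Cr * norm t ^ N"
    if "t \<in> ball 0 \<delta>" for t
    by (rule ball[THEN conjunct1]) (use that in \<open>simp add: dist_commute\<close>)
  have s: "sinh_cbrt analytic_on {t} \<and> sinh_cbrt t ^ 3 = sinh t - t" if "t \<in> ball 0 \<delta>" for t
    by (rule ball[THEN conjunct2]) (use that in \<open>simp add: dist_commute\<close>)
  \<comment> \<open>Since \<open>sinh_cbrt t / t\<close> tends to a positive number, close to 0 the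
    value of \<open>sinh_cbrt\<close> points in the direction of a. This puts u S in the right one
    of the three sectors of positive Re (y^3).\<close>
  have "\<forall>\<^sub>F \<rho> in at_right 0. Re (cis (\<alpha>0 / 3) * sinh_cbrt (of_real \<rho> * a)) > 0"
  proof -
    have "filterlim (\<lambda>\<rho>. of_real \<rho> * a) (at 0) (at_right (0::real))"
    proof (rule filterlim_atI)
      have "((\<lambda>\<rho>. of_real \<rho> * a) \<longlongrightarrow> of_real 0 * a) (at_right (0::real))"
        by (intro tendsto_intros)
      then show "((\<lambda>\<rho>. of_real \<rho> * a) \<longlongrightarrow> 0) (at_right (0::real))" by simp
      have "\<forall>\<^sub>F \<rho> in at_right (0::real). \<rho> > 0" by (rule eventually_at_right_less)
      then show "\<forall>\<^sub>F \<rho> in at_right (0::real). of_real \<rho> * a \<noteq> 0"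
        by eventually_elim (use a0 in simp)
    qed
    then have "((\<lambda>\<rho>. sinh_cbrt (of_real \<rho> * a) / (of_real \<rho> * a)) \<longlongrightarrow> of_real (6 powr (- 1 / 3))) (at_right 0)"
      by (rule filterlim_compose[OF lagrange_expansion(3)])
    then have "((\<lambda>\<rho>. Re (cis (\<alpha>0 / 3) * a * (sinh_cbrt (of_real \<rho> * a) / (of_real \<rho> * a)))) \<longlongrightarrow> Re (cis (\<alpha>0 / 3) * a * of_real (6 powr (- 1 / 3)))) (at_right 0)"
      by (intro tendsto_intros)
    moreover have "Re (cis (\<alpha>0 / 3) * a * of_real (6 powr (- 1 / 3))) > 0"
      using B by (subst mult.commute, subst Re_of_real_mult) (simp del: times_complex.sel)
    ultimately have "\<forall>\<^sub>F \<rho> in at_right 0. Re (cis (\<alpha>0 / 3) * a * (sinh_cbrt (of_real \<rho> * a) / (of_real \<rho> * a))) > 0"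
      by (rule order_tendstoD)
    moreover have "\<forall>\<^sub>F \<rho> in at_right (0::real). \<rho> > 0" by (rule eventually_at_right_less)
    ultimately show ?thesis
    proof eventually_elim
      case (elim \<rho>)
      have "cis (\<alpha>0 / 3) * sinh_cbrt (of_real \<rho> * a) = of_real \<rho> * (cis (\<alpha>0 / 3) * a * (sinh_cbrt (of_real \<rho> * a) / (of_real \<rho> * a)))"
        using a0 elim(2) by simp
      then show ?case using elim by (simp only: Re_of_real_mult) simp
    qed
  qed
  moreover have "\<forall>\<^sub>F \<rho> in at_right 0. \<rho> \<in> {0<..<min 1 (\<delta> / norm a)}"
    by (rule eventually_at_right_real) (use \<delta> a0 in auto)
  ultimately have "\<forall>\<^sub>F \<rho> in at_right 0. Re (cis (\<alpha>0 / 3) * sinh_cbrt (of_real \<rho> * a)) > 0 \<and> \<rho> \<in> {0<..<min 1 (\<delta> / norm a)}"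
    by (rule eventually_conj)
  then obtain \<rho>0 where \<rho>0: "Re (cis (\<alpha>0 / 3) * sinh_cbrt (of_real \<rho>0 * a)) > 0" "\<rho>0 \<in> {0<..<min 1 (\<delta> / norm a)}"
    using eventually_happens'[OF trivial_limit_at_right_real] by blast
  define e where "e = of_real \<rho>0 * a"
  have \<rho>0': "\<rho>0 \<in> {0<..1}" using \<rho>0 by auto
  have e: "e \<in> ball 0 \<delta>" using \<rho>0 a0 by (auto simp: e_def norm_mult field_simps)
  \<comment> \<open>The factor \<rho>0^3 turns a bound in multiples of a into one in multiples of e,
    and makes the cubic lower bound on the tail segment constant.\<close>
  define c' where "c' = c * \<rho>0 ^ 3"
  have c': "c' > 0" "c' \<le> c" using c \<rho>0' by (auto simp: c'_def mult_left_le power_le_one)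
  obtain C1 where C1: "\<forall>\<zeta>. Re \<zeta> \<ge> 0 \<longrightarrow> (\<forall>x\<in>{0..1}. Re (cis (Im \<zeta>) * (sinh (of_real x * e) - of_real x * e)) \<ge> c' * x ^ 3) \<longrightarrow>
      Re (cis (Im \<zeta> / 3) * sinh_cbrt e) > 0 \<longrightarrow>
      norm (contour_integral (linepath 0 e) (near_kernel \<kappa> (exp \<zeta>)) - (\<Sum>n<N. near_coeff n \<kappa> / exp (\<zeta> / 3) ^ (n + 1)))
        \<le> C1 / exp (Re \<zeta> / 3) ^ (N + 1)"
    using near_segment_asymptotic[OF c'(1) s rem e] by (rule exE)
  obtain C2 where C2: "\<forall>\<zeta>. Re \<zeta> \<ge> 0 \<longrightarrow> (\<forall>x\<in>{\<rho>0..1}. Re (cis (Im \<zeta>) * (sinh (of_real x * a) - of_real x * a)) \<ge> c') \<longrightarrow>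
      (\<forall>s\<ge>0. Re (cis (Im \<zeta>) * (sinh (a + of_real s) - (a + of_real s))) \<ge> c' * exp s) \<longrightarrow> \<rho>0 \<in> {0<..1} \<longrightarrow>
      norm (contour_integral (linepath (of_real \<rho>0 * a) a) (near_kernel \<kappa> (exp \<zeta>)) + ray_int (near_kernel \<kappa> (exp \<zeta>)) a)
        \<le> C2 / exp (Re \<zeta> / 3) ^ (N + 1)"
    using near_tail_bound[OF c'(1), of \<rho>0 a \<kappa> N] by (rule exE)
  have "((\<lambda>\<alpha>. Re (cis (\<alpha> / 3) * sinh_cbrt e)) \<longlongrightarrow> Re (cis (\<alpha>0 / 3) * sinh_cbrt e)) (nhds \<alpha>0)"
    by (intro tendsto_intros filterlim_ident) auto
  then have ev1: "\<forall>\<^sub>F \<alpha> in nhds \<alpha>0. Re (cis (\<alpha> / 3) * sinh_cbrt e) > 0"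
    using \<rho>0 by (intro order_tendstoD) (auto simp: e_def)
  have "((\<lambda>\<alpha>. \<bar>Im a + \<alpha>\<bar>) \<longlongrightarrow> \<bar>Im a + \<alpha>0\<bar>) (nhds \<alpha>0)"
    by (intro tendsto_intros filterlim_ident)
  then have ev2: "\<forall>\<^sub>F \<alpha> in nhds \<alpha>0. \<bar>Im a + \<alpha>\<bar> < pi / 2"
    using B by (intro order_tendstoD) auto
  from evc ev1 ev2 have "\<forall>\<^sub>F \<alpha> in nhds \<alpha>0. \<forall>\<zeta>. Im \<zeta> = \<alpha> \<longrightarrow> Re \<zeta> \<ge> 0 \<longrightarrow>
    norm (near_A \<kappa> \<zeta> - (\<Sum>n<N. near_coeff n \<kappa> / exp (\<zeta> / 3) ^ (n + 1))) \<le> (C1 + C2) / exp (Re \<zeta> / 3) ^ (N + 1)"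
  proof eventually_elim
    case (elim \<alpha>)
    show ?case
    proof (intro allI impI)
      fix \<zeta> assume \<zeta>: "Im \<zeta> = \<alpha>" "Re \<zeta> \<ge> 0"
      let ?K = "near_kernel \<kappa> (exp \<zeta>)"
      obtain G where G: "\<And>x. (G has_field_derivative ?K x) (at x)"
        using entire_primitive[OF holomorphic_near_kernel] by blast
      have A: "near_A \<kappa> \<zeta> = contour_integral (linepath 0 e) ?K + (contour_integral (linepath e a) ?K + ray_int ?K a)"
        using near_A_base[of a \<zeta> \<kappa>] elim(3) \<zeta> by (simp add: contour_integral_linepath_primitive[OF G])
      have 1: "norm (contour_integral (linepath 0 e) ?K - (\<Sum>n<N. near_coeff n \<kappa> / exp (\<zeta> / 3) ^ (n + 1))) \<le> C1 / exp (Re \<zeta> / 3) ^ (N + 1)"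
      proof (rule C1[THEN spec, THEN mp, THEN mp, THEN mp])
        show "\<forall>x\<in>{0..1}. Re (cis (Im \<zeta>) * (sinh (of_real x * e) - of_real x * e)) \<ge> c' * x ^ 3"
        proof
          fix x :: real assume x: "x \<in> {0..1}"
          have "x * \<rho>0 \<in> {0..1}" using x \<rho>0' by (auto simp: mult_le_one)
          then have "Re (cis \<alpha> * (sinh (of_real (x * \<rho>0) * a) - of_real (x * \<rho>0) * a)) \<ge> c * (x * \<rho>0) ^ 3"
            using elim(1) by blast
          then show "Re (cis (Im \<zeta>) * (sinh (of_real x * e) - of_real x * e)) \<ge> c' * x ^ 3"
            by (simp add: \<zeta> e_def c'_def power_mult_distrib mult_ac)
        qed
        show "Re (cis (Im \<zeta> / 3) * sinh_cbrt e) > 0" using elim(2) \<zeta> by simp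
      qed (rule \<zeta>(2))
      have 2: "norm (contour_integral (linepath e a) ?K + ray_int ?K a) \<le> C2 / exp (Re \<zeta> / 3) ^ (N + 1)"
        unfolding e_def
      proof (rule C2[THEN spec, THEN mp, THEN mp, THEN mp, THEN mp])
        show "\<forall>x\<in>{\<rho>0..1}. Re (cis (Im \<zeta>) * (sinh (of_real x * a) - of_real x * a)) \<ge> c'"
        proof
          fix x assume x: "x \<in> {\<rho>0..1}"
          have "c' \<le> c * x ^ 3" unfolding c'_def using x \<rho>0' c by (intro mult_left_mono power_mono) auto
          also have "\<dots> \<le> Re (cis \<alpha> * (sinh (of_real x * a) - of_real x * a))" using elim(1) x \<rho>0' by auto
          finally show "Re (cis (Im \<zeta>) * (sinh (of_real x * a) - of_real x * a)) \<ge> c'" by (simp add: \<zeta>)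
        qed
        show "\<forall>s\<ge>0. Re (cis (Im \<zeta>) * (sinh (a + of_real s) - (a + of_real s))) \<ge> c' * exp s"
        proof (intro allI impI)
          fix s :: real assume "s \<ge> 0"
          have "c' * exp s \<le> c * exp s" using c' by (intro mult_right_mono) auto
          also have "\<dots> \<le> Re (cis \<alpha> * (sinh (a + of_real s) - (a + of_real s)))" using elim(1) \<open>s \<ge> 0\<close> by auto
          finally show "Re (cis (Im \<zeta>) * (sinh (a + of_real s) - (a + of_real s))) \<ge> c' * exp s" by (simp add: \<zeta>)
        qed
      qed (rule \<zeta>(2) \<rho>0')+
      have "near_A \<kappa> \<zeta> - (\<Sum>n<N. near_coeff n \<kappa> / exp (\<zeta> / 3) ^ (n + 1)) =
        (contour_integral (linepath 0 e) ?K - (\<Sum>n<N. near_coeff n \<kappa> / exp (\<zeta> / 3) ^ (n + 1))) + (contour_integral (linepath e a) ?K + ray_int ?K a)"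
        unfolding A by simp
      then show "norm (near_A \<kappa> \<zeta> - (\<Sum>n<N. near_coeff n \<kappa> / exp (\<zeta> / 3) ^ (n + 1))) \<le> (C1 + C2) / exp (Re \<zeta> / 3) ^ (N + 1)"
        using norm_triangle_mono[OF 1 2] by (simp only: add_divide_distrib)
    qed
  qed
  then show ?thesis by blast
qed

text \<open>The sum of the moduli over a finite subcover dominates each local constant.\<close>

lemma compact_uniform_constant:
  fixes P :: "real \<Rightarrow> 'a :: topological_space \<Rightarrow> bool"
  assumes K: "compact K" and loc: "\<And>x. x \<in> K \<Longrightarrow> \<exists>C. \<forall>\<^sub>F y in nhds x. P C y"
    and mono: "\<And>C C' y. C \<le> C' \<Longrightarrow> P C y \<Longrightarrow> P C' y"
  shows "\<exists>C. \<forall>y\<in>K. P C y"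
proof -
  have "\<forall>x\<in>K. \<exists>C. \<forall>\<^sub>F y in nhds x. P C y" using loc by simp
  from bchoice[OF this] obtain C where C: "\<And>x. x \<in> K \<Longrightarrow> \<forall>\<^sub>F y in nhds x. P (C x) y" by auto
  have "\<forall>x\<in>K. \<exists>U. open U \<and> x \<in> U \<and> (\<forall>y\<in>U. P (C x) y)"
    using C unfolding eventually_nhds by simp
  from bchoice[OF this] obtain U where U: "\<And>x. x \<in> K \<Longrightarrow> open (U x) \<and> x \<in> U x \<and> (\<forall>y\<in>U x. P (C x) y)" by auto
  obtain T where T: "T \<subseteq> K" "finite T" "K \<subseteq> (\<Union>x\<in>T. U x)"
  proof (rule compactE_image[OF K, of K U])
    show "K \<subseteq> (\<Union>x\<in>K. U x)" using U by auto
  qed (use U in auto)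
  have "P (\<Sum>x\<in>T. \<bar>C x\<bar>) y" if y: "y \<in> K" for y
  proof -
    obtain x where x: "x \<in> T" "y \<in> U x" using T(3) y by auto
    have "C x \<le> \<bar>C x\<bar>" by simp
    also have "\<dots> \<le> (\<Sum>x\<in>T. \<bar>C x\<bar>)" by (rule member_le_sum) (use x T in auto)
    finally show ?thesis
    proof (rule mono)
      have "x \<in> K" using x T by auto
      then show "P (C x) y" using U x(2) by simp
    qed
  qed
  then show ?thesis by (intro exI ballI)
qed

text \<open>The closed sector matters: its two edges carry the boundary integrals of the later
  Cauchy formula.\<close>

lemma near_A_asymptotic:
  "\<exists>C. \<forall>\<zeta>. \<bar>Im \<zeta>\<bar> \<le> 3 * pi / 2 \<longrightarrow> Re \<zeta> \<ge> 0 \<longrightarrow>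
    norm (near_A \<kappa> \<zeta> - (\<Sum>n<N. near_coeff n \<kappa> / exp (\<zeta> / 3) ^ (n + 1))) \<le> C / exp (Re \<zeta> / 3) ^ (N + 1)"
proof -
  define d where "d = (\<lambda>\<zeta>. norm (near_A \<kappa> \<zeta> - (\<Sum>n<N. near_coeff n \<kappa> / exp (\<zeta> / 3) ^ (n + 1))))"
  define P where "P = (\<lambda>C \<alpha>. \<forall>\<zeta>. Im \<zeta> = \<alpha> \<longrightarrow> Re \<zeta> \<ge> 0 \<longrightarrow> d \<zeta> \<le> C / exp (Re \<zeta> / 3) ^ (N + 1))"
  have "\<exists>C. \<forall>\<alpha>\<in>{- (3 * pi / 2)..3 * pi / 2}. P C \<alpha>"
  proof (rule compact_uniform_constant)
    fix \<alpha> assume "\<alpha> \<in> {- (3 * pi / 2)..3 * pi / 2}"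
    then have "\<bar>\<alpha>\<bar> \<le> 3 * pi / 2" by auto
    then obtain a where "descent_base \<alpha> a" using descent_base_exists by auto
    then show "\<exists>C. \<forall>\<^sub>F \<alpha> in nhds \<alpha>. P C \<alpha>"
      unfolding P_def d_def by (rule near_A_asymptotic_local)
  next
    fix C C' :: real and \<alpha> assume C: "C \<le> C'" and P: "P C \<alpha>"
    show "P C' \<alpha>"
      unfolding P_def
    proof (intro allI impI)
      fix \<zeta> assume "Im \<zeta> = \<alpha>" "Re \<zeta> \<ge> 0"
      then have "d \<zeta> \<le> C / exp (Re \<zeta> / 3) ^ (N + 1)" using P by (simp add: P_def)
      also have "\<dots> \<le> C' / exp (Re \<zeta> / 3) ^ (N + 1)" using C by (intro divide_right_mono) auto
      finally show "d \<zeta> \<le> C' / exp (Re \<zeta> / 3) ^ (N + 1)" .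
    qed
  qed auto
  then obtain C where C: "\<And>\<alpha>. \<alpha> \<in> {- (3 * pi / 2)..3 * pi / 2} \<Longrightarrow> P C \<alpha>" by blast
  have "d \<zeta> \<le> C / exp (Re \<zeta> / 3) ^ (N + 1)" if "\<bar>Im \<zeta>\<bar> \<le> 3 * pi / 2" "Re \<zeta> \<ge> 0" for \<zeta>
  proof -
    have "Im \<zeta> \<in> {- (3 * pi / 2)..3 * pi / 2}"
      using that(1) unfolding abs_le_iff atLeastAtMost_iff by linarith
    from C[OF this] that(2) show ?thesis unfolding P_def by blast
  qed
  then show ?thesis unfolding d_def by (intro exI[of _ C] allI impI)
qed

section \<open>The residue theorem in a strip\<close>

text \<open>The segment from 0 to - log z has length about log (1/|z|), and the integrand on it is
  of order |z|^(-|Re \<kappa>|); the ray contributes the same order without the logarithm. Raising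
  the exponent from |Re \<kappa>| to \<sigma> absorbs the logarithm.\<close>

lemma near_A_small:
  assumes \<sigma>: "\<bar>Re \<kappa>\<bar> < \<sigma>"
  shows "\<exists>C. \<forall>\<zeta>. \<bar>Im \<zeta>\<bar> \<le> 3 * pi / 2 \<longrightarrow> Re \<zeta> \<le> 0 \<longrightarrow> norm (near_A \<kappa> \<zeta>) \<le> C * exp (- (\<sigma> * Re \<zeta>))"
proof -
  define k where "k = norm \<kappa>"
  define \<epsilon> where "\<epsilon> = \<sigma> - \<bar>Re \<kappa>\<bar>"
  have \<epsilon>: "\<epsilon> > 0" using \<sigma> by (simp add: \<epsilon>_def)
  define A where "A = exp (7 + 5 * k)"
  define B where "B = exp (7 + 5 * k) * exp (((1 + k) + 1)\<^sup>2 / (2 * (1 / 2)))"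
  have "norm (near_A \<kappa> \<zeta>) \<le> (A * (1 / \<epsilon> + 5) + B) * exp (- (\<sigma> * Re \<zeta>))"
    if \<zeta>: "\<bar>Im \<zeta>\<bar> \<le> 3 * pi / 2" "Re \<zeta> \<le> 0" for \<zeta>
  proof -
    define y where "y = - Re \<zeta>"
    have y: "y \<ge> 0" using \<zeta> by (simp add: y_def)
    \<comment> \<open>The numerical constants below all come from 3 pi/2 < 5.\<close>
    have I5: "\<bar>Im \<zeta>\<bar> \<le> 5" 
  proof -
    have "pi < 33 / 10" using pi_approx by simp
    then show ?thesis using \<zeta>(1) by linarith
  qed
    have n\<zeta>: "norm \<zeta> \<le> y + 5" using cmod_le[of \<zeta>] I5 y by (simp add: y_def)
    define E where "E = exp (\<bar>Re \<kappa>\<bar> * y)"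
    \<comment> \<open>The elementary bound |z| log (1/|z|) \<le> 1: it keeps the term z t harmless
      on paths of logarithmic length.\<close>
    have ey: "exp (Re \<zeta>) * (y + c) \<le> 1 + c" if "c \<ge> 0" for c
    proof -
      have "y + 1 \<le> exp y" using exp_ge_add_one_self[of y] by linarith
      then have "exp (Re \<zeta>) * y \<le> exp (Re \<zeta>) * exp y" by (intro mult_left_mono) auto
      then have "exp (Re \<zeta>) * y \<le> 1" by (simp add: y_def mult_exp_exp)
      moreover have "exp (Re \<zeta>) * c \<le> 1 * c" using \<zeta> that by (intro mult_right_mono) auto
      ultimately show ?thesis by (simp add: algebra_simps)
    qed
    have Re\<kappa>\<zeta>: "\<bar>Re (\<kappa> * \<zeta>)\<bar> \<le> \<bar>Re \<kappa>\<bar> * y + 5 * k"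
    proof -
      have "\<bar>Re (\<kappa> * \<zeta>)\<bar> \<le> \<bar>Re \<kappa> * Re \<zeta>\<bar> + \<bar>Im \<kappa> * Im \<zeta>\<bar>" by simp
      moreover have "\<bar>Re \<kappa> * Re \<zeta>\<bar> = \<bar>Re \<kappa>\<bar> * y" using \<zeta> by (simp add: abs_mult y_def)
      moreover have "\<bar>Im \<kappa> * Im \<zeta>\<bar> \<le> k * 5"
        unfolding abs_mult k_def using I5 abs_Im_le_cmod[of \<kappa>] by (intro mult_mono) auto
      ultimately show ?thesis by linarith
    qed
    let ?K = "near_kernel \<kappa> (exp \<zeta>)"
    have nK: "norm (?K t) = exp (- Re (exp \<zeta> * sinh t) + Re (exp \<zeta> * t) - Re (\<kappa> * t))" for t
      by (simp add: near_kernel_def right_diff_distrib del: times_complex.sel)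
    have nA: "near_A \<kappa> \<zeta> = contour_integral (linepath 0 (- \<zeta>)) ?K + ray_int ?K (- \<zeta>)"
      by (rule near_A_base) simp
    have 1: "norm (contour_integral (linepath 0 (- \<zeta>)) ?K) \<le> (A * E) * norm (- \<zeta> - 0)"
    proof (rule contour_integral_bound_linepath)
      show "?K contour_integrable_on linepath 0 (- \<zeta>)"
        by (intro contour_integrable_continuous_linepath holomorphic_on_imp_continuous_on holomorphic_near_kernel)
      fix t assume "t \<in> closed_segment 0 (- \<zeta>)"
      then obtain x where x: "0 \<le> x" "x \<le> 1" and t: "t = - (of_real x * \<zeta>)"
        by (auto simp: closed_segment_def scaleR_conv_of_real)
      have Ret: "Re t = x * y" by (simp add: t y_def)
      have xy: "x * y \<le> y" "x * y \<ge> 0" using x y by (auto simp: mult_left_le_one_le)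
      have "norm (exp \<zeta> * sinh t) \<le> 1"
      proof -
        have "norm (sinh t) \<le> (norm (exp t) + norm (exp (- t))) / 2"
          unfolding sinh_field_def norm_divide by (simp add: norm_triangle_ineq4 divide_right_mono del: norm_exp_eq_Re)
        also have "\<dots> \<le> (exp y + exp y) / 2" using xy y by (intro divide_right_mono add_mono) (auto simp: Ret)
        finally have "norm (exp \<zeta> * sinh t) \<le> exp (Re \<zeta>) * exp y" by (simp add: norm_mult)
        then show ?thesis by (simp add: y_def mult_exp_exp)
      qed
      moreover have "norm (exp \<zeta> * t) \<le> 6"
      proof -
        have "norm t \<le> 1 * norm \<zeta>" unfolding t norm_minus_cancel norm_mult using x by (intro mult_right_mono) auto
        then have "norm t \<le> y + 5" using n\<zeta> by simp
        then have "norm (exp \<zeta> * t) \<le> exp (Re \<zeta>) * (y + 5)" unfolding norm_mult by (simp add: mult_left_mono)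
        then show ?thesis using ey[of 5] by simp
      qed
      moreover have "- Re (\<kappa> * t) \<le> \<bar>Re \<kappa>\<bar> * y + 5 * k"
      proof -
        have "\<kappa> * t = of_real (- x) * (\<kappa> * \<zeta>)" by (simp add: t)
        then have "- Re (\<kappa> * t) = x * Re (\<kappa> * \<zeta>)" by (simp only: Re_of_real_mult)
        also have "\<dots> \<le> x * \<bar>Re (\<kappa> * \<zeta>)\<bar>" using x by (intro mult_left_mono) auto
        also have "\<dots> \<le> 1 * \<bar>Re (\<kappa> * \<zeta>)\<bar>" using x by (intro mult_right_mono) auto
        finally show ?thesis using Re\<kappa>\<zeta> by linarith
      qed
      ultimately have "- Re (exp \<zeta> * sinh t) + Re (exp \<zeta> * t) - Re (\<kappa> * t) \<le> (7 + 5 * k) + \<bar>Re \<kappa>\<bar> * y"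
        using abs_Re_le_cmod[of "exp \<zeta> * sinh t"] abs_Re_le_cmod[of "exp \<zeta> * t"] by linarith
      then show "norm (?K t) \<le> A * E" unfolding nK A_def E_def mult_exp_exp exp_le_cancel_iff .
    qed (simp add: A_def E_def)
    have 2: "norm (ray_int ?K (- \<zeta>)) \<le> B * E"
    proof (rule norm_ray_int_le)
      fix s :: real assume s: "s \<ge> 0"
      define t where "t = - \<zeta> + of_real s"
      have "- Re (exp \<zeta> * sinh t) \<le> (1 - exp s) / 2"
      proof -
        have "exp (Re \<zeta> - Re t) * cos (Im \<zeta> - Im t) \<le> exp (Re \<zeta> - Re t) * 1"
          by (intro mult_left_mono) auto
        also have "\<dots> \<le> 1" using \<zeta> s by (simp add: t_def)
        finally have "exp (Re \<zeta> - Re t) * cos (Im \<zeta> - Im t) \<le> 1" .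
        moreover have "exp (Re \<zeta> + Re t) = exp s" "cos (Im \<zeta> + Im t) = 1" by (simp_all add: t_def)
        ultimately have "Re (exp \<zeta> * sinh t) \<ge> (exp s * 1 - 1) / 2"
          unfolding Re_exp_mult_sinh by (simp only:) (intro divide_right_mono diff_mono order_refl; simp)
        then show ?thesis by (simp del: times_complex.sel)
      qed
      moreover have "norm (exp \<zeta> * t) \<le> s + 6"
      proof -
        have "norm t \<le> y + (s + 5)" using norm_triangle_ineq[of "- \<zeta>" "of_real s"] n\<zeta> s by (simp add: t_def)
        then have "norm (exp \<zeta> * t) \<le> exp (Re \<zeta>) * (y + (s + 5))" unfolding norm_mult by (simp add: mult_left_mono)
        then show ?thesis using ey[of "s + 5"] s by simp
      qed
      moreover have "- Re (\<kappa> * t) \<le> k * s + (\<bar>Re \<kappa>\<bar> * y + 5 * k)"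
      proof -
        have "\<kappa> * t = \<kappa> * of_real s - \<kappa> * \<zeta>" by (simp add: t_def algebra_simps)
        then have "- Re (\<kappa> * t) = - (Re \<kappa> * s) + Re (\<kappa> * \<zeta>)" by simp
        moreover have "- (Re \<kappa> * s) \<le> k * s"
        proof -
          have "- Re \<kappa> \<le> k" using abs_Re_le_cmod[of \<kappa>] unfolding k_def by linarith
          then have "- Re \<kappa> * s \<le> k * s" using s by (rule mult_right_mono)
          then show ?thesis by simp
        qed
        ultimately show ?thesis using Re\<kappa>\<zeta> by linarith
      qed
      ultimately have "- Re (exp \<zeta> * sinh t) + Re (exp \<zeta> * t) - Re (\<kappa> * t) \<le> (7 + 5 * k) + \<bar>Re \<kappa>\<bar> * y + (- (1 / 2 * exp s) + (1 + k) * s)"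
        using abs_Re_le_cmod[of "exp \<zeta> * t"] by (simp add: algebra_simps del: times_complex.sel)
      then have "norm (?K t) \<le> exp (7 + 5 * k) * E * exp (- (1 / 2 * exp s) + (1 + k) * s)"
        unfolding nK E_def mult_exp_exp exp_le_cancel_iff .
      also have "\<dots> \<le> exp (7 + 5 * k) * E * (exp (((1 + k) + 1)\<^sup>2 / (2 * (1 / 2))) * exp (- s))"
        using s by (intro mult_left_mono exp_neg_exp_le) (auto simp: E_def)
      finally show "norm (?K (- \<zeta> + of_real s)) \<le> B * E * exp (- s)" by (simp add: t_def B_def mult_ac)
    qed
    have EE: "exp (- (\<sigma> * Re \<zeta>)) = E * exp (\<epsilon> * y)"
      by (simp add: E_def mult_exp_exp \<epsilon>_def y_def algebra_simps)
    have e1: "1 \<le> exp (\<epsilon> * y)" using \<epsilon> y by simp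
    have "\<epsilon> * y \<le> exp (\<epsilon> * y)" using exp_ge_add_one_self[of "\<epsilon> * y"] by linarith
    then have y1: "y \<le> 1 / \<epsilon> * exp (\<epsilon> * y)" using \<epsilon> by (simp add: field_simps)
    have "norm \<zeta> \<le> (1 / \<epsilon> + 5) * exp (\<epsilon> * y)"
      unfolding distrib_right using n\<zeta> e1 y1 by linarith
    then have "(A * E) * norm \<zeta> \<le> (A * E) * ((1 / \<epsilon> + 5) * exp (\<epsilon> * y))"
      by (intro mult_left_mono) (auto simp: A_def E_def)
    moreover have "B * E * 1 \<le> B * E * exp (\<epsilon> * y)" using e1 by (intro mult_left_mono) (auto simp: B_def E_def)
    ultimately have "norm (near_A \<kappa> \<zeta>) \<le> (A * E) * ((1 / \<epsilon> + 5) * exp (\<epsilon> * y)) + B * E * exp (\<epsilon> * y)"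
      unfolding nA using 1 2 by (intro order_trans[OF norm_triangle_ineq] add_mono) auto
    then show ?thesis unfolding EE by (simp add: algebra_simps)
  qed
  then show ?thesis by blast
qed

section \<open>Rectangles exhausting the strip\<close>

lemma contour_integral_horizontal:
  assumes h: "continuous_on (closed_segment (Complex p b) (Complex q b)) h" and pq: "p < q"
  shows "contour_integral (linepath (Complex p b) (Complex q b)) h = (LBINT x:{p..q}. h (Complex x b))"
proof -
  have c: "continuous_on {p..q} (\<lambda>x. h (Complex x b))"
  proof (rule continuous_on_compose2[OF h])
    show "continuous_on {p..q} (\<lambda>x. Complex x b)" by (intro continuous_intros)
    show "(\<lambda>x. Complex x b) ` {p..q} \<subseteq> closed_segment (Complex p b) (Complex q b)"
      using pq by (auto simp: closed_segment_same_Im closed_segment_eq_real_ivl)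
  qed
  have "contour_integral (linepath (Complex p b) (Complex q b)) h = contour_integral (linepath (of_real p) (of_real q)) (\<lambda>z. h (z + \<i> * of_real b))"
  proof -
    have "linepath (Complex p b) (Complex q b) x = linepath (of_real p) (of_real q) x + \<i> * of_real b" for x
      by (simp add: linepath_def complex_eq_iff algebra_simps)
    moreover have "Complex q b - Complex p b = of_real q - of_real p" by (simp add: complex_eq_iff)
    ultimately show ?thesis by (simp add: contour_integral_integral)
  qed
  also have "\<dots> = integral {p..q} (\<lambda>x. h (of_real x + \<i> * of_real b))"
    using pq by (subst contour_integral_linepath_Reals_eq) auto
  also have "(\<lambda>x. h (of_real x + \<i> * of_real b)) = (\<lambda>x. h (Complex x b))"
    by (simp add: Complex_eq)
  also have "integral {p..q} (\<lambda>x. h (Complex x b)) = (LBINT x:{p..q}. h (Complex x b))"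
    by (rule set_borel_integral_eq_integral(2)[symmetric]) (rule borel_integrable_atLeastAtMost'[OF c])
  finally show ?thesis .
qed

lemma integrable_exp_decay_line:
  fixes f :: "real \<Rightarrow> complex"
  assumes c: "continuous_on UNIV f" and \<eta>: "\<eta> > 0"
    and bd: "\<And>x. \<bar>x\<bar> \<ge> X0 \<Longrightarrow> norm (f x) \<le> C * exp (- (\<eta> * \<bar>x\<bar>))"
  shows "integrable lborel f"
proof -
  have "compact (f ` {- \<bar>X0\<bar>..\<bar>X0\<bar>})" by (intro compact_continuous_image continuous_on_subset[OF c]) auto
  then obtain B where B: "\<And>x. x \<in> {- \<bar>X0\<bar>..\<bar>X0\<bar>} \<Longrightarrow> norm (f x) \<le> B"
    by (fastforce dest!: compact_imp_bounded simp: bounded_iff)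
  define D where "D = \<bar>C\<bar> + \<bar>B\<bar> * exp (\<eta> * \<bar>X0\<bar>)"
  have bd': "norm (f x) \<le> D * exp (- (\<eta> * \<bar>x\<bar>))" for x
  proof (cases "\<bar>x\<bar> \<ge> X0")
    case True
    have "C * exp (- (\<eta> * \<bar>x\<bar>)) \<le> D * exp (- (\<eta> * \<bar>x\<bar>))" by (intro mult_right_mono) (auto simp: D_def add_increasing2)
    then show ?thesis using bd[OF True] by linarith
  next
    case False
    then have x: "\<bar>x\<bar> \<le> \<bar>X0\<bar>" by linarith
    have "norm (f x) \<le> B" by (rule B) (use x in auto)
    also have "\<dots> \<le> \<bar>B\<bar> * 1" by simp
    also have "\<dots> \<le> \<bar>B\<bar> * (exp (\<eta> * \<bar>X0\<bar>) * exp (- (\<eta> * \<bar>x\<bar>)))"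
      using x \<eta> by (intro mult_left_mono) (auto simp: mult_exp_exp mult_left_mono)
    also have "\<dots> \<le> D * exp (- (\<eta> * \<bar>x\<bar>))" by (simp add: D_def algebra_simps)
    finally show ?thesis .
  qed
  show ?thesis
  proof (rule integrable_line_split(1))
    show "set_integrable lborel {0<..} f"
      by (rule set_integrable_continuous_bound[OF continuous_on_subset[OF c] _ set_integrable_exp_neg_rate[OF \<eta>, of D]])
         (use bd' in auto, metis abs_of_pos bd')
    show "set_integrable lborel {0<..} (\<lambda>x. f (- x))"
    proof (rule set_integrable_continuous_bound[OF _ _ set_integrable_exp_neg_rate[OF \<eta>, of D]])
      show "continuous_on {0<..} (\<lambda>x. f (- x))" by (intro continuous_on_compose2[OF c] continuous_intros) auto
      fix x :: real assume "x \<in> {0<..}"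
      then show "norm (f (- x)) \<le> D * exp (- (\<eta> * x))" using bd'[of "- x"] by simp
    qed auto
  qed
qed

lemma integral_symmetric_tendsto:
  fixes f :: "real \<Rightarrow> complex"
  assumes "integrable lborel f"
  shows "(\<lambda>n. LBINT x:{- real n..real n}. f x) \<longlonglongrightarrow> (LBINT x. f x)"
  unfolding set_lebesgue_integral_def
proof (rule integral_dominated_convergence[where w = "\<lambda>x. norm (f x)"])
  show "AE x in lborel. (\<lambda>n. indicat_real {- real n..real n} x *\<^sub>R f x) \<longlonglongrightarrow> f x"
  proof (rule AE_I2)
    fix x :: real
    obtain n0 where n0: "\<bar>x\<bar> \<le> real n0" using real_arch_simple by blast
    have "\<forall>\<^sub>F n in sequentially. indicat_real {- real n..real n} x *\<^sub>R f x = f x"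
      using n0 by (intro eventually_sequentiallyI[of n0]) (auto simp: indicator_def abs_le_iff)
    then show "(\<lambda>n. indicat_real {- real n..real n} x *\<^sub>R f x) \<longlonglongrightarrow> f x"
      by (rule tendsto_eventually)
  qed
qed (use assms in \<open>auto simp: indicator_def borel_measurable_integrable\<close>)

text \<open>Residue theorem on the rectangles with vertical sides at \<plusminus>n. The sides have
  length pi and a small integrand, so the residue is left to the two edges. The margin \<delta>
  provides an open set around the closed strip.\<close>

lemma strip_residue:
  assumes \<delta>: "\<delta> > 0" and hol: "h holomorphic_on {l. \<bar>Im l\<bar> < pi / 2 + \<delta>} - {p}" and p: "\<bar>Im p\<bar> < pi / 2"
    and \<eta>: "\<eta> > 0" and bd: "\<And>l. \<bar>Im l\<bar> \<le> pi / 2 \<Longrightarrow> \<bar>Re l\<bar> \<ge> X0 \<Longrightarrow> norm (h l) \<le> C * exp (- (\<eta> * \<bar>Re l\<bar>))"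
  shows "integrable lborel (\<lambda>x. h (Complex x (pi / 2)))" "integrable lborel (\<lambda>x. h (Complex x (- (pi / 2))))"
    and "(LBINT x. h (Complex x (- (pi / 2)))) - (LBINT x. h (Complex x (pi / 2))) = 2 * pi * \<i> * residue h p"
proof -
  define S where "S = {l. \<bar>Im l\<bar> < pi / 2 + \<delta>}"
  have SInt: "S = {l. Im l < pi / 2 + \<delta>} \<inter> {l. Im l > - (pi / 2 + \<delta>)}"
    by (auto simp: S_def abs_less_iff)
  have opS: "open S" unfolding SInt by (intro open_Int open_halfspace_Im_lt open_halfspace_Im_gt)
  have cvS: "convex S" unfolding SInt by (intro convex_Int convex_halfspace_Im_lt convex_halfspace_Im_gt)
  have ch: "continuous_on T h" if "T \<subseteq> S - {p}" for T
    using holomorphic_on_imp_continuous_on[OF hol] that continuous_on_subset S_def by blast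
  have int: "integrable lborel (\<lambda>x. h (Complex x b))" if b: "\<bar>b\<bar> = pi / 2" for b
  proof (rule integrable_exp_decay_line[OF _ \<eta>])
    show "continuous_on UNIV (\<lambda>x. h (Complex x b))"
    proof (rule continuous_on_compose2[OF ch])
      show "S - {p} \<subseteq> S - {p}" by simp
      show "range (\<lambda>x. Complex x b) \<subseteq> S - {p}" using b p \<delta> by (auto simp: S_def)
    qed (intro continuous_intros)
    show "norm (h (Complex x b)) \<le> C * exp (- (\<eta> * \<bar>x\<bar>))" if "\<bar>x\<bar> \<ge> X0" for x
      using bd[of "Complex x b"] b that by simp
  qed
  show i1: "integrable lborel (\<lambda>x. h (Complex x (pi / 2)))" and i2: "integrable lborel (\<lambda>x. h (Complex x (- (pi / 2))))"
    by (rule int; simp)+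
  define I where "I = (\<lambda>n. contour_integral (linepath (Complex (real n) (- (pi / 2))) (Complex (real n) (pi / 2))) h
     + contour_integral (linepath (Complex (- real n) (pi / 2)) (Complex (- real n) (- (pi / 2)))) h)"
  obtain n0 :: nat where n0: "real n0 > \<bar>Re p\<bar>" "real n0 > X0" "real n0 > 0"
  proof -
    obtain n0 :: nat where "real n0 > max \<bar>Re p\<bar> (max X0 0)" using reals_Archimedean2 by blast
    then show ?thesis using that by auto
  qed
  have eq: "(LBINT x:{- real n..real n}. h (Complex x (- (pi / 2)))) - (LBINT x:{- real n..real n}. h (Complex x (pi / 2))) + I n = 2 * pi * \<i> * residue h p"
    and Ibd: "norm (I n) \<le> 2 * (C * exp (- (\<eta> * real n)) * pi)" if n: "n \<ge> n0" for n
  proof -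
    have nr: "real n > \<bar>Re p\<bar>" "real n > X0" "real n > 0" using n n0 by (auto simp: less_le_trans)
    define a1 a2 a3 a4 where "a1 = Complex (- real n) (- (pi / 2))" and "a2 = Complex (real n) (- (pi / 2))"
      and "a3 = Complex (real n) (pi / 2)" and "a4 = Complex (- real n) (pi / 2)"
    have rp: "rectpath a1 a3 = linepath a1 a2 +++ linepath a2 a3 +++ linepath a3 a4 +++ linepath a4 a1"
      by (simp add: rectpath_def Let_def a1_def a2_def a3_def a4_def)
    have aS: "a1 \<in> S" "a2 \<in> S" "a3 \<in> S" "a4 \<in> S" using \<delta> by (auto simp: S_def a1_def a2_def a3_def a4_def)
    have seg: "closed_segment a b \<subseteq> S" if "a \<in> S" "b \<in> S" for a b
      using cvS that by (rule closed_segment_subset[rotated 2])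
    have pn: "p \<notin> closed_segment a1 a2" "p \<notin> closed_segment a2 a3" "p \<notin> closed_segment a3 a4" "p \<notin> closed_segment a4 a1" "p \<notin> closed_segment a4 a3"
      using p nr by (auto simp: a1_def a2_def a3_def a4_def closed_segment_same_Im closed_segment_same_Re closed_segment_eq_real_ivl)
    have c: "continuous_on (closed_segment a1 a2) h" "continuous_on (closed_segment a2 a3) h" "continuous_on (closed_segment a3 a4) h"
       "continuous_on (closed_segment a4 a1) h" "continuous_on (closed_segment a4 a3) h"
      using pn seg aS by (auto intro!: ch)
    have img: "path_image (rectpath a1 a3) \<subseteq> S - {p}"
      unfolding rp using pn seg aS by (auto simp: path_image_join)
    have "contour_integral (rectpath a1 a3) h = 2 * pi * \<i> * (\<Sum>q\<in>{p}. winding_number (rectpath a1 a3) q * residue h q)"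
    proof (rule Residue_theorem[OF opS])
      show "connected S" using cvS by (rule convex_connected)
      show "h holomorphic_on S - {p}" using hol by (simp add: S_def)
      show "\<forall>z. z \<notin> S \<longrightarrow> winding_number (rectpath a1 a3) z = 0"
      proof (intro allI impI winding_number_rectpath_outside)
        fix z assume "z \<notin> S"
        then show "z \<notin> cbox a1 a3" using \<delta> by (auto simp: S_def in_cbox_complex_iff a1_def a3_def abs_less_iff)
      qed (auto simp: a1_def a3_def)
    qed (use img in auto)
    also have "winding_number (rectpath a1 a3) p = 1"
      by (rule winding_number_rectpath) (use p nr in \<open>auto simp: in_box_complex_iff a1_def a3_def abs_less_iff\<close>)
    then have "2 * pi * \<i> * (\<Sum>q\<in>{p}. winding_number (rectpath a1 a3) q * residue h q) = 2 * pi * \<i> * residue h p" by simp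
    also have "contour_integral (rectpath a1 a3) h = contour_integral (linepath a1 a2) h + (contour_integral (linepath a2 a3) h + (contour_integral (linepath a3 a4) h + contour_integral (linepath a4 a1) h))"
      unfolding rp using c by (simp add: contour_integrable_continuous_linepath)
    also have "contour_integral (linepath a3 a4) h = - contour_integral (linepath a4 a3) h"
      by (rule contour_integral_reverse_linepath) (rule c)
    also have "contour_integral (linepath a1 a2) h = (LBINT x:{- real n..real n}. h (Complex x (- (pi / 2))))"
      using c nr unfolding a1_def a2_def by (intro contour_integral_horizontal) auto
    also have "contour_integral (linepath a4 a3) h = (LBINT x:{- real n..real n}. h (Complex x (pi / 2)))"
      using c nr unfolding a3_def a4_def by (intro contour_integral_horizontal) auto
    finally show "(LBINT x:{- real n..real n}. h (Complex x (- (pi / 2)))) - (LBINT x:{- real n..real n}. h (Complex x (pi / 2))) + I n = 2 * pi * \<i> * residue h p"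
      by (simp add: I_def a1_def a2_def a3_def a4_def algebra_simps)
    have C: "C * exp (- (\<eta> * real n)) \<ge> 0"
      using bd[of "Complex (real n) 0"] nr norm_ge_zero[of "h (Complex (real n) 0)"] by (simp del: norm_ge_zero)
    have v: "norm (contour_integral (linepath (Complex q b) (Complex q b')) h) \<le> (C * exp (- (\<eta> * real n))) * norm (Complex q b' - Complex q b)"
      if q: "\<bar>q\<bar> = real n" "\<bar>b\<bar> \<le> pi / 2" "\<bar>b'\<bar> \<le> pi / 2" and cc: "continuous_on (closed_segment (Complex q b) (Complex q b')) h" for q b b'
    proof (rule contour_integral_bound_linepath)
      fix x assume "x \<in> closed_segment (Complex q b) (Complex q b')"
      then have "Re x = q" "Im x \<in> closed_segment b b'" by (auto simp: closed_segment_same_Re)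
      moreover have "closed_segment b b' \<subseteq> {- (pi / 2)..pi / 2}"
        using q by (intro closed_segment_subset) (auto simp: abs_le_iff)
      ultimately have "Im x \<in> {- (pi / 2)..pi / 2}" "\<bar>Re x\<bar> = real n" using q by blast+
      then have "\<bar>Im x\<bar> \<le> pi / 2" "\<bar>Re x\<bar> = real n" unfolding abs_le_iff atLeastAtMost_iff by linarith+
      then show "norm (h x) \<le> C * exp (- (\<eta> * real n))" using bd[of x] nr by simp
    qed (use C cc in \<open>auto intro: contour_integrable_continuous_linepath\<close>)
    have d: "norm (Complex q b' - Complex q b) = \<bar>b' - b\<bar>" for q b b'
      using cmod_eq_Im[of "Complex q b' - Complex q b"] by simp
    have "norm (I n) \<le> (C * exp (- (\<eta> * real n))) * pi + (C * exp (- (\<eta> * real n))) * pi"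
      unfolding I_def
    proof (intro norm_triangle_mono)
      show "norm (contour_integral (linepath (Complex (real n) (- (pi / 2))) (Complex (real n) (pi / 2))) h) \<le> C * exp (- (\<eta> * real n)) * pi"
        using v[of "real n" "- (pi / 2)" "pi / 2"] c(2) by (simp add: a2_def a3_def d)
      show "norm (contour_integral (linepath (Complex (- real n) (pi / 2)) (Complex (- real n) (- (pi / 2)))) h) \<le> C * exp (- (\<eta> * real n)) * pi"
        using v[of "- real n" "pi / 2" "- (pi / 2)"] c(4) by (simp add: a1_def a4_def d)
    qed
    then show "norm (I n) \<le> 2 * (C * exp (- (\<eta> * real n)) * pi)" by (simp add: mult_ac)
  qed
  have "I \<longlonglongrightarrow> 0"
  proof (rule Lim_null_comparison)
    show "\<forall>\<^sub>F n in sequentially. norm (I n) \<le> 2 * (C * exp (- (\<eta> * real n)) * pi)"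
      using Ibd by (intro eventually_sequentiallyI)
    show "(\<lambda>n. 2 * (C * exp (- (\<eta> * real n)) * pi)) \<longlonglongrightarrow> 0"
      using \<eta> by real_asymp
  qed
  then have "(\<lambda>n. (LBINT x:{- real n..real n}. h (Complex x (- (pi / 2)))) - (LBINT x:{- real n..real n}. h (Complex x (pi / 2))) + I n)
     \<longlonglongrightarrow> (LBINT x. h (Complex x (- (pi / 2)))) - (LBINT x. h (Complex x (pi / 2))) + 0"
    by (intro tendsto_add tendsto_diff integral_symmetric_tendsto i1 i2)
  moreover have "(\<lambda>n. (LBINT x:{- real n..real n}. h (Complex x (- (pi / 2)))) - (LBINT x:{- real n..real n}. h (Complex x (pi / 2))) + I n)
     \<longlonglongrightarrow> 2 * pi * \<i> * residue h p"
    by (rule tendsto_eventually) (use eq in \<open>intro eventually_sequentiallyI\<close>)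
  ultimately show "(LBINT x. h (Complex x (- (pi / 2)))) - (LBINT x. h (Complex x (pi / 2))) = 2 * pi * \<i> * residue h p"
    using LIMSEQ_unique by fastforce
qed

text \<open>As \<open>B_base\<close> is even, changing the sign of \<kappa> amounts to changing that
  of t, and n derivatives produce (-1)^n.\<close>

lemma B_coeff_minus: "B_coeff n (- \<kappa>) = (- 1) ^ n * B_coeff n \<kappa>"
proof -
  define \<phi> where "\<phi> = (\<lambda>\<kappa> t. exp (\<kappa> * t) * B_base t powr (of_nat (n + 1) / 3))"
  have "isCont sinh_quot 0" using sinh_quot_analytic analytic_at_imp_isCont by blast
  then have "((\<lambda>t. 6 * sinh_quot t) \<longlongrightarrow> 6 * sinh_quot 0) (nhds 0)"
    by (intro tendsto_intros) (simp add: isCont_def tendsto_at_iff_tendsto_nhds)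
  then have "\<forall>\<^sub>F t in nhds 0. 6 * sinh_quot t \<in> {w. Re w > 0}"
    by (rule topological_tendstoD) (auto simp: sinh_quot_def open_halfspace_Re_gt)
  then obtain \<delta> where \<delta>: "\<delta> > 0" "\<And>t. t \<in> ball 0 \<delta> \<Longrightarrow> Re (6 * sinh_quot t) > 0"
    by (auto simp: eventually_nhds_metric dist_commute)
  have B: "B_base t \<notin> \<real>\<^sub>\<le>\<^sub>0" if "t \<in> ball 0 \<delta>" for t
  proof -
    have "Re (inverse (6 * sinh_quot t)) > 0"
      using \<delta>(2)[OF that] unfolding inverse_complex.sel
      by (intro divide_pos_pos add_pos_nonneg) auto
    then show ?thesis by (auto simp: B_base_sinh_quot complex_nonpos_Reals_iff inverse_eq_divide)
  qed
  have hol: "\<phi> \<kappa> holomorphic_on ball 0 \<delta>"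
  proof -
    have "sinh_quot holomorphic_on ball 0 \<delta>" by (intro analytic_imp_holomorphic sinh_quot_analytic)
    then have "B_base holomorphic_on ball 0 \<delta>"
      unfolding B_base_sinh_quot[abs_def] using \<delta>(2) by (intro holomorphic_intros) force+
    then show ?thesis unfolding \<phi>_def using B by (intro holomorphic_intros) auto
  qed
  have "\<phi> (- \<kappa>) = (\<lambda>t. \<phi> \<kappa> (- 1 * t))"
  proof
    fix t
    have "B_base (- 1 * t) = B_base t"
    proof (cases "t = 0")
      case False
      have "(- t) ^ 3 / (sinh (- t) - - t) = t ^ 3 / (sinh t - t)"
      proof -
        have "(- t) ^ 3 = - (t ^ 3)" "sinh (- t) - - t = - (sinh t - t)" by simp_all
        then show ?thesis by (simp only: minus_divide_divide)
      qed
      then show ?thesis using False by (simp add: B_base_def)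
    qed simp
    then show "\<phi> (- \<kappa>) t = \<phi> \<kappa> (- 1 * t)" by (simp add: \<phi>_def)
  qed
  then have "(deriv ^^ n) (\<phi> (- \<kappa>)) 0 = (deriv ^^ n) (\<lambda>t. \<phi> \<kappa> (- 1 * t)) 0" by simp
  also have "\<dots> = (- 1) ^ n * (deriv ^^ n) (\<phi> \<kappa>) (- 1 * 0)"
    by (rule higher_deriv_compose_linear[OF hol, of "ball 0 \<delta>"]) (use \<delta> in auto)
  finally show ?thesis by (simp add: B_coeff_def \<phi>_def)
qed

lemma near_coeff_minus: "near_coeff n (- \<kappa>) = (- 1) ^ n * near_coeff n \<kappa>"
  by (simp add: near_coeff_def B_coeff_minus)

section \<open>The scaled remainder and its Cauchy integrals\<close>

definition near_rest :: "nat \<Rightarrow> complex \<Rightarrow> complex \<Rightarrow> complex" where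
  "near_rest N \<kappa> l = near_A \<kappa> (3 * l) - (\<Sum>n<N. near_coeff n \<kappa> / exp l ^ (n + 1))"

text \<open>The factor z^((N+1)/3) balances both ends of the strip: the remainder becomes bounded as
  z \<rightarrow> \<infinity> and tends to 0 as z \<rightarrow> 0. Against a kernel of order 1/exp l
  at the right end, all integrals converge.\<close>

definition near_scaled :: "nat \<Rightarrow> complex \<Rightarrow> complex \<Rightarrow> complex" where
  "near_scaled N \<kappa> l = exp l ^ (N + 1) * near_rest N \<kappa> l"

lemma holomorphic_near_scaled: "near_scaled N \<kappa> holomorphic_on A"
proof -
  have "near_scaled N \<kappa> holomorphic_on UNIV"
    unfolding near_scaled_def[abs_def] near_rest_def by (intro holomorphic_intros) auto
  then show ?thesis by (rule holomorphic_on_subset) auto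
qed

lemma near_scaled_bound:
  assumes \<kappa>: "\<bar>Re \<kappa>\<bar> < real (N + 1) / 3"
  shows "\<exists>C \<eta>. 0 < \<eta> \<and> \<eta> \<le> 1 \<and> C \<ge> 0 \<and> (\<forall>l. \<bar>Im l\<bar> \<le> pi / 2 \<longrightarrow> norm (near_scaled N \<kappa> l) \<le> C * exp (\<eta> * min (Re l) 0))"
proof -
  define m where "m = real (N + 1) / 3"
  have m: "\<bar>Re \<kappa>\<bar> < m" "3 * m = real (N + 1)" using \<kappa> by (simp_all add: m_def)
  \<comment> \<open>Midway between |Re \<kappa>| and (N + 1)/3, which leaves room both for the
    logarithm near z = 0 and for decay.\<close>
  define \<sigma> where "\<sigma> = (\<bar>Re \<kappa>\<bar> + m) / 2"
  have "\<bar>Re \<kappa>\<bar> < \<sigma>" unfolding \<sigma>_def using m(1) by (simp add: field_simps)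
  moreover have "3 * \<sigma> < real (N + 1)" unfolding m(2)[symmetric] \<sigma>_def using m(1) by (simp add: field_simps)
  ultimately have \<sigma>: "\<bar>Re \<kappa>\<bar> < \<sigma>" "3 * \<sigma> < real (N + 1)" by auto
  \<comment> \<open>The rate is limited by \<open>near_A\<close> to N + 1 - 3\<sigma>, and by 1
    because the last term of the truncated sum, n = N - 1, leaves a single factor exp l.\<close>
  define \<eta> where "\<eta> = min 1 (real (N + 1) - 3 * \<sigma>)"
  have \<eta>: "0 < \<eta>" "\<eta> \<le> 1" "\<eta> \<le> real (N + 1) - 3 * \<sigma>" using \<sigma> by (auto simp: \<eta>_def)
  obtain C1 where C1: "\<forall>\<zeta>. \<bar>Im \<zeta>\<bar> \<le> 3 * pi / 2 \<longrightarrow> Re \<zeta> \<ge> 0 \<longrightarrow>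
    norm (near_A \<kappa> \<zeta> - (\<Sum>n<N. near_coeff n \<kappa> / exp (\<zeta> / 3) ^ (n + 1))) \<le> C1 / exp (Re \<zeta> / 3) ^ (N + 1)"
    using near_A_asymptotic[of \<kappa> N] by (rule exE)
  obtain C2 where C2: "\<forall>\<zeta>. \<bar>Im \<zeta>\<bar> \<le> 3 * pi / 2 \<longrightarrow> Re \<zeta> \<le> 0 \<longrightarrow> norm (near_A \<kappa> \<zeta>) \<le> C2 * exp (- (\<sigma> * Re \<zeta>))"
    using near_A_small[OF \<sigma>(1)] by (rule exE)
  define C where "C = \<bar>C1\<bar> + \<bar>C2\<bar> + (\<Sum>n<N. norm (near_coeff n \<kappa>))"
  have sum0: "(\<Sum>n<N. norm (near_coeff n \<kappa>)) \<ge> 0" by (intro sum_nonneg) auto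
  have "norm (near_scaled N \<kappa> l) \<le> C * exp (\<eta> * min (Re l) 0)" if l: "\<bar>Im l\<bar> \<le> pi / 2" for l
  proof (cases "Re l \<ge> 0")
    case True
    have "norm (near_rest N \<kappa> l) \<le> C1 / exp (Re l) ^ (N + 1)"
      using C1[rule_format, of "3 * l"] l True by (simp add: near_rest_def)
    then have "norm (near_scaled N \<kappa> l) \<le> exp (Re l) ^ (N + 1) * (C1 / exp (Re l) ^ (N + 1))"
      unfolding near_scaled_def norm_mult norm_power norm_exp_eq_Re by (intro mult_left_mono) auto
    then show ?thesis using True sum0 by (simp add: C_def)
  next
    case False
    define x where "x = Re l"
    have x: "x < 0" using False by (simp add: x_def)
    have "norm (near_A \<kappa> (3 * l)) \<le> C2 * exp (- (\<sigma> * (3 * x)))"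
      using C2[rule_format, of "3 * l"] l x by (simp add: x_def)
    then have 1: "norm (exp l ^ (N + 1) * near_A \<kappa> (3 * l)) \<le> \<bar>C2\<bar> * exp (\<eta> * x)"
    proof -
      assume A: "norm (near_A \<kappa> (3 * l)) \<le> C2 * exp (- (\<sigma> * (3 * x)))"
      have "norm (exp l ^ (N + 1) * near_A \<kappa> (3 * l)) = exp x ^ (N + 1) * norm (near_A \<kappa> (3 * l))"
        by (simp add: norm_mult norm_power x_def)
      also have "exp x ^ (N + 1) = exp (real (N + 1) * x)" by (rule exp_of_nat_mult[symmetric])
      also have "exp (real (N + 1) * x) * norm (near_A \<kappa> (3 * l)) \<le> exp (real (N + 1) * x) * (C2 * exp (- (\<sigma> * (3 * x))))"
        using A by (intro mult_left_mono) auto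
      also have "\<dots> = C2 * exp ((real (N + 1) - 3 * \<sigma>) * x)" by (simp add: mult_exp_exp algebra_simps)
      also have "\<dots> \<le> \<bar>C2\<bar> * exp (\<eta> * x)"
        using \<eta>(3) x by (intro mult_mono) (auto simp: mult_right_mono_neg)
      finally show ?thesis .
    qed
    have 2: "norm (exp l ^ (N + 1) * (\<Sum>n<N. near_coeff n \<kappa> / exp l ^ (n + 1))) \<le> (\<Sum>n<N. norm (near_coeff n \<kappa>)) * exp (\<eta> * x)"
      unfolding sum_distrib_left sum_distrib_right
    proof (rule sum_norm_le)
      fix n assume "n \<in> {..<N}"
      then have n: "n < N" by simp
      have "norm (exp l ^ (N + 1) * (near_coeff n \<kappa> / exp l ^ (n + 1))) = norm (near_coeff n \<kappa>) * (exp x ^ (N + 1) / exp x ^ (n + 1))"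
        by (simp add: norm_mult norm_divide norm_power x_def)
      also have "exp x ^ (N + 1) / exp x ^ (n + 1) = exp (real (N - n) * x)"
        using n by (simp add: of_nat_diff exp_diff[symmetric] left_diff_distrib flip: exp_of_nat_mult)
      also have "\<dots> \<le> exp (\<eta> * x)"
        using n \<eta>(2) x by (simp add: mult_right_mono_neg)
      finally show "norm (exp l ^ (N + 1) * (near_coeff n \<kappa> / exp l ^ (n + 1))) \<le> norm (near_coeff n \<kappa>) * exp (\<eta> * x)"
        by (simp add: mult_left_mono)
    qed
    have "norm (near_scaled N \<kappa> l) \<le> \<bar>C2\<bar> * exp (\<eta> * x) + (\<Sum>n<N. norm (near_coeff n \<kappa>)) * exp (\<eta> * x)"
      unfolding near_scaled_def near_rest_def right_diff_distrib
      using 1 2 by (intro order_trans[OF norm_triangle_ineq4] add_mono)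
    also have "\<dots> \<le> C * exp (\<eta> * x)" by (simp add: C_def algebra_simps)
    finally show ?thesis using x by (simp add: x_def)
  qed
  moreover have "C \<ge> 0" using sum0 by (simp add: C_def)
  ultimately show ?thesis using \<eta>(1,2) by (intro exI[of _ C] exI[of _ \<eta>] conjI allI impI)
qed

text \<open>To the right of the pole the kernel decays like exp (- Re l) while F is bounded; to the
  left the kernel is bounded and F decays. X0 keeps |exp l| away from |v| by a factor of 2 on either
  side.\<close>

lemma exp_kernel_bound:
  assumes v: "v \<noteq> 0" and \<eta>: "0 < \<eta>" "\<eta> \<le> 1" and C: "C \<ge> 0"
    and bd: "\<And>l. \<bar>Im l\<bar> \<le> pi / 2 \<Longrightarrow> norm (F l) \<le> C * exp (\<eta> * min (Re l) 0)"
  shows "\<exists>X0 D. \<forall>l. \<bar>Im l\<bar> \<le> pi / 2 \<longrightarrow> \<bar>Re l\<bar> \<ge> X0 \<longrightarrow> norm (F l / (exp l - v)) \<le> D * exp (- (\<eta> * \<bar>Re l\<bar>))"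
proof -
  define W where "W = norm v"
  have W: "W > 0" using v by (simp add: W_def)
  define X0 where "X0 = \<bar>ln (2 * W)\<bar> + \<bar>ln (W / 2)\<bar>"
  define D where "D = 2 * C + C * (2 / W)"
  have "norm (F l / (exp l - v)) \<le> D * exp (- (\<eta> * \<bar>Re l\<bar>))" if l: "\<bar>Im l\<bar> \<le> pi / 2" "\<bar>Re l\<bar> \<ge> X0" for l
  proof (cases "Re l \<ge> 0")
    case True
    then have "Re l \<ge> ln (2 * W)" using l(2) by (simp add: X0_def)
    then have "exp (ln (2 * W)) \<le> exp (Re l)" by (simp only: exp_le_cancel_iff)
    then have "exp (Re l) \<ge> 2 * W" using W by simp
    moreover have "norm (exp l - v) \<ge> exp (Re l) - W" using norm_triangle_ineq2[of "exp l" v] by (simp add: W_def)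
    ultimately have d: "norm (exp l - v) \<ge> exp (Re l) / 2" by simp
    have "norm (F l / (exp l - v)) \<le> C / (exp (Re l) / 2)"
      unfolding norm_divide using d bd[OF l(1)] True C by (intro frac_le) auto
    also have "\<dots> = 2 * C * exp (- (1 * Re l))" by (simp add: exp_minus field_simps)
    also have "\<dots> \<le> D * exp (- (\<eta> * \<bar>Re l\<bar>))"
      using True \<eta> C W by (intro mult_mono) (auto simp: D_def mult_right_mono mult_left_le_one_le)
    finally show ?thesis .
  next
    case False
    then have "Re l \<le> ln (W / 2)" using l(2) by (simp add: X0_def)
    then have "exp (Re l) \<le> exp (ln (W / 2))" by (simp only: exp_le_cancel_iff)
    then have "exp (Re l) \<le> W / 2" using W by simp
    moreover have "norm (exp l - v) \<ge> W - exp (Re l)" using norm_triangle_ineq3[of "exp l" v] by (simp add: W_def)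
    ultimately have d: "norm (exp l - v) \<ge> W / 2" by simp
    have "norm (F l / (exp l - v)) \<le> (C * exp (\<eta> * min (Re l) 0)) / (W / 2)"
      unfolding norm_divide using d bd[OF l(1)] C W by (intro frac_le) auto
    also have "\<dots> = C * (2 / W) * exp (- (\<eta> * \<bar>Re l\<bar>))" using False by (simp add: field_simps)
    also have "\<dots> \<le> D * exp (- (\<eta> * \<bar>Re l\<bar>))"
      using C by (intro mult_right_mono) (auto simp: D_def)
    finally show ?thesis .
  qed
  then show ?thesis by (intro exI[of _ X0] exI[of _ D] allI impI)
qed

text \<open>The rule for simple poles presupposes a numerator that does not vanish at p. If F p = 0,
  the function is written as the difference of the cases F + 1 and 1.\<close>

lemma residue_exp_kernel:
  assumes F: "F holomorphic_on UNIV"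
  shows "residue (\<lambda>l. F l / (exp l - exp p)) p = F p / exp p"
proof -
  have der: "((\<lambda>l. exp l - exp p) has_field_derivative exp p) (at p)"
    by (auto intro!: derivative_eq_intros)
  have res: "residue (\<lambda>l. G l / (exp l - exp p)) p = G p / exp p" if "G holomorphic_on UNIV" "G p \<noteq> 0" for G
    by (rule residue_simple_pole_deriv[where s = UNIV]) (use that der in \<open>auto intro!: holomorphic_intros\<close>)
  show ?thesis
  proof (cases "F p = 0")
    case False
    then show ?thesis by (rule res[OF F])
  next
    case True
    have hol: "G holomorphic_on UNIV \<Longrightarrow> (\<lambda>l. G l / (exp l - exp p)) holomorphic_on ball p 1 - {p}" for G
    proof -
      assume "G holomorphic_on UNIV"
      then have "G holomorphic_on ball p 1 - {p}" by (rule holomorphic_on_subset) auto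
      moreover have "exp l - exp p \<noteq> 0" if l: "l \<in> ball p 1 - {p}" for l
      proof
        assume "exp l - exp p = 0"
        then obtain k :: int where k: "l = p + (of_int (2 * k) * pi) * \<i>" by (auto simp: exp_eq)
        then have "norm (l - p) = \<bar>of_int (2 * k) * pi\<bar>" by (simp add: norm_mult abs_mult)
        moreover have "norm (l - p) < 1" using l by (simp add: dist_norm norm_minus_commute)
        moreover have "k \<noteq> 0" using l k by auto
        then have "\<bar>of_int (2 * k) * pi\<bar> \<ge> 2 * 1"
          unfolding abs_mult using pi_gt3 by (intro mult_mono) auto
        ultimately show False by simp
      qed
      ultimately show ?thesis by (intro holomorphic_intros) auto
    qed
    have 1: "(\<lambda>l. F l + 1) holomorphic_on UNIV" "(\<lambda>l. 1 :: complex) holomorphic_on UNIV"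
      using F by (auto intro!: holomorphic_intros)
    have "residue (\<lambda>l. (F l + 1) / (exp l - exp p) - 1 / (exp l - exp p)) p =
       residue (\<lambda>l. (F l + 1) / (exp l - exp p)) p - residue (\<lambda>l. 1 / (exp l - exp p)) p"
      by (rule residue_diff[of "ball p 1"]) (auto intro!: hol 1)
    also have "\<dots> = 0" using res[OF 1(1)] res[OF 1(2)] True by simp
    finally show ?thesis by (simp add: True diff_divide_distrib[symmetric])
  qed
qed

text \<open>The strip is widened by the distance from p to its edges. Then Im l and Im p differ by
  less than pi, which rules out the 2 pi i translates of p and the solutions of exp l = - exp
  p.\<close>

lemma exp_ne_in_strip:
  assumes "\<bar>Im p\<bar> < pi / 2" "\<bar>Im l\<bar> < pi / 2 + (pi / 2 - \<bar>Im p\<bar>)"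
  shows "l \<noteq> p \<Longrightarrow> exp l \<noteq> exp p" "exp l \<noteq> - exp p"
proof -
  show "exp l \<noteq> exp p" if "l \<noteq> p"
  proof
    assume "exp l = exp p"
    then obtain k :: int where k: "l = p + (of_int (2 * k) * pi) * \<i>" by (auto simp: exp_eq)
    then have "Im l - Im p = of_int (2 * k) * pi" by simp
    moreover have "\<bar>Im l - Im p\<bar> < pi" using assms by linarith
    ultimately have "\<bar>of_int (2 * k)\<bar> * pi < 1 * pi" by (simp add: abs_mult)
    then have "\<bar>of_int (2 * k) :: real\<bar> < 1" by (simp only: mult_less_cancel_right_pos[OF pi_gt_zero])
    then have "k = 0" by linarith
    then show False using k that by simp
  qed
  show "exp l \<noteq> - exp p"
  proof
    assume "exp l = - exp p"
    then have "exp l = exp (p + \<i> * pi)" by (simp add: exp_add)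
    then obtain k :: int where k: "l = p + \<i> * pi + (of_int (2 * k) * pi) * \<i>" by (auto simp: exp_eq)
    then have "Im l = Im p + of_int (2 * k + 1) * pi" by (simp add: algebra_simps)
    moreover have "1 \<le> \<bar>2 * k + 1\<bar>" by presburger
    then have "\<bar>of_int (2 * k + 1) :: real\<bar> \<ge> 1" by (metis of_int_1_le_iff of_int_abs)
    then have "\<bar>of_int (2 * k + 1)\<bar> * pi \<ge> 1 * pi" by (intro mult_right_mono) auto
    then have "\<bar>of_int (2 * k + 1) * pi\<bar> \<ge> pi" by (simp add: abs_mult)
    ultimately show False using assms by linarith
  qed
qed

lemma near_scaled_cauchy:
  assumes \<kappa>: "\<bar>Re \<kappa>\<bar> < real (N + 1) / 3" and p: "\<bar>Im p\<bar> < pi / 2"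
  defines "w \<equiv> exp p"
  shows "integrable lborel (\<lambda>x. near_scaled N \<kappa> (Complex x (pi / 2)) / (exp (Complex x (pi / 2)) - w))"
    and "integrable lborel (\<lambda>x. near_scaled N \<kappa> (Complex x (- (pi / 2))) / (exp (Complex x (- (pi / 2))) - w))"
    and "(LBINT x. near_scaled N \<kappa> (Complex x (- (pi / 2))) / (exp (Complex x (- (pi / 2))) - w))
        - (LBINT x. near_scaled N \<kappa> (Complex x (pi / 2)) / (exp (Complex x (pi / 2)) - w)) = 2 * pi * \<i> * (near_scaled N \<kappa> p / w)"
    and "integrable lborel (\<lambda>x. near_scaled N \<kappa> (Complex x (pi / 2)) / (exp (Complex x (pi / 2)) + w))"
    and "integrable lborel (\<lambda>x. near_scaled N \<kappa> (Complex x (- (pi / 2))) / (exp (Complex x (- (pi / 2))) + w))"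
    and "(LBINT x. near_scaled N \<kappa> (Complex x (- (pi / 2))) / (exp (Complex x (- (pi / 2))) + w))
        - (LBINT x. near_scaled N \<kappa> (Complex x (pi / 2)) / (exp (Complex x (pi / 2)) + w)) = 0"
proof -
  obtain C \<eta> where C0: "0 < \<eta> \<and> \<eta> \<le> 1 \<and> C \<ge> 0 \<and> (\<forall>l. \<bar>Im l\<bar> \<le> pi / 2 \<longrightarrow> norm (near_scaled N \<kappa> l) \<le> C * exp (\<eta> * min (Re l) 0))"
    using near_scaled_bound[OF \<kappa>] by (elim exE)
  have C: "0 < \<eta>" "\<eta> \<le> 1" "C \<ge> 0" using C0 by auto
  have bd: "norm (near_scaled N \<kappa> l) \<le> C * exp (\<eta> * min (Re l) 0)" if "\<bar>Im l\<bar> \<le> pi / 2" for l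
    using C0[THEN conjunct2, THEN conjunct2, THEN conjunct2, rule_format, OF that] .
  have ex: "\<exists>X0 D. \<forall>l. \<bar>Im l\<bar> \<le> pi / 2 \<longrightarrow> \<bar>Re l\<bar> \<ge> X0 \<longrightarrow> norm (near_scaled N \<kappa> l / (exp l - v)) \<le> D * exp (- (\<eta> * \<bar>Re l\<bar>))"
    if "v \<noteq> 0" for v
    by (rule exp_kernel_bound[OF that C bd])
  define \<delta> where "\<delta> = pi / 2 - \<bar>Im p\<bar>"
  have \<delta>: "\<delta> > 0" using p by (simp add: \<delta>_def)
  have w0: "w \<noteq> 0" "- w \<noteq> 0" by (auto simp: w_def)
  obtain X1 D1 where 1: "\<forall>l. \<bar>Im l\<bar> \<le> pi / 2 \<longrightarrow> \<bar>Re l\<bar> \<ge> X1 \<longrightarrow> norm (near_scaled N \<kappa> l / (exp l - w)) \<le> D1 * exp (- (\<eta> * \<bar>Re l\<bar>))"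
    using ex[OF w0(1)] by (elim exE)
  obtain X2 D2 where 2: "\<forall>l. \<bar>Im l\<bar> \<le> pi / 2 \<longrightarrow> \<bar>Re l\<bar> \<ge> X2 \<longrightarrow> norm (near_scaled N \<kappa> l / (exp l - - w)) \<le> D2 * exp (- (\<eta> * \<bar>Re l\<bar>))"
    using ex[OF w0(2)] by (elim exE)
  have h1: "(\<lambda>l. near_scaled N \<kappa> l / (exp l - w)) holomorphic_on {l. \<bar>Im l\<bar> < pi / 2 + \<delta>} - {p}"
    using exp_ne_in_strip(1)[OF p] by (intro holomorphic_intros holomorphic_near_scaled) (auto simp: \<delta>_def w_def)
  have h2: "(\<lambda>l. near_scaled N \<kappa> l / (exp l - - w)) holomorphic_on {l. \<bar>Im l\<bar> < pi / 2 + \<delta>}"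
    using exp_ne_in_strip(2)[OF p] by (intro holomorphic_intros holomorphic_near_scaled) (auto simp: \<delta>_def w_def add_eq_0_iff2)
  have h2': "(\<lambda>l. near_scaled N \<kappa> l / (exp l - - w)) holomorphic_on {l. \<bar>Im l\<bar> < pi / 2 + \<delta>} - {p}"
    using h2 by (rule holomorphic_on_subset) auto
  note A = strip_residue[OF \<delta> h1 p C(1) 1[rule_format]]
  note B = strip_residue[OF \<delta> h2' p C(1) 2[rule_format]]
  have r1: "residue (\<lambda>l. near_scaled N \<kappa> l / (exp l - w)) p = near_scaled N \<kappa> p / w"
    unfolding w_def by (rule residue_exp_kernel) (rule holomorphic_near_scaled)
  have r2: "residue (\<lambda>l. near_scaled N \<kappa> l / (exp l - - w)) p = 0"
  proof (rule residue_holo[OF _ _ holomorphic_on_subset[OF h2]])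
    show "open (ball p \<delta>)" "p \<in> ball p \<delta>" using \<delta> by auto
    show "ball p \<delta> \<subseteq> {l. \<bar>Im l\<bar> < pi / 2 + \<delta>}"
    proof
      fix l assume "l \<in> ball p \<delta>"
      then have "\<bar>Im (l - p)\<bar> < \<delta>" using abs_Im_le_cmod[of "l - p"] by (simp add: dist_norm norm_minus_commute)
      then show "l \<in> {l. \<bar>Im l\<bar> < pi / 2 + \<delta>}" using p by simp
    qed
  qed
  show "integrable lborel (\<lambda>x. near_scaled N \<kappa> (Complex x (pi / 2)) / (exp (Complex x (pi / 2)) - w))"
    by (rule A(1))
  show "integrable lborel (\<lambda>x. near_scaled N \<kappa> (Complex x (- (pi / 2))) / (exp (Complex x (- (pi / 2))) - w))"
    by (rule A(2))
  show "(LBINT x. near_scaled N \<kappa> (Complex x (- (pi / 2))) / (exp (Complex x (- (pi / 2))) - w))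
        - (LBINT x. near_scaled N \<kappa> (Complex x (pi / 2)) / (exp (Complex x (pi / 2)) - w)) = 2 * pi * \<i> * (near_scaled N \<kappa> p / w)"
    using A(3) unfolding r1 .
  show "integrable lborel (\<lambda>x. near_scaled N \<kappa> (Complex x (pi / 2)) / (exp (Complex x (pi / 2)) + w))"
    "integrable lborel (\<lambda>x. near_scaled N \<kappa> (Complex x (- (pi / 2))) / (exp (Complex x (- (pi / 2))) + w))"
    using B(1,2) by simp_all
  show "(LBINT x. near_scaled N \<kappa> (Complex x (- (pi / 2))) / (exp (Complex x (- (pi / 2))) + w))
        - (LBINT x. near_scaled N \<kappa> (Complex x (pi / 2)) / (exp (Complex x (pi / 2)) + w)) = 0"
    using B(3) unfolding r2 by simp
qed

section \<open>Boundary values and the exact remainder\<close>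

text \<open>The jump formula writes the Hankel values as a quotient of entire functions of log t, so
  no separate study of the order and argument dependence is required.\<close>

lemma continuous_on_hankel_it: "continuous_on {0<..} (\<lambda>t. hankel_it t \<kappa>)"
proof -
  have c: "continuous_on UNIV (near_A \<kappa>)" for \<kappa>
    by (intro holomorphic_on_imp_continuous_on holomorphic_near_A[of "\<lambda>w. w"] holomorphic_intros)
  define F where "F = (\<lambda>t::real. (near_A \<kappa> (of_real (ln t) + \<i> * (3 * pi / 2)) + near_A (- \<kappa>) (of_real (ln t) - \<i> * (3 * pi / 2)))
     / (pi * \<i> * exp (2 * pi * \<i> * \<kappa>) * exp (- 2 * pi * t)))"
  have "continuous_on {0<..} F"
    unfolding F_def by (intro continuous_intros continuous_on_compose2[OF c]) auto
  moreover have "F t = hankel_it t \<kappa>" if "t \<in> {0<..}" for t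
    unfolding F_def using near_A_jump[of t \<kappa>] that by simp
  ultimately show ?thesis by (rule continuous_on_eq)
qed

text \<open>Here w is z^(1/3). The value s = 1 combines the upper edge for \<kappa> with the lower
  edge for -\<kappa>, and s = -1 the other two edges; the singular point of the kernel is at w = s i
  t^(1/3).\<close>

definition jump_integrand :: "complex \<Rightarrow> nat \<Rightarrow> complex \<Rightarrow> complex \<Rightarrow> real \<Rightarrow> complex" where
  "jump_integrand s N \<kappa> w t = of_real (t powr ((real N - 2) / 3) * exp (- 2 * pi * t)) * hankel_it t (s * \<kappa>) /
     (1 - s * \<i> * of_real (t powr (1 / 3)) / w)"

lemma jump_denominator_nonzero:
  assumes "s = 1 \<or> s = (- 1 :: complex)" "Re w > 0"
  shows "1 - s * \<i> * of_real r / w \<noteq> 0"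
proof
  assume "1 - s * \<i> * of_real r / w = 0"
  moreover have "w \<noteq> 0" using assms(2) by auto
  ultimately have "w = s * \<i> * of_real r" by (simp add: field_simps)
  then show False using assms by auto
qed

text \<open>The substitution is t = exp (3x), since the edge point is exp l = s i t^(1/3). The three
  factors exp x of dt and the exponent (N - 2)/3 make up the power N + 1.\<close>

lemma jump_substitution:
  fixes s \<kappa> w :: complex and N :: nat
  defines "J \<equiv> \<lambda>x::real. (s * \<i> * of_real (exp x)) ^ (N + 1) *
     (near_A (s * \<kappa>) (of_real (3 * x) + \<i> * (3 * pi / 2)) + near_A (- (s * \<kappa>)) (of_real (3 * x) - \<i> * (3 * pi / 2)))
       / (w - s * \<i> * of_real (exp x))"
  assumes s: "s = 1 \<or> s = - 1" and w: "Re w > 0" and int: "integrable lborel J"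
  shows "set_integrable lborel {0<..} (jump_integrand s N \<kappa> w)"
    and "(LBINT x. J x) = ((s * \<i>) ^ (N + 1) * (pi * \<i> * exp (2 * pi * \<i> * (s * \<kappa>))) / (3 * w)) *
      (LBINT t:{0<..}. jump_integrand s N \<kappa> w t)"
proof -
  define K where "K = (s * \<i>) ^ (N + 1) * (pi * \<i> * exp (2 * pi * \<i> * (s * \<kappa>))) / (3 * w)"
  have w0: "w \<noteq> 0" using w by auto
  have K0: "K \<noteq> 0" using s w0 by (auto simp: K_def)
  have eq: "(3 * exp (3 * x)) *\<^sub>R jump_integrand s N \<kappa> w (exp (3 * x)) = J x / K" for x
  proof -
    define e where "e = complex_of_real (exp x)"
    define H where "H = exp (- 2 * pi * exp (3 * x)) * hankel_it (exp (3 * x)) (s * \<kappa>)"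
    have p1: "exp (3 * x) powr (1 / 3) = exp x" by (simp add: powr_def)
    have "exp (3 * x) * exp (3 * x) powr ((real N - 2) / 3) = exp (3 * x + (real N - 2) * x)"
      by (simp add: powr_def exp_add)
    also have "3 * x + (real N - 2) * x = real (N + 1) * x" by (simp add: algebra_simps)
    also have "exp (real (N + 1) * x) = exp x ^ (N + 1)" by (rule exp_of_nat_mult)
    finally have p2: "exp (3 * x) * exp (3 * x) powr ((real N - 2) / 3) = exp x ^ (N + 1)" .
    have d: "w - s * \<i> * e = w * (1 - s * \<i> * e / w)" using w0 by (simp add: right_diff_distrib)
    have d0: "1 - s * \<i> * e / w \<noteq> 0" unfolding e_def by (rule jump_denominator_nonzero[OF s w])
    have "(3 * exp (3 * x)) *\<^sub>R jump_integrand s N \<kappa> w (exp (3 * x)) =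
       3 * of_real (exp (3 * x) * exp (3 * x) powr ((real N - 2) / 3)) * H / (1 - s * \<i> * e / w)"
      unfolding jump_integrand_def p1 by (simp add: H_def e_def scaleR_conv_of_real mult_ac)
    also have "\<dots> = 3 * e ^ (N + 1) * H / (1 - s * \<i> * e / w)"
      unfolding p2 by (simp add: e_def)
    finally have 1: "(3 * exp (3 * x)) *\<^sub>R jump_integrand s N \<kappa> w (exp (3 * x)) = 3 * e ^ (N + 1) * H / (1 - s * \<i> * e / w)" .
    have "J x = (s * \<i> * e) ^ (N + 1) * (pi * \<i> * exp (2 * pi * \<i> * (s * \<kappa>)) * H) / (w - s * \<i> * e)"
      using near_A_jump[of "exp (3 * x)" "s * \<kappa>"] by (simp add: J_def e_def H_def mult_ac)
    also have "\<dots> = K * (3 * e ^ (N + 1) * H / (1 - s * \<i> * e / w))"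
      unfolding d K_def power_mult_distrib using w0 d0 by (simp add: divide_simps)
    finally show ?thesis unfolding 1 using K0 by simp
  qed
  have c: "continuous_on {0<..} (jump_integrand s N \<kappa> w)"
  proof -
    have "1 - s * \<i> * of_real r / w \<noteq> 0" for r by (rule jump_denominator_nonzero[OF s w])
    then show ?thesis unfolding jump_integrand_def
      by (intro continuous_intros continuous_on_hankel_it) (auto simp: w0)
  qed
  have i: "integrable lborel (\<lambda>x. (3 * exp (3 * x)) *\<^sub>R jump_integrand s N \<kappa> w (exp (3 * x)))"
    unfolding eq using int by simp
  show "set_integrable lborel {0<..} (jump_integrand s N \<kappa> w)"
    by (rule integral_exp_substitution(1)[OF _ c i]) simp
  have "(LBINT t:{0<..}. jump_integrand s N \<kappa> w t) = (LBINT x. J x / K)"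
    unfolding eq[symmetric] by (rule integral_exp_substitution(2)[OF _ c i]) simp
  then show "(LBINT x. J x) = ((s * \<i>) ^ (N + 1) * (pi * \<i> * exp (2 * pi * \<i> * (s * \<kappa>))) / (3 * w)) *
      (LBINT t:{0<..}. jump_integrand s N \<kappa> w t)"
    unfolding K_def[symmetric] using K0 by simp
qed

text \<open>On opposite edges exp l takes the values u and -u, so the kernels with -w and +w have
  denominators that agree up to sign. By parity of the coefficients the two truncated sums cancel,
  leaving the bare sum X + Y.\<close>

lemma near_jump_algebra:
  assumes u: "u \<noteq> 0"
  shows "u ^ (N + 1) * (X + Y) / (w - u) =
    - (u ^ (N + 1) * (X - (\<Sum>n<N. near_coeff n \<kappa> / u ^ (n + 1))) / (u - w)) +
    (- 1) ^ (N + 1) * ((- u) ^ (N + 1) * (Y - (\<Sum>n<N. near_coeff n (- \<kappa>) / (- u) ^ (n + 1))) / (- u + w))"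
proof -
  define S where "S = (\<Sum>n<N. near_coeff n \<kappa> / u ^ (n + 1))"
  have "near_coeff n (- \<kappa>) / (- u) ^ (n + 1) = - (near_coeff n \<kappa> / u ^ (n + 1))" for n
    unfolding near_coeff_minus power_minus[of u] by (simp add: divide_simps)
  then have "(\<Sum>n<N. near_coeff n (- \<kappa>) / (- u) ^ (n + 1)) = - S" by (simp add: S_def sum_negf)
  moreover have "(- 1) ^ (N + 1) * ((- u) ^ (N + 1) * Z / (- u + w)) = u ^ (N + 1) * Z / (w - u)" for Z
    unfolding power_minus[of u] by (simp del: power_Suc add: mult.assoc[symmetric] power_mult_distrib[symmetric])
  moreover have "- (u ^ (N + 1) * Z / (u - w)) = u ^ (N + 1) * Z / (w - u)" for Z
    by (metis minus_diff_eq minus_divide_right)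
  ultimately show ?thesis
    unfolding S_def[symmetric] by (simp only: add_divide_distrib[symmetric] distrib_left[symmetric]) simp
qed

text \<open>Cauchy's formula for \<kappa> reproduces the value at p; that for -\<kappa> gives 0 and
  is added with the sign (-1)^(N+1), which completes each boundary value of the first to a sum given
  by the jump formula.\<close>

lemma near_A_representation:
  assumes \<kappa>: "\<bar>Re \<kappa>\<bar> < real (N + 1) / 3" and p: "\<bar>Im p\<bar> < pi / 2"
  shows "set_integrable lborel {0<..} (jump_integrand 1 N \<kappa> (exp p))"
    and "set_integrable lborel {0<..} (jump_integrand (- 1) N \<kappa> (exp p))"
    and "near_A \<kappa> (3 * p) = (\<Sum>n<N. near_coeff n \<kappa> / exp p ^ (n + 1)) + \<i> / (6 * exp p ^ (N + 1)) *
      (\<i> ^ N * exp (2 * pi * \<i> * \<kappa>) * (LBINT t:{0<..}. jump_integrand 1 N \<kappa> (exp p) t) +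
       (- \<i>) ^ N * exp (- (2 * pi * \<i> * \<kappa>)) * (LBINT t:{0<..}. jump_integrand (- 1) N \<kappa> (exp p) t))"
proof -
  define w where "w = exp p"
  have w0: "w \<noteq> 0" by (simp add: w_def)
  have Rw: "Re w > 0" using p by (auto simp: w_def Re_exp intro!: mult_pos_pos cos_gt_zero_pi)
  have \<kappa>': "\<bar>Re (- \<kappa>)\<bar> < real (N + 1) / 3" using \<kappa> by simp
  note A = near_scaled_cauchy[OF \<kappa> p, folded w_def]
  note B = near_scaled_cauchy[OF \<kappa>' p, folded w_def]
  define u where "u = (\<lambda>x. \<i> * of_real (exp x))"
  have u0: "u x \<noteq> 0" for x by (simp add: u_def)
  have eu: "exp (Complex x (pi / 2)) = u x" "exp (Complex x (- (pi / 2))) = - u x" for x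
    by (simp_all add: u_def exp_eq_polar complex_eq_iff)
  define T L where "T = (\<lambda>\<kappa> x. near_A \<kappa> (of_real (3 * x) + \<i> * (3 * pi / 2)))"
    and "L = (\<lambda>\<kappa> x. near_A \<kappa> (of_real (3 * x) - \<i> * (3 * pi / 2)))"
  have "3 * Complex x (pi / 2) = of_real (3 * x) + \<i> * (3 * pi / 2)" "3 * Complex x (- (pi / 2)) = of_real (3 * x) - \<i> * (3 * pi / 2)" for x
    by (simp_all add: complex_eq_iff)
  then have P: "near_scaled N \<kappa> (Complex x (pi / 2)) = u x ^ (N + 1) * (T \<kappa> x - (\<Sum>n<N. near_coeff n \<kappa> / u x ^ (n + 1)))"
    and M: "near_scaled N \<kappa> (Complex x (- (pi / 2))) = (- u x) ^ (N + 1) * (L \<kappa> x - (\<Sum>n<N. near_coeff n \<kappa> / (- u x) ^ (n + 1)))" for x \<kappa>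
    unfolding near_scaled_def near_rest_def eu T_def L_def by simp_all
  define P1 where "P1 = (\<lambda>x. near_scaled N \<kappa> (Complex x (pi / 2)) / (exp (Complex x (pi / 2)) - w))"
  define M1 where "M1 = (\<lambda>x. near_scaled N \<kappa> (Complex x (- (pi / 2))) / (exp (Complex x (- (pi / 2))) - w))"
  define P2 where "P2 = (\<lambda>x. near_scaled N (- \<kappa>) (Complex x (pi / 2)) / (exp (Complex x (pi / 2)) + w))"
  define M2 where "M2 = (\<lambda>x. near_scaled N (- \<kappa>) (Complex x (- (pi / 2))) / (exp (Complex x (- (pi / 2))) + w))"
  have int: "integrable lborel P1" "integrable lborel M1" "integrable lborel P2" "integrable lborel M2"
    unfolding P1_def M1_def P2_def M2_def using A(1,2) B(4,5) by auto
  define J1 where "J1 = (\<lambda>x. (1 * \<i> * of_real (exp x)) ^ (N + 1) *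
     (near_A (1 * \<kappa>) (of_real (3 * x) + \<i> * (3 * pi / 2)) + near_A (- (1 * \<kappa>)) (of_real (3 * x) - \<i> * (3 * pi / 2)))
       / (w - 1 * \<i> * of_real (exp x)))"
  define J2 where "J2 = (\<lambda>x. (- 1 * \<i> * of_real (exp x)) ^ (N + 1) *
     (near_A (- 1 * \<kappa>) (of_real (3 * x) + \<i> * (3 * pi / 2)) + near_A (- (- 1 * \<kappa>)) (of_real (3 * x) - \<i> * (3 * pi / 2)))
       / (w - - 1 * \<i> * of_real (exp x)))"
  have J1: "J1 = (\<lambda>x. - P1 x + (- 1) ^ (N + 1) * M2 x)"
  proof
    fix x
    have "J1 x = u x ^ (N + 1) * (T \<kappa> x + L (- \<kappa>) x) / (w - u x)"
      by (simp add: J1_def u_def T_def L_def)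
    then show "J1 x = - P1 x + (- 1) ^ (N + 1) * M2 x"
      by (simp only: near_jump_algebra[OF u0[of x], of N "T \<kappa> x" "L (- \<kappa>) x" w \<kappa>] P1_def M2_def P M eu)
  qed
  have J2: "J2 = (\<lambda>x. - M1 x + (- 1) ^ (N + 1) * P2 x)"
  proof
    fix x
    have u0': "- u x \<noteq> 0" using u0 by simp
    have "J2 x = (- u x) ^ (N + 1) * (L \<kappa> x + T (- \<kappa>) x) / (w - - u x)"
      by (simp add: J2_def u_def T_def L_def add.commute)
    then show "J2 x = - M1 x + (- 1) ^ (N + 1) * P2 x"
      by (simp only: near_jump_algebra[OF u0', of N "L \<kappa> x" "T (- \<kappa>) x" w \<kappa>] M1_def P2_def P M eu minus_minus)
  qed
  have iJ: "integrable lborel J1" "integrable lborel J2"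
    unfolding J1 J2 using int by auto
  note S1 = jump_substitution[of 1 w N \<kappa>, folded J1_def, OF _ Rw iJ(1)]
  note S2 = jump_substitution[of "- 1" w N \<kappa>, folded J2_def, OF _ Rw iJ(2)]
  show "set_integrable lborel {0<..} (jump_integrand 1 N \<kappa> (exp p))"
    using S1(1) by (simp add: w_def)
  show "set_integrable lborel {0<..} (jump_integrand (- 1) N \<kappa> (exp p))"
    using S2(1) by (simp add: w_def)
  define V1 V2 where "V1 = (LBINT t:{0<..}. jump_integrand 1 N \<kappa> w t)" and "V2 = (LBINT t:{0<..}. jump_integrand (- 1) N \<kappa> w t)"
  \<comment> \<open>Regrouping the four edge integrals by function instead of by value of s: M1 - P1
    is the Cauchy integral for \<kappa>, M2 - P2 the vanishing one for -\<kappa>.\<close>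
  have "(LBINT x. J1 x) - (LBINT x. J2 x) = (- (LBINT x. P1 x) + (- 1) ^ (N + 1) * (LBINT x. M2 x)) - (- (LBINT x. M1 x) + (- 1) ^ (N + 1) * (LBINT x. P2 x))"
    unfolding J1 J2 using int by (simp del: power_Suc)
  also have "\<dots> = ((LBINT x. M1 x) - (LBINT x. P1 x)) + (- 1) ^ (N + 1) * ((LBINT x. M2 x) - (LBINT x. P2 x))"
    by (simp add: algebra_simps)
  also have "(LBINT x. M1 x) - (LBINT x. P1 x) = 2 * pi * \<i> * (near_scaled N \<kappa> p / w)"
    unfolding M1_def P1_def by (rule A(3))
  also have "(LBINT x. M2 x) - (LBINT x. P2 x) = 0"
    unfolding M2_def P2_def by (rule B(6))
  finally have "2 * pi * \<i> * (near_scaled N \<kappa> p / w) = (LBINT x. J1 x) - (LBINT x. J2 x)" by simp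
  also have "(LBINT x. J1 x) = (\<i> ^ (N + 1) * (pi * \<i> * exp (2 * pi * \<i> * \<kappa>)) / (3 * w)) * V1"
    using S1(2) by (simp add: V1_def)
  also have "(LBINT x. J2 x) = ((- \<i>) ^ (N + 1) * (pi * \<i> * exp (- (2 * pi * \<i> * \<kappa>))) / (3 * w)) * V2"
    using S2(2) by (simp add: V2_def)
  finally have main: "2 * pi * \<i> * (near_scaled N \<kappa> p / w) = (\<i> ^ (N + 1) * (pi * \<i> * exp (2 * pi * \<i> * \<kappa>)) / (3 * w)) * V1
     - ((- \<i>) ^ (N + 1) * (pi * \<i> * exp (- (2 * pi * \<i> * \<kappa>))) / (3 * w)) * V2" .
  have ns: "near_scaled N \<kappa> p / w = w ^ N * near_rest N \<kappa> p"
    using w0 by (simp add: near_scaled_def w_def)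
  define U where "U = \<i> ^ N * exp (2 * pi * \<i> * \<kappa>) * V1 + (- \<i>) ^ N * exp (- (2 * pi * \<i> * \<kappa>)) * V2"
  have "(2 * pi * \<i>) * (w ^ N * near_rest N \<kappa> p) = (2 * pi * \<i>) * (\<i> / (6 * w) * U)"
    unfolding main[unfolded ns] U_def using w0 by (simp add: field_simps)
  then have "w ^ N * near_rest N \<kappa> p = \<i> / (6 * w) * U" by (rule mult_left_cancel[THEN iffD1, rotated]) simp
  also have "\<dots> = w ^ N * (\<i> / (6 * w ^ (N + 1)) * U)" using w0 by simp
  finally have "near_rest N \<kappa> p = \<i> / (6 * w ^ (N + 1)) * U"
    by (rule mult_left_cancel[THEN iffD1, rotated]) (simp add: w0)
  then show "near_A \<kappa> (3 * p) = (\<Sum>n<N. near_coeff n \<kappa> / exp p ^ (n + 1)) + \<i> / (6 * exp p ^ (N + 1)) *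
      (\<i> ^ N * exp (2 * pi * \<i> * \<kappa>) * (LBINT t:{0<..}. jump_integrand 1 N \<kappa> (exp p) t) +
       (- \<i>) ^ N * exp (- (2 * pi * \<i> * \<kappa>)) * (LBINT t:{0<..}. jump_integrand (- 1) N \<kappa> (exp p) t))"
    by (simp add: near_rest_def U_def V1_def V2_def w_def diff_eq_eq add.commute)
qed

text \<open>The parameter c ranges over the cube roots of -1, namely -1 and exp (\<plusminus> pi
  i/3). All kernels in the theorem are linear combinations of these simple fractions, one for each
  rotation of z.\<close>

definition ray_kernel :: "nat \<Rightarrow> complex \<Rightarrow> complex \<Rightarrow> complex \<Rightarrow> complex \<Rightarrow> real \<Rightarrow> complex" where
  "ray_kernel N \<kappa> \<zeta> c s t =
     of_real (t powr ((real N - 2) / 3) * exp (- 2 * pi * t)) * (1 / (1 + s * \<i> * cbrt_quot t \<zeta> * c)) * hankel_it t (s * \<kappa>)"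

definition phase :: "nat \<Rightarrow> complex \<Rightarrow> complex" where
  "phase N \<kappa> = exp ((2 * of_real pi * \<kappa> - of_real (pi / 2 * real N)) * \<i>)"

definition ray_rem :: "nat \<Rightarrow> complex \<Rightarrow> complex \<Rightarrow> complex \<Rightarrow> complex" where
  "ray_rem N \<kappa> \<zeta> c = phase N \<kappa> * (LBINT t:{0<..}. ray_kernel N \<kappa> \<zeta> c 1 t)
     + inverse (phase N \<kappa>) * (LBINT t:{0<..}. ray_kernel N \<kappa> \<zeta> c (- 1) t)"

definition ray_term :: "nat \<Rightarrow> complex \<Rightarrow> complex \<Rightarrow> complex" where
  "ray_term n \<kappa> \<zeta> = of_real (6 powr (real (n + 1) / 3)) * B_coeff n \<kappa> *
     (of_real (Gamma (real (n + 1) / 3)) / zpow \<zeta> (real (n + 1) / 3))"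

definition ray_total :: "nat \<Rightarrow> complex \<Rightarrow> complex \<Rightarrow> complex \<Rightarrow> complex" where
  "ray_total N \<kappa> \<zeta> c = (\<Sum>n<N. c ^ (n + 1) * (ray_term n \<kappa> \<zeta> / 3))
     + \<i> * c ^ (N + 1) / (6 * zpow \<zeta> (real (N + 1) / 3)) * ray_rem N \<kappa> \<zeta> c"

section \<open>Rotations of z in the exact formula\<close>

lemma zpow_third: "zpow \<zeta> (real k / 3) = exp (\<zeta> / 3) ^ k"
proof -
  have "of_real (real k / 3) * \<zeta> = of_nat k * (\<zeta> / 3)" by simp
  then show ?thesis unfolding zpow_def by (simp only: exp_of_nat_mult)
qed

lemma cbrt_quot_exp: "cbrt_quot t \<zeta> = of_real (t powr (1 / 3)) / exp (\<zeta> / 3)"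
  using zpow_third[of \<zeta> 1] by (simp add: cbrt_quot_def)

lemma phase_eq:
  "phase N \<kappa> = (- \<i>) ^ N * exp (2 * pi * \<i> * \<kappa>)"
  "inverse (phase N \<kappa>) = \<i> ^ N * exp (- (2 * pi * \<i> * \<kappa>))"
  "exp (- (2 * of_real pi * \<kappa> - of_real (pi / 2 * real N)) * \<i>) = inverse (phase N \<kappa>)"
proof -
  have e: "exp (- (pi / 2 * \<i>)) = - \<i>" by (simp add: exp_eq_polar complex_eq_iff)
  have "(2 * of_real pi * \<kappa> - of_real (pi / 2 * real N)) * \<i> = of_nat N * (- (pi / 2 * \<i>)) + 2 * pi * \<i> * \<kappa>"
    by (simp add: algebra_simps)
  then show 1: "phase N \<kappa> = (- \<i>) ^ N * exp (2 * pi * \<i> * \<kappa>)"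
    unfolding phase_def by (simp only: exp_add exp_of_nat_mult e)
  have "inverse ((- \<i>) ^ N) = \<i> ^ N" by (simp add: power_inverse[symmetric])
  then show "inverse (phase N \<kappa>) = \<i> ^ N * exp (- (2 * pi * \<i> * \<kappa>))"
    unfolding 1 by (simp add: exp_minus)
  show "exp (- (2 * of_real pi * \<kappa> - of_real (pi / 2 * real N)) * \<i>) = inverse (phase N \<kappa>)"
    unfolding phase_def exp_minus[symmetric] by (simp only: mult_minus_left)
qed

lemma near_coeff_ray:
  "near_coeff n \<kappa> = (- 1) ^ n * (of_real (6 powr (real (n + 1) / 3)) * B_coeff n \<kappa> * of_real (Gamma (real (n + 1) / 3)) / 3)"
  unfolding near_coeff_def B_coeff_minus by simp

text \<open>Rotating z by 3\<theta> multiplies its cube root by cis \<theta>, and for \<sigma> = -1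
  the sign of \<kappa> interchanges the two integrals. Both effects are absorbed in c, so expansions
  at different sheets become one expression in c and can be added. The cases needed are (\<theta>,
  \<sigma>) = (0, 1) and (\<plusminus> pi/3, -1).\<close>

lemma near_A_ray:
  assumes \<kappa>: "\<bar>Re \<kappa>\<bar> < real (N + 1) / 3" and \<theta>: "\<bar>Im \<zeta> / 3 + \<theta>\<bar> < pi / 2"
    and \<sigma>: "\<sigma> = 1 \<or> \<sigma> = - 1" and c: "c = - \<sigma> * cis (- \<theta>)"
  shows "set_integrable lborel {0<..} (ray_kernel N \<kappa> \<zeta> c 1)"
    and "set_integrable lborel {0<..} (ray_kernel N \<kappa> \<zeta> c (- 1))"
    and "near_A (\<sigma> * \<kappa>) (\<zeta> + 3 * \<i> * of_real \<theta>) = - \<sigma> * ray_total N \<kappa> \<zeta> c"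
proof -
  define p where "p = \<zeta> / 3 + \<i> * of_real \<theta>"
  define w where "w = exp (\<zeta> / 3)"
  have w0: "w \<noteq> 0" by (simp add: w_def)
  have ep: "exp p = w * cis \<theta>" by (simp add: p_def w_def exp_add cis_conv_exp)
  have ic: "inverse (cis \<theta>) = - \<sigma> * c" using \<sigma> by (auto simp: c cis_inverse)
  have ep': "inverse (exp p) = - \<sigma> * c / w" unfolding ep inverse_mult_distrib ic by (simp add: divide_inverse)
  have \<sigma>2: "\<sigma> * \<sigma> = 1" using \<sigma> by auto
  have \<kappa>': "\<bar>Re (\<sigma> * \<kappa>)\<bar> < real (N + 1) / 3" using \<kappa> \<sigma> by auto
  have p: "\<bar>Im p\<bar> < pi / 2" using \<theta> by (simp add: p_def)
  have J: "jump_integrand s N (\<sigma> * \<kappa>) (exp p) = ray_kernel N \<kappa> \<zeta> c (s * \<sigma>)" for s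
  proof
    fix t
    have "s * \<i> * of_real (t powr (1 / 3)) / exp p = - ((s * \<sigma>) * \<i> * cbrt_quot t \<zeta> * c)"
      unfolding divide_inverse[of _ "exp p"] ep' cbrt_quot_exp w_def[symmetric] by simp
    then show "jump_integrand s N (\<sigma> * \<kappa>) (exp p) t = ray_kernel N \<kappa> \<zeta> c (s * \<sigma>) t"
      by (simp add: jump_integrand_def ray_kernel_def mult.assoc)
  qed
  note R = near_A_representation[OF \<kappa>' p, unfolded J]
  show "set_integrable lborel {0<..} (ray_kernel N \<kappa> \<zeta> c 1)" "set_integrable lborel {0<..} (ray_kernel N \<kappa> \<zeta> c (- 1))"
    using R(1,2) \<sigma> by auto
  have inv: "x / exp p ^ k = (- \<sigma> * c) ^ k * x / w ^ k" for x k
    unfolding divide_inverse[of x] power_inverse[symmetric] ep' power_divide by simp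
  have sum_term: "near_coeff n (\<sigma> * \<kappa>) / exp p ^ (n + 1) = - \<sigma> * (c ^ (n + 1) * (ray_term n \<kappa> \<zeta> / 3))" for n
  proof -
    define g where "g = of_real (6 powr (real (n + 1) / 3)) * B_coeff n \<kappa> * of_real (Gamma (real (n + 1) / 3)) / 3"
    have "near_coeff n (\<sigma> * \<kappa>) = \<sigma> ^ n * near_coeff n \<kappa>"
      using \<sigma> near_coeff_minus[of n \<kappa>] by auto
    also have "\<dots> = (- \<sigma>) ^ n * g"
      unfolding near_coeff_ray g_def[symmetric] power_minus[of \<sigma>] by (simp only: mult_ac)
    finally have 1: "near_coeff n (\<sigma> * \<kappa>) = (- \<sigma>) ^ n * g" .
    have 2: "(- \<sigma>) ^ (n + 1) * (- \<sigma>) ^ n = - \<sigma>"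
      using \<sigma> by (auto simp: power_mult_distrib[symmetric])
    have 3: "ray_term n \<kappa> \<zeta> / 3 = g / w ^ (n + 1)"
      unfolding ray_term_def zpow_third w_def[symmetric] g_def by (simp del: power_Suc)
    have "(- \<sigma> * c) ^ (n + 1) * ((- \<sigma>) ^ n * g) / w ^ (n + 1) = ((- \<sigma>) ^ (n + 1) * (- \<sigma>) ^ n) * (c ^ (n + 1) * (g / w ^ (n + 1)))"
      unfolding power_mult_distrib by (simp only: mult_ac times_divide_eq_right)
    then show ?thesis unfolding inv 1 2 3 .
  qed
  have S: "(\<Sum>n<N. near_coeff n (\<sigma> * \<kappa>) / exp p ^ (n + 1)) = - \<sigma> * (\<Sum>n<N. c ^ (n + 1) * (ray_term n \<kappa> \<zeta> / 3))"
    by (simp only: sum_distrib_left sum_term)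
  define V where "V = (\<lambda>s. LBINT t:{0<..}. ray_kernel N \<kappa> \<zeta> c s t)"
  have V: "(LBINT t:{0<..}. ray_kernel N \<kappa> \<zeta> c s t) = V s" for s by (simp add: V_def)
  define e where "e = exp (2 * pi * \<i> * \<kappa>)"
  have e': "exp (- (2 * pi * \<i> * \<kappa>)) = inverse e" by (simp add: e_def exp_minus)
  have "\<i> / (6 * exp p ^ (N + 1)) * (\<i> ^ N * exp (2 * pi * \<i> * (\<sigma> * \<kappa>)) * V (1 * \<sigma>) + (- \<i>) ^ N * exp (- (2 * pi * \<i> * (\<sigma> * \<kappa>))) * V (- 1 * \<sigma>))
    = - \<sigma> * (\<i> * c ^ (N + 1) / (6 * w ^ (N + 1)) * ((- \<i>) ^ N * e * V 1 + \<i> ^ N * inverse e * V (- 1)))"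
  proof -
    have "\<i> / (6 * exp p ^ (N + 1)) = (- \<sigma> * c) ^ (N + 1) * (\<i> / 6) / w ^ (N + 1)"
      using inv[of "\<i> / 6" "N + 1"] by (simp del: power_Suc)
    moreover from \<sigma> have "(- \<sigma> * c) ^ (N + 1) * (\<i> / 6) / w ^ (N + 1) * (\<i> ^ N * exp (2 * pi * \<i> * (\<sigma> * \<kappa>)) * V (1 * \<sigma>) + (- \<i>) ^ N * exp (- (2 * pi * \<i> * (\<sigma> * \<kappa>))) * V (- 1 * \<sigma>))
      = - \<sigma> * (\<i> * c ^ (N + 1) / (6 * w ^ (N + 1)) * ((- \<i>) ^ N * e * V 1 + \<i> ^ N * inverse e * V (- 1)))"
    proof
      assume 1: "\<sigma> = 1"
      have "(- c) ^ (N + 1) * (\<i> / 6) / w ^ (N + 1) * (\<i> ^ N * e * V 1 + (- \<i>) ^ N * inverse e * V (- 1)) =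
         - (\<i> * c ^ (N + 1) / (6 * w ^ (N + 1)) * ((- \<i>) ^ N * e * V 1 + \<i> ^ N * inverse e * V (- 1)))"
        unfolding power_minus[of c] power_minus[of \<i>] by (cases "even N") (simp_all add: right_diff_distrib diff_divide_distrib mult_ac)
      then show ?thesis using 1 by (simp only: mult_1 mult_1_right e' e_def[symmetric] mult_minus_left)
    next
      assume 1: "\<sigma> = - 1"
      have "c ^ (N + 1) * (\<i> / 6) / w ^ (N + 1) * (\<i> ^ N * inverse e * V (- 1) + (- \<i>) ^ N * e * V 1) =
         \<i> * c ^ (N + 1) / (6 * w ^ (N + 1)) * ((- \<i>) ^ N * e * V 1 + \<i> ^ N * inverse e * V (- 1))"
        by (simp add: add.commute)
      then show ?thesis using 1 by (simp only: mult_1 mult_1_right e' e_def[symmetric] mult_minus_left mult_minus_right minus_minus)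
    qed
    ultimately show ?thesis by simp
  qed
  note T = this
  have rr: "ray_rem N \<kappa> \<zeta> c = (- \<i>) ^ N * e * V 1 + \<i> ^ N * inverse e * V (- 1)"
    unfolding ray_rem_def V phase_eq(2) unfolding phase_eq(1) e' e_def[symmetric] ..
  have "near_A (\<sigma> * \<kappa>) (3 * p) = - \<sigma> * (\<Sum>n<N. c ^ (n + 1) * (ray_term n \<kappa> \<zeta> / 3)) +
     - \<sigma> * (\<i> * c ^ (N + 1) / (6 * w ^ (N + 1)) * ((- \<i>) ^ N * e * V 1 + \<i> ^ N * inverse e * V (- 1)))"
    using R(3) unfolding S V T .
  then have "near_A (\<sigma> * \<kappa>) (3 * p) = - \<sigma> * ray_total N \<kappa> \<zeta> c"
    unfolding ray_total_def rr zpow_third w_def[symmetric] by (simp only: distrib_left)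
  moreover have "3 * p = \<zeta> + 3 * \<i> * of_real \<theta>" by (simp add: p_def)
  ultimately show "near_A (\<sigma> * \<kappa>) (\<zeta> + 3 * \<i> * of_real \<theta>) = - \<sigma> * ray_total N \<kappa> \<zeta> c" by simp
qed

text \<open>Three fractions fit all kernels: the one for Y has three, those for H and J have two and
  are padded with coefficient 0. Convergence of each fraction separately justifies splitting the
  integral.\<close>

lemma remainder_rays:
  assumes K: "\<And>s t. K N s \<zeta> t = a / (1 + s * \<i> * cbrt_quot t \<zeta> * c) + b / (1 + s * \<i> * cbrt_quot t \<zeta> * d) + e / (1 + s * \<i> * cbrt_quot t \<zeta> * f)"
    and int: "\<forall>s\<in>{1, - 1}. \<forall>x\<in>{c, d, f}. set_integrable lborel {0<..} (ray_kernel N \<kappa> \<zeta> x s)"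
  shows "rem_converges K N \<zeta> \<kappa>"
    and "remainder K k N \<zeta> \<kappa> = (a * ray_rem N \<kappa> \<zeta> c + b * ray_rem N \<kappa> \<zeta> d + e * ray_rem N \<kappa> \<zeta> f) / (k * zpow \<zeta> (real (N + 1) / 3))"
proof -
  have eq: "rem_integrand K N s \<zeta> \<kappa> = (\<lambda>t. a * ray_kernel N \<kappa> \<zeta> c s t + b * ray_kernel N \<kappa> \<zeta> d s t + e * ray_kernel N \<kappa> \<zeta> f s t)" for s
    unfolding rem_integrand_def K ray_kernel_def by (simp add: fun_eq_iff algebra_simps)
  have i: "set_integrable lborel {0<..} (\<lambda>t. y * ray_kernel N \<kappa> \<zeta> x s t)" if "s \<in> {1, - 1}" "x \<in> {c, d, f}" for s x y
    using int that by (intro set_integrable_mult_right) blast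
  show "rem_converges K N \<zeta> \<kappa>" unfolding rem_converges_def eq
    by (intro conjI set_integral_add(1) i) auto
  have I: "(LBINT t:{0<..}. rem_integrand K N s \<zeta> \<kappa> t) = a * (LBINT t:{0<..}. ray_kernel N \<kappa> \<zeta> c s t)
      + b * (LBINT t:{0<..}. ray_kernel N \<kappa> \<zeta> d s t) + e * (LBINT t:{0<..}. ray_kernel N \<kappa> \<zeta> f s t)"
    if s: "s \<in> {1, - 1}" for s
  proof -
    have "(LBINT t:{0<..}. rem_integrand K N s \<zeta> \<kappa> t) = (LBINT t:{0<..}. a * ray_kernel N \<kappa> \<zeta> c s t)
      + (LBINT t:{0<..}. b * ray_kernel N \<kappa> \<zeta> d s t) + (LBINT t:{0<..}. e * ray_kernel N \<kappa> \<zeta> f s t)"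
      unfolding eq by (subst set_integral_add(2), intro set_integral_add(1) i s, simp, simp, intro i s, simp)
        (subst set_integral_add(2), intro i s, simp, intro i s, simp, simp)
    then show ?thesis by simp
  qed
  show "remainder K k N \<zeta> \<kappa> = (a * ray_rem N \<kappa> \<zeta> c + b * ray_rem N \<kappa> \<zeta> d + e * ray_rem N \<kappa> \<zeta> f) / (k * zpow \<zeta> (real (N + 1) / 3))"
    unfolding remainder_def ray_rem_def phase_eq(3) phase_def[symmetric] by (subst (1 2) I) (simp_all add: algebra_simps add_divide_distrib)
qed

section \<open>Trigonometric factors and the four functions\<close>

lemma cis_triple:
  fixes n :: nat
  shows "cis (real n * pi) = (- 1) ^ n" "cis (pi / 3) ^ n = cis (real n * pi / 3)" "cis (- (pi / 3)) ^ n = cis (- (real n * pi / 3))"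
proof -
  have "cis (real n * pi) = cis pi ^ n" by (rule Complex.DeMoivre[symmetric])
  then show "cis (real n * pi) = (- 1) ^ n" by (simp only: cis_pi)
  show "cis (pi / 3) ^ n = cis (real n * pi / 3)" "cis (- (pi / 3)) ^ n = cis (- (real n * pi / 3))"
    unfolding Complex.DeMoivre by simp_all
qed

text \<open>Meant for a = cis \<phi>, b its conjugate and m = (-1)^n with \<phi> = n pi/3: then m =
  a^3 and a - b = 2 i sin \<phi>, so both right-hand sides expose sines.\<close>

lemma sixth_root_identities:
  fixes a b m :: complex
  assumes "a * b = 1" "m = a * a * a" "m * m = 1"
  shows "a - m = - (a * a) * (a - b)" "a + b - 2 * m = m * (a - b)\<^sup>2"
  using assms by algebra+

lemma cis_minus_one_power:
  fixes n :: nat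
  defines "\<phi> \<equiv> real n * pi / 3"
  shows "cis \<phi> - (- 1) ^ n = - 2 * \<i> * cis (2 * real n * pi / 3) * of_real (sin \<phi>)"
    and "cis \<phi> - cis (- \<phi>) = 2 * \<i> * of_real (sin \<phi>)"
    and "cis \<phi> + cis (- \<phi>) - 2 * (- 1) ^ n = - 4 * (- 1) ^ n * of_real ((sin \<phi>)\<^sup>2)"
proof -
  have 1: "cis (2 * real n * pi / 3) = cis \<phi> * cis \<phi>" by (simp add: cis_mult \<phi>_def mult_ac)
  have 3: "(- 1) ^ n = cis \<phi> * cis \<phi> * cis \<phi>"
    unfolding cis_triple(1)[symmetric] by (simp add: cis_mult \<phi>_def mult.commute)
  have u: "cis \<phi> * cis (- \<phi>) = 1" by (simp add: cis_mult)
  have m: "(- 1 :: complex) ^ n * (- 1) ^ n = 1" by (simp add: power_mult_distrib[symmetric])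
  have s: "cis \<phi> - cis (- \<phi>) = 2 * \<i> * of_real (sin \<phi>)" by (simp add: complex_eq_iff)
  then show "cis \<phi> - cis (- \<phi>) = 2 * \<i> * of_real (sin \<phi>)" .
  have "cis \<phi> - (- 1) ^ n = - (cis \<phi> * cis \<phi>) * (cis \<phi> - cis (- \<phi>))" by (rule sixth_root_identities(1)[OF u 3 m])
  then show "cis \<phi> - (- 1) ^ n = - 2 * \<i> * cis (2 * real n * pi / 3) * of_real (sin \<phi>)"
    unfolding s 1 by (simp only: mult_ac mult_minus_left mult_minus_right)
  have "cis \<phi> + cis (- \<phi>) - 2 * (- 1) ^ n = (- 1) ^ n * (cis \<phi> - cis (- \<phi>))\<^sup>2" by (rule sixth_root_identities(2)[OF u 3 m])
  then show "cis \<phi> + cis (- \<phi>) - 2 * (- 1) ^ n = - 4 * (- 1) ^ n * of_real ((sin \<phi>)\<^sup>2)"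
    unfolding s by (simp add: power_mult_distrib)
qed

text \<open>The weights act on the n-th term through the powers c^(n+1), which become h n, while in
  the remainder the powers c^(N+1) stay with their separate integrals as the numerators of the
  kernels.\<close>

lemma ray_total_combination:
  assumes "\<And>n. n < N \<Longrightarrow> a * c ^ (n + 1) + b * d ^ (n + 1) + e * f ^ (n + 1) = h n"
  shows "a * ray_total N \<kappa> \<zeta> c + b * ray_total N \<kappa> \<zeta> d + e * ray_total N \<kappa> \<zeta> f =
    (\<Sum>n<N. h n * ray_term n \<kappa> \<zeta>) / 3 + \<i> / (6 * zpow \<zeta> (real (N + 1) / 3)) *
      (a * c ^ (N + 1) * ray_rem N \<kappa> \<zeta> c + b * d ^ (N + 1) * ray_rem N \<kappa> \<zeta> d + e * f ^ (N + 1) * ray_rem N \<kappa> \<zeta> f)"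
proof -
  have S: "y * (\<Sum>n<N. x ^ (n + 1) * (ray_term n \<kappa> \<zeta> / 3)) = (\<Sum>n<N. (y * x ^ (n + 1)) * ray_term n \<kappa> \<zeta>) / 3" for x y
    by (simp add: sum_distrib_left sum_divide_distrib mult.assoc)
  have "(\<Sum>n<N. h n * ray_term n \<kappa> \<zeta>) = (\<Sum>n<N. (a * c ^ (n + 1)) * ray_term n \<kappa> \<zeta>) + (\<Sum>n<N. (b * d ^ (n + 1)) * ray_term n \<kappa> \<zeta>)
     + (\<Sum>n<N. (e * f ^ (n + 1)) * ray_term n \<kappa> \<zeta>)"
    unfolding sum.distrib[symmetric]
    by (intro sum.cong refl) (simp only: distrib_right[symmetric] assms lessThan_iff)
  then show ?thesis unfolding ray_total_def distrib_left S by (simp add: add_divide_distrib algebra_simps)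
qed

text \<open>The sector is the intersection of the ranges in which \<zeta>/3 and (\<zeta> - i pi)/3
  lie in the strip. No order occurs in the statement, so that it can be reused at a rotated point
  with -\<kappa>.\<close>

lemma near_A_hankel_form:
  assumes \<kappa>: "\<bar>Re \<kappa>\<bar> < real (N + 1) / 3" and \<zeta>: "- (pi / 2) < Im \<zeta>" "Im \<zeta> < 3 * pi / 2"
  shows "rem_converges kernel_H N \<zeta> \<kappa>"
    and "(near_A \<kappa> \<zeta> + near_A (- \<kappa>) (\<zeta> - \<i> * pi)) / (pi * \<i>) =
      - (2 / (3 * of_real pi)) * (\<Sum>n<N. cis (2 * real (n + 1) * pi / 3) * of_real (sin (real (n + 1) * pi / 3)) * ray_term n \<kappa> \<zeta>)
      + rem_H N \<zeta> \<kappa>"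
proof -
  have r: "\<bar>Im \<zeta> / 3 + 0\<bar> < pi / 2" "\<bar>Im \<zeta> / 3 + (- (pi / 3))\<bar> < pi / 2" using \<zeta> by linarith+
  note R1 = near_A_ray[OF \<kappa> r(1), of 1 "- 1"]
  note R2 = near_A_ray[OF \<kappa> r(2), of "- 1" "cis (pi / 3)"]
  have K: "kernel_H N s \<zeta> t = cis (real (N + 1) * pi / 3) / (1 + s * \<i> * cbrt_quot t \<zeta> * cis (pi / 3)) + (- cis (real (N + 1) * pi)) / (1 + s * \<i> * cbrt_quot t \<zeta> * (- 1))
     + 0 / (1 + s * \<i> * cbrt_quot t \<zeta> * (- 1))" for s t
    by (simp add: kernel_H_def)
  have int: "\<forall>s\<in>{1, - 1}. \<forall>x\<in>{cis (pi / 3), - 1, - 1}. set_integrable lborel {0<..} (ray_kernel N \<kappa> \<zeta> x s)"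
    using R1(1,2) R2(1,2) by simp
  note R = remainder_rays[where K = kernel_H, OF K int]
  show "rem_converges kernel_H N \<zeta> \<kappa>" by (rule R(1))
  have A: "near_A \<kappa> \<zeta> = - ray_total N \<kappa> \<zeta> (- 1)" "near_A (- \<kappa>) (\<zeta> - \<i> * pi) = ray_total N \<kappa> \<zeta> (cis (pi / 3))"
    using R1(3) R2(3) by simp_all
  have c: "1 * cis (pi / 3) ^ (n + 1) + (- 1) * (- 1) ^ (n + 1) + 0 * (- 1) ^ (n + 1) =
      - 2 * \<i> * (cis (2 * real (n + 1) * pi / 3) * of_real (sin (real (n + 1) * pi / 3)))" for n
    using cis_minus_one_power(1)[of "n + 1"] unfolding cis_triple by simp
  have "near_A \<kappa> \<zeta> + near_A (- \<kappa>) (\<zeta> - \<i> * pi) = 1 * ray_total N \<kappa> \<zeta> (cis (pi / 3)) + (- 1) * ray_total N \<kappa> \<zeta> (- 1) + 0 * ray_total N \<kappa> \<zeta> (- 1)"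
    by (simp add: A)
  also have "\<dots> = (\<Sum>n<N. - 2 * \<i> * (cis (2 * real (n + 1) * pi / 3) * of_real (sin (real (n + 1) * pi / 3))) * ray_term n \<kappa> \<zeta>) / 3
     + \<i> / (6 * zpow \<zeta> (real (N + 1) / 3)) * (1 * cis (pi / 3) ^ (N + 1) * ray_rem N \<kappa> \<zeta> (cis (pi / 3)) + (- 1) * (- 1) ^ (N + 1) * ray_rem N \<kappa> \<zeta> (- 1) + 0 * (- 1) ^ (N + 1) * ray_rem N \<kappa> \<zeta> (- 1))"
    by (rule ray_total_combination) (rule c)
  also have "(\<Sum>n<N. - 2 * \<i> * (cis (2 * real (n + 1) * pi / 3) * of_real (sin (real (n + 1) * pi / 3))) * ray_term n \<kappa> \<zeta>) =
     - 2 * \<i> * (\<Sum>n<N. cis (2 * real (n + 1) * pi / 3) * of_real (sin (real (n + 1) * pi / 3)) * ray_term n \<kappa> \<zeta>)"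
    by (simp only: sum_distrib_left mult.assoc)
  also have "\<i> / (6 * zpow \<zeta> (real (N + 1) / 3)) * (1 * cis (pi / 3) ^ (N + 1) * ray_rem N \<kappa> \<zeta> (cis (pi / 3)) + (- 1) * (- 1) ^ (N + 1) * ray_rem N \<kappa> \<zeta> (- 1) + 0 * (- 1) ^ (N + 1) * ray_rem N \<kappa> \<zeta> (- 1))
     = pi * \<i> * rem_H N \<zeta> \<kappa>"
    unfolding rem_H_def R(2) cis_triple by simp
  finally show "(near_A \<kappa> \<zeta> + near_A (- \<kappa>) (\<zeta> - \<i> * pi)) / (pi * \<i>) =
      - (2 / (3 * of_real pi)) * (\<Sum>n<N. cis (2 * real (n + 1) * pi / 3) * of_real (sin (real (n + 1) * pi / 3)) * ray_term n \<kappa> \<zeta>)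
      + rem_H N \<zeta> \<kappa>"
    by (simp add: add_divide_distrib diff_divide_distrib)
qed

text \<open>Here both rotations by \<plusminus> pi have to stay in the sector of half-angle 3 pi/2,
  which leaves |arg z| < pi/2.\<close>

lemma near_A_bessel_J_form:
  assumes \<kappa>: "\<bar>Re \<kappa>\<bar> < real (N + 1) / 3" and \<zeta>: "\<bar>Im \<zeta>\<bar> < pi / 2"
  shows "rem_converges kernel_J N \<zeta> \<kappa>"
    and "(near_A (- \<kappa>) (\<zeta> - \<i> * pi) - near_A (- \<kappa>) (\<zeta> + \<i> * pi)) / (2 * pi * \<i>) =
      1 / (3 * of_real pi) * (\<Sum>n<N. of_real (sin (real (n + 1) * pi / 3)) * ray_term n \<kappa> \<zeta>) + rem_J N \<zeta> \<kappa>"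
proof -
  have r: "\<bar>Im \<zeta> / 3 + (- (pi / 3))\<bar> < pi / 2" "\<bar>Im \<zeta> / 3 + pi / 3\<bar> < pi / 2" using \<zeta> by linarith+
  note R1 = near_A_ray[OF \<kappa> r(2), of "- 1" "cis (- (pi / 3))"]
  note R2 = near_A_ray[OF \<kappa> r(1), of "- 1" "cis (pi / 3)"]
  have K: "kernel_J N s \<zeta> t = cis (real (N + 1) * pi / 3) / (1 + s * \<i> * cbrt_quot t \<zeta> * cis (pi / 3))
     + (- cis (- (real (N + 1) * pi / 3))) / (1 + s * \<i> * cbrt_quot t \<zeta> * cis (- (pi / 3)))
     + 0 / (1 + s * \<i> * cbrt_quot t \<zeta> * cis (pi / 3))" for s t
    by (simp add: kernel_J_def)
  have int: "\<forall>s\<in>{1, - 1}. \<forall>x\<in>{cis (pi / 3), cis (- (pi / 3)), cis (pi / 3)}. set_integrable lborel {0<..} (ray_kernel N \<kappa> \<zeta> x s)"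
    using R1(1,2) R2(1,2) by simp
  note R = remainder_rays[where K = kernel_J, OF K int]
  show "rem_converges kernel_J N \<zeta> \<kappa>" by (rule R(1))
  have A: "near_A (- \<kappa>) (\<zeta> + \<i> * pi) = ray_total N \<kappa> \<zeta> (cis (- (pi / 3)))" "near_A (- \<kappa>) (\<zeta> - \<i> * pi) = ray_total N \<kappa> \<zeta> (cis (pi / 3))"
    using R1(3) R2(3) by simp_all
  have c: "1 * cis (pi / 3) ^ (n + 1) + (- 1) * cis (- (pi / 3)) ^ (n + 1) + 0 * cis (pi / 3) ^ (n + 1) =
      2 * \<i> * of_real (sin (real (n + 1) * pi / 3))" for n
    using cis_minus_one_power(2)[of "n + 1"] unfolding cis_triple by simp
  have "near_A (- \<kappa>) (\<zeta> - \<i> * pi) - near_A (- \<kappa>) (\<zeta> + \<i> * pi) = 1 * ray_total N \<kappa> \<zeta> (cis (pi / 3)) + (- 1) * ray_total N \<kappa> \<zeta> (cis (- (pi / 3))) + 0 * ray_total N \<kappa> \<zeta> (cis (pi / 3))"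
    by (simp add: A)
  also have "\<dots> = (\<Sum>n<N. 2 * \<i> * of_real (sin (real (n + 1) * pi / 3)) * ray_term n \<kappa> \<zeta>) / 3
     + \<i> / (6 * zpow \<zeta> (real (N + 1) / 3)) * (1 * cis (pi / 3) ^ (N + 1) * ray_rem N \<kappa> \<zeta> (cis (pi / 3)) + (- 1) * cis (- (pi / 3)) ^ (N + 1) * ray_rem N \<kappa> \<zeta> (cis (- (pi / 3))) + 0 * cis (pi / 3) ^ (N + 1) * ray_rem N \<kappa> \<zeta> (cis (pi / 3)))"
    by (rule ray_total_combination) (rule c)
  also have "(\<Sum>n<N. 2 * \<i> * of_real (sin (real (n + 1) * pi / 3)) * ray_term n \<kappa> \<zeta>) =
     2 * \<i> * (\<Sum>n<N. of_real (sin (real (n + 1) * pi / 3)) * ray_term n \<kappa> \<zeta>)"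
    by (simp only: sum_distrib_left mult.assoc)
  also have "\<i> / (6 * zpow \<zeta> (real (N + 1) / 3)) * (1 * cis (pi / 3) ^ (N + 1) * ray_rem N \<kappa> \<zeta> (cis (pi / 3)) + (- 1) * cis (- (pi / 3)) ^ (N + 1) * ray_rem N \<kappa> \<zeta> (cis (- (pi / 3))) + 0 * cis (pi / 3) ^ (N + 1) * ray_rem N \<kappa> \<zeta> (cis (pi / 3)))
     = 2 * pi * \<i> * rem_J N \<zeta> \<kappa>"
    unfolding rem_J_def R(2) cis_triple by simp
  finally show "(near_A (- \<kappa>) (\<zeta> - \<i> * pi) - near_A (- \<kappa>) (\<zeta> + \<i> * pi)) / (2 * pi * \<i>) =
      1 / (3 * of_real pi) * (\<Sum>n<N. of_real (sin (real (n + 1) * pi / 3)) * ray_term n \<kappa> \<zeta>) + rem_J N \<zeta> \<kappa>"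
    by (simp add: add_divide_distrib)
qed

lemma near_A_bessel_Y_form:
  assumes \<kappa>: "\<bar>Re \<kappa>\<bar> < real (N + 1) / 3" and \<zeta>: "\<bar>Im \<zeta>\<bar> < pi / 2"
  shows "rem_converges kernel_Y N \<zeta> \<kappa>"
    and "- (2 * near_A \<kappa> \<zeta> + near_A (- \<kappa>) (\<zeta> - \<i> * pi) + near_A (- \<kappa>) (\<zeta> + \<i> * pi)) / (2 * pi) =
      - (2 / (3 * of_real pi)) * (\<Sum>n<N. (- 1) ^ n * of_real ((sin (real (n + 1) * pi / 3))\<^sup>2) * ray_term n \<kappa> \<zeta>) + rem_Y N \<zeta> \<kappa>"
proof -
  have r: "\<bar>Im \<zeta> / 3 + (- (pi / 3))\<bar> < pi / 2" "\<bar>Im \<zeta> / 3 + pi / 3\<bar> < pi / 2" "\<bar>Im \<zeta> / 3 + 0\<bar> < pi / 2" using \<zeta> by linarith+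
  note R1 = near_A_ray[OF \<kappa> r(2), of "- 1" "cis (- (pi / 3))"]
  note R2 = near_A_ray[OF \<kappa> r(1), of "- 1" "cis (pi / 3)"]
  note R3 = near_A_ray[OF \<kappa> r(3), of 1 "- 1"]
  have K: "kernel_Y N s \<zeta> t = cis (real (N + 1) * pi / 3) / (1 + s * \<i> * cbrt_quot t \<zeta> * cis (pi / 3))
     + cis (- (real (N + 1) * pi / 3)) / (1 + s * \<i> * cbrt_quot t \<zeta> * cis (- (pi / 3)))
     + (- (2 * cis (real (N + 1) * pi))) / (1 + s * \<i> * cbrt_quot t \<zeta> * (- 1))" for s t
    by (simp add: kernel_Y_def)
  have int: "\<forall>s\<in>{1, - 1}. \<forall>x\<in>{cis (pi / 3), cis (- (pi / 3)), - 1}. set_integrable lborel {0<..} (ray_kernel N \<kappa> \<zeta> x s)"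
    using R1(1,2) R2(1,2) R3(1,2) by simp
  note R = remainder_rays[where K = kernel_Y, OF K int]
  show "rem_converges kernel_Y N \<zeta> \<kappa>" by (rule R(1))
  have A: "near_A (- \<kappa>) (\<zeta> + \<i> * pi) = ray_total N \<kappa> \<zeta> (cis (- (pi / 3)))" "near_A (- \<kappa>) (\<zeta> - \<i> * pi) = ray_total N \<kappa> \<zeta> (cis (pi / 3))"
    "near_A \<kappa> \<zeta> = - ray_total N \<kappa> \<zeta> (- 1)"
    using R1(3) R2(3) R3(3) by simp_all
  have g: "\<i> / (6 * W) * S = - 2 * pi * (S / (12 * of_real pi * \<i> * W))" for S W
    by (cases "W = 0") (simp_all add: field_simps)
  have c: "1 * cis (pi / 3) ^ (n + 1) + 1 * cis (- (pi / 3)) ^ (n + 1) + (- 2) * (- 1) ^ (n + 1) =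
      4 * ((- 1) ^ n * of_real ((sin (real (n + 1) * pi / 3))\<^sup>2))" for n
    using cis_minus_one_power(3)[of "n + 1"] unfolding cis_triple by simp
  have "2 * near_A \<kappa> \<zeta> + near_A (- \<kappa>) (\<zeta> - \<i> * pi) + near_A (- \<kappa>) (\<zeta> + \<i> * pi) = 1 * ray_total N \<kappa> \<zeta> (cis (pi / 3)) + 1 * ray_total N \<kappa> \<zeta> (cis (- (pi / 3))) + (- 2) * ray_total N \<kappa> \<zeta> (- 1)"
    by (simp add: A)
  also have "\<dots> = (\<Sum>n<N. 4 * ((- 1) ^ n * of_real ((sin (real (n + 1) * pi / 3))\<^sup>2)) * ray_term n \<kappa> \<zeta>) / 3
     + \<i> / (6 * zpow \<zeta> (real (N + 1) / 3)) * (1 * cis (pi / 3) ^ (N + 1) * ray_rem N \<kappa> \<zeta> (cis (pi / 3)) + 1 * cis (- (pi / 3)) ^ (N + 1) * ray_rem N \<kappa> \<zeta> (cis (- (pi / 3))) + (- 2) * (- 1) ^ (N + 1) * ray_rem N \<kappa> \<zeta> (- 1))"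
    by (rule ray_total_combination) (rule c)
  also have "(\<Sum>n<N. 4 * ((- 1) ^ n * of_real ((sin (real (n + 1) * pi / 3))\<^sup>2)) * ray_term n \<kappa> \<zeta>) =
     4 * (\<Sum>n<N. (- 1) ^ n * of_real ((sin (real (n + 1) * pi / 3))\<^sup>2) * ray_term n \<kappa> \<zeta>)"
    by (simp only: sum_distrib_left mult.assoc)
  also have "\<i> / (6 * zpow \<zeta> (real (N + 1) / 3)) * (1 * cis (pi / 3) ^ (N + 1) * ray_rem N \<kappa> \<zeta> (cis (pi / 3)) + 1 * cis (- (pi / 3)) ^ (N + 1) * ray_rem N \<kappa> \<zeta> (cis (- (pi / 3))) + (- 2) * (- 1) ^ (N + 1) * ray_rem N \<kappa> \<zeta> (- 1))
     = - 2 * pi * rem_Y N \<zeta> \<kappa>"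
    unfolding rem_Y_def R(2) cis_triple g by simp
  finally show "- (2 * near_A \<kappa> \<zeta> + near_A (- \<kappa>) (\<zeta> - \<i> * pi) + near_A (- \<kappa>) (\<zeta> + \<i> * pi)) / (2 * pi) =
      - (2 / (3 * of_real pi)) * (\<Sum>n<N. (- 1) ^ n * of_real ((sin (real (n + 1) * pi / 3))\<^sup>2) * ray_term n \<kappa> \<zeta>) + rem_Y N \<zeta> \<kappa>"
    by (simp add: add_divide_distrib diff_divide_distrib)
qed

text \<open>This corresponds to the continuation formula in which the second Hankel function of
  order \<nu> at z is minus the first one of order -\<nu> at z exp (pi i); -\<kappa> plays the role
  of \<kappa> there.\<close>

lemma near_A_hankel_form_rotated:
  assumes \<kappa>: "\<bar>Re \<kappa>\<bar> < real (N + 1) / 3" and \<zeta>: "- (3 * pi / 2) < Im \<zeta>" "Im \<zeta> < pi / 2"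
  shows "rem_converges kernel_H N (\<zeta> + of_real pi * \<i>) (- \<kappa>)"
    and "- (near_A \<kappa> \<zeta> + near_A (- \<kappa>) (\<zeta> + \<i> * pi)) / (pi * \<i>) =
      - (2 / (3 * of_real pi)) * (\<Sum>n<N. cis (- (2 * real (n + 1) * pi / 3)) * of_real (sin (real (n + 1) * pi / 3)) * ray_term n \<kappa> \<zeta>)
      - rem_H N (\<zeta> + of_real pi * \<i>) (- \<kappa>)"
proof -
  define \<zeta>' where "\<zeta>' = \<zeta> + of_real pi * \<i>"
  have \<kappa>': "\<bar>Re (- \<kappa>)\<bar> < real (N + 1) / 3" using \<kappa> by simp
  have \<zeta>'r: "- (pi / 2) < Im \<zeta>'" "Im \<zeta>' < 3 * pi / 2" using \<zeta> by (simp_all add: \<zeta>'_def)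
  note R = near_A_hankel_form[OF \<kappa>' \<zeta>'r]
  show "rem_converges kernel_H N (\<zeta> + of_real pi * \<i>) (- \<kappa>)" using R(1) by (simp add: \<zeta>'_def)
  have e: "exp (\<zeta>' / 3) = exp (\<zeta> / 3) * cis (pi / 3)"
    by (simp add: \<zeta>'_def add_divide_distrib exp_add cis_conv_exp mult.commute)
  \<comment> \<open>With \<phi> = (n+1) pi/3 the phases are 2\<phi> from the formula, -\<phi> from
    the power of the rotated z and -3\<phi> from the parity factor (-1)^n = - cis (- 3\<phi>). They
    add up to -2\<phi>, and the sign left over cancels the one in front.\<close>
  have t: "cis (2 * real (n + 1) * pi / 3) * ray_term n (- \<kappa>) \<zeta>' = - (cis (- (2 * real (n + 1) * pi / 3)) * ray_term n \<kappa> \<zeta>)" for n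
  proof -
    define \<phi> where "\<phi> = real (n + 1) * pi / 3"
    have z: "zpow \<zeta>' (real (n + 1) / 3) = zpow \<zeta> (real (n + 1) / 3) * cis \<phi>"
      unfolding zpow_third e power_mult_distrib cis_triple \<phi>_def ..
    have "(- 1 :: complex) ^ (n + 1) = cis (3 * \<phi>)" unfolding cis_triple(1)[symmetric] by (simp add: \<phi>_def)
    then have m0: "- ((- 1 :: complex) ^ n) = cis (3 * \<phi>)" by simp
    have m: "(- 1 :: complex) ^ n = - cis (3 * \<phi>)" unfolding m0[symmetric] by simp
    have "(- 1 :: complex) ^ n = inverse ((- 1) ^ n)" by (simp add: power_inverse[symmetric])
    also have "\<dots> = - cis (- 3 * \<phi>)" unfolding m by (simp add: cis_inverse)
    finally have m': "(- 1 :: complex) ^ n = - cis (- 3 * \<phi>)" .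
    have d: "x / (y * cis \<phi>) = cis (- \<phi>) * (x / y)" for x y by (simp add: divide_inverse mult_ac)
    have "ray_term n (- \<kappa>) \<zeta>' = - cis (- 3 * \<phi>) * cis (- \<phi>) * ray_term n \<kappa> \<zeta>"
      unfolding ray_term_def B_coeff_minus z m' d by (simp only: mult_ac)
    moreover have "cis (2 * real (n + 1) * pi / 3) * (cis (- 3 * \<phi>) * cis (- \<phi>)) = cis (- (2 * real (n + 1) * pi / 3))"
      unfolding cis_mult by (rule arg_cong[of _ _ cis]) (simp add: \<phi>_def field_simps)
    ultimately show ?thesis by (simp add: mult.assoc[symmetric])
  qed
  have s: "cis (2 * real (n + 1) * pi / 3) * of_real (sin (real (n + 1) * pi / 3)) * ray_term n (- \<kappa>) \<zeta>' =
     - (cis (- (2 * real (n + 1) * pi / 3)) * of_real (sin (real (n + 1) * pi / 3)) * ray_term n \<kappa> \<zeta>)" for n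
    using arg_cong[OF t[of n], of "\<lambda>x. of_real (sin (real (n + 1) * pi / 3)) * x"] by (simp only: mult_ac mult_minus_right)
  have "\<zeta>' - \<i> * pi = \<zeta>" "\<zeta>' = \<zeta> + \<i> * pi" by (simp_all add: \<zeta>'_def mult.commute)
  then have "- (near_A \<kappa> \<zeta> + near_A (- \<kappa>) (\<zeta> + \<i> * pi)) / (pi * \<i>) = - ((near_A (- \<kappa>) \<zeta>' + near_A (- (- \<kappa>)) (\<zeta>' - \<i> * pi)) / (pi * \<i>))"
    by (simp only: minus_minus minus_divide_left[symmetric] add.commute[of "near_A (- \<kappa>) _"])
  then show "- (near_A \<kappa> \<zeta> + near_A (- \<kappa>) (\<zeta> + \<i> * pi)) / (pi * \<i>) =
      - (2 / (3 * of_real pi)) * (\<Sum>n<N. cis (- (2 * real (n + 1) * pi / 3)) * of_real (sin (real (n + 1) * pi / 3)) * ray_term n \<kappa> \<zeta>)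
      - rem_H N (\<zeta> + of_real pi * \<i>) (- \<kappa>)"
    unfolding R(2) s sum_negf by (simp add: \<zeta>'_def)
qed

section \<open>The coefficients as integrals\<close>

text \<open>The jump integrand at w = \<infinity>, where its denominator becomes 1.\<close>

definition jump_limit :: "complex \<Rightarrow> nat \<Rightarrow> complex \<Rightarrow> real \<Rightarrow> complex" where
  "jump_limit s n \<kappa> t = of_real (t powr ((real n - 2) / 3) * exp (- 2 * pi * t)) * hankel_it t (s * \<kappa>)"

text \<open>Absolute convergence is read off from two remainders at z = 1 that are already known to
  converge: with \<tau> = t^(1/3), the integrand for n minus s i times that for n + 1 has the
  numerator 1 - s i \<tau>, which cancels the denominator.\<close>

lemma jump_limit_integrable:
  assumes \<kappa>: "\<bar>Re \<kappa>\<bar> < real (n + 1) / 3" and s: "s = 1 \<or> s = (- 1 :: complex)"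
  shows "set_integrable lborel {0<..} (jump_limit s n \<kappa>)"
proof -
  have "real (n + 1) / 3 \<le> real (n + 1 + 1) / 3" by simp
  then have \<kappa>': "\<bar>Re \<kappa>\<bar> < real (n + 1 + 1) / 3" using \<kappa> by (rule order_less_le_trans[rotated])
  have p: "\<bar>Im 0\<bar> < pi / 2" by simp
  have "set_integrable lborel {0<..} (\<lambda>t. jump_integrand s n \<kappa> 1 t - (s * \<i>) * jump_integrand s (n + 1) \<kappa> 1 t)"
    using near_A_representation(1,2)[OF \<kappa> p] near_A_representation(1,2)[OF \<kappa>' p] s
    by (intro set_integral_diff(1) set_integrable_mult_right) auto
  moreover have "jump_integrand s n \<kappa> 1 t - (s * \<i>) * jump_integrand s (n + 1) \<kappa> 1 t = jump_limit s n \<kappa> t" if t: "t \<in> {0<..}" for t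
  proof -
    define \<tau> where "\<tau> = complex_of_real (t powr (1 / 3))"
    define H where "H = jump_limit s n \<kappa> t"
    have d: "1 - s * \<i> * \<tau> / 1 \<noteq> 0" unfolding \<tau>_def by (rule jump_denominator_nonzero[OF s]) simp
    have "(real (n + 1) - 2) / 3 = (real n - 2) / 3 + 1 / 3" by (simp add: add_divide_distrib[symmetric])
    then have "t powr ((real (n + 1) - 2) / 3) = t powr ((real n - 2) / 3) * t powr (1 / 3)"
      by (simp only: powr_add)
    then have 2: "jump_integrand s (n + 1) \<kappa> 1 t = \<tau> * H / (1 - s * \<i> * \<tau> / 1)"
      unfolding jump_integrand_def H_def jump_limit_def \<tau>_def by (simp only: of_real_mult mult_ac)
    have 1: "jump_integrand s n \<kappa> 1 t = H / (1 - s * \<i> * \<tau> / 1)"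
      unfolding jump_integrand_def H_def jump_limit_def \<tau>_def ..
    have "H / (1 - s * \<i> * \<tau> / 1) - s * \<i> * (\<tau> * H / (1 - s * \<i> * \<tau> / 1)) = (1 - s * \<i> * \<tau> / 1) * H / (1 - s * \<i> * \<tau> / 1)"
      by (simp add: left_diff_distrib diff_divide_distrib)
    also have "\<dots> = H" using d by simp
    finally show ?thesis unfolding 1 2 H_def[symmetric] .
  qed
  ultimately show ?thesis
    using set_integrable_cong[OF refl refl, of "{0<..}" "\<lambda>t. jump_integrand s n \<kappa> 1 t - (s * \<i>) * jump_integrand s (n + 1) \<kappa> 1 t" "jump_limit s n \<kappa>" lborel]
    by (simp only:)
qed

text \<open>For real positive w the denominator has real part 1, hence modulus at least 1, and the
  limit integrand is itself the majorant.\<close>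

lemma jump_integral_tendsto:
  assumes \<kappa>: "\<bar>Re \<kappa>\<bar> < real (n + 1) / 3" and s: "s = 1 \<or> s = (- 1 :: complex)"
  shows "(\<lambda>k. LBINT t:{0<..}. jump_integrand s n \<kappa> (exp (of_real (real k))) t) \<longlonglongrightarrow> (LBINT t:{0<..}. jump_limit s n \<kappa> t)"
proof -
  have i: "set_integrable lborel {0<..} (jump_integrand s n \<kappa> (exp (of_real (real k))))" for k
    using near_A_representation(1,2)[OF \<kappa>, of "of_real (real k)"] s by auto
  note l = jump_limit_integrable[OF \<kappa> s]
  have q: "jump_integrand s n \<kappa> w t = jump_limit s n \<kappa> t / (1 - s * \<i> * of_real (t powr (1 / 3)) / w)" for w t
    by (simp add: jump_integrand_def jump_limit_def)
  have w0: "(\<lambda>k. inverse (exp (complex_of_real (real k)))) \<longlonglongrightarrow> 0"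
  proof (rule tendsto_norm_zero_cancel)
    have "(\<lambda>k. inverse (exp (real k))) \<longlonglongrightarrow> 0" by real_asymp
    then show "(\<lambda>k. norm (inverse (exp (complex_of_real (real k))))) \<longlonglongrightarrow> 0" by (simp add: norm_inverse)
  qed
  show ?thesis unfolding set_lebesgue_integral_def
  proof (rule integral_dominated_convergence[where w = "\<lambda>t. norm (indicat_real {0<..} t *\<^sub>R jump_limit s n \<kappa> t)"])
    show "(\<lambda>t. indicat_real {0<..} t *\<^sub>R jump_limit s n \<kappa> t) \<in> borel_measurable lborel"
      using l unfolding set_integrable_def by (rule borel_measurable_integrable)
    show "(\<lambda>t. indicat_real {0<..} t *\<^sub>R jump_integrand s n \<kappa> (exp (of_real (real k))) t) \<in> borel_measurable lborel" for k
      using i unfolding set_integrable_def by (rule borel_measurable_integrable)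
    show "integrable lborel (\<lambda>t. norm (indicat_real {0<..} t *\<^sub>R jump_limit s n \<kappa> t))"
      using l unfolding set_integrable_def by (rule integrable_norm)
    show "AE t in lborel. (\<lambda>k. indicat_real {0<..} t *\<^sub>R jump_integrand s n \<kappa> (exp (of_real (real k))) t) \<longlonglongrightarrow> indicat_real {0<..} t *\<^sub>R jump_limit s n \<kappa> t"
    proof (rule AE_I2)
      fix t
      have "(\<lambda>k. indicat_real {0<..} t *\<^sub>R (jump_limit s n \<kappa> t / (1 - s * \<i> * of_real (t powr (1 / 3)) * inverse (exp (complex_of_real (real k))))))
         \<longlonglongrightarrow> indicat_real {0<..} t *\<^sub>R (jump_limit s n \<kappa> t / (1 - s * \<i> * of_real (t powr (1 / 3)) * 0))"
        by (intro tendsto_intros w0) simp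
      then show "(\<lambda>k. indicat_real {0<..} t *\<^sub>R jump_integrand s n \<kappa> (exp (of_real (real k))) t) \<longlonglongrightarrow> indicat_real {0<..} t *\<^sub>R jump_limit s n \<kappa> t"
        unfolding q by (simp add: divide_inverse[of _ "exp _"])
    qed
    show "AE t in lborel. norm (indicat_real {0<..} t *\<^sub>R jump_integrand s n \<kappa> (exp (of_real (real k))) t) \<le> norm (indicat_real {0<..} t *\<^sub>R jump_limit s n \<kappa> t)" for k
    proof (rule AE_I2)
      fix t
      define r where "r = t powr (1 / 3) / exp (real k)"
      have e: "1 - s * \<i> * of_real (t powr (1 / 3)) / exp (complex_of_real (real k)) = 1 - s * \<i> * of_real r"
        by (simp only: r_def exp_of_real of_real_divide times_divide_eq_right)
      have R: "Re (1 - s * \<i> * of_real r) = 1" using s by auto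
      have "norm (1 - s * \<i> * of_real r) \<ge> 1" using complex_Re_le_cmod[of "1 - s * \<i> * of_real r"] unfolding R .
      then have "norm (jump_limit s n \<kappa> t) / norm (1 - s * \<i> * of_real r) \<le> norm (jump_limit s n \<kappa> t) / 1"
        by (intro divide_left_mono) auto
      then show "norm (indicat_real {0<..} t *\<^sub>R jump_integrand s n \<kappa> (exp (of_real (real k))) t) \<le> norm (indicat_real {0<..} t *\<^sub>R jump_limit s n \<kappa> t)"
        unfolding q e norm_scaleR norm_divide by (intro mult_left_mono) auto
    qed
  qed
qed

text \<open>The exact formula truncated at n and the asymptotic bound truncated at n + 1 are
  compared along real z. Multiplied by z^((n+1)/3), the former is the integral expression and the
  latter the n-th coefficient up to O(z^(-1/3)).\<close>

lemma near_coeff_integral: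
  assumes \<kappa>: "\<bar>Re \<kappa>\<bar> < real (n + 1) / 3"
  shows "near_coeff n \<kappa> = \<i> / 6 * (\<i> ^ n * exp (2 * pi * \<i> * \<kappa>) * (LBINT t:{0<..}. jump_limit 1 n \<kappa> t) +
       (- \<i>) ^ n * exp (- (2 * pi * \<i> * \<kappa>)) * (LBINT t:{0<..}. jump_limit (- 1) n \<kappa> t))"
proof -
  define Q where "Q = (\<lambda>k. \<i> / 6 * (\<i> ^ n * exp (2 * pi * \<i> * \<kappa>) * (LBINT t:{0<..}. jump_integrand 1 n \<kappa> (exp (of_real (real k))) t) +
       (- \<i>) ^ n * exp (- (2 * pi * \<i> * \<kappa>)) * (LBINT t:{0<..}. jump_integrand (- 1) n \<kappa> (exp (of_real (real k))) t)))"
  have lim: "Q \<longlonglongrightarrow> \<i> / 6 * (\<i> ^ n * exp (2 * pi * \<i> * \<kappa>) * (LBINT t:{0<..}. jump_limit 1 n \<kappa> t) +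
       (- \<i>) ^ n * exp (- (2 * pi * \<i> * \<kappa>)) * (LBINT t:{0<..}. jump_limit (- 1) n \<kappa> t))"
    unfolding Q_def by (intro tendsto_intros jump_integral_tendsto[OF \<kappa>]) auto
  \<comment> \<open>The sum includes the term n, so what is left is smaller than that term by a
    factor exp (- k).\<close>
  obtain C where C: "\<forall>\<zeta>. \<bar>Im \<zeta>\<bar> \<le> 3 * pi / 2 \<longrightarrow> Re \<zeta> \<ge> 0 \<longrightarrow>
    norm (near_A \<kappa> \<zeta> - (\<Sum>i<n + 1. near_coeff i \<kappa> / exp (\<zeta> / 3) ^ (i + 1))) \<le> C / exp (Re \<zeta> / 3) ^ (n + 1 + 1)"
    using near_A_asymptotic[of \<kappa> "n + 1"] by (rule exE)
  have bd: "norm (Q k - near_coeff n \<kappa>) \<le> C * exp (- real k)" for k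
  proof -
    define x where "x = exp (real k)"
    define w where "w = exp (complex_of_real (real k))"
    have x: "x > 0" "norm w = x" by (simp_all add: x_def w_def)
    have w0: "w \<noteq> 0" by (simp add: w_def)
    have p: "\<bar>Im (complex_of_real (real k))\<bar> < pi / 2" by simp
    have "near_A \<kappa> (3 * of_real (real k)) - (\<Sum>i<n. near_coeff i \<kappa> / w ^ (i + 1)) = Q k / w ^ (n + 1)"
      using near_A_representation(3)[OF \<kappa> p] unfolding w_def[symmetric] Q_def by simp
    then have "near_A \<kappa> (3 * of_real (real k)) - (\<Sum>i<n + 1. near_coeff i \<kappa> / w ^ (i + 1)) = (Q k - near_coeff n \<kappa>) / w ^ (n + 1)"
      unfolding Suc_eq_plus1[symmetric] sum.lessThan_Suc by (simp only: diff_diff_eq[symmetric] diff_divide_distrib)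
    moreover have "norm (near_A \<kappa> (3 * of_real (real k)) - (\<Sum>i<n + 1. near_coeff i \<kappa> / w ^ (i + 1))) \<le> C / x ^ (n + 1 + 1)"
      using C[rule_format, of "3 * of_real (real k)"] unfolding w_def x_def by (simp del: sum.lessThan_Suc)
    ultimately have "norm ((Q k - near_coeff n \<kappa>) / w ^ (n + 1)) \<le> C / x ^ (n + 1 + 1)" by (simp only:)
    moreover have "C / x ^ (n + 1 + 1) = C / x / x ^ (n + 1)" by simp
    ultimately have "norm (Q k - near_coeff n \<kappa>) / x ^ (n + 1) \<le> C / x / x ^ (n + 1)"
      unfolding norm_divide norm_power x(2) by (simp only:)
    then have "norm (Q k - near_coeff n \<kappa>) \<le> C / x"
      using x(1) by (subst (asm) divide_le_cancel) (simp del: power_Suc)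
    then show ?thesis by (simp add: x_def exp_minus divide_inverse)
  qed
  have "Q \<longlonglongrightarrow> near_coeff n \<kappa>"
  proof (rule LIM_zero_cancel, rule Lim_null_comparison)
    show "\<forall>\<^sub>F k in sequentially. norm (Q k - near_coeff n \<kappa>) \<le> C * exp (- real k)" using bd by simp
    show "(\<lambda>k. C * exp (- real k)) \<longlonglongrightarrow> 0" by real_asymp
  qed
  then show ?thesis using lim by (rule LIMSEQ_unique)
qed

text \<open>Only constants remain to be sorted: \<open>near_coeff\<close> contains B_n(-\<kappa>),
  and its factor (-1)^n exchanges i^n and (-i)^n, which gives the phases of the stated
  integrand.\<close>

lemma B_coeff_integral:
  assumes \<kappa>: "\<bar>Re \<kappa>\<bar> < real (n + 1) / 3"
  shows "set_integrable lborel {0<..} (B_integrand n \<kappa>)"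
    and "B_coeff n \<kappa> = of_real (6 powr (- (real (n + 1) / 3)) / (2 * Gamma (real (n + 1) / 3))) * (LBINT t:{0<..}. B_integrand n \<kappa> t)"
proof -
  define P where "P = phase n \<kappa>"
  have eq: "B_integrand n \<kappa> = (\<lambda>t. (\<i> * P) * jump_limit 1 n \<kappa> t + (\<i> * inverse P) * jump_limit (- 1) n \<kappa> t)"
    unfolding B_integrand_def phase_eq(3) phase_def[symmetric] P_def[symmetric] jump_limit_def
    by (simp add: fun_eq_iff algebra_simps)
  have i: "set_integrable lborel {0<..} (\<lambda>t. c * jump_limit 1 n \<kappa> t)" "set_integrable lborel {0<..} (\<lambda>t. c * jump_limit (- 1) n \<kappa> t)" for c
    by (intro set_integrable_mult_right jump_limit_integrable[OF \<kappa>]; simp)+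
  show "set_integrable lborel {0<..} (B_integrand n \<kappa>)"
    unfolding eq by (intro set_integral_add(1) i)
  define L1 L2 where "L1 = (LBINT t:{0<..}. jump_limit 1 n \<kappa> t)" and "L2 = (LBINT t:{0<..}. jump_limit (- 1) n \<kappa> t)"
  have I: "(LBINT t:{0<..}. B_integrand n \<kappa> t) = (\<i> * P) * L1 + (\<i> * inverse P) * L2"
    unfolding eq set_integral_add(2)[OF i(1) i(2)] L1_def L2_def by simp
  define e where "e = exp (2 * pi * \<i> * \<kappa>)"
  have e': "exp (- (2 * pi * \<i> * \<kappa>)) = inverse e" by (simp add: e_def exp_minus)
  have P: "P = (- \<i>) ^ n * e" "inverse P = \<i> ^ n * inverse e"
    unfolding P_def phase_eq(2) by (simp_all only: phase_eq(1) e_def exp_minus)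
  define G where "G = complex_of_real (Gamma (real (n + 1) / 3))"
  define S where "S = complex_of_real (6 powr (real (n + 1) / 3))"
  have "Gamma (real (n + 1) / 3) > 0" by (rule Gamma_real_pos) simp
  then have "Gamma (real (n + 1) / 3) \<noteq> 0" by (rule less_imp_neq[THEN not_sym])
  then have G0: "G \<noteq> 0" unfolding G_def of_real_eq_0_iff .
  have S0: "S \<noteq> 0" by (simp add: S_def)
  have m1: "(- 1 :: complex) ^ n * (- 1) ^ n = 1" by (simp add: power_mult_distrib[symmetric])
  have k: "(- 1) ^ n * \<i> ^ n = (- \<i>) ^ n" "(- 1) ^ n * (- \<i>) ^ n = \<i> ^ n"
    unfolding power_mult_distrib[symmetric] by simp_all
  define X where "X = S * B_coeff n \<kappa> * G / 3"
  have main: "(- 1) ^ n * X = \<i> / 6 * (\<i> ^ n * e * L1 + (- \<i>) ^ n * inverse e * L2)"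
    using near_coeff_integral[OF \<kappa>]
    unfolding near_coeff_ray L1_def[symmetric] L2_def[symmetric] e' e_def[symmetric] S_def[symmetric] G_def[symmetric] X_def[symmetric] .
  have dist: "m * (\<i> / 6 * (a * c * L1 + b * d * L2)) = \<i> / 6 * ((m * a) * c * L1 + (m * b) * d * L2)" for m a b c d
    by (simp add: algebra_simps)
  have out: "\<i> / 6 * (x * L1 + y * L2) = ((\<i> * x) * L1 + (\<i> * y) * L2) / 6" for x y
    by (simp add: algebra_simps add_divide_distrib)
  have "X = (- 1) ^ n * ((- 1) ^ n * X)" unfolding mult.assoc[symmetric] m1 by simp
  then have "X = \<i> / 6 * ((- \<i>) ^ n * e * L1 + \<i> ^ n * inverse e * L2)"
    unfolding main dist k .
  then have "X = (LBINT t:{0<..}. B_integrand n \<kappa> t) / 6"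
    unfolding I out P(2) unfolding P(1) .
  then have fin: "S * B_coeff n \<kappa> * G / 3 = (LBINT t:{0<..}. B_integrand n \<kappa> t) / 6" unfolding X_def .
  have "of_real (6 powr (- (real (n + 1) / 3)) / (2 * Gamma (real (n + 1) / 3))) = 1 / (S * (2 * G))"
    by (simp only: powr_minus of_real_divide of_real_mult of_real_inverse of_real_numeral S_def G_def divide_inverse inverse_mult_distrib mult_1_left mult.assoc)
  moreover have "B_coeff n \<kappa> = 1 / (S * (2 * G)) * (LBINT t:{0<..}. B_integrand n \<kappa> t)"
  proof -
    have "(LBINT t:{0<..}. B_integrand n \<kappa> t) = 6 * (S * B_coeff n \<kappa> * G / 3)" unfolding fin by simp
    also have "\<dots> = S * (2 * G) * B_coeff n \<kappa>" by simp
    finally show ?thesis using S0 G0 by simp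
  qed
  ultimately show "B_coeff n \<kappa> = of_real (6 powr (- (real (n + 1) / 3)) / (2 * Gamma (real (n + 1) / 3))) * (LBINT t:{0<..}. B_integrand n \<kappa> t)"
    by (simp only:)
qed

theorem theorem1p1:
  fixes N :: nat and \<kappa> \<nu> \<zeta> z :: complex
  assumes kappa: "\<bar>Re \<kappa>\<bar> < real (N + 1) / 3"
    and z: "z = exp \<zeta>"
    and nu: "\<nu> + \<kappa> = z"
  shows
    "(- (pi / 2) < Im \<zeta> \<and> Im \<zeta> < 3 * pi / 2 \<longrightarrow>
       rem_converges kernel_H N \<zeta> \<kappa> \<and>
       hankel_1 \<nu> \<zeta> =
         - (2 / (3 * of_real pi)) *
           (\<Sum>n<N. of_real (6 powr (real (n + 1) / 3)) * B_coeff n \<kappa> *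
              cis (2 * real (n + 1) * pi / 3) * of_real (sin (real (n + 1) * pi / 3)) *
              (of_real (Gamma (real (n + 1) / 3)) / zpow \<zeta> (real (n + 1) / 3)))
         + rem_H N \<zeta> \<kappa>) \<and>
     (- (3 * pi / 2) < Im \<zeta> \<and> Im \<zeta> < pi / 2 \<longrightarrow>
       rem_converges kernel_H N (\<zeta> + of_real pi * \<i>) (- \<kappa>) \<and>
       hankel_2 \<nu> \<zeta> =
         - (2 / (3 * of_real pi)) *
           (\<Sum>n<N. of_real (6 powr (real (n + 1) / 3)) * B_coeff n \<kappa> *
              cis (- (2 * real (n + 1) * pi / 3)) * of_real (sin (real (n + 1) * pi / 3)) *
              (of_real (Gamma (real (n + 1) / 3)) / zpow \<zeta> (real (n + 1) / 3)))
         - rem_H N (\<zeta> + of_real pi * \<i>) (- \<kappa>)) \<and>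
     (\<bar>Im \<zeta>\<bar> < pi / 2 \<longrightarrow>
       rem_converges kernel_J N \<zeta> \<kappa> \<and>
       bessel_J \<nu> \<zeta> =
         1 / (3 * of_real pi) *
           (\<Sum>n<N. of_real (6 powr (real (n + 1) / 3)) * B_coeff n \<kappa> *
              of_real (sin (real (n + 1) * pi / 3)) *
              (of_real (Gamma (real (n + 1) / 3)) / zpow \<zeta> (real (n + 1) / 3)))
         + rem_J N \<zeta> \<kappa>) \<and>
     (\<bar>Im \<zeta>\<bar> < pi / 2 \<longrightarrow>
       rem_converges kernel_Y N \<zeta> \<kappa> \<and>
       bessel_Y \<nu> \<zeta> =
         - (2 / (3 * of_real pi)) *
           (\<Sum>n<N. (-1) ^ n * of_real (6 powr (real (n + 1) / 3)) * B_coeff n \<kappa> *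
              of_real ((sin (real (n + 1) * pi / 3))\<^sup>2) *
              (of_real (Gamma (real (n + 1) / 3)) / zpow \<zeta> (real (n + 1) / 3)))
         + rem_Y N \<zeta> \<kappa>) \<and>
     (\<forall>n. \<bar>Re \<kappa>\<bar> < real (n + 1) / 3 \<longrightarrow>
       set_integrable lborel {0<..} (B_integrand n \<kappa>) \<and>
       B_coeff n \<kappa> =
         of_real (6 powr (- (real (n + 1) / 3)) / (2 * Gamma (real (n + 1) / 3))) *
         (LBINT t:{0<..}. B_integrand n \<kappa> t))"
proof -
  have nu': "\<nu> + \<kappa> = exp \<zeta>" using nu z by simp
  have h1: "rem_converges kernel_H N \<zeta> \<kappa> \<and>
       hankel_1 \<nu> \<zeta> =
         - (2 / (3 * of_real pi)) *
           (\<Sum>n<N. of_real (6 powr (real (n + 1) / 3)) * B_coeff n \<kappa> *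
              cis (2 * real (n + 1) * pi / 3) * of_real (sin (real (n + 1) * pi / 3)) *
              (of_real (Gamma (real (n + 1) / 3)) / zpow \<zeta> (real (n + 1) / 3)))
         + rem_H N \<zeta> \<kappa>"
    if "- (pi / 2) < Im \<zeta> \<and> Im \<zeta> < 3 * pi / 2"
  proof -
    note R = near_A_hankel_form[OF kappa that[THEN conjunct1] that[THEN conjunct2]]
    have "hankel_1 \<nu> \<zeta> = - (2 / (3 * of_real pi)) * (\<Sum>n<N. cis (2 * real (n + 1) * pi / 3) * of_real (sin (real (n + 1) * pi / 3)) * ray_term n \<kappa> \<zeta>)
      + rem_H N \<zeta> \<kappa>"
      unfolding hankel_1_near_A[OF nu'] by (rule R(2))
    then show ?thesis unfolding ray_term_def using R(1) by (simp only: mult_ac simp_thms)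
  qed
  have h2: "rem_converges kernel_H N (\<zeta> + of_real pi * \<i>) (- \<kappa>) \<and>
       hankel_2 \<nu> \<zeta> =
         - (2 / (3 * of_real pi)) *
           (\<Sum>n<N. of_real (6 powr (real (n + 1) / 3)) * B_coeff n \<kappa> *
              cis (- (2 * real (n + 1) * pi / 3)) * of_real (sin (real (n + 1) * pi / 3)) *
              (of_real (Gamma (real (n + 1) / 3)) / zpow \<zeta> (real (n + 1) / 3)))
         - rem_H N (\<zeta> + of_real pi * \<i>) (- \<kappa>)"
    if "- (3 * pi / 2) < Im \<zeta> \<and> Im \<zeta> < pi / 2"
  proof -
    note R = near_A_hankel_form_rotated[OF kappa that[THEN conjunct1] that[THEN conjunct2]]
    have "hankel_2 \<nu> \<zeta> = - (2 / (3 * of_real pi)) * (\<Sum>n<N. cis (- (2 * real (n + 1) * pi / 3)) * of_real (sin (real (n + 1) * pi / 3)) * ray_term n \<kappa> \<zeta>)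
      - rem_H N (\<zeta> + of_real pi * \<i>) (- \<kappa>)"
      unfolding hankel_2_near_A[OF nu'] by (rule R(2))
    then show ?thesis unfolding ray_term_def using R(1) by (simp only: mult_ac simp_thms)
  qed
  have j: "rem_converges kernel_J N \<zeta> \<kappa> \<and>
       bessel_J \<nu> \<zeta> =
         1 / (3 * of_real pi) *
           (\<Sum>n<N. of_real (6 powr (real (n + 1) / 3)) * B_coeff n \<kappa> *
              of_real (sin (real (n + 1) * pi / 3)) *
              (of_real (Gamma (real (n + 1) / 3)) / zpow \<zeta> (real (n + 1) / 3)))
         + rem_J N \<zeta> \<kappa>"
    if "\<bar>Im \<zeta>\<bar> < pi / 2"
  proof -
    note R = near_A_bessel_J_form[OF kappa that]
    have "bessel_J \<nu> \<zeta> = 1 / (3 * of_real pi) * (\<Sum>n<N. of_real (sin (real (n + 1) * pi / 3)) * ray_term n \<kappa> \<zeta>) + rem_J N \<zeta> \<kappa>"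
      unfolding bessel_J_near_A[OF nu'] by (rule R(2))
    then show ?thesis unfolding ray_term_def using R(1) by (simp only: mult_ac simp_thms)
  qed
  have y: "rem_converges kernel_Y N \<zeta> \<kappa> \<and>
       bessel_Y \<nu> \<zeta> =
         - (2 / (3 * of_real pi)) *
           (\<Sum>n<N. (-1) ^ n * of_real (6 powr (real (n + 1) / 3)) * B_coeff n \<kappa> *
              of_real ((sin (real (n + 1) * pi / 3))\<^sup>2) *
              (of_real (Gamma (real (n + 1) / 3)) / zpow \<zeta> (real (n + 1) / 3)))
         + rem_Y N \<zeta> \<kappa>"
    if "\<bar>Im \<zeta>\<bar> < pi / 2"
  proof -
    note R = near_A_bessel_Y_form[OF kappa that]
    have "bessel_Y \<nu> \<zeta> = - (2 / (3 * of_real pi)) * (\<Sum>n<N. (- 1) ^ n * of_real ((sin (real (n + 1) * pi / 3))\<^sup>2) * ray_term n \<kappa> \<zeta>) + rem_Y N \<zeta> \<kappa>"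
      unfolding bessel_Y_near_A[OF nu'] by (rule R(2))
    then show ?thesis unfolding ray_term_def using R(1) by (simp only: mult_ac simp_thms)
  qed
  show ?thesis
    by (rule conjI, rule impI, erule h1, rule conjI, rule impI, erule h2, rule conjI, rule impI, erule j,
      rule conjI, rule impI, erule y, rule allI, rule impI, rule conjI, erule B_coeff_integral(1), erule B_coeff_integral(2))
qed

end
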